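(* Let $d\ge 1$ and $\lambda>0$. There exists a unique stationary solution $u$ with finite second moment of the landscape equation $$-\triangle u+\lambda V u=1 \quad\text{on } \mathbb{R}^d .$$ That is, there is a unique (up to almost sure equality) stationary random field $u$ such that, for almost all $\omega$, $u$ lies in the Sobolev space $H^1_{\mathrm{loc}}(\mathbb{R}^d)$ and is a weak solution of this equation, and such that $\mathbb{E}\big[\int_Q u^2\big]<+\infty$. In addition, $u$ is positive and for all $p\ge 1$ it satisfies $$\mathbb{E}\Big[\sup_Q u^p\Big]^{\frac1p}\le C_{\lambda,p},$$ where $C_{\lambda,p}<\infty$ is a constant depending only on $d$, $\varphi$, $F$, $\lambda$ and $p$.
   Context: Let $d\ge 1$ and let $\varphi\in C_0^\infty(B_{1/10}(0))$ be a nontrivial (not identically zero) bump function supported in the ball of $\mathbb{R}^d$ centered at $0$ of radius $1/10$, with $0\le\varphi\le1$. Let $\omega=(\omega_j)_{j\in\mathbb{Z}^d}$ be i.i.d. random variables taking values in $[0,1]$ whose common probability distribution $F(\delta)=\mathbb{P}[\omega_j\le\delta]$, $0\le\delta\le1$, is not concentrated at one point and is such that $0$ is the infimum of its support (no further regularity is assumed; atoms are allowed). The random potential is $$V(x)=V_\omega(x)=\sum_{j\in\mathbb{Z}^d}\omega_j\,\varphi(x-j),\qquad x\in\mathbb{R}^d.$$ $\mathbb{E}$ denotes the expectation with respect to $\omega$, and $Q:=[-\frac12,\frac12)^d$. A random field $v$ (a measurable map of both $x\in\mathbb{R}^d$ and $\omega$) is called stationary if for all $x\in\mathbb{R}^d$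 and $z\in\mathbb{Z}^d$ one has $v(x+z,\omega)=v(x,\tau_z\omega)$, where $(\tau_z\omega)_j=\omega_{j+z}$ for all $j\in\mathbb{Z}^d$. *)

theory Defs
  imports "HOL-Probability.Probability"
begin

definition partial_deriv :: "'n::finite \<Rightarrow> (real^'n \<Rightarrow> real) \<Rightarrow> real^'n \<Rightarrow> real" where
  "partial_deriv i f x = frechet_derivative f (at x) (axis i 1)"

definition gradient :: "(real^'n::finite \<Rightarrow> real) \<Rightarrow> real^'n \<Rightarrow> real^'n" where
  "gradient f x = (\<chi> i. partial_deriv i f x)"

primrec C_k :: "nat \<Rightarrow> (real^'n::finite \<Rightarrow> real) \<Rightarrow> bool" where
  "C_k 0 f \<longleftrightarrow> continuous_on UNIV f"
| "C_k (Suc k) f \<longleftrightarrow> (\<forall>x. f differentiable (at x)) \<and> (\<forall>i. C_k k (partial_deriv i f))"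

definition smooth :: "(real^'n::finite \<Rightarrow> real) \<Rightarrow> bool" where
  "smooth f \<longleftrightarrow> (\<forall>k. C_k k f)"

definition Cc_infty :: "(real^'n::finite) set \<Rightarrow> (real^'n \<Rightarrow> real) set" where
  "Cc_infty U = {f. smooth f \<and> compact (closure {x. f x \<noteq> 0}) \<and> closure {x. f x \<noteq> 0} \<subseteq> U}"

definition L2_loc :: "(real^'n::finite \<Rightarrow> 'b::euclidean_space) \<Rightarrow> bool" where
  "L2_loc f \<longleftrightarrow> f \<in> borel_measurable lborel \<and>
     (\<forall>K. compact K \<longrightarrow> set_integrable lborel K (\<lambda>x. (norm (f x))\<^sup>2))"

definition weak_gradient :: "(real^'n::finite \<Rightarrow> real) \<Rightarrow> (real^'n \<Rightarrow> real^'n) \<Rightarrow> bool" where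
  "weak_gradient f g \<longleftrightarrow> (\<forall>\<psi>\<in>Cc_infty UNIV. \<forall>i.
     (LINT x|lborel. f x * partial_deriv i \<psi> x) = - (LINT x|lborel. g x $ i * \<psi> x))"

definition H1_loc :: "(real^'n::finite \<Rightarrow> real) \<Rightarrow> bool" where
  "H1_loc f \<longleftrightarrow> L2_loc f \<and> (\<exists>g. L2_loc g \<and> weak_gradient f g)"

text \<open>Weak formulation of \<open>- \<Delta> f + W f = 1\<close> on the whole space, for \<open>f\<close> in \<open>H1_loc\<close>.
  The choice of \<open>g\<close> is immaterial, as weak gradients are unique up to null sets.\<close>

definition weak_landscape_solution ::
    "(real^'n::finite \<Rightarrow> real) \<Rightarrow> (real^'n \<Rightarrow> real) \<Rightarrow> bool" where
  "weak_landscape_solution W f \<longleftrightarrow>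
     (\<exists>g. L2_loc g \<and> weak_gradient f g \<and>
       (\<forall>\<psi>\<in>Cc_infty UNIV.
          (LINT x|lborel. g x \<bullet> gradient \<psi> x) + (LINT x|lborel. W x * f x * \<psi> x)
            = (LINT x|lborel. \<psi> x)))"

type_synonym 'n config = "int^'n \<Rightarrow> real"

definition lattice_pt :: "int^'n::finite \<Rightarrow> real^'n" where
  "lattice_pt j = (\<chi> i. real_of_int (j $ i))"

definition unit_cell :: "(real^'n::finite) set" where
  "unit_cell = {x. \<forall>i. - (1/2) \<le> x $ i \<and> x $ i < 1/2}"

definition law_support :: "real measure \<Rightarrow> real set" where
  "law_support \<mu> = {t \<in> space \<mu>. \<forall>e>0. measure \<mu> (ball t e \<inter> space \<mu>) > 0}"

text \<open>The probability space carrying i.i.d. coordinates with common law \<open>\<mu>\<close>.\<close>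

definition config_space :: "real measure \<Rightarrow> ('n::finite) config measure" where
  "config_space \<mu> = PiM UNIV (\<lambda>_. \<mu>)"

definition shift :: "int^'n::finite \<Rightarrow> 'n config \<Rightarrow> 'n config" where
  "shift z \<omega> = (\<lambda>j. \<omega> (j + z))"

text \<open>For \<open>\<phi>\<close> of compact support only finitely many summands are nonzero at each point.\<close>

definition random_potential ::
    "(real^'n::finite \<Rightarrow> real) \<Rightarrow> 'n config \<Rightarrow> real^'n \<Rightarrow> real" where
  "random_potential \<phi> \<omega> x = (\<Sum>\<^sub>\<infinity>j\<in>UNIV. \<omega> j * \<phi> (x - lattice_pt j))"

definition random_field :: "real measure \<Rightarrow> (real^'n::finite \<Rightarrow> 'n config \<Rightarrow> real) \<Rightarrow> bool" where
  "random_field \<mu> v \<longleftrightarrow> (\<lambda>(x, \<omega>). v x \<omega>) \<in> borel_measurable (lborel \<Otimes>\<^sub>M config_space \<mu>)"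

definition stationary :: "real measure \<Rightarrow> (real^'n::finite \<Rightarrow> 'n config \<Rightarrow> real) \<Rightarrow> bool" where
  "stationary \<mu> v \<longleftrightarrow>
     (\<forall>\<omega>\<in>space (config_space \<mu>). \<forall>x z. v (x + lattice_pt z) \<omega> = v x (shift z \<omega>))"

definition stationary_landscape ::
    "(real^'n::finite \<Rightarrow> real) \<Rightarrow> real measure \<Rightarrow> real \<Rightarrow> (real^'n \<Rightarrow> 'n config \<Rightarrow> real) \<Rightarrow> bool" where
  "stationary_landscape \<phi> \<mu> \<Lambda> v \<longleftrightarrow>
     random_field \<mu> v \<and> stationary \<mu> v \<and>
     (AE \<omega> in config_space \<mu>.
        H1_loc (\<lambda>x. v x \<omega>) \<and>
        weak_landscape_solution (\<lambda>x. \<Lambda> * random_potential \<phi> \<omega> x) (\<lambda>x. v x \<omega>)) \<and>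
     (\<integral>\<^sup>+\<omega>. (\<integral>\<^sup>+x\<in>unit_cell. ennreal ((v x \<omega>)\<^sup>2) \<partial>lborel) \<partial>config_space \<mu>) < \<infinity>"

end

theory Submission
  imports Defs
begin

text \<open>With \<open>q = 1 - V\<close>, which takes values in \<open>[0, 1]\<close>, the equation reads
  \<open>(\<Lambda> - \<Delta>) u = 1 + \<Lambda> q u\<close>. Since \<open>\<Lambda> (\<Lambda> - \<Delta>)\<^sup>-\<^sup>1 f (x) = E f (x + Z) = P f (x)\<close> for a centred
  Gaussian \<open>Z\<close> stopped at an independent exponential time, this is the fixed point equation
  \<open>u = 1 / \<Lambda> + P (q u)\<close>, whose solution is the series \<open>u = (1 / \<Lambda>) \<Sum>\<^sub>n s\<^sub>n\<close> with
  \<open>s\<^sub>n = (P q)\<^sup>n 1\<close>: the probability that a random walk which survives at \<open>y\<close> with probability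
  \<open>q y\<close> is alive after \<open>n\<close> steps.

  The average of \<open>s\<^sub>n\<close> over the environment decays faster than any power of \<open>n\<close>. After a block of
  \<open>k + 1\<close> steps the walk has a probability at least of order \<open>k\<close> to the power \<open>- d / 2\<close> of landing
  where \<open>\<phi>\<close> is bounded below in some unit cell not used before; such a landing multiplies the
  average by a factor less than one, independent of the other cells. An integrable envelope of the
  resolvent kernel converts the average at a point into one of the supremum over the unit cell,
  which yields convergence of the series and all moments.

  For uniqueness, the difference \<open>w\<close> of two solutions satisfies \<open>w = P (q w)\<close>, hence
  \<open>\<bar>w\<bar> \<le> (P q)\<^sup>n \<bar>w\<bar> \<le> K s\<^sub>n + (1 / K) (P q)\<^sup>n w\<^sup>2\<close> for every \<open>K\<close>. By stationarity \<open>P\<close> preserves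
  the mean of the integral over the unit cell, so the mean of \<open>\<bar>w\<bar>\<close> is at most
  \<open>K E s\<^sub>n + E w\<^sup>2 / K\<close>, and \<open>n = K\<^sup>2 \<rightarrow> \<infinity>\<close> gives \<open>w = 0\<close>.\<close>

section \<open>The heat kernel\<close>

text \<open>The obstacle is that \<open>V\<close> may vanish on arbitrarily large regions, so
  \<open>P q\<close> need not contract uniformly. Convergence is obtained only after averaging over
  the environment, and statements for a fixed environment are recovered almost surely from moment
  bounds and stationarity. In both directions the bridge between the weak formulation and the fixed
  point equation is the identity \<open>P (\<Lambda> - \<Delta>) \<psi> = \<Lambda> \<psi>\<close>
  for test functions \<open>\<psi>\<close>. For existence, the derivative of \<open>P f\<close> is
  replaced by an average of \<open>f\<close> with the Gaussian weight \<open>y / (2t)\<close>, which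
  is integrable at small times. For uniqueness, the natural test function \<open>P \<psi>\<close> is
  smooth but not compactly supported, so dilated cutoffs are inserted and removed in the limit.
  Suprema are handled through the series itself, whose terms are continuous. Powers of the series
  would involve joint moments of its terms; since the terms lie in [0, 1], a telescoping inequality
  reduces them to first moments with polynomial weights, and decay faster than every power absorbs
  any such weight.\<close>

lemma borel_measurable_vec_nth [measurable (raw)]:
  assumes "f \<in> borel_measurable M" shows "(\<lambda>x. (f x :: real^'n::finite) $ i) \<in> borel_measurable M"
  using measurable_compose[OF assms borel_measurable_continuous_onI[OF continuous_on_component[OF continuous_on_id]]]
  by simp

lemma nn_integral_prod_vec:
  fixes f :: "'n::finite \<Rightarrow> real \<Rightarrow> ennreal"
  assumes [measurable]: "\<And>i. f i \<in> borel_measurable borel"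
  shows "(\<integral>\<^sup>+x. (\<Prod>i\<in>UNIV. f i ((x::real^'n) $ i)) \<partial>lborel) = (\<Prod>i\<in>UNIV. \<integral>\<^sup>+r. f i r \<partial>lborel)"
proof -
  \<comment> \<open>The product formula for \<open>lborel\<close> is indexed by
    \<open>Basis\<close>; \<open>idx\<close> recovers the coordinate belonging to a basis
    vector.\<close>
  define idx where "idx b = (THE i. b = axis i (1::real))" for b :: "real^'n"
  have idx: "idx (axis i 1) = i" for i
    by (auto simp: idx_def axis_eq_axis)
  have B: "(Basis :: (real^'n) set) = range (\<lambda>i. axis i 1)"
    by (auto simp: Basis_vec_def)
  have inj: "inj (\<lambda>i. axis i (1::real) :: real^'n)"
    by (auto simp: inj_on_def axis_eq_axis)
  have prod_B: "(\<Prod>b\<in>Basis. g b) = (\<Prod>i\<in>UNIV. g (axis i 1))" for g :: "real^'n \<Rightarrow> ennreal"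
    unfolding B by (subst prod.reindex[OF inj]) simp
  have "(\<integral>\<^sup>+x. (\<Prod>b\<in>Basis. f (idx b) ((x::real^'n) \<bullet> b)) \<partial>lborel)
      = (\<Prod>b\<in>(Basis::(real^'n) set). \<integral>\<^sup>+r. f (idx b) r \<partial>lborel)"
    by (rule nn_integral_lborel_prod) auto
  then show ?thesis
    by (simp add: prod_B idx inner_axis)
qed

lemma nn_integral_translate:
  fixes f :: "'a::euclidean_space \<Rightarrow> ennreal"
  assumes [measurable]: "f \<in> borel_measurable borel"
  shows "(\<integral>\<^sup>+x. f (a + x) \<partial>lborel) = (\<integral>\<^sup>+x. f x \<partial>lborel)"
proof -
  have "(\<integral>\<^sup>+x. f x \<partial>lborel) = (\<integral>\<^sup>+x. f x \<partial>distr lborel borel ((+) a))"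
    by (simp add: lborel_distr_plus)
  also have "\<dots> = (\<integral>\<^sup>+x. f (a + x) \<partial>lborel)"
    by (subst nn_integral_distr) auto
  finally show ?thesis ..
qed

lemma distr_lborel_reflect:
  "distr lborel borel (\<lambda>x::'a::euclidean_space. a - x) = lborel"
  using lborel_affine[of "-1" a] by (simp add: density_1)

lemma nn_integral_reflect:
  fixes f :: "'a::euclidean_space \<Rightarrow> ennreal"
  assumes [measurable]: "f \<in> borel_measurable borel"
  shows "(\<integral>\<^sup>+x. f (a - x) \<partial>lborel) = (\<integral>\<^sup>+x. f x \<partial>lborel)"
proof -
  have "(\<integral>\<^sup>+x. f x \<partial>lborel) = (\<integral>\<^sup>+x. f x \<partial>distr lborel borel (\<lambda>x. a - x))"
    by (simp add: distr_lborel_reflect)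
  also have "\<dots> = (\<integral>\<^sup>+x. f (a - x) \<partial>lborel)"
    by (subst nn_integral_distr) auto
  finally show ?thesis ..
qed

lemma integral_translate:
  fixes f :: "'a::euclidean_space \<Rightarrow> real"
  shows "(LINT x|lborel. f (a + x)) = (LINT x|lborel. f x)"
proof (cases "f \<in> borel_measurable borel")
  case True
  have "(LINT x|lborel. f x) = (LINT x|distr lborel borel ((+) a). f x)"
    by (simp add: lborel_distr_plus)
  also have "\<dots> = (LINT x|lborel. f (a + x))"
    using True by (subst integral_distr) auto
  finally show ?thesis ..
next
  \<comment> \<open>If \<open>f\<close> is not measurable, neither is its translate, since
    translating back would recover \<open>f\<close>. Both integrals then have the default value
    0.\<close>
  case False
  have "\<not> (\<lambda>x. f (a + x)) \<in> borel_measurable borel"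
  proof
    assume [measurable]: "(\<lambda>x. f (a + x)) \<in> borel_measurable borel"
    have "(\<lambda>x. f (a + (x - a))) \<in> borel_measurable borel"
      by (rule measurable_compose[of "\<lambda>x. x - a" borel borel "\<lambda>x. f (a + x)"]) auto
    with False show False by simp
  qed
  with False have "\<not> integrable lborel f" "\<not> integrable lborel (\<lambda>x. f (a + x))"
    by (auto dest: borel_measurable_integrable)
  then show ?thesis by (simp add: not_integrable_integral_eq)
qed

text \<open>Each coordinate has variance \<open>2 * t\<close>, so this is the kernel of the heat
  equation with the full Laplacian rather than half of it. The product form lets integrals factor
  over the coordinates.\<close>

definition heat :: "real \<Rightarrow> real^'n::finite \<Rightarrow> real" where
  "heat t y = (\<Prod>i\<in>UNIV. normal_density 0 (sqrt (2 * t)) (y $ i))"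

lemma heat_nonneg [simp]: "0 \<le> heat t y"
  by (simp add: heat_def prod_nonneg)

lemma heat_measurable [measurable]:
  "(\<lambda>(t, y::real^'n::finite). heat t y) \<in> borel_measurable (borel \<Otimes>\<^sub>M borel)"
  unfolding heat_def normal_density_def by measurable

lemma heat_minus [simp]: "heat t (- y) = heat t y"
  by (simp add: heat_def normal_density_def)

lemma ennreal_heat: "ennreal (heat t y) = (\<Prod>i\<in>UNIV. ennreal (normal_density 0 (sqrt (2 * t)) (y $ i)))"
  unfolding heat_def by (rule prod_ennreal[symmetric]) simp

lemma nn_integral_normal_density:
  assumes "0 < \<sigma>" shows "(\<integral>\<^sup>+x. ennreal (normal_density m \<sigma> x) \<partial>lborel) = 1"
  using prob_space_normal_density[OF assms, of m]
  by (auto dest!: prob_space.emeasure_space_1 simp: emeasure_density)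

lemma nn_integral_heat:
  assumes "0 < t" shows "(\<integral>\<^sup>+y. ennreal (heat t (y::real^'n::finite)) \<partial>lborel) = 1"
  unfolding ennreal_heat using assms
  by (subst nn_integral_prod_vec) (auto simp: nn_integral_normal_density)

text \<open>Coordinatewise this is the addition of variances of independent centred normals:
  \<open>2 * s + 2 * t = 2 * (s + t)\<close>.\<close>

lemma heat_convolution:
  assumes "0 < s" "0 < t"
  shows "(\<integral>\<^sup>+y. ennreal (heat s (x - y)) * ennreal (heat t (y::real^'n::finite)) \<partial>lborel) = ennreal (heat (s + t) x)"
proof -
  have "(\<integral>\<^sup>+y. ennreal (heat s (x - y)) * ennreal (heat t y) \<partial>lborel)
     = (\<integral>\<^sup>+y. (\<Prod>i\<in>UNIV. (\<lambda>r. ennreal (normal_density 0 (sqrt (2 * s)) (x $ i - r) * normal_density 0 (sqrt (2 * t)) r)) (y $ i)) \<partial>lborel)"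
    unfolding ennreal_heat by (simp add: prod.distrib[symmetric] ennreal_mult)
  also have "\<dots> = (\<Prod>i\<in>UNIV. \<integral>\<^sup>+r. ennreal (normal_density 0 (sqrt (2 * s)) (x $ i - r) * normal_density 0 (sqrt (2 * t)) r) \<partial>lborel)"
    by (rule nn_integral_prod_vec) auto
  also have "\<dots> = (\<Prod>i\<in>UNIV. ennreal (normal_density 0 (sqrt ((sqrt (2 * s))\<^sup>2 + (sqrt (2 * t))\<^sup>2)) (x $ i)))"
    using assms by (subst conv_normal_density_zero_mean[THEN fun_cong]) auto
  also have "\<dots> = ennreal (heat (s + t) x)"
    using assms unfolding ennreal_heat by (simp add: distrib_left)
  finally show ?thesis .
qed

text \<open>The exact value is \<open>sqrt (2 * t) * sqrt (2 / pi)\<close>. Divided by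
  \<open>2 * t\<close> it leaves a singularity of order -1/2 at time zero, which is integrable; this
  is why the resolvent kernel has an integrable gradient.\<close>

lemma nn_integral_heat_abs:
  assumes "0 < t"
  shows "(\<integral>\<^sup>+y. ennreal (heat t (y::real^'n::finite) * \<bar>y $ i\<bar>) \<partial>lborel) \<le> ennreal (sqrt (2 * t))"
proof -
  let ?s = "sqrt (2 * t)"
  have s: "0 < ?s" using assms by simp
  let ?f = "\<lambda>j r. ennreal (normal_density 0 ?s r) * (if j = i then ennreal \<bar>r\<bar> else 1)"
  have "(\<integral>\<^sup>+y. ennreal (heat t y * \<bar>y $ i\<bar>) \<partial>lborel) = (\<integral>\<^sup>+y. (\<Prod>j\<in>UNIV. ?f j ((y::real^'n) $ j)) \<partial>lborel)"
    by (auto simp: ennreal_heat prod.distrib ennreal_mult intro!: nn_integral_cong)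
  also have "\<dots> = (\<Prod>j\<in>UNIV. \<integral>\<^sup>+r. ?f j r \<partial>lborel)"
    by (rule nn_integral_prod_vec) auto
  also have "\<dots> = (\<Prod>j\<in>UNIV. if j = i then ennreal (?s * sqrt (2 / pi)) else 1)"
  proof (rule prod.cong[OF refl])
    fix j :: 'n
    have "(\<integral>\<^sup>+r. ennreal (normal_density 0 ?s r) * ennreal \<bar>r\<bar> \<partial>lborel) = ennreal (?s * sqrt (2 / pi))"
      using normal_moment_abs_odd[OF s, of 0 0]
      by (subst ennreal_mult[symmetric]) (auto simp: has_bochner_integral_iff nn_integral_eq_integral)
    then show "(\<integral>\<^sup>+r. ?f j r \<partial>lborel) = (if j = i then ennreal (?s * sqrt (2 / pi)) else 1)"
      using s by (simp add: nn_integral_normal_density)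
  qed
  also have "\<dots> = ennreal (?s * sqrt (2 / pi))" by simp
  also have "\<dots> \<le> ennreal ?s"
    using s pi_gt3 by (intro ennreal_leI mult_left_le) auto
  finally show ?thesis .
qed

section \<open>Test functions\<close>

lemma partial_deriv_eq:
  assumes "(f has_derivative f') (at x)" shows "partial_deriv i f x = f' (axis i 1)"
  using frechet_derivative_at[OF assms] by (simp add: partial_deriv_def)

lemma frechet_derivative_eq_sum_partial:
  fixes f :: "real^'n::finite \<Rightarrow> real"
  assumes "f differentiable (at x)"
  shows "frechet_derivative f (at x) h = (\<Sum>i\<in>UNIV. h $ i * partial_deriv i f x)"
proof -
  have "linear (frechet_derivative f (at x))"
    using linear_frechet_derivative[OF assms] .
  then have "frechet_derivative f (at x) (\<Sum>i\<in>UNIV. h $ i *\<^sub>R axis i 1) = (\<Sum>i\<in>UNIV. h $ i * partial_deriv i f x)"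
    by (simp add: linear_sum linear_cmul partial_deriv_def)
  then show ?thesis
    using basis_expansion[of h] by (simp add: scalar_mult_eq_scaleR)
qed

lemma has_derivative_partial:
  fixes f :: "real^'n::finite \<Rightarrow> real"
  assumes "f differentiable (at x)"
  shows "(f has_derivative (\<lambda>h. \<Sum>i\<in>UNIV. h $ i * partial_deriv i f x)) (at x)"
  using assms[unfolded frechet_derivative_works]
  by (rule has_derivative_eq_rhs) (intro ext frechet_derivative_eq_sum_partial[OF assms])

lemma C_k_differentiable: "C_k (Suc k) f \<Longrightarrow> f differentiable (at x)"
  by simp

lemma C_k_continuous:
  assumes "C_k k f" shows "continuous_on UNIV f"
proof (cases k)
  case (Suc k')
  then have "f differentiable (at x)" for x using assms by simp
  then show ?thesis
    by (intro continuous_at_imp_continuous_on ballI differentiable_imp_continuous_within)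
qed (use assms in simp)

lemma C_k_SucD: "C_k (Suc k) f \<Longrightarrow> C_k k f"
proof (induction k arbitrary: f)
  case 0 then show ?case using C_k_continuous[OF 0] by simp
next
  case (Suc k)
  show ?case
    unfolding C_k.simps(2)[of k] using Suc.IH Suc.prems[unfolded C_k.simps(2)[of "Suc k"]] by blast
qed

lemma C_k_const: "C_k k (\<lambda>x::real^'n::finite. c)"
proof (induction k arbitrary: c)
  case (Suc k)
  have "partial_deriv i (\<lambda>x::real^'n. c) = (\<lambda>x. 0)" for i
    by (rule ext) (subst partial_deriv_eq[OF has_derivative_const], simp)
  with Suc show ?case by simp
qed simp

lemma partial_deriv_add:
  fixes f g :: "real^'n::finite \<Rightarrow> real"
  shows "f differentiable (at x) \<Longrightarrow> g differentiable (at x) \<Longrightarrow>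
    partial_deriv i (\<lambda>x. f x + g x) x = partial_deriv i f x + partial_deriv i g x"
  by (subst partial_deriv_eq[OF has_derivative_add])
     (auto simp: frechet_derivative_works partial_deriv_def)

lemma C_k_add: "C_k k f \<Longrightarrow> C_k k g \<Longrightarrow> C_k k (\<lambda>x. f x + g x)"
proof (induction k arbitrary: f g)
  case (Suc k)
  then have "partial_deriv i (\<lambda>x. f x + g x) = (\<lambda>x. partial_deriv i f x + partial_deriv i g x)" for i
    by (intro ext partial_deriv_add) auto
  with Suc show ?case by auto
qed (auto intro: continuous_intros)

lemma partial_deriv_mult:
  fixes f g :: "real^'n::finite \<Rightarrow> real"
  shows "f differentiable (at x) \<Longrightarrow> g differentiable (at x) \<Longrightarrow>
    partial_deriv i (\<lambda>x. f x * g x) x = f x * partial_deriv i g x + partial_deriv i f x * g x"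
  by (subst partial_deriv_eq[OF has_derivative_mult])
     (auto simp: frechet_derivative_works partial_deriv_def)

lemma C_k_mult: "C_k k f \<Longrightarrow> C_k k g \<Longrightarrow> C_k k (\<lambda>x. f x * g x)"
proof (induction k arbitrary: f g)
  case (Suc k)
  then have "partial_deriv i (\<lambda>x. f x * g x) = (\<lambda>x. f x * partial_deriv i g x + partial_deriv i f x * g x)" for i
    by (intro ext partial_deriv_mult) auto
  moreover have "C_k k f" "C_k k g" using Suc.prems by (blast dest: C_k_SucD)+
  ultimately show ?case using Suc by (auto intro!: C_k_add)
qed (auto intro: continuous_intros)

lemma partial_deriv_affine:
  fixes f :: "real^'n::finite \<Rightarrow> real"
  assumes "f differentiable (at (a + c *\<^sub>R x))"
  shows "partial_deriv i (\<lambda>x. f (a + c *\<^sub>R x)) x = c * partial_deriv i f (a + c *\<^sub>R x)"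
proof -
  have "((\<lambda>x. f (a + c *\<^sub>R x)) has_derivative (\<lambda>h. frechet_derivative f (at (a + c *\<^sub>R x)) (c *\<^sub>R h))) (at x)"
    by (rule has_derivative_compose[where f="\<lambda>x. a + c *\<^sub>R x"])
       (use assms in \<open>auto intro!: derivative_eq_intros simp: frechet_derivative_works\<close>)
  from partial_deriv_eq[OF this] show ?thesis
    by (simp add: partial_deriv_def[of i f] linear_cmul[OF linear_frechet_derivative[OF assms]])
qed

lemma C_k_affine: "C_k k f \<Longrightarrow> C_k k (\<lambda>x. f (a + c *\<^sub>R x))"
proof (induction k arbitrary: f)
  case 0 then show ?case
    by (auto intro!: continuous_on_compose2[of UNIV f] continuous_intros)
next
  case (Suc k)
  then have "partial_deriv i (\<lambda>x. f (a + c *\<^sub>R x)) = (\<lambda>x. c * partial_deriv i f (a + c *\<^sub>R x))" for i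
    by (intro ext partial_deriv_affine) auto
  moreover have "(\<lambda>x. f (a + c *\<^sub>R x)) differentiable (at x)" for x
    using Suc.prems differentiable_chain_at[of "\<lambda>x. a + c *\<^sub>R x" x f, unfolded o_def] by simp
  ultimately show ?case using Suc by (auto intro!: C_k_mult C_k_const)
qed

lemma C_k_linear:
  assumes "bounded_linear (f :: real^'n::finite \<Rightarrow> real)" shows "C_k k f"
proof (cases k)
  case 0 then show ?thesis using assms
    by (auto intro: linear_continuous_on)
next
  case (Suc k')
  have "partial_deriv i f = (\<lambda>x. f (axis i 1))" for i
    by (rule ext) (rule partial_deriv_eq[OF bounded_linear_imp_has_derivative[OF assms]])
  then show ?thesis
    using Suc assms by (auto intro: C_k_const bounded_linear_imp_differentiable)
qed

lemma smooth_C_k: "smooth f \<Longrightarrow> C_k k f" by (simp add: smooth_def)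

lemma smooth_const: "smooth (\<lambda>x. c)" by (simp add: smooth_def C_k_const)

lemma smooth_add: "smooth f \<Longrightarrow> smooth g \<Longrightarrow> smooth (\<lambda>x. f x + g x)" by (simp add: smooth_def C_k_add)

lemma smooth_mult: "smooth f \<Longrightarrow> smooth g \<Longrightarrow> smooth (\<lambda>x. f x * g x)" by (simp add: smooth_def C_k_mult)

lemma smooth_affine: "smooth f \<Longrightarrow> smooth (\<lambda>x. f (a + c *\<^sub>R x))" by (simp add: smooth_def C_k_affine)

lemma smooth_differentiable: "smooth f \<Longrightarrow> f differentiable (at x)"
  using smooth_C_k[of f "Suc 0"] by (blast intro: C_k_differentiable)

lemma smooth_continuous: "smooth f \<Longrightarrow> continuous_on UNIV f"
  using smooth_C_k[of f 0] by (rule C_k_continuous)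

lemma smooth_partial_deriv:
  assumes "smooth f" shows "smooth (partial_deriv i f)"
  unfolding smooth_def
proof
  fix k show "C_k k (partial_deriv i f)" using smooth_C_k[OF assms, of "Suc k"] by simp
qed

text \<open>Polynomials multiplied by a bump function are test functions because of this; they are
  the approximants in the fundamental lemma.\<close>

lemma smooth_real_polynomial_function:
  assumes "real_polynomial_function f" shows "smooth (f :: real^'n::finite \<Rightarrow> real)"
  using assms
proof (induction f rule: real_polynomial_function.induct)
  case (linear f) then show ?case by (simp add: smooth_def C_k_linear)
next
  case (const c) show ?case by (rule smooth_const)
next
  case (add f g) then show ?case by (intro smooth_add)
next
  case (mult f g) then show ?case by (intro smooth_mult)
qed

lemma Cc_infty_UNIV_iff: "f \<in> Cc_infty UNIV \<longleftrightarrow> smooth f \<and> bounded {x. f x \<noteq> 0}"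
  by (auto simp: Cc_infty_def compact_closure)

lemma Cc_inftyI:
  assumes "smooth f" "\<And>x. R < norm x \<Longrightarrow> f x = 0" shows "f \<in> Cc_infty UNIV"
  unfolding Cc_infty_UNIV_iff
proof
  show "bounded {x. f x \<noteq> 0}"
    using assms(2) by (intro boundedI[of _ R]) (auto simp: not_less[symmetric])
qed (fact assms(1))

lemma Cc_infty_mono: "f \<in> Cc_infty U \<Longrightarrow> f \<in> Cc_infty UNIV"
  by (auto simp: Cc_infty_def)

lemma Cc_infty_smooth: "f \<in> Cc_infty U \<Longrightarrow> smooth f"
  by (auto simp: Cc_infty_def)

lemma Cc_infty_support:
  assumes "f \<in> Cc_infty UNIV" obtains R where "R > 0" "\<And>x. R < norm x \<Longrightarrow> f x = 0"
proof -
  have "bounded {x. f x \<noteq> 0}" using assms by (simp add: Cc_infty_UNIV_iff)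
  then obtain R where "R > 0" "\<forall>x\<in>{x. f x \<noteq> 0}. norm x \<le> R"
    by (auto simp: bounded_pos)
  then show thesis by (intro that[of R]) force+
qed

lemma Cc_infty_measurable: "f \<in> Cc_infty UNIV \<Longrightarrow> f \<in> borel_measurable borel"
  by (intro borel_measurable_continuous_onI smooth_continuous Cc_infty_smooth)

lemma partial_deriv_eq_0:
  assumes "\<And>x. R < norm x \<Longrightarrow> f x = 0" "R < norm x" shows "partial_deriv i f x = 0"
proof -
  have "((\<lambda>x. 0) has_derivative (\<lambda>h. 0)) (at x)" by simp
  moreover have "open {x::real^'a. R < norm x}"
    by (intro open_Collect_less continuous_intros)
  ultimately have "(f has_derivative (\<lambda>h. 0)) (at x)"
    by (rule has_derivative_transform_within_open) (use assms in auto)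
  then show ?thesis by (simp add: partial_deriv_eq)
qed

lemma Cc_infty_partial_deriv:
  assumes "f \<in> Cc_infty UNIV" shows "partial_deriv i f \<in> Cc_infty UNIV"
proof -
  obtain R where "\<And>x. R < norm x \<Longrightarrow> f x = 0" using Cc_infty_support[OF assms] by metis
  then show ?thesis
    using assms by (intro Cc_inftyI[of _ R]) (auto intro: partial_deriv_eq_0 smooth_partial_deriv Cc_infty_smooth)
qed

lemma Cc_infty_mult:
  assumes "f \<in> Cc_infty UNIV" "smooth g" shows "(\<lambda>x. f x * g x) \<in> Cc_infty UNIV"
proof -
  obtain R where "\<And>x. R < norm x \<Longrightarrow> f x = 0" using Cc_infty_support[OF assms(1)] by metis
  then show ?thesis
    using assms by (intro Cc_inftyI[of _ R]) (auto intro: smooth_mult Cc_infty_smooth)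
qed

lemma Cc_infty_add:
  assumes "f \<in> Cc_infty UNIV" "g \<in> Cc_infty UNIV" shows "(\<lambda>x. f x + g x) \<in> Cc_infty UNIV"
proof -
  obtain R R' where "\<And>x. R < norm x \<Longrightarrow> f x = 0" "\<And>x. R' < norm x \<Longrightarrow> g x = 0"
    using Cc_infty_support assms by metis
  then show ?thesis
    using assms by (intro Cc_inftyI[of _ "max R R'"]) (auto intro: smooth_add Cc_infty_smooth)
qed

lemma Cc_infty_cmult:
  assumes "f \<in> Cc_infty UNIV" shows "(\<lambda>x. c * f x) \<in> Cc_infty UNIV"
  using Cc_infty_mult[OF assms smooth_const[of c]] by (simp only: mult.commute)

lemma Cc_infty_sum:
  assumes "\<And>i. i \<in> I \<Longrightarrow> f i \<in> Cc_infty UNIV" shows "(\<lambda>x. \<Sum>i\<in>I. f i x) \<in> Cc_infty UNIV"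
  using assms
proof (induction I rule: infinite_finite_induct)
  case (insert i I) then show ?case using Cc_infty_add[of "f i"] by simp
qed (auto intro: Cc_inftyI smooth_const)

lemma Cc_infty_affine:
  assumes "f \<in> Cc_infty UNIV" "c \<noteq> 0" shows "(\<lambda>x. f (a + c *\<^sub>R x)) \<in> Cc_infty UNIV"
proof -
  obtain R where R: "\<And>x. R < norm x \<Longrightarrow> f x = 0" using Cc_infty_support assms by metis
  show ?thesis
  proof (rule Cc_inftyI[of _ "(R + norm a) / \<bar>c\<bar>"])
    fix x :: "real^'a" assume "(R + norm a) / \<bar>c\<bar> < norm x"
    then have "R + norm a < norm (c *\<^sub>R x)" using assms(2) by (simp add: field_simps)
    also have "norm (c *\<^sub>R x) \<le> norm (a + c *\<^sub>R x) + norm a"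
      using norm_triangle_ineq4[of "a + c *\<^sub>R x" a] by simp
    finally show "f (a + c *\<^sub>R x) = 0" by (intro R) simp
  qed (use assms in \<open>auto intro: smooth_affine Cc_infty_smooth\<close>)
qed

lemma compact_support_bounded:
  fixes f :: "real^'n::finite \<Rightarrow> real"
  assumes "continuous_on UNIV f" "\<And>x. R < norm x \<Longrightarrow> f x = 0"
  obtains C where "C > 0" "\<And>x. \<bar>f x\<bar> \<le> C * indicator (cball 0 R) x"
proof -
  have "compact (f ` cball 0 R)"
    by (intro compact_continuous_image continuous_on_subset[OF assms(1)]) auto
  then have "bounded (f ` cball 0 R)" by (rule compact_imp_bounded)
  then obtain C where "C > 0" "\<forall>y\<in>f ` cball 0 R. norm y \<le> C" by (auto simp: bounded_pos)
  then show thesis using assms(2) by (intro that[of C]) (auto simp: indicator_def)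
qed

lemma Cc_infty_bounded:
  assumes "f \<in> Cc_infty UNIV"
  obtains C R where "C > 0" "R > 0" "\<And>x. \<bar>f x\<bar> \<le> C * indicator (cball 0 R) x"
proof -
  obtain R where "R > 0" "\<And>x. R < norm x \<Longrightarrow> f x = 0" using Cc_infty_support[OF assms] by metis
  moreover obtain C where "C > 0" "\<And>x. \<bar>f x\<bar> \<le> C * indicator (cball 0 R) x"
    using compact_support_bounded smooth_continuous Cc_infty_smooth assms calculation by metis
  ultimately show thesis using that by blast
qed

lemma integrable_compact_support:
  fixes f :: "real^'n::finite \<Rightarrow> real"
  assumes "continuous_on UNIV f" "\<And>x. R < norm x \<Longrightarrow> f x = 0"
  shows "integrable lborel f"
proof -
  obtain C where "\<And>x. \<bar>f x\<bar> \<le> C * indicator (cball 0 R) x" using compact_support_bounded assms by metis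
  moreover have "integrable lborel (\<lambda>x::real^'n. C * indicator (cball 0 R) x :: real)"
    by (intro integrable_mult_right integrable_real_indicator)
       (auto intro: emeasure_bounded_finite[unfolded infinity_ennreal_def])
  moreover have "f \<in> borel_measurable borel" using assms(1) by (rule borel_measurable_continuous_onI)
  ultimately show ?thesis
    by (intro Bochner_Integration.integrable_bound[of lborel "\<lambda>x::real^'n. C * indicator (cball 0 R) x" f])
       (auto intro!: order_trans[OF _ abs_ge_self])
qed

lemma mean_value_partial:
  fixes f :: "real^'n::finite \<Rightarrow> real"
  assumes "\<And>x. f differentiable (at x)"
  obtains \<theta> where "0 < \<theta>" "\<theta> < 1" "f (z + h) - f z = (\<Sum>i\<in>UNIV. h $ i * partial_deriv i f (z + \<theta> *\<^sub>R h))"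
proof -
  have "((\<lambda>s. f (z + s *\<^sub>R h)) has_real_derivative (\<Sum>i\<in>UNIV. h $ i * partial_deriv i f (z + s *\<^sub>R h))) (at s)" for s
  proof -
    have "((\<lambda>s. f (z + s *\<^sub>R h)) has_derivative (\<lambda>r. frechet_derivative f (at (z + s *\<^sub>R h)) (r *\<^sub>R h))) (at s)"
      by (rule has_derivative_compose[where f="\<lambda>s. z + s *\<^sub>R h"])
       (use assms in \<open>auto intro!: derivative_eq_intros simp: frechet_derivative_works\<close>)
    then show ?thesis
      unfolding has_field_derivative_def
      by (rule has_derivative_eq_rhs) (auto simp: frechet_derivative_eq_sum_partial assms sum_distrib_left sum_distrib_right mult_ac)
  qed
  from MVT2[OF _ this, of 0 1] show thesis using that by auto
qed

lemma Cc_infty_lipschitz: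
  assumes "f \<in> Cc_infty UNIV"
  obtains M where "M > 0" "\<And>z h. \<bar>f (z + h) - f z\<bar> \<le> M * norm h"
proof -
  have "\<forall>i. \<exists>C>0. \<forall>x. \<bar>partial_deriv i f x\<bar> \<le> C"
  proof
    fix i
    obtain C R where "C > 0" "\<And>x. \<bar>partial_deriv i f x\<bar> \<le> C * indicator (cball 0 R) x"
      using Cc_infty_bounded[OF Cc_infty_partial_deriv[OF assms]] by metis
    moreover have "C * indicator (cball 0 R) x \<le> C" for x :: "real^'a"
      using \<open>C > 0\<close> by (auto simp: indicator_def)
    ultimately show "\<exists>C>0. \<forall>x. \<bar>partial_deriv i f x\<bar> \<le> C" by (meson order_trans)
  qed
  then obtain C where C: "\<And>i. C i > 0" "\<And>i x. \<bar>partial_deriv i f x\<bar> \<le> C i" by metis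
  show thesis
  proof
    show "(\<Sum>i\<in>UNIV. C i) > 0" using C by (intro sum_pos) auto
    fix z h
    obtain \<theta> where "f (z + h) - f z = (\<Sum>i\<in>UNIV. h $ i * partial_deriv i f (z + \<theta> *\<^sub>R h))"
      using mean_value_partial[of f z h] smooth_differentiable Cc_infty_smooth assms by metis
    then have "\<bar>f (z + h) - f z\<bar> \<le> (\<Sum>i\<in>UNIV. \<bar>h $ i * partial_deriv i f (z + \<theta> *\<^sub>R h)\<bar>)"
      by (simp add: sum_abs)
    also have "\<dots> \<le> (\<Sum>i\<in>UNIV. norm h * C i)"
      using C by (intro sum_mono) (auto simp: abs_mult intro!: mult_mono component_le_norm_cart)
    finally show "\<bar>f (z + h) - f z\<bar> \<le> (\<Sum>i\<in>UNIV. C i) * norm h"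
      by (simp add: sum_distrib_left mult.commute sum_distrib_right)
  qed
qed

text \<open>The Lipschitz bound for the partial derivatives, applied at the intermediate point of
  the mean value theorem, gives a remainder uniform in \<open>z\<close>. That uniformity permits
  differentiation under the step average.\<close>

lemma Cc_infty_taylor:
  assumes "f \<in> Cc_infty UNIV"
  obtains M where "M > 0" "\<And>z h. \<bar>f (z + h) - f z - (\<Sum>i\<in>UNIV. h $ i * partial_deriv i f z)\<bar> \<le> M * (norm h)\<^sup>2"
proof -
  have "\<forall>i. \<exists>M>0. \<forall>z h. \<bar>partial_deriv i f (z + h) - partial_deriv i f z\<bar> \<le> M * norm h"
    using Cc_infty_lipschitz[OF Cc_infty_partial_deriv[OF assms]] by metis
  then obtain C where C: "\<And>i. C i > 0" "\<And>i z h. \<bar>partial_deriv i f (z + h) - partial_deriv i f z\<bar> \<le> C i * norm h"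
    by metis
  show thesis
  proof
    show "(\<Sum>i\<in>UNIV. C i) > 0" using C by (intro sum_pos) auto
    fix z h
    obtain \<theta> where \<theta>: "0 < \<theta>" "\<theta> < 1" "f (z + h) - f z = (\<Sum>i\<in>UNIV. h $ i * partial_deriv i f (z + \<theta> *\<^sub>R h))"
      using mean_value_partial[of f z h] smooth_differentiable Cc_infty_smooth assms by metis
    have "\<bar>f (z + h) - f z - (\<Sum>i\<in>UNIV. h $ i * partial_deriv i f z)\<bar>
       = \<bar>\<Sum>i\<in>UNIV. h $ i * (partial_deriv i f (z + \<theta> *\<^sub>R h) - partial_deriv i f z)\<bar>"
      unfolding \<theta>(3) by (simp add: right_diff_distrib sum_subtractf)
    also have "\<dots> \<le> (\<Sum>i\<in>UNIV. \<bar>h $ i * (partial_deriv i f (z + \<theta> *\<^sub>R h) - partial_deriv i f z)\<bar>)"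
      by (rule sum_abs)
    also have "\<dots> \<le> (\<Sum>i\<in>UNIV. norm h * (C i * norm h))"
    proof (intro sum_mono)
      fix i
      have "\<bar>partial_deriv i f (z + \<theta> *\<^sub>R h) - partial_deriv i f z\<bar> \<le> C i * norm (\<theta> *\<^sub>R h)"
        by (rule C)
      also have "\<dots> \<le> C i * norm h"
        using \<theta> C(1)[of i] by (intro mult_left_mono) (auto intro!: mult_left_le_one_le)
      finally show "\<bar>h $ i * (partial_deriv i f (z + \<theta> *\<^sub>R h) - partial_deriv i f z)\<bar> \<le> norm h * (C i * norm h)"
        by (auto simp: abs_mult intro!: mult_mono component_le_norm_cart)
    qed
    also have "\<dots> = (\<Sum>i\<in>UNIV. C i) * (norm h)\<^sup>2"
      by (simp add: sum_distrib_left sum_distrib_right power2_eq_square mult_ac)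
    finally show "\<bar>f (z + h) - f z - (\<Sum>i\<in>UNIV. h $ i * partial_deriv i f z)\<bar> \<le> (\<Sum>i\<in>UNIV. C i) * (norm h)\<^sup>2" .
  qed
qed

text \<open>The increment \<open>F (x + ?e) - F x\<close> is the integral of the derivative along a
  unit segment. Integrated over all \<open>x\<close> it vanishes by translation invariance, while
  Fubini and the same invariance turn the other side into the integral of the derivative. One
  derivative is assumed, which matches the regularity \<open>C_1_heat\<close> of the heat
  kernel.\<close>

lemma integral_partial_deriv_eq_0:
  fixes F :: "real^'n::finite \<Rightarrow> real"
  assumes F: "C_k 1 F" and supp: "\<And>x. R < norm x \<Longrightarrow> F x = 0"
  shows "(LINT x|lborel. partial_deriv i F x) = 0"
proof -
  let ?D = "partial_deriv i F" and ?e = "axis i (1::real) :: real^'n"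
  have cF: "continuous_on UNIV F" using F by (rule C_k_continuous)
  have cD: "continuous_on UNIV ?D" using F by simp
  have diff: "\<And>x. F differentiable (at x)" using F by simp
  have supp': "\<And>x. R < norm x \<Longrightarrow> ?D x = 0" by (rule partial_deriv_eq_0[OF supp])
  have [measurable]: "?D \<in> borel_measurable borel" by (rule borel_measurable_continuous_onI[OF cD])
  obtain C where C: "C > 0" "\<And>x. \<bar>?D x\<bar> \<le> C * indicator (cball 0 R) x"
    using compact_support_bounded[OF cD supp'] by metis
  have ftc: "(LINT s|lborel. indicator {0..1} s *\<^sub>R ?D (x + s *\<^sub>R ?e)) = F (x + ?e) - F x" for x
  proof -
    have "((\<lambda>s. F (x + s *\<^sub>R ?e)) has_vector_derivative ?D (x + s *\<^sub>R ?e)) (at s within {0..1})" for s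
    proof -
      have "((\<lambda>s. F (x + s *\<^sub>R ?e)) has_derivative (\<lambda>r. frechet_derivative F (at (x + s *\<^sub>R ?e)) (r *\<^sub>R ?e))) (at s)"
        by (rule has_derivative_compose[where f="\<lambda>s. x + s *\<^sub>R ?e"])
         (use diff in \<open>auto intro!: derivative_eq_intros simp: frechet_derivative_works\<close>)
      then have "((\<lambda>s. F (x + s *\<^sub>R ?e)) has_vector_derivative ?D (x + s *\<^sub>R ?e)) (at s)"
        unfolding has_vector_derivative_def
        by (rule has_derivative_eq_rhs)
           (auto simp: linear_cmul[OF linear_frechet_derivative[OF diff]] partial_deriv_def)
      then show ?thesis by (rule has_vector_derivative_at_within)
    qed
    then show ?thesis
      by (subst integral_FTC_Icc[where F="\<lambda>s. F (x + s *\<^sub>R ?e)"])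
         (auto intro!: continuous_on_compose2[OF cD] continuous_intros)
  qed
  \<comment> \<open>Moving by at most \<open>norm ?e = 1\<close> keeps the support within the ball
    of radius \<open>R + 1\<close>, so the double integral converges absolutely.\<close>
  have int: "integrable (lborel \<Otimes>\<^sub>M lborel) (\<lambda>(s, x). indicator {0..1} s *\<^sub>R ?D (x + s *\<^sub>R ?e))"
  proof (rule Bochner_Integration.integrable_bound)
    show "integrable (lborel \<Otimes>\<^sub>M lborel) (\<lambda>z. C * indicator ({0..1::real} \<times> cball (0::real^'n) (R + 1)) z :: real)"
      by (intro integrable_mult_right integrable_real_indicator)
         (auto simp: lborel.emeasure_pair_measure_Times ennreal_mult_less_top intro: emeasure_bounded_finite[unfolded infinity_ennreal_def])
    have "\<bar>?D (x + s *\<^sub>R ?e)\<bar> \<le> C * indicator (cball 0 (R + 1)) x" if "0 \<le> s" "s \<le> 1" for s x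
    proof (cases "norm x \<le> R + 1")
      case True
      then show ?thesis using C(2)[of "x + s *\<^sub>R ?e"] C(1)
        by (auto simp: indicator_def of_bool_def split: if_splits)
    next
      case False
      have "norm x \<le> norm (x + s *\<^sub>R ?e) + norm (s *\<^sub>R ?e)"
        using norm_triangle_ineq4[of "x + s *\<^sub>R ?e" "s *\<^sub>R ?e"] by simp
      with False that have "R < norm (x + s *\<^sub>R ?e)" by (simp add: norm_axis_1)
      then show ?thesis using supp' C(1) by (simp add: indicator_def)
    qed
    then have "norm (indicator {0..1} s *\<^sub>R ?D (x + s *\<^sub>R ?e)) \<le> norm (C * indicator ({0..1} \<times> cball 0 (R + 1)) (s, x) :: real)" for s x
      using C(1) by (cases "s \<in> {0..1}") (auto simp: indicator_times)
    then show "AE z in lborel \<Otimes>\<^sub>M lborel. norm (case z of (s, x) \<Rightarrow> indicator {0..1} s *\<^sub>R ?D (x + s *\<^sub>R ?e))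
        \<le> norm (C * indicator ({0..1} \<times> cball 0 (R + 1)) z :: real)"
      by (intro AE_I2) (simp only: split_paired_all prod.case)
  qed (use cD in measurable)
  have iF: "integrable lborel F" by (rule integrable_compact_support[OF cF supp])
  have iF': "integrable lborel (\<lambda>x. F (x + ?e))"
  proof (rule integrable_compact_support[of _ "R + 1"])
    fix x :: "real^'n" assume "R + 1 < norm x"
    moreover have "norm x \<le> norm (x + ?e) + norm ?e"
      using norm_triangle_ineq4[of "x + ?e" "?e"] by simp
    ultimately show "F (x + ?e) = 0" by (intro supp) (simp add: norm_axis_1)
  qed (auto intro!: continuous_on_compose2[OF cF] continuous_intros)
  have tr: "(LINT x|lborel. ?D (x + a)) = (LINT x|lborel. ?D x)" for a
    using integral_translate[of ?D a] by (simp only: add.commute[of a])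
  have "(LINT x|lborel. LINT s|lborel. indicator {0..1} s *\<^sub>R ?D (x + s *\<^sub>R ?e))
     = (LINT s|lborel. LINT x|lborel. indicator {0..1} s *\<^sub>R ?D (x + s *\<^sub>R ?e))"
    using lborel_pair.Fubini_integral[OF int] by simp
  also have "\<dots> = (LINT s|lborel. indicator {0..1::real} s *\<^sub>R (LINT x|lborel. ?D x))"
    by (simp add: tr)
  also have "\<dots> = (LINT x|lborel. ?D x)" by simp
  finally have "(LINT x|lborel. ?D x) = (LINT x|lborel. F (x + ?e) - F x)"
    unfolding ftc by simp
  also have "\<dots> = 0"
    using integral_translate[of F ?e]
    by (simp add: Bochner_Integration.integral_diff[OF iF' iF] add.commute[of ?e])
  finally show ?thesis .
qed

section \<open>Derivatives of the heat kernel and Gaussian integration by parts\<close>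

lemma heat_eq_exp:
  assumes "t > 0"
  shows "heat t (y::real^'n::finite) = (1 / sqrt (4 * pi * t)) ^ CARD('n) * exp (- (y \<bullet> y) / (4 * t))"
proof -
  have "heat t y = (\<Prod>i\<in>(UNIV::'n set). 1 / sqrt (4 * pi * t) * exp (- (y $ i)\<^sup>2 / (4 * t)))"
    using assms by (simp add: heat_def normal_density_def mult_ac)
  also have "\<dots> = (1 / sqrt (4 * pi * t)) ^ CARD('n) * exp (\<Sum>i\<in>UNIV. - (y $ i)\<^sup>2 / (4 * t))"
    by (simp add: prod_dividef exp_sum power_one_over)
  also have "(\<Sum>i\<in>UNIV. - (y $ i)\<^sup>2 / (4 * t)) = - (y \<bullet> y) / (4 * t)"
    by (simp add: inner_vec_def power2_eq_square sum_divide_distrib sum_negf)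
  finally show ?thesis .
qed

lemma has_derivative_heat:
  assumes "t > 0"
  shows "(heat t has_derivative (\<lambda>h. - (y \<bullet> h) / (2 * t) * heat t (y::real^'n::finite))) (at y)"
proof -
  have h: "heat t = (\<lambda>y::real^'n. (1 / sqrt (4 * pi * t)) ^ CARD('n) * exp (- (y \<bullet> y) / (4 * t)))"
    using heat_eq_exp[OF assms] by (intro ext)
  show ?thesis
    unfolding h using assms
    by (auto intro!: derivative_eq_intros simp: fun_eq_iff inner_commute field_simps)
qed

lemma partial_deriv_heat:
  assumes "t > 0" shows "partial_deriv i (heat t) y = - (y $ i / (2 * t)) * heat t y"
  using partial_deriv_eq[OF has_derivative_heat[OF assms]] by (simp add: inner_axis)

lemma continuous_heat:
  assumes "t > 0" shows "continuous_on UNIV (heat t :: real^'n::finite \<Rightarrow> real)"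
  using has_derivative_heat[OF assms] has_derivative_continuous
  by (intro continuous_at_imp_continuous_on ballI) blast

lemma C_1_heat:
  assumes "t > 0" shows "C_k 1 (heat t :: real^'n::finite \<Rightarrow> real)"
proof -
  have "partial_deriv i (heat t) = (\<lambda>y::real^'n. - (y $ i / (2 * t)) * heat t y)" for i
    using partial_deriv_heat[OF assms] by (intro ext)
  then show ?thesis
    using assms has_derivative_heat[OF assms] by (auto simp: differentiable_def intro!: continuous_intros continuous_heat)
qed

text \<open>Gaussian integration by parts: it turns derivatives of test functions into the weight
  \<open>y\<^sub>i / (2t)\<close>, both for the gradient of the resolvent and for the heat equation.\<close>

lemma heat_integration_by_parts:
  fixes f :: "real^'n::finite \<Rightarrow> real"
  assumes "t > 0" "f \<in> Cc_infty UNIV"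
  shows "(LINT y|lborel. heat t y * partial_deriv i f (x + y)) = (LINT y|lborel. heat t y * (y $ i / (2 * t)) * f (x + y))"
proof -
  let ?f = "\<lambda>y. f (x + y)"
  have f: "?f \<in> Cc_infty UNIV" using Cc_infty_affine[OF assms(2), of 1 x] by simp
  then obtain R where R: "\<And>y. R < norm y \<Longrightarrow> ?f y = 0" using Cc_infty_support by metis
  have df: "partial_deriv i ?f y = partial_deriv i f (x + y)" for y
    using partial_deriv_affine[of f x 1 y i] smooth_differentiable[OF Cc_infty_smooth[OF assms(2)]] by simp
  have cdf: "continuous_on UNIV (\<lambda>y. partial_deriv i f (x + y))"
    using smooth_continuous[OF Cc_infty_smooth[OF Cc_infty_partial_deriv[OF f, of i]]]
    unfolding df[abs_def, symmetric] .
  have cf: "continuous_on UNIV ?f" using smooth_continuous[OF Cc_infty_smooth[OF f]] .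
  have R': "partial_deriv i f (x + y) = 0" if "R < norm y" for y
    using partial_deriv_eq_0[of R ?f y i, OF R that] df by simp
  have "C_k 1 (\<lambda>y. heat t y * ?f y)"
    using C_k_mult[OF C_1_heat[OF assms(1)] smooth_C_k[OF Cc_infty_smooth[OF f]]] .
  then have zero: "(LINT y|lborel. partial_deriv i (\<lambda>y. heat t y * ?f y) y) = 0"
    by (rule integral_partial_deriv_eq_0[where R=R]) (simp add: R)
  have eq: "partial_deriv i (\<lambda>y. heat t y * ?f y) = (\<lambda>y. heat t y * partial_deriv i f (x + y) - heat t y * (y $ i / (2 * t)) * f (x + y))"
  proof
    fix y :: "real^'n"
    have "heat t differentiable (at y)"
      using has_derivative_heat[OF assms(1)] differentiableI by blast
    then show "partial_deriv i (\<lambda>y. heat t y * ?f y) y = heat t y * partial_deriv i f (x + y) - heat t y * (y $ i / (2 * t)) * f (x + y)"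
      using smooth_differentiable[OF Cc_infty_smooth[OF f]]
      by (simp add: partial_deriv_mult df partial_deriv_heat[OF assms(1)] del: minus_divide_left)
  qed
  have "(LINT y|lborel. heat t y * partial_deriv i f (x + y) - heat t y * (y $ i / (2 * t)) * f (x + y)) =
    (LINT y|lborel. heat t y * partial_deriv i f (x + y)) - (LINT y|lborel. heat t y * (y $ i / (2 * t)) * f (x + y))"
  proof (intro Bochner_Integration.integral_diff integrable_compact_support[where R=R])
    have "continuous_on UNIV (heat t :: real^'n \<Rightarrow> real)" by (rule continuous_heat[OF assms(1)])
    then show "continuous_on UNIV (\<lambda>y. heat t y * partial_deriv i f (x + y))"
      "continuous_on UNIV (\<lambda>y. heat t y * (y $ i / (2 * t)) * f (x + y))"
      using cf cdf assms(1) by (intro continuous_on_mult continuous_on_divide continuous_intros; simp)+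
  qed (simp_all add: R R')
  then show ?thesis using zero unfolding eq by simp
qed

section \<open>The resolvent as a random walk step\<close>

text \<open>The step of the random walk is a Gaussian vector run for an exponential time; after \<open>k + 1\<close>
  steps the elapsed time is Erlang distributed. We keep the time as a coordinate, since the
  gradient of the resolvent carries the weight \<open>y / (2t)\<close>.\<close>

definition step :: "real \<Rightarrow> nat \<Rightarrow> (real \<times> (real^'n::finite)) measure" where
  "step l k = density (lborel \<Otimes>\<^sub>M lborel) (\<lambda>(t, y). ennreal (erlang_density k l t * heat t y))"

text \<open>The density of the spatial marginal of \<open>step l k\<close>: for \<open>k = 0\<close>
  the kernel of \<open>l (l - \<Delta>)\<close> inverse, in general of its power
  \<open>k + 1\<close>. Values are in \<open>ennreal\<close> because the kernel of order 0 is
  infinite at the origin from dimension two on.\<close>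

definition resolvent_kernel :: "real \<Rightarrow> nat \<Rightarrow> real^'n::finite \<Rightarrow> ennreal" where
  "resolvent_kernel l k y = (\<integral>\<^sup>+t. ennreal (erlang_density k l t * heat t y) \<partial>lborel)"

lemma sets_step [measurable_cong, simp]: "sets (step l k :: (real \<times> (real^'n::finite)) measure) = sets (borel \<Otimes>\<^sub>M borel)"
  by (simp add: step_def cong: sets_pair_measure_cong)

lemma space_step [simp]: "space (step l k) = UNIV"
  by (simp add: step_def space_pair_measure)

lemma nn_integral_step:
  assumes [measurable]: "f \<in> borel_measurable (borel \<Otimes>\<^sub>M borel)"
  shows "(\<integral>\<^sup>+z. f z \<partial>step l k) = (\<integral>\<^sup>+t. ennreal (erlang_density k l t) * (\<integral>\<^sup>+y. ennreal (heat t (y::real^'n::finite)) * f (t, y) \<partial>lborel) \<partial>lborel)"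
proof -
  have "(\<integral>\<^sup>+z. f z \<partial>step l k) = (\<integral>\<^sup>+z. ennreal (erlang_density k l (fst z) * heat (fst z) (snd z)) * f z \<partial>(lborel \<Otimes>\<^sub>M lborel))"
    unfolding step_def by (subst nn_integral_density) (auto simp: case_prod_beta')
  also have "\<dots> = (\<integral>\<^sup>+t. \<integral>\<^sup>+y. ennreal (erlang_density k l t * heat t y) * f (t, y) \<partial>lborel \<partial>lborel)"
    by (subst lborel.nn_integral_fst[symmetric]) simp_all
  also have "\<dots> = (\<integral>\<^sup>+t. ennreal (erlang_density k l t) * (\<integral>\<^sup>+y. ennreal (heat t y) * f (t, y) \<partial>lborel) \<partial>lborel)"
    by (subst nn_integral_cmult[symmetric]) (auto simp: ennreal_mult'' mult.assoc)
  finally show ?thesis .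
qed

lemma resolvent_kernel_measurable [measurable]: "resolvent_kernel l k \<in> borel_measurable borel"
  unfolding resolvent_kernel_def[abs_def] by measurable

lemma nn_integral_step_snd:
  assumes [measurable]: "f \<in> borel_measurable borel"
  shows "(\<integral>\<^sup>+z. f (snd z) \<partial>step l k) = (\<integral>\<^sup>+y. resolvent_kernel l k y * f (y::real^'n::finite) \<partial>lborel)"
proof -
  have "(\<integral>\<^sup>+z. f (snd z) \<partial>step l k) = (\<integral>\<^sup>+t. \<integral>\<^sup>+y. ennreal (erlang_density k l t * heat t y) * f y \<partial>lborel \<partial>lborel)"
    by (subst nn_integral_step) (auto simp: nn_integral_cmult[symmetric] ennreal_mult'' mult.assoc)
  also have "\<dots> = (\<integral>\<^sup>+y. \<integral>\<^sup>+t. ennreal (erlang_density k l t * heat t y) * f y \<partial>lborel \<partial>lborel)"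
    by (rule lborel_pair.Fubini') simp
  also have "\<dots> = (\<integral>\<^sup>+y. resolvent_kernel l k y * f y \<partial>lborel)"
    unfolding resolvent_kernel_def by (subst nn_integral_multc) auto
  finally show ?thesis .
qed

lemma nn_integral_step_add:
  assumes [measurable]: "f \<in> borel_measurable borel"
  shows "(\<integral>\<^sup>+z. f (x + snd z) \<partial>step l k) = (\<integral>\<^sup>+y. resolvent_kernel l k (y - x) * f (y::real^'n::finite) \<partial>lborel)"
  using nn_integral_translate[of "\<lambda>y. resolvent_kernel l k (y - x) * f y" x]
  by (simp add: nn_integral_step_snd[of "\<lambda>y. f (x + y)"])

lemma resolvent_kernel_minus [simp]: "resolvent_kernel l k (- y) = resolvent_kernel l k y"
  by (simp add: resolvent_kernel_def)

text \<open>The displacement has a density, so an exceptional null set is invisible to the average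
  from every \<open>x\<close>. This is what allows an inequality valid almost everywhere to be
  iterated.\<close>

lemma nn_integral_step_mono_AE:
  assumes [measurable]: "f \<in> borel_measurable borel" "g \<in> borel_measurable borel"
    and "AE x in lborel. f (x::real^'n::finite) \<le> g x"
  shows "(\<integral>\<^sup>+z. f (x + snd z) \<partial>step l k) \<le> (\<integral>\<^sup>+z. g (x + snd z) \<partial>step l k)"
  unfolding nn_integral_step_add[OF assms(1)] nn_integral_step_add[OF assms(2)]
  by (rule nn_integral_mono_AE, rule AE_mp[OF assms(3)]) (auto intro!: AE_I2 mult_left_mono)

text \<open>Negative times have density zero and time zero is a null set, so properties of the heat
  kernel need to be checked only where it is a genuine Gaussian.\<close>

lemma AE_erlang_pos:
  assumes "\<And>t. 0 < t \<Longrightarrow> P t"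
  shows "AE t in lborel. erlang_density k l t = 0 \<or> P t"
proof -
  have "AE t in lborel. t \<noteq> (0::real)" by (rule AE_lborel_singleton)
  then show ?thesis
    by eventually_elim (use assms in \<open>auto simp: erlang_density_def not_less\<close>)
qed

lemma nn_integral_erlang_cong:
  assumes "\<And>t. 0 < t \<Longrightarrow> f t = g t"
  shows "(\<integral>\<^sup>+t. ennreal (erlang_density k l t) * f t \<partial>lborel) = (\<integral>\<^sup>+t. ennreal (erlang_density k l t) * g t \<partial>lborel)"
  using AE_erlang_pos[of "\<lambda>t. f t = g t" k l, OF assms] by (intro nn_integral_cong_AE) auto

lemma nn_integral_erlang_mono:
  assumes "\<And>t. 0 < t \<Longrightarrow> f t \<le> g t"
  shows "(\<integral>\<^sup>+t. ennreal (erlang_density k l t) * f t \<partial>lborel) \<le> (\<integral>\<^sup>+t. ennreal (erlang_density k l t) * g t \<partial>lborel)"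
  by (intro nn_integral_mono_AE, rule AE_mp[OF AE_erlang_pos[of "\<lambda>t. f t \<le> g t" k l, OF assms]])
     (auto intro!: AE_I2 mult_left_mono)

context
  fixes l :: real assumes l: "0 < l"
begin

lemma erlang_nonneg [simp]: "0 \<le> erlang_density k l t"
  using l by (simp add: erlang_density_nonneg)

lemma prob_space_step: "prob_space (step l k :: (real \<times> (real^'n::finite)) measure)"
proof
  have "(\<integral>\<^sup>+z. 1 \<partial>(step l k :: (real \<times> (real^'n)) measure)) = (\<integral>\<^sup>+t. ennreal (erlang_density k l t) * (\<integral>\<^sup>+y. ennreal (heat t (y::real^'n)) \<partial>lborel) \<partial>lborel)"
    by (subst nn_integral_step) simp_all
  also have "\<dots> = (\<integral>\<^sup>+t. ennreal (erlang_density k l t) * 1 \<partial>lborel)"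
    by (rule nn_integral_erlang_cong) (simp add: nn_integral_heat)
  also have "\<dots> = 1"
    using nn_integral_erlang_ith_moment[OF l, of k 0] by simp
  finally show "emeasure (step l k :: (real \<times> (real^'n)) measure) (space (step l k)) = 1" by simp
qed

text \<open>Heat kernels convolve by adding times, and the sum of independent exponential and Erlang
  times is Erlang of the next order. Fubini separates the two convolutions.\<close>

lemma resolvent_kernel_convolution:
  "(\<integral>\<^sup>+y. resolvent_kernel l 0 y * resolvent_kernel l k (w - y) \<partial>lborel) = resolvent_kernel l (Suc k) (w::real^'n::finite)"
proof -
  let ?e = "\<lambda>k t. ennreal (erlang_density k l t)" and ?h = "\<lambda>t y. ennreal (heat t (y::real^'n))"
  have "(\<integral>\<^sup>+y. resolvent_kernel l 0 y * resolvent_kernel l k (w - y) \<partial>lborel)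
     = (\<integral>\<^sup>+y. \<integral>\<^sup>+s. \<integral>\<^sup>+t. (?e 0 s * ?h s y) * (?e k t * ?h t (w - y)) \<partial>lborel \<partial>lborel \<partial>lborel)"
    unfolding resolvent_kernel_def
    by (simp add: nn_integral_multc nn_integral_cmult ennreal_mult)
  also have "\<dots> = (\<integral>\<^sup>+s. \<integral>\<^sup>+y. \<integral>\<^sup>+t. (?e 0 s * ?h s y) * (?e k t * ?h t (w - y)) \<partial>lborel \<partial>lborel \<partial>lborel)"
    by (rule lborel_pair.Fubini') simp
  also have "\<dots> = (\<integral>\<^sup>+s. \<integral>\<^sup>+t. \<integral>\<^sup>+y. (?e 0 s * ?h s y) * (?e k t * ?h t (w - y)) \<partial>lborel \<partial>lborel \<partial>lborel)"
    by (intro nn_integral_cong lborel_pair.Fubini') simp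
  also have "\<dots> = (\<integral>\<^sup>+s. ?e 0 s * (\<integral>\<^sup>+t. ?e k t * (\<integral>\<^sup>+y. ?h t (w - y) * ?h s y \<partial>lborel) \<partial>lborel) \<partial>lborel)"
    by (intro nn_integral_cong) (auto simp: nn_integral_cmult[symmetric] mult_ac intro!: nn_integral_cong)
  also have "\<dots> = (\<integral>\<^sup>+s. ?e 0 s * (\<integral>\<^sup>+t. ?e k t * ?h (t + s) w \<partial>lborel) \<partial>lborel)"
    by (intro nn_integral_erlang_cong heat_convolution)
  also have "\<dots> = (\<integral>\<^sup>+s. \<integral>\<^sup>+t. ?e 0 s * ?e k t * ?h (t + s) w \<partial>lborel \<partial>lborel)"
    by (simp add: nn_integral_cmult[symmetric] mult.assoc)
  \<comment> \<open>Substitution of the total time \<open>r = t + s\<close>, which frees the heat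
    kernel from the inner variable.\<close>
  also have "\<dots> = (\<integral>\<^sup>+s. \<integral>\<^sup>+r. ?e 0 s * ?e k (r - s) * ?h r w \<partial>lborel \<partial>lborel)"
  proof (rule nn_integral_cong)
    fix s :: real
    show "(\<integral>\<^sup>+t. ?e 0 s * ?e k t * ?h (t + s) w \<partial>lborel) = (\<integral>\<^sup>+r. ?e 0 s * ?e k (r - s) * ?h r w \<partial>lborel)"
      using nn_integral_translate[of "\<lambda>r. ?e 0 s * ?e k (r - s) * ?h r w" s] by (simp add: add.commute)
  qed
  also have "\<dots> = (\<integral>\<^sup>+r. \<integral>\<^sup>+s. ?e 0 s * ?e k (r - s) * ?h r w \<partial>lborel \<partial>lborel)"
    by (rule lborel_pair.Fubini') simp
  also have "\<dots> = (\<integral>\<^sup>+r. \<integral>\<^sup>+s. (?e k (r - s) * ?e 0 s) * ?h r w \<partial>lborel \<partial>lborel)"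
    by (simp only: mult_ac)
  also have "\<dots> = (\<integral>\<^sup>+r. (\<integral>\<^sup>+s. ?e k (r - s) * ?e 0 s \<partial>lborel) * ?h r w \<partial>lborel)"
    by (intro nn_integral_cong nn_integral_multc) simp
  also have "\<dots> = resolvent_kernel l (Suc k) w"
    unfolding convolution_erlang_density[OF l, THEN fun_cong] resolvent_kernel_def
    by (simp add: ennreal_mult)
  finally show ?thesis .
qed

text \<open>Concatenating independent displacements convolves their kernels; iterated, this merges a
  whole block of single steps into one step of higher order.\<close>

lemma nn_integral_step_Suc:
  assumes [measurable]: "f \<in> borel_measurable borel"
  shows "(\<integral>\<^sup>+z. \<integral>\<^sup>+z'. f (x + snd z + snd z') \<partial>step l k \<partial>step l 0) = (\<integral>\<^sup>+z. f (x + snd z :: real^'n::finite) \<partial>step l (Suc k))"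
proof -
  have "(\<integral>\<^sup>+z. \<integral>\<^sup>+z'. f (x + snd z + snd z') \<partial>step l k \<partial>step l 0)
      = (\<integral>\<^sup>+z. (\<lambda>y. \<integral>\<^sup>+w. resolvent_kernel l k (w - (x + y)) * f w \<partial>lborel) (snd z) \<partial>step l 0)"
    by (simp add: nn_integral_step_add)
  also have "\<dots> = (\<integral>\<^sup>+y. resolvent_kernel l 0 y * (\<integral>\<^sup>+w. resolvent_kernel l k (w - (x + y)) * f w \<partial>lborel) \<partial>lborel)"
    by (rule nn_integral_step_snd) simp
  also have "\<dots> = (\<integral>\<^sup>+y. \<integral>\<^sup>+w. resolvent_kernel l 0 y * resolvent_kernel l k (w - x - y) * f w \<partial>lborel \<partial>lborel)"
    by (simp add: nn_integral_cmult[symmetric] mult.assoc diff_diff_eq)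
  also have "\<dots> = (\<integral>\<^sup>+w. \<integral>\<^sup>+y. resolvent_kernel l 0 y * resolvent_kernel l k (w - x - y) * f w \<partial>lborel \<partial>lborel)"
    by (rule lborel_pair.Fubini') simp
  also have "\<dots> = (\<integral>\<^sup>+w. resolvent_kernel l (Suc k) (w - x) * f w \<partial>lborel)"
    by (simp add: nn_integral_multc resolvent_kernel_convolution)
  also have "\<dots> = (\<integral>\<^sup>+z. f (x + snd z) \<partial>step l (Suc k))"
    by (simp add: nn_integral_step_add)
  finally show ?thesis .
qed

section \<open>Integrability of the gradient weight\<close>

text \<open>Up to time one the exponential density is at most \<open>l\<close> and the power -1/2 of
  \<open>t\<close> is integrable; after time one the extra factor is below 1.\<close>

lemma nn_integral_exp_div_sqrt:
  "(\<integral>\<^sup>+t. ennreal (erlang_density 0 l t * (1 / sqrt (2 * t))) \<partial>lborel) < \<infinity>"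
proof -
  have hi: "((\<lambda>t::real. t powr (-1/2)) has_integral (1 powr (-1/2 + 1) / (-1/2 + 1))) {0..1}"
    by (rule has_integral_powr_from_0) auto
  have "(\<integral>\<^sup>+t. ennreal (erlang_density 0 l t * (1 / sqrt (2 * t))) \<partial>lborel)
     \<le> (\<integral>\<^sup>+t. ennreal l * (indicator {0..1} t * ennreal (t powr (-1/2))) + ennreal (erlang_density 0 l t) \<partial>lborel)"
  proof (rule nn_integral_mono)
    fix t :: real
    consider "t \<le> 0" | "0 < t" "t \<le> 1" | "1 < t" by linarith
    then show "ennreal (erlang_density 0 l t * (1 / sqrt (2 * t))) \<le> ennreal l * (indicator {0..1} t * ennreal (t powr (-1/2))) + ennreal (erlang_density 0 l t)"
    proof cases
      case 1 then show ?thesis by (cases "t = 0") (auto simp: erlang_density_def)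
    next
      case 2
      have "erlang_density 0 l t * (1 / sqrt (2 * t)) \<le> l * (t powr (-1/2))"
      proof (rule mult_mono)
        show "erlang_density 0 l t \<le> l" using l 2 by (simp add: erlang_density_def)
        have "1 / sqrt (2 * t) \<le> 1 / sqrt t" using 2 by (simp add: frac_le)
        then show "1 / sqrt (2 * t) \<le> t powr (-1/2)" using 2 by (simp add: powr_minus_divide powr_half_sqrt)
      qed (use l 2 in auto)
      then have "ennreal (erlang_density 0 l t * (1 / sqrt (2 * t))) \<le> ennreal (l * (t powr (-1/2)))"
        by (rule ennreal_leI)
      also have "\<dots> = ennreal l * (indicator {0..1} t * ennreal (t powr (-1/2)))"
        using 2 l by (simp add: ennreal_mult)
      finally show ?thesis by (rule order_trans) simp
    next
      case 3
      have "erlang_density 0 l t * (1 / sqrt (2 * t)) \<le> erlang_density 0 l t"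
        using 3 by (intro mult_left_le) auto
      then have "ennreal (erlang_density 0 l t * (1 / sqrt (2 * t))) \<le> ennreal (erlang_density 0 l t)"
        by (rule ennreal_leI)
      then show ?thesis by (rule order_trans) simp
    qed
  qed
  also have "\<dots> = ennreal l * (\<integral>\<^sup>+t. ennreal (indicator {0..1} t * t powr (-1/2)) \<partial>lborel) + 1"
    using nn_integral_erlang_ith_moment[OF l, of 0 0]
    by (simp add: nn_integral_add nn_integral_cmult ennreal_mult' ennreal_indicator)
  also have "(\<integral>\<^sup>+t. ennreal (indicator {0..1} t * t powr (-1/2)) \<partial>lborel) = ennreal 2"
    using hi by (intro nn_integral_has_integral_lborel) (auto simp: has_integral_restrict_UNIV[symmetric, of _ _ "{0..1}"] indicator_def of_bool_def if_distrib if_distribR cong: if_cong)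
  also have "ennreal l * ennreal 2 + 1 < \<infinity>"
    by (simp add: ennreal_mult_less_top)
  finally show ?thesis .
qed

definition gradient_mass :: real where
  "gradient_mass = enn2real (\<integral>\<^sup>+t. ennreal (erlang_density 0 l t * (1 / sqrt (2 * t))) \<partial>lborel)"

text \<open>Since \<open>y / (2t)\<close> is minus the logarithmic gradient of the heat kernel, this
  controls the total mass of the gradient of the resolvent kernel.\<close>

lemma nn_integral_gradient_weight:
  "(\<integral>\<^sup>+z. ennreal (\<bar>snd z $ i\<bar> / (2 * fst z)) \<partial>(step l 0 :: (real \<times> (real^'n::finite)) measure)) \<le> ennreal gradient_mass"
proof -
  have "(\<integral>\<^sup>+z. ennreal (\<bar>snd z $ i\<bar> / (2 * fst z)) \<partial>(step l 0 :: (real \<times> (real^'n)) measure))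
    = (\<integral>\<^sup>+t. ennreal (erlang_density 0 l t) * (\<integral>\<^sup>+y. ennreal (heat t (y::real^'n)) * ennreal (\<bar>y $ i\<bar> / (2 * t)) \<partial>lborel) \<partial>lborel)"
    by (subst nn_integral_step) simp_all
  also have "\<dots> \<le> (\<integral>\<^sup>+t. ennreal (erlang_density 0 l t) * ennreal (1 / sqrt (2 * t)) \<partial>lborel)"
  proof (rule nn_integral_erlang_mono)
    fix t :: real assume t: "t > 0"
    have "(\<integral>\<^sup>+y. ennreal (heat t (y::real^'n)) * ennreal (\<bar>y $ i\<bar> / (2 * t)) \<partial>lborel)
       = (\<integral>\<^sup>+y. ennreal (1 / (2 * t)) * ennreal (heat t (y::real^'n) * \<bar>y $ i\<bar>) \<partial>lborel)"
      using t by (intro nn_integral_cong) (simp add: ennreal_mult[symmetric])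
    also have "\<dots> = ennreal (1 / (2 * t)) * (\<integral>\<^sup>+y. ennreal (heat t (y::real^'n) * \<bar>y $ i\<bar>) \<partial>lborel)"
      by (simp add: nn_integral_cmult)
    also have "\<dots> \<le> ennreal (1 / (2 * t)) * ennreal (sqrt (2 * t))"
      by (intro mult_left_mono nn_integral_heat_abs t) simp
    also have "\<dots> = ennreal (1 / sqrt (2 * t))"
      using t by (simp add: ennreal_mult[symmetric] real_div_sqrt field_simps)
    finally show "(\<integral>\<^sup>+y. ennreal (heat t (y::real^'n)) * ennreal (\<bar>y $ i\<bar> / (2 * t)) \<partial>lborel) \<le> ennreal (1 / sqrt (2 * t))" .
  qed
  also have "\<dots> = (\<integral>\<^sup>+t. ennreal (erlang_density 0 l t * (1 / sqrt (2 * t))) \<partial>lborel)"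
    by (intro nn_integral_cong, subst ennreal_mult'[symmetric]) simp_all
  also have "\<dots> = ennreal gradient_mass"
    using nn_integral_exp_div_sqrt by (simp add: gradient_mass_def)
  finally show ?thesis .
qed

end

section \<open>The Laplacian under the step average\<close>

definition laplacian :: "(real^'n::finite \<Rightarrow> real) \<Rightarrow> real^'n \<Rightarrow> real" where
  "laplacian f x = (\<Sum>i\<in>UNIV. partial_deriv i (partial_deriv i f) x)"

lemma Cc_infty_laplacian: "f \<in> Cc_infty UNIV \<Longrightarrow> laplacian f \<in> Cc_infty UNIV"
  unfolding laplacian_def[abs_def] by (intro Cc_infty_sum Cc_infty_partial_deriv)

lemma Cc_infty_bounded_by:
  assumes "f \<in> Cc_infty UNIV" obtains C where "C > 0" "\<And>x. \<bar>f x\<bar> \<le> C"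
proof -
  obtain C R where C: "C > 0" "\<And>x. \<bar>f x\<bar> \<le> C * indicator (cball 0 R) x"
    using Cc_infty_bounded[OF assms] by metis
  have "\<bar>f x\<bar> \<le> C" for x
    using C(2)[of x] C(1) by (auto simp: indicator_def of_bool_def split: if_splits)
  with C(1) show thesis by (rule that)
qed

lemma heat_scale:
  assumes "t > 0"
  shows "sqrt (2 * t) ^ CARD('n) * heat t (sqrt (2 * t) *\<^sub>R (w::real^'n::finite)) = heat (1 / 2) w"
proof -
  have "sqrt (2 * t) / sqrt (4 * pi * t) = 1 / sqrt (4 * pi * (1 / 2))"
    using assms by (simp add: real_sqrt_divide real_sqrt_mult field_simps)
  then have c: "sqrt (2 * t) ^ CARD('n) * (1 / sqrt (4 * pi * t)) ^ CARD('n) = (1 / sqrt (4 * pi * (1 / 2))) ^ CARD('n)"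
    by (simp only: power_mult_distrib[symmetric] times_divide_eq_right mult_1_right)
  have "sqrt (2 * t) *\<^sub>R w \<bullet> sqrt (2 * t) *\<^sub>R w = 2 * t * (w \<bullet> w)"
    using assms by (simp add: mult.assoc[symmetric])
  then have e: "- (sqrt (2 * t) *\<^sub>R w \<bullet> sqrt (2 * t) *\<^sub>R w) / (4 * t) = - (w \<bullet> w) / (4 * (1 / 2))"
    using assms by (simp add: field_simps)
  show ?thesis
    unfolding heat_eq_exp[OF assms] heat_eq_exp[of "1/2", simplified] mult.assoc[symmetric] c e by simp
qed

text \<open>\<open>heat (1/2)\<close> is the standard normal density. Writing the displacement as
  \<open>sqrt (2 * t)\<close> times a standard normal \<open>w\<close> separates time from noise, so
  that one can differentiate in \<open>t\<close> with \<open>w\<close> fixed.\<close>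

lemma heat_distr:
  assumes t: "t > 0"
  shows "density lborel (\<lambda>y. ennreal (heat t y)) = distr (density lborel (\<lambda>w. ennreal (heat (1/2) w))) borel (\<lambda>w::real^'n::finite. sqrt (2 * t) *\<^sub>R w)"
    (is "?L = ?R")
proof (rule measure_eqI)
  let ?c = "sqrt (2 * t)"
  have c: "?c > 0" using t by simp
  fix A assume "A \<in> sets ?L"
  then have [measurable]: "A \<in> sets borel" by simp
  have "emeasure ?L A = (\<integral>\<^sup>+y. ennreal (heat t y) * indicator A y \<partial>lborel)"
    by (subst emeasure_density) auto
  also have "\<dots> = (\<integral>\<^sup>+w. ennreal (\<bar>?c\<bar> ^ DIM(real^'n)) * (ennreal (heat t (?c *\<^sub>R w)) * indicator A (?c *\<^sub>R w)) \<partial>lborel)"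
    using c by (subst lborel_affine[of ?c "0::real^'n"]) (auto simp: nn_integral_density nn_integral_distr)
  also have "\<dots> = (\<integral>\<^sup>+w. ennreal (heat (1/2) w) * indicator A (?c *\<^sub>R w) \<partial>lborel)"
    using c t by (intro nn_integral_cong) (simp add: heat_scale[symmetric, OF t] ennreal_mult mult.assoc)
  also have "\<dots> = emeasure ?R A"
    by (simp add: nn_integral_distr nn_integral_density flip: nn_integral_indicator)
  finally show "emeasure ?L A = emeasure ?R A" .
qed simp

text \<open>Minus the logarithmic derivative of the heat kernel in direction \<open>i\<close>, as a
  function of the pair of time and displacement.\<close>

definition gradient_weight :: "'n \<Rightarrow> real \<times> (real^'n::finite) \<Rightarrow> real" where
  "gradient_weight i z = snd z $ i / (2 * fst z)"

lemma gradient_weight_measurable [measurable]: "gradient_weight i \<in> borel_measurable (borel \<Otimes>\<^sub>M borel)"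
  unfolding gradient_weight_def[abs_def] by measurable

lemma step_eq: "step l k = density (lborel \<Otimes>\<^sub>M lborel) (\<lambda>z. ennreal (erlang_density k l (fst z) * heat (fst z) (snd z)))"
  by (simp add: step_def case_prod_beta')

context
  fixes l :: real assumes l: "0 < l"
begin

lemma integral_step:
  fixes f :: "real \<times> (real^'n::finite) \<Rightarrow> real"
  assumes "integrable (step l k) f"
  shows "(LINT z|step l k. f z) = (LINT t|lborel. erlang_density k l t * (LINT y|lborel. heat t y * f (t, y)))"
proof -
  have [measurable]: "f \<in> borel_measurable (borel \<Otimes>\<^sub>M borel)"
    using borel_measurable_integrable[OF assms] by simp
  have f: "integrable (lborel \<Otimes>\<^sub>M lborel) (\<lambda>z. (erlang_density k l (fst z) * heat (fst z) (snd z)) * f z)"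
    using assms unfolding step_eq
    by (subst (asm) integrable_density) (auto simp: l erlang_nonneg)
  have "(LINT z|step l k. f z) = (LINT z|(lborel \<Otimes>\<^sub>M lborel). (erlang_density k l (fst z) * heat (fst z) (snd z)) * f z)"
    unfolding step_eq by (subst integral_density) (auto simp: l erlang_nonneg)
  also have "\<dots> = (LINT t|lborel. LINT y|lborel. (erlang_density k l t * heat t y) * f (t, y))"
    using lborel_pair.integral_fst'[OF f] by simp
  finally show ?thesis by (simp add: mult.assoc)
qed

lemma integrable_step_test:
  assumes "f \<in> Cc_infty UNIV" shows "integrable (step l k) (\<lambda>z. f (x + snd z :: real^'n::finite))"
proof -
  interpret prob_space "step l k :: (real \<times> (real^'n)) measure" by (rule prob_space_step[OF l])
  obtain C where C: "\<And>x. \<bar>f x\<bar> \<le> C" using Cc_infty_bounded_by assms by metis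
  have [measurable]: "f \<in> borel_measurable borel" by (rule Cc_infty_measurable[OF assms])
  show ?thesis by (rule integrable_const_bound[of _ C]) (auto simp: C)
qed

lemma integrable_step_gradient_weight:
  fixes f :: "real \<times> (real^'n::finite) \<Rightarrow> real"
  assumes [measurable]: "f \<in> borel_measurable (borel \<Otimes>\<^sub>M borel)" and C: "\<And>x. \<bar>f x\<bar> \<le> C"
  shows "integrable (step l 0) (\<lambda>z. gradient_weight i z * f z)"
proof -
  have *: "integrable (step l 0) (\<lambda>z::real \<times> (real^'n). \<bar>snd z $ i\<bar> / (2 * \<bar>fst z\<bar>))"
  proof (rule integrableI_bounded)
    have "AE z in (step l 0 :: (real \<times> (real^'n)) measure). fst z \<ge> 0"
      unfolding step_def by (subst AE_density) (auto simp: erlang_density_def split: if_splits intro!: AE_I2)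
    then have "(\<integral>\<^sup>+z. ennreal (norm (\<bar>snd z $ i\<bar> / (2 * \<bar>fst z\<bar>))) \<partial>step l 0) = (\<integral>\<^sup>+z. ennreal (\<bar>snd z $ i\<bar> / (2 * fst z)) \<partial>(step l 0 :: (real \<times> (real^'n)) measure))"
      by (intro nn_integral_cong_AE) auto
    also have "\<dots> < \<infinity>"
      using nn_integral_gradient_weight[OF l, of i] by (simp add: le_less_trans)
    finally show "(\<integral>\<^sup>+z. ennreal (norm (\<bar>snd z $ i\<bar> / (2 * \<bar>fst z\<bar>))) \<partial>(step l 0 :: (real \<times> (real^'n)) measure)) < \<infinity>" .
  qed simp
  have "\<bar>snd z $ i\<bar> / (2 * \<bar>fst z\<bar>) * \<bar>f z\<bar> \<le> \<bar>snd z $ i\<bar> / (2 * \<bar>fst z\<bar>) * C" for z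
    by (intro mult_left_mono C) auto
  then show ?thesis
    using order_trans[OF abs_ge_zero C]
    by (intro Bochner_Integration.integrable_bound[OF integrable_mult_left[OF *, of C]])
       (auto simp: abs_mult gradient_weight_def)
qed

lemma integral_step_gradient_weight:
  fixes f :: "real^'n::finite \<Rightarrow> real"
  assumes f: "f \<in> Cc_infty UNIV"
  shows "(LINT z|step l 0. gradient_weight i z * f (x + snd z)) = (LINT z|step l 0. partial_deriv i f (x + snd z))"
proof -
  have [measurable]: "f \<in> borel_measurable borel" by (rule Cc_infty_measurable[OF f])
  obtain C where C: "\<And>x. \<bar>f x\<bar> \<le> C" using Cc_infty_bounded_by f by metis
  have "AE t in lborel. erlang_density 0 l t * (LINT y|lborel. heat t y * (gradient_weight i (t, y) * f (x + y))) =
      erlang_density 0 l t * (LINT y|lborel. heat t y * partial_deriv i f (x + y))"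
    by (rule AE_mp[OF AE_erlang_pos[of "\<lambda>t. t > 0" 0 l]])
       (auto intro!: AE_I2 simp: heat_integration_by_parts[OF _ f] gradient_weight_def mult.assoc)
  moreover have [measurable]: "partial_deriv i f \<in> borel_measurable borel"
    by (intro Cc_infty_measurable Cc_infty_partial_deriv f)
  ultimately have "(LINT t|lborel. erlang_density 0 l t * (LINT y|lborel. heat t y * (gradient_weight i (t, y) * f (x + y)))) =
      (LINT t|lborel. erlang_density 0 l t * (LINT y|lborel. heat t y * partial_deriv i f (x + y)))"
    by (intro integral_cong_AE) measurable
  then show ?thesis
    using integral_step[OF integrable_step_gradient_weight[of "\<lambda>z. f (x + snd z)" C i]] C
      integral_step[OF integrable_step_test[OF Cc_infty_partial_deriv[OF f, of i], where x=x]]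
    by simp
qed

text \<open>One derivative of the Laplacian is traded for \<open>gradient_weight\<close>, leaving
  only first derivatives of \<open>f\<close>. After the substitution
  \<open>y = sqrt (2 * t) * w\<close>, the integrand for fixed \<open>w\<close> is the exact time
  derivative of \<open>- exp (- l * t) * l * f (x + sqrt (2 * t) * w)\<close>, so the fundamental
  theorem of calculus on the half line yields \<open>l * f x\<close> for almost every
  \<open>w\<close>.\<close>

lemma integral_step_resolvent:
  fixes f :: "real^'n::finite \<Rightarrow> real"
  assumes f: "f \<in> Cc_infty UNIV"
  shows "(LINT z|step l 0. l * f (x + snd z) - laplacian f (x + snd z)) = l * f x"
proof -
  let ?\<gamma> = "density lborel (\<lambda>w::real^'n. ennreal (heat (1/2) w))"
  let ?d = "\<lambda>i. partial_deriv i f" and ?c = "\<lambda>t. sqrt (2 * t)"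
  \<comment> \<open>The integrand after one integration by parts: each second derivative has become
    a weight times a first derivative.\<close>
  define G where "G z = l * f (x + snd z) - (\<Sum>i\<in>UNIV. gradient_weight i z * ?d i (x + snd z))" for z
  \<comment> \<open>\<open>H\<close> is \<open>G\<close> times the exponential density, in the
    variables time and standard normal; it is integrated first in time.\<close>
  define H where "H t w = erlang_density 0 l t * G (t, ?c t *\<^sub>R w)" for t w
  have df: "?d i \<in> Cc_infty UNIV" for i by (rule Cc_infty_partial_deriv[OF f])
  have [measurable]: "f \<in> borel_measurable borel" "?d i \<in> borel_measurable borel" for i
    by (auto intro: Cc_infty_measurable f df)
  have cf: "continuous_on UNIV f" "continuous_on UNIV (?d i)" for i
    using f df smooth_continuous Cc_infty_smooth by blast+
  have dC: "\<exists>C. \<forall>x. \<bar>?d i x\<bar> \<le> C" for i using Cc_infty_bounded_by[OF df] by metis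
  have i1: "integrable (step l 0) (\<lambda>z. gradient_weight i z * ?d i (x + snd z))" for i
  proof -
    obtain C where "\<And>x. \<bar>?d i x\<bar> \<le> C" using dC by metis
    then show ?thesis by (intro integrable_step_gradient_weight[where C=C]) auto
  qed
  have iG: "integrable (step l 0) G"
    unfolding G_def[abs_def]
    by (intro Bochner_Integration.integrable_diff Bochner_Integration.integrable_sum integrable_mult_right integrable_step_test f i1)
  have [measurable]: "G \<in> borel_measurable (borel \<Otimes>\<^sub>M borel)"
    unfolding G_def[abs_def] by measurable
  interpret \<gamma>: prob_space ?\<gamma>
    using nn_integral_heat[of "1/2", where 'n='n] by (intro prob_spaceI) (simp add: emeasure_density)
  interpret P: pair_sigma_finite lborel ?\<gamma> ..
  have [measurable]: "case_prod H \<in> borel_measurable (borel \<Otimes>\<^sub>M borel)"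
    unfolding H_def[abs_def] by measurable
  have "(LINT z|step l 0. l * f (x + snd z) - laplacian f (x + snd z)) = (LINT z|step l 0. G z)"
  proof -
    have i2: "integrable (step l 0) (\<lambda>z. partial_deriv i (?d i) (x + snd z))" for i
      by (intro integrable_step_test Cc_infty_partial_deriv f)
    have i3: "integrable (step l 0) (\<lambda>z. l * f (x + snd z))"
      by (intro integrable_mult_right integrable_step_test f)
    show ?thesis
      unfolding laplacian_def G_def
      by (simp add: Bochner_Integration.integral_diff[OF i3 Bochner_Integration.integrable_sum] i1 i2
        integral_step_gradient_weight[OF df])
  qed
  also have "\<dots> = (LINT t|lborel. erlang_density 0 l t * (LINT y|lborel. heat t y * G (t, y)))"
    by (rule integral_step[OF iG])
  also have "\<dots> = (LINT t|lborel. LINT w|?\<gamma>. H t w)"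
  proof (rule integral_cong_AE)
    show "AE t in lborel. erlang_density 0 l t * (LINT y|lborel. heat t y * G (t, y)) = (LINT w|?\<gamma>. H t w)"
    proof (rule AE_mp[OF AE_erlang_pos[of "\<lambda>t. t > 0" 0 l]], simp, rule AE_I2, rule impI)
      fix t assume "erlang_density 0 l t = 0 \<or> 0 < t"
      then consider "erlang_density 0 l t = 0" | "t > 0" by blast
      then show "erlang_density 0 l t * (LINT y|lborel. heat t y * G (t, y)) = (LINT w|?\<gamma>. H t w)"
      proof cases
        case 2
        have "(LINT y|lborel. heat t y * G (t, y)) = (LINT y|density lborel (\<lambda>y. ennreal (heat t y)). G (t, y))"
          by (subst integral_density) auto
        also have "\<dots> = (LINT w|?\<gamma>. G (t, ?c t *\<^sub>R w))"
          unfolding heat_distr[OF 2] by (subst integral_distr) auto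
        finally show ?thesis by (simp add: H_def)
      qed (simp add: H_def)
    qed
  qed measurable
  finally have eq: "(LINT z|step l 0. l * f (x + snd z) - laplacian f (x + snd z)) = (LINT t|lborel. LINT w|?\<gamma>. H t w)" .
  \<comment> \<open>Undoing the Gaussian substitution turns the absolute integral of
    \<open>H\<close> back into that of \<open>G\<close> under \<open>step l 0\<close>, which is
    known to be finite.\<close>
  have iH: "integrable (lborel \<Otimes>\<^sub>M ?\<gamma>) (case_prod H)"
    proof (rule integrableI_bounded)
      have "(\<integral>\<^sup>+z. ennreal (norm (case_prod H z)) \<partial>(lborel \<Otimes>\<^sub>M ?\<gamma>)) = (\<integral>\<^sup>+t. \<integral>\<^sup>+w. ennreal (norm (H t w)) \<partial>?\<gamma> \<partial>lborel)"
        by (subst \<gamma>.nn_integral_fst[symmetric]) auto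
      also have "\<dots> = (\<integral>\<^sup>+t. ennreal (erlang_density 0 l t) * (\<integral>\<^sup>+w. ennreal (norm (G (t, ?c t *\<^sub>R w))) \<partial>?\<gamma>) \<partial>lborel)"
        using l by (subst nn_integral_cmult[symmetric]) (auto simp: H_def abs_mult ennreal_mult erlang_nonneg)
      also have "\<dots> = (\<integral>\<^sup>+t. ennreal (erlang_density 0 l t) * (\<integral>\<^sup>+y. ennreal (heat t y) * ennreal (norm (G (t, y))) \<partial>lborel) \<partial>lborel)"
      proof (rule nn_integral_erlang_cong)
        fix t :: real assume "t > 0"
        have "(\<integral>\<^sup>+y. ennreal (heat t y) * ennreal (norm (G (t, y))) \<partial>lborel) = (\<integral>\<^sup>+y. ennreal (norm (G (t, y))) \<partial>density lborel (\<lambda>y. ennreal (heat t y)))"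
          by (subst nn_integral_density) auto
        also have "\<dots> = (\<integral>\<^sup>+w. ennreal (norm (G (t, ?c t *\<^sub>R w))) \<partial>?\<gamma>)"
          unfolding heat_distr[OF \<open>t > 0\<close>] by (subst nn_integral_distr) auto
        finally show "(\<integral>\<^sup>+w. ennreal (norm (G (t, ?c t *\<^sub>R w))) \<partial>?\<gamma>) = (\<integral>\<^sup>+y. ennreal (heat t y) * ennreal (norm (G (t, y))) \<partial>lborel)" by simp
      qed
      also have "\<dots> = (\<integral>\<^sup>+z. ennreal (norm (G z)) \<partial>step l 0)"
        by (subst nn_integral_step) auto
      also have "\<dots> < \<infinity>" using iG by (simp add: integrable_iff_bounded)
      finally show "(\<integral>\<^sup>+z. ennreal (norm (case_prod H z)) \<partial>(lborel \<Otimes>\<^sub>M ?\<gamma>)) < \<infinity>" .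
    qed simp
  obtain C where C: "C > 0" "\<And>x. \<bar>f x\<bar> \<le> C" using Cc_infty_bounded_by f by metis
  have "AE w in ?\<gamma>. integrable lborel (\<lambda>t. H t w)"
    using P.AE_integrable_snd[OF iH] by simp
  then have AE: "AE w in ?\<gamma>. (LINT t|lborel. H t w) = l * f x"
  proof eventually_elim
    case (elim w)
    let ?F = "\<lambda>t. - exp (- l * t) * (l * f (x + ?c t *\<^sub>R w))"
    let ?H = "\<lambda>t. l * exp (- l * t) * (l * f (x + ?c t *\<^sub>R w) - (\<Sum>i\<in>UNIV. w $ i / ?c t * ?d i (x + ?c t *\<^sub>R w)))"
    have H_pos: "H t w = ?H t" if "t > 0" for t
    proof -
      have "?c t / (2 * t) = 1 / ?c t" using that by (simp add: real_div_sqrt field_simps)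
      then have "?c t * w $ i / (2 * t) = w $ i / ?c t" for i
        by (metis (no_types, opaque_lifting) mult.commute mult_1 times_divide_eq_left)
      then show ?thesis using that by (simp add: H_def G_def gradient_weight_def erlang_density_def)
    qed
    have c_deriv: "(?c has_real_derivative 1 / ?c t) (at t)" if "t > 0" for t
      using that by (auto intro!: derivative_eq_intros simp: field_simps)
    have f_deriv: "((\<lambda>t. f (x + ?c t *\<^sub>R w)) has_real_derivative (\<Sum>i\<in>UNIV. w $ i / ?c t * ?d i (x + ?c t *\<^sub>R w))) (at t)" if "t > 0" for t
    proof -
      have "((\<lambda>t. x + ?c t *\<^sub>R w) has_derivative (\<lambda>h. (1 / ?c t * h) *\<^sub>R w)) (at t)"
        by (rule has_derivative_eq_rhs[OF has_derivative_add[OF has_derivative_const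
              has_derivative_scaleR_left[OF c_deriv[OF that, unfolded has_field_derivative_def]]]]) simp
      from has_derivative_compose[OF this has_derivative_partial[OF smooth_differentiable[OF Cc_infty_smooth[OF f]]]]
      show ?thesis
        unfolding has_field_derivative_def
        by (rule has_derivative_eq_rhs) (auto simp: fun_eq_iff sum_distrib_left sum_distrib_right mult_ac)
    qed
    have H_cont: "continuous_on {0<..} (\<lambda>t. H t w)"
      by (subst continuous_on_cong[OF refl H_pos])
         (auto intro!: continuous_intros continuous_on_compose2[OF cf(1)] continuous_on_compose2[OF cf(2)])
    have "(LBINT t=0..\<infinity>. H t w) = 0 - (- (l * f x))"
    proof (rule interval_integral_FTC_integrable)
      show "(?F has_vector_derivative H t w) (at t)" if "0 < ereal t" for t
      proof -
        have t: "t > 0" using that by simp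
        have "(?F has_real_derivative ?H t) (at t)"
        proof -
          have "((\<lambda>t. - exp (- l * t)) has_real_derivative l * exp (- l * t)) (at t)"
            by (auto intro!: derivative_eq_intros)
          from DERIV_mult[OF this DERIV_cmult[OF f_deriv[OF t], of l]] show ?thesis
            by (rule DERIV_cong) (simp add: algebra_simps)
        qed
        then show ?thesis
          by (simp add: H_pos[OF t] has_real_derivative_iff_has_vector_derivative)
      qed
      show "isCont (\<lambda>t. H t w) t" if "0 < ereal t" for t
        using H_cont that by (simp add: continuous_on_eq_continuous_at)
      show "set_integrable lborel (einterval 0 \<infinity>) (\<lambda>t. H t w)"
        using elim unfolding set_integrable_def by (intro integrable_mult_indicator) auto
      have "continuous_on UNIV ?F"
        by (auto intro!: continuous_intros continuous_on_compose2[OF cf(1)])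
      then have "isCont ?F 0" by (simp add: continuous_on_eq_continuous_at)
      then have "(?F \<longlongrightarrow> - (l * f x)) (at 0)" by (simp add: isCont_def)
      then have "(?F \<longlongrightarrow> - (l * f x)) (at_right 0)" by (rule filterlim_mono) (auto simp: at_le)
      then show "((?F \<circ> real_of_ereal) \<longlongrightarrow> - (l * f x)) (at_right 0)"
        by (simp add: zero_ereal_def ereal_tendsto_simps)
      have "(?F \<longlongrightarrow> 0) at_top"
      proof (rule Lim_null_comparison)
        show "\<forall>\<^sub>F t in at_top. norm (?F t) \<le> exp (- l * t) * (l * C)"
          using l C by (auto simp: abs_mult intro!: always_eventually mult_left_mono)
        have "filterlim (\<lambda>t. - l * t) at_bot at_top"
          using l by (intro filterlim_tendsto_neg_mult_at_bot[OF tendsto_const _ filterlim_ident]) auto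
        then have "((\<lambda>t. exp (- l * t)) \<longlongrightarrow> 0) at_top" by (rule filterlim_compose[OF exp_at_bot])
        then show "((\<lambda>t. exp (- l * t) * (l * C)) \<longlongrightarrow> 0) at_top" by (rule tendsto_mult_left_zero)
      qed
      then show "((?F \<circ> real_of_ereal) \<longlongrightarrow> 0) (at_left \<infinity>)"
        by (simp add: ereal_tendsto_simps)
    qed simp
    moreover have "(LBINT t=0..\<infinity>. H t w) = (LINT t|lborel. H t w)"
    proof -
      have [measurable]: "(\<lambda>t. H t w) \<in> borel_measurable borel"
        using elim by (auto dest: borel_measurable_integrable)
      have "AE t in lborel. indicator (einterval 0 \<infinity>) t *\<^sub>R H t w = H t w"
        by (rule AE_mp[OF AE_lborel_singleton[of 0]])
           (auto intro!: AE_I2 simp: indicator_def einterval_def H_def erlang_density_def)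
      then show ?thesis
        unfolding interval_lebesgue_integral_def set_lebesgue_integral_def
        by (auto intro!: integral_cong_AE)
    qed
    ultimately show ?case by simp
  qed
  have "(LINT t|lborel. LINT w|?\<gamma>. H t w) = (LINT w|?\<gamma>. LINT t|lborel. H t w)"
    by (rule P.Fubini_integral[symmetric, OF iH])
  also have "\<dots> = (LINT w|?\<gamma>. l * f x)"
    by (rule integral_cong_AE) (use AE in measurable)
  also have "\<dots> = l * f x" using \<gamma>.prob_space by simp
  finally show ?thesis using eq by simp
qed

end

subsection \<open>Estimates for the resolvent kernel\<close>

text \<open>A majorant of all normal densities with deviation \<open>s\<close> and centre in the
  interval from -1/2 to 1/2. Inside the interval the density is at most \<open>1 / s\<close>;
  outside, the closest admissible centre is an endpoint.\<close>

definition normal_envelope :: "real \<Rightarrow> real \<Rightarrow> real" where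
  "normal_envelope s r = 1 / s * indicator {-1/2..1/2} r + normal_density (1/2) s r + normal_density (-1/2) s r"

lemma normal_envelope_measurable [measurable]: "(\<lambda>(s, r). normal_envelope s r) \<in> borel_measurable (borel \<Otimes>\<^sub>M borel)"
proof -
  have "(\<lambda>x::real \<times> real. indicator {-1/2..1/2::real} (snd x) :: real) \<in> borel_measurable (borel \<Otimes>\<^sub>M borel)"
    by (rule measurable_compose[OF measurable_snd]) simp
  then show ?thesis unfolding normal_envelope_def normal_density_def case_prod_beta' by measurable
qed

lemma normal_envelope_nonneg: "s \<ge> 0 \<Longrightarrow> normal_envelope s r \<ge> 0"
  by (simp add: normal_envelope_def)

lemma normal_density_antimono:
  assumes "\<bar>r - m\<bar> \<le> \<bar>r' - m'\<bar>"
  shows "normal_density m' s r' \<le> normal_density m s r"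
proof -
  have "(r - m)\<^sup>2 \<le> (r' - m')\<^sup>2" using assms by (metis abs_ge_zero power2_abs power_mono)
  then show ?thesis
    unfolding normal_density_def by (intro mult_left_mono) (auto intro!: divide_right_mono)
qed

lemma normal_density_le_inverse:
  assumes "s > 0" shows "normal_density m s r \<le> 1 / s"
proof -
  have "s\<^sup>2 \<le> 2 * pi * s\<^sup>2" using pi_gt3 by (simp add: mult_le_cancel_right1)
  then have "s \<le> sqrt (2 * pi * s\<^sup>2)" using assms by (intro real_le_rsqrt)
  then have "1 / sqrt (2 * pi * s\<^sup>2) \<le> 1 / s" using assms by (intro divide_left_mono) auto
  moreover have "exp (- (r - m)\<^sup>2 / (2 * s\<^sup>2)) \<le> 1" by simp
  ultimately show ?thesis unfolding normal_density_def
    using mult_mono[of "1 / sqrt (2 * pi * s\<^sup>2)" "1 / s" "exp (- (r - m)\<^sup>2 / (2 * s\<^sup>2))" 1] assms by simp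
qed

lemma normal_density_le_envelope:
  assumes "s > 0" "\<bar>a\<bar> \<le> 1/2" shows "normal_density 0 s (r - a) \<le> normal_envelope s r"
proof -
  consider "\<bar>r\<bar> \<le> 1/2" | "r > 1/2" | "r < -1/2" by linarith
  then show ?thesis
  proof cases
    case 1
    then have "indicator {-1/2..1/2} r = (1::real)" by (auto simp: indicator_def)
    then show ?thesis using normal_density_le_inverse[OF assms(1), of 0 "r - a"]
      by (simp add: normal_envelope_def add_increasing2)
  next
    case 2
    then have "normal_density 0 s (r - a) \<le> normal_density (1/2) s r"
      using assms by (intro normal_density_antimono) auto
    then show ?thesis using assms unfolding normal_envelope_def
      by (simp add: add_increasing2 add_increasing)
  next
    case 3
    then have "normal_density 0 s (r - a) \<le> normal_density (-1/2) s r"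
      using assms by (intro normal_density_antimono) auto
    then show ?thesis using assms unfolding normal_envelope_def
      by (simp add: add_increasing2 add_increasing)
  qed
qed

lemma nn_integral_normal_envelope:
  assumes "s > 0" shows "(\<integral>\<^sup>+r. ennreal (normal_envelope s r) \<partial>lborel) = ennreal (1 / s + 2)"
proof -
  have "(\<integral>\<^sup>+r. ennreal (normal_envelope s r) \<partial>lborel) = (\<integral>\<^sup>+r. ennreal (1 / s) * indicator {-1/2..1/2} r + ennreal (normal_density (1/2) s r) + ennreal (normal_density (-1/2) s r) \<partial>lborel)"
    using assms unfolding normal_envelope_def
    by (intro nn_integral_cong) (auto simp: ennreal_plus[symmetric] indicator_def of_bool_def simp del: ennreal_plus)
  also have "\<dots> = ennreal (1 / s) + 1 + 1"
    using assms by (simp add: nn_integral_add nn_integral_normal_density nn_integral_cmult)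
  also have "\<dots> = ennreal (1 / s + 2)"
    using assms by (simp add: add.assoc)
  finally show ?thesis .
qed

definition heat_envelope :: "real \<Rightarrow> real^'n::finite \<Rightarrow> real" where
  "heat_envelope t y = (\<Prod>i\<in>UNIV. normal_envelope (sqrt (2 * t)) (y $ i))"

lemma heat_envelope_measurable [measurable (raw)]:
  assumes [measurable]: "f \<in> borel_measurable M" "g \<in> borel_measurable M"
  shows "(\<lambda>x. heat_envelope (f x) (g x :: real^'n::finite)) \<in> borel_measurable M"
  unfolding heat_envelope_def by measurable

lemma heat_le_envelope:
  assumes "t > 0" "\<And>i. \<bar>x $ i\<bar> \<le> 1/2"
  shows "heat t (y - x) \<le> heat_envelope t (y::real^'n::finite)"
  unfolding heat_def heat_envelope_def using assms
  by (intro prod_mono conjI) (auto intro!: normal_density_le_envelope)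

lemma nn_integral_heat_envelope:
  assumes "t > 0"
  shows "(\<integral>\<^sup>+y. ennreal (heat_envelope t (y::real^'n::finite)) \<partial>lborel) = ennreal ((1 / sqrt (2 * t) + 2) ^ CARD('n))"
proof -
  have "(\<integral>\<^sup>+y. ennreal (heat_envelope t (y::real^'n)) \<partial>lborel) = (\<integral>\<^sup>+y. (\<Prod>i\<in>UNIV. ennreal (normal_envelope (sqrt (2 * t)) ((y::real^'n) $ i))) \<partial>lborel)"
    unfolding heat_envelope_def using assms
    by (intro nn_integral_cong prod_ennreal[symmetric] normal_envelope_nonneg) auto
  also have "\<dots> = (\<Prod>i\<in>(UNIV::'n set). \<integral>\<^sup>+r. ennreal (normal_envelope (sqrt (2 * t)) r) \<partial>lborel)"
    by (rule nn_integral_prod_vec) measurable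
  also have "\<dots> = ennreal ((1 / sqrt (2 * t) + 2) ^ CARD('n))"
    using assms by (subst nn_integral_normal_envelope) (simp_all add: ennreal_power del: ennreal_plus)
  finally show ?thesis .
qed

definition kernel_envelope :: "real \<Rightarrow> real^'n::finite \<Rightarrow> ennreal" where
  "kernel_envelope l y = (\<integral>\<^sup>+t. ennreal (erlang_density CARD('n) l t) * ennreal (heat_envelope t y) \<partial>lborel)"

lemma kernel_envelope_measurable [measurable]: "kernel_envelope l \<in> borel_measurable borel"
  unfolding kernel_envelope_def[abs_def] by measurable

text \<open>The right side is independent of \<open>x\<close>; integrating against it therefore
  bounds the step average from all starting points of the unit cell simultaneously.\<close>

lemma resolvent_kernel_le_envelope:
  assumes "l > 0" "\<And>i. \<bar>x $ i\<bar> \<le> 1/2"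
  shows "resolvent_kernel l CARD('n) (y - x) \<le> kernel_envelope l (y::real^'n::finite)"
proof -
  have "resolvent_kernel l CARD('n) (y - x) = (\<integral>\<^sup>+t. ennreal (erlang_density CARD('n) l t) * ennreal (heat t (y - x)) \<partial>lborel)"
    by (simp add: resolvent_kernel_def ennreal_mult'')
  also have "\<dots> \<le> kernel_envelope l y"
    unfolding kernel_envelope_def
    by (intro nn_integral_erlang_mono ennreal_leI heat_le_envelope assms)
  finally show ?thesis .
qed

lemma power_add_le:
  fixes a b :: real assumes "a \<ge> 0" "b \<ge> 0" shows "(a + b) ^ n \<le> 2 ^ n * (a ^ n + b ^ n)"
proof -
  have "(a + b) ^ n \<le> (2 * max a b) ^ n" using assms by (intro power_mono) auto
  also have "\<dots> = 2 ^ n * max a b ^ n" by (simp add: power_mult_distrib)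
  also have "\<dots> \<le> 2 ^ n * (a ^ n + b ^ n)"
    using assms by (intro mult_left_mono) (auto simp: max_def)
  finally show ?thesis .
qed

text \<open>The Erlang density of order \<open>n\<close> vanishes to order \<open>n\<close> at time zero, which compensates the
  singularity of the mass of the heat envelope.\<close>

lemma nn_integral_kernel_envelope:
  assumes l: "l > 0" shows "(\<integral>\<^sup>+y. kernel_envelope l (y::real^'n::finite) \<partial>lborel) < \<infinity>"
proof -
  let ?n = "CARD('n)"
  let ?c = "2 ^ ?n * 3 ^ ?n :: real" and ?c' = "2 ^ ?n * l ^ ?n / fact ?n :: real"
  have "(\<integral>\<^sup>+y. kernel_envelope l (y::real^'n) \<partial>lborel) = (\<integral>\<^sup>+t. \<integral>\<^sup>+y. ennreal (erlang_density ?n l t) * ennreal (heat_envelope t (y::real^'n)) \<partial>lborel \<partial>lborel)"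
    unfolding kernel_envelope_def by (rule lborel_pair.Fubini') measurable
  also have "\<dots> = (\<integral>\<^sup>+t. ennreal (erlang_density ?n l t) * (\<integral>\<^sup>+y. ennreal (heat_envelope t (y::real^'n)) \<partial>lborel) \<partial>lborel)"
    by (intro nn_integral_cong nn_integral_cmult) measurable
  also have "\<dots> \<le> (\<integral>\<^sup>+t. ennreal (erlang_density ?n l t) * ennreal (?c + 2 ^ ?n * (1 / t) ^ ?n) \<partial>lborel)"
  proof (rule nn_integral_erlang_mono)
    fix t :: real assume t: "t > 0"
    \<comment> \<open>This crude bound replaces the half integer power of the singularity by the
      integer power that the Erlang density can cancel exactly.\<close>
    have "1 / sqrt (2 * t) \<le> 1 + 1 / t"
    proof (cases "2 * t \<ge> 1")
      case True
      then have "1 / sqrt (2 * t) \<le> 1" by simp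
      moreover have "0 \<le> 1 / t" using t by simp
      ultimately show ?thesis by linarith
    next
      case False
      have "2 * t * (2 * t) \<le> 2 * t * 1" using False t by (intro mult_left_mono) auto
      then have "t \<le> sqrt (2 * t)" using t by (intro real_le_rsqrt) (auto simp: power2_eq_square)
      then have "1 / sqrt (2 * t) \<le> 1 / t" using t by (intro divide_left_mono) auto
      then show ?thesis by simp
    qed
    then have "(1 / sqrt (2 * t) + 2) ^ ?n \<le> (3 + 1 / t) ^ ?n"
      using t by (intro power_mono) auto
    also have "\<dots> \<le> 2 ^ ?n * (3 ^ ?n + (1 / t) ^ ?n)" using t by (intro power_add_le) auto
    finally show "(\<integral>\<^sup>+y. ennreal (heat_envelope t (y::real^'n)) \<partial>lborel) \<le> ennreal (?c + 2 ^ ?n * (1 / t) ^ ?n)"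
      unfolding nn_integral_heat_envelope[OF t] by (intro ennreal_leI) (simp add: distrib_left)
  qed
  also have "\<dots> \<le> (\<integral>\<^sup>+t. ennreal ?c * ennreal (erlang_density ?n l t) + ennreal ?c' * ennreal (erlang_density 0 l t) \<partial>lborel)"
  proof (rule nn_integral_mono)
    fix t :: real
    \<comment> \<open>The factor \<open>t ^ ?n\<close> of the Erlang density cancels
      \<open>(1 / t) ^ ?n\<close> and leaves a multiple of the exponential density; this is the
      origin of \<open>?c'\<close>.\<close>
    have "erlang_density ?n l t * (?c + 2 ^ ?n * (1 / t) ^ ?n) \<le> ?c * erlang_density ?n l t + ?c' * erlang_density 0 l t"
      using l by (cases "t = 0") (auto simp: erlang_density_def field_simps power_one_over power_0_left)
    then have "ennreal (erlang_density ?n l t * (?c + 2 ^ ?n * (1 / t) ^ ?n)) \<le> ennreal (?c * erlang_density ?n l t + ?c' * erlang_density 0 l t)"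
      by (rule ennreal_leI)
    then show "ennreal (erlang_density ?n l t) * ennreal (?c + 2 ^ ?n * (1 / t) ^ ?n) \<le> ennreal ?c * ennreal (erlang_density ?n l t) + ennreal ?c' * ennreal (erlang_density 0 l t)"
      using l by (simp add: ennreal_mult'[symmetric] erlang_density_nonneg ennreal_plus[symmetric] del: ennreal_plus)
  qed
  also have "\<dots> = ennreal ?c + ennreal ?c'"
    using nn_integral_erlang_ith_moment[OF l, of _ 0]
    by (subst nn_integral_add) (auto simp: nn_integral_cmult)
  also have "\<dots> < \<infinity>" by simp
  finally show ?thesis .
qed

text \<open>Chebyshev with mean \<open>m = (k + 1) / l\<close> and variance
  \<open>(k + 1) / l\<^sup>2\<close>: a deviation of \<open>m / 2\<close> has probability at most
  \<open>4 / (k + 1)\<close>, which is at most 1/2 for \<open>k \<ge> 7\<close>.\<close>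

lemma erlang_concentration:
  assumes l: "l > 0" and k: "k \<ge> 7"
  defines "m \<equiv> real (k + 1) / l"
  shows "ennreal (1/2) \<le> (\<integral>\<^sup>+t. ennreal (erlang_density k l t) * indicator {m/2<..<3*m/2} t \<partial>lborel)"
proof -
  interpret D: prob_space "density lborel (erlang_density k l)" by (rule prob_space_erlang_density[OF l])
  let ?D = "density lborel (erlang_density k l)"
  have m: "m > 0" using l by (simp add: m_def)
  have dist: "distributed ?D lborel (\<lambda>x. x) (erlang_density k l)"
    using l by (auto simp: distributed_def distr_id2 cong: measurable_cong_sets)
  have E: "D.expectation (\<lambda>x. x) = m"
    using D.erlang_ith_moment[OF l dist, of 1] by (simp add: m_def)
  have "D.prob {x \<in> space ?D. \<bar>x - D.expectation (\<lambda>x. x)\<bar> \<ge> m / 2} \<le> D.variance (\<lambda>x. x) / (m / 2)\<^sup>2"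
    using m D.erlang_ith_moment_integrable[OF l dist, of 2] by (intro D.Chebyshev_inequality) auto
  also have "D.variance (\<lambda>x. x) = real (k + 1) / l\<^sup>2" by (rule D.erlang_distributed_variance[OF l dist])
  also have "real (k + 1) / l\<^sup>2 / (m / 2)\<^sup>2 = 4 / real (k + 1)"
  proof -
    have "K / l\<^sup>2 / (K / l / 2)\<^sup>2 = 4 / K" if "K > 0" for K
      using that l by (simp add: field_simps power2_eq_square)
    then show ?thesis unfolding m_def by simp
  qed
  also have "\<dots> \<le> 1 / 2" using k by (simp add: field_simps)
  finally have "D.prob {x. \<bar>x - m\<bar> \<ge> m / 2} \<le> 1 / 2" unfolding E by simp
  moreover have "{m/2<..<3*m/2} = space ?D - {x. \<bar>x - m\<bar> \<ge> m / 2}" using m by (auto simp: abs_if field_simps split: if_splits)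
  moreover have "{x. \<bar>x - m\<bar> \<ge> m / 2} \<in> sets ?D" by simp
  ultimately have "1/2 \<le> D.prob {m/2<..<3*m/2}"
    using D.prob_compl[of "{x. \<bar>x - m\<bar> \<ge> m / 2}"] by simp
  then have "ennreal (1/2) \<le> emeasure ?D {m/2<..<3*m/2}"
    unfolding D.emeasure_eq_measure by (rule ennreal_leI)
  then show ?thesis by (subst (asm) emeasure_density) auto
qed

text \<open>With probability at least 1/2 the elapsed time lies between \<open>m / 2\<close> and
  \<open>3 * m / 2\<close>. There the variance \<open>2 * t\<close> is at most \<open>3 * m\<close>,
  which bounds the prefactor, and the exponent is at least -1/2 because
  \<open>(y $ i)\<^sup>2 \<le> m < 2 * t\<close>.\<close>

lemma resolvent_kernel_lower_bound:
  assumes l: "l > 0" and k: "k \<ge> 7"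
  defines "m \<equiv> real (k + 1) / l"
  assumes y: "\<And>i. (y $ i)\<^sup>2 \<le> m"
  shows "ennreal (1/2 * (exp (-1/2) / sqrt (6 * pi * m)) ^ CARD('n)) \<le> resolvent_kernel l k (y::real^'n::finite)"
proof -
  let ?b = "exp (-1/2) / sqrt (6 * pi * m)"
  have m: "m > 0" using l by (simp add: m_def)
  have heat: "?b ^ CARD('n) \<le> heat t y" if "t \<in> {m/2<..<3*m/2}" for t
  proof -
    have t: "t > 0" "m < 2 * t" "2 * t < 3 * m" using that m by auto
    have "?b \<le> normal_density 0 (sqrt (2 * t)) (y $ i)" for i
    proof -
      have "1 / sqrt (6 * pi * m) \<le> 1 / sqrt (2 * pi * (sqrt (2 * t))\<^sup>2)"
        using t m by (intro divide_left_mono) auto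
      moreover have "exp (-1/2) \<le> exp (- (y $ i - 0)\<^sup>2 / (2 * (sqrt (2 * t))\<^sup>2))"
        using t y[of i] by (simp add: field_simps)
      ultimately have "1 / sqrt (6 * pi * m) * exp (-1/2) \<le> normal_density 0 (sqrt (2 * t)) (y $ i)"
        unfolding normal_density_def using t by (intro mult_mono) auto
      then show ?thesis by simp
    qed
    then have "(\<Prod>i\<in>(UNIV::'n set). ?b) \<le> heat t y"
      unfolding heat_def using m by (intro prod_mono) auto
    then show ?thesis by simp
  qed
  have "ennreal (1/2 * ?b ^ CARD('n)) = ennreal (1/2) * ennreal (?b ^ CARD('n))"
    using m by (intro ennreal_mult) auto
  also have "\<dots> \<le> (\<integral>\<^sup>+t. ennreal (erlang_density k l t) * indicator {m/2<..<3*m/2} t \<partial>lborel) * ennreal (?b ^ CARD('n))"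
    unfolding m_def by (intro mult_right_mono erlang_concentration[OF l k]) simp
  also have "\<dots> = (\<integral>\<^sup>+t. ennreal (erlang_density k l t) * indicator {m/2<..<3*m/2} t * ennreal (?b ^ CARD('n)) \<partial>lborel)"
    by (simp add: nn_integral_multc)
  also have "\<dots> \<le> resolvent_kernel l k y"
    unfolding resolvent_kernel_def
  proof (rule nn_integral_mono)
    fix t :: real
    show "ennreal (erlang_density k l t) * indicator {m/2<..<3*m/2} t * ennreal (?b ^ CARD('n)) \<le> ennreal (erlang_density k l t * heat t y)"
      using heat[of t] l
      by (cases "t \<in> {m/2<..<3*m/2}") (auto simp: ennreal_mult erlang_density_nonneg intro!: mult_left_mono ennreal_leI)
  qed
  finally show ?thesis .
qed

section \<open>Smoothness of the resolvent and the fundamental lemma\<close>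

context
  fixes l :: real assumes l: "0 < l"
begin

text \<open>The Taylor remainder is uniform in the base point, so integrating it against the
  probability measure \<open>step l 0\<close> preserves the quadratic bound.\<close>

lemma has_derivative_step_average:
  fixes f :: "real^'n::finite \<Rightarrow> real"
  assumes f: "f \<in> Cc_infty UNIV"
  shows "((\<lambda>x. LINT z|step l 0. f (x + snd z)) has_derivative (\<lambda>h. \<Sum>i\<in>UNIV. h $ i * (LINT z|step l 0. partial_deriv i f (x + snd z)))) (at x)"
proof -
  interpret prob_space "step l 0 :: (real \<times> (real^'n)) measure" by (rule prob_space_step[OF l])
  obtain M where M: "M > 0" "\<And>z h. \<bar>f (z + h) - f z - (\<Sum>i\<in>UNIV. h $ i * partial_deriv i f z)\<bar> \<le> M * (norm h)\<^sup>2"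
    using Cc_infty_taylor[OF f] by metis
  note int = integrable_step_test[OF l f] integrable_step_test[OF l Cc_infty_partial_deriv[OF f]]
  show ?thesis
  proof (rule has_derivativeI_sandwich[where e=1 and H="\<lambda>y. M * norm (y - x)"])
    show "bounded_linear (\<lambda>h. \<Sum>i\<in>UNIV. h $ i * (LINT z|step l 0. partial_deriv i f (x + snd z)))"
      by (intro bounded_linear_sum bounded_linear_mult_const bounded_linear_vec_nth)
    show "((\<lambda>y. M * norm (y - x)) \<longlongrightarrow> 0) (at x)"
      by (rule tendsto_eq_intros refl tendsto_ident_at | simp)+
    fix y :: "real^'n" assume "y \<noteq> x"
    let ?h = "y - x"
    have "(LINT z|step l 0. f (y + snd z)) - (LINT z|step l 0. f (x + snd z)) - (\<Sum>i\<in>UNIV. ?h $ i * (LINT z|step l 0. partial_deriv i f (x + snd z)))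
      = (LINT z|step l 0. f (y + snd z) - f (x + snd z) - (\<Sum>i\<in>UNIV. ?h $ i * partial_deriv i f (x + snd z)))"
      by (simp add: int Bochner_Integration.integral_diff Bochner_Integration.integral_sum)
    also have "norm \<dots> \<le> (LINT z|(step l 0 :: (real \<times> (real^'n)) measure). M * (norm ?h)\<^sup>2)"
    proof (rule Bochner_Integration.integral_norm_bound_integral)
      fix z :: "real \<times> (real^'n)"
      show "norm (f (y + snd z) - f (x + snd z) - (\<Sum>i\<in>UNIV. ?h $ i * partial_deriv i f (x + snd z))) \<le> M * (norm ?h)\<^sup>2"
        using M(2)[of "x + snd z" ?h] by (simp add: algebra_simps)
    qed (auto intro!: int Bochner_Integration.integrable_diff Bochner_Integration.integrable_sum integrable_mult_right)
    also have "\<dots> = M * (norm ?h)\<^sup>2" using prob_space by simp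
    finally show "norm ((LINT z|step l 0. f (y + snd z)) - (LINT z|step l 0. f (x + snd z)) - (\<Sum>i\<in>UNIV. ?h $ i * (LINT z|step l 0. partial_deriv i f (x + snd z)))) / norm ?h \<le> M * norm ?h"
      using \<open>y \<noteq> x\<close> by (simp add: divide_le_eq power2_eq_square mult_ac)
  qed simp
qed

lemma partial_deriv_step_average:
  assumes "f \<in> Cc_infty UNIV"
  shows "partial_deriv i (\<lambda>x. LINT z|step l 0. f (x + snd z)) = (\<lambda>x. LINT z|step l 0. partial_deriv i f (x + snd z))"
  by (rule ext) (simp add: partial_deriv_eq[OF has_derivative_step_average[OF assms]] axis_def if_distrib[of "\<lambda>c. c * _"] cong: if_cong)

lemma smooth_step_average:
  fixes f :: "real^'n::finite \<Rightarrow> real"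
  assumes "f \<in> Cc_infty UNIV"
  shows "smooth (\<lambda>x. LINT z|step l 0. f (x + snd z))"
proof -
  have "C_k k (\<lambda>x. LINT z|step l 0. f (x + snd z))" for k
    using assms
  proof (induction k arbitrary: f)
    case 0
    then show ?case
      by (auto intro!: continuous_at_imp_continuous_on has_derivative_continuous has_derivative_step_average)
  next
    case (Suc k)
    have "(\<lambda>x. LINT z|step l 0. f (x + snd z)) differentiable (at x)" for x
      using has_derivative_step_average[OF Suc.prems] differentiableI by blast
    then show ?case
      using Suc.IH[OF Cc_infty_partial_deriv[OF Suc.prems]] by (simp add: partial_deriv_step_average[OF Suc.prems])
  qed
  then show ?thesis by (simp add: smooth_def)
qed

end

section \<open>Recovering a function from its integrals against test functions\<close>

text \<open>The positive and negative parts of \<open>k\<close> are densities of finite measures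
  that agree on closed sets. These form an intersection stable generator of the Borel sets, so the
  measures coincide; evaluation on \<open>k > 0\<close> and \<open>k < 0\<close> forces both parts
  to vanish.\<close>

lemma integral_closed_eq_0_imp_AE:
  fixes k :: "'a::euclidean_space \<Rightarrow> real"
  assumes k: "integrable lborel k"
    and closed: "\<And>C. closed C \<Longrightarrow> (LINT x|lborel. k x * indicator C x) = 0"
  shows "AE x in lborel. k x = 0"
proof -
  have [measurable]: "k \<in> borel_measurable borel" using k by (auto dest: borel_measurable_integrable)
  let ?P = "density lborel (\<lambda>x. ennreal (k x))" and ?N = "density lborel (\<lambda>x. ennreal (- k x))"
  have fin: "(\<integral>\<^sup>+x. ennreal (k x) \<partial>lborel) < \<infinity>" "(\<integral>\<^sup>+x. ennreal (- k x) \<partial>lborel) < \<infinity>"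
    using k by (auto simp: real_integrable_def top.not_eq_extremum)
  have emP: "emeasure ?P A = (\<integral>\<^sup>+x. ennreal (k x) * indicator A x \<partial>lborel)"
    and emN: "emeasure ?N A = (\<integral>\<^sup>+x. ennreal (- k x) * indicator A x \<partial>lborel)" if "A \<in> sets borel" for A
    using that by (auto simp: emeasure_density)
  have "?P = ?N"
  proof (rule measure_eqI_generator_eq[where E="Collect closed" and \<Omega>=UNIV and A="\<lambda>_. UNIV"])
    show "Int_stable (Collect closed :: 'a set set)" by (auto simp: Int_stable_def)
    show "sets ?P = sigma_sets UNIV (Collect closed)" "sets ?N = sigma_sets UNIV (Collect closed)"
      by (simp_all add: borel_eq_closed)
    fix C :: "'a set" assume "C \<in> Collect closed"
    then have C: "closed C" and [measurable]: "C \<in> sets borel" by auto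
    have int: "integrable lborel (\<lambda>x. k x * indicator C x)"
      using k by (intro integrable_real_mult_indicator) auto
    have le: "(\<integral>\<^sup>+x. ennreal (k x * indicator C x) \<partial>lborel) < \<infinity>" "(\<integral>\<^sup>+x. ennreal (- (k x * indicator C x)) \<partial>lborel) < \<infinity>"
      using int by (auto simp: real_integrable_def top.not_eq_extremum)
    have "enn2real (\<integral>\<^sup>+x. ennreal (k x * indicator C x) \<partial>lborel) - enn2real (\<integral>\<^sup>+x. ennreal (- (k x * indicator C x)) \<partial>lborel) = 0"
      using closed[OF C] real_lebesgue_integral_def[OF int] by simp
    then have "(\<integral>\<^sup>+x. ennreal (k x * indicator C x) \<partial>lborel) = (\<integral>\<^sup>+x. ennreal (- (k x * indicator C x)) \<partial>lborel)"
      using le by (metis eq_iff_diff_eq_0 ennreal_enn2real infinity_ennreal_def)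
    moreover have "ennreal (k x * indicator C x) = ennreal (k x) * indicator C x" "ennreal (- (k x * indicator C x)) = ennreal (- k x) * indicator C x" for x
      by (auto simp: indicator_def)
    ultimately show "emeasure ?P C = emeasure ?N C" by (simp add: emP emN)
  next
    show "emeasure ?P UNIV \<noteq> \<infinity>" for i :: nat using fin by (simp add: emP)
  qed auto
  then have eq: "(\<integral>\<^sup>+x. ennreal (k x) * indicator A x \<partial>lborel) = (\<integral>\<^sup>+x. ennreal (- k x) * indicator A x \<partial>lborel)" if "A \<in> sets borel" for A
    using emP[OF that] emN[OF that] by simp
  have "(\<integral>\<^sup>+x. ennreal (k x) * indicator {x. k x > 0} x \<partial>lborel) = 0"
    by (subst eq) (auto simp: nn_integral_0_iff_AE indicator_def ennreal_neg intro!: AE_I2)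
  moreover have "(\<integral>\<^sup>+x. ennreal (- k x) * indicator {x. k x < 0} x \<partial>lborel) = 0"
    by (subst eq[symmetric]) (auto simp: nn_integral_0_iff_AE indicator_def ennreal_neg intro!: AE_I2)
  ultimately have "AE x in lborel. ennreal (k x) * indicator {x. k x > 0} x = 0" "AE x in lborel. ennreal (- k x) * indicator {x. k x < 0} x = 0"
    by (auto simp: nn_integral_0_iff_AE)
  then show ?thesis
  proof eventually_elim
    case (elim x)
    then show ?case by (cases "k x" "0::real" rule: linorder_cases) (auto simp: ennreal_eq_0_iff)
  qed
qed

text \<open>Stone-Weierstrass on the ball carrying \<open>k\<close> extends the vanishing from
  polynomials to continuous functions, and truncated distance functions extend it to indicators of
  closed sets.\<close>

lemma integral_polynomial_eq_0_imp_AE: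
  fixes k :: "'a::euclidean_space \<Rightarrow> real"
  assumes k: "integrable lborel k" and supp: "\<And>x. R < norm x \<Longrightarrow> k x = 0"
    and poly: "\<And>g. real_polynomial_function g \<Longrightarrow> (LINT x|lborel. k x * g x) = 0"
  shows "AE x in lborel. k x = 0"
proof (rule integral_closed_eq_0_imp_AE[OF k])
  have [measurable]: "k \<in> borel_measurable borel" using k by (auto dest: borel_measurable_integrable)
  have int_cont: "integrable lborel (\<lambda>x. k x * f x)" if f: "continuous_on UNIV f" for f :: "'a \<Rightarrow> real"
  proof -
    have [measurable]: "f \<in> borel_measurable borel" by (rule borel_measurable_continuous_onI[OF f])
    have "bounded (f ` cball 0 R)"
      by (intro compact_imp_bounded compact_continuous_image continuous_on_subset[OF f]) auto
    then obtain B where B: "\<And>x. norm x \<le> R \<Longrightarrow> \<bar>f x\<bar> \<le> B" by (force simp: bounded_iff)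
    have "norm (k x * f x) \<le> norm (k x * B)" for x
      using B[of x] supp[of x] by (cases "norm x \<le> R") (auto simp: abs_mult intro!: mult_left_mono)
    then show ?thesis
      by (intro Bochner_Integration.integrable_bound[OF integrable_mult_left[OF k, of B]]) auto
  qed
  have cont: "(LINT x|lborel. k x * f x) = 0" if f: "continuous_on UNIV f" for f :: "'a \<Rightarrow> real"
  proof -
    have "\<bar>LINT x|lborel. k x * f x\<bar> \<le> e * (LINT x|lborel. \<bar>k x\<bar>)" if "e > 0" for e
    proof -
      obtain g where g: "real_polynomial_function g" "\<And>x. x \<in> cball 0 R \<Longrightarrow> \<bar>f x - g x\<bar> < e"
        using Stone_Weierstrass_real_polynomial_function[OF compact_cball continuous_on_subset[OF f subset_UNIV] \<open>e > 0\<close>] by metis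
      have cg: "continuous_on UNIV g"
        using g(1) by (intro continuous_at_imp_continuous_on ballI) (simp add: continuous_real_polymonial_function)
      have "(LINT x|lborel. k x * f x) = (LINT x|lborel. k x * f x) - (LINT x|lborel. k x * g x)"
        using poly[OF g(1)] by simp
      also have "\<dots> = (LINT x|lborel. k x * f x - k x * g x)"
        by (rule Bochner_Integration.integral_diff[symmetric]) (intro int_cont f cg)+
      also have "norm \<dots> \<le> (LINT x|lborel. e * \<bar>k x\<bar>)"
      proof (rule Bochner_Integration.integral_norm_bound_integral)
        fix x
        show "norm (k x * f x - k x * g x) \<le> e * \<bar>k x\<bar>"
        proof (cases "norm x \<le> R")
          case True
          have "norm (k x * f x - k x * g x) = \<bar>f x - g x\<bar> * \<bar>k x\<bar>"
            unfolding right_diff_distrib[symmetric] real_norm_def abs_mult by (rule mult.commute)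
          also have "\<dots> \<le> e * \<bar>k x\<bar>" using g(2)[of x] True by (intro mult_right_mono) auto
          finally show ?thesis .
        qed (use supp[of x] in auto)
      qed (auto intro!: int_cont f cg k Bochner_Integration.integrable_diff)
      finally show ?thesis by simp
    qed
    then have *: "\<And>e. e > 0 \<Longrightarrow> \<bar>LINT x|lborel. k x * f x\<bar> \<le> e * (LINT x|lborel. \<bar>k x\<bar>)" by simp
    let ?I = "LINT x|lborel. \<bar>k x\<bar>"
    have "?I \<ge> 0" by simp
    then have "\<bar>LINT x|lborel. k x * f x\<bar> \<le> e" if "e > 0" for e
    proof -
      have "e / (?I + 1) > 0" using that add_nonneg_pos[OF \<open>?I \<ge> 0\<close> zero_less_one] by (rule divide_pos_pos)
      then have "\<bar>LINT x|lborel. k x * f x\<bar> \<le> e / (?I + 1) * ?I" by (rule *)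
      also have "\<dots> \<le> e" using that \<open>?I \<ge> 0\<close> add_nonneg_pos[OF \<open>?I \<ge> 0\<close> zero_less_one] by (simp add: field_simps)
      finally show ?thesis .
    qed
    then show ?thesis using field_le_epsilon[of "\<bar>LINT x|lborel. k x * f x\<bar>" 0] by simp
  qed
  fix C :: "'a set" assume C: "closed C"
  show "(LINT x|lborel. k x * indicator C x) = 0"
  \<comment> \<open>The empty set is split off because \<open>infdist\<close> to it is 0 by
    convention, so the approximants below would not tend to its indicator.\<close>
  proof (cases "C = {}")
    case False
    let ?f = "\<lambda>n x. max 0 (1 - real n * infdist x C)"
    have "(\<lambda>n. LINT x|lborel. k x * ?f n x) \<longlonglongrightarrow> (LINT x|lborel. k x * indicator C x)"
    proof (rule integral_dominated_convergence[where w="\<lambda>x. \<bar>k x\<bar>"])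
      show "AE x in lborel. (\<lambda>n. k x * ?f n x) \<longlonglongrightarrow> k x * indicator C x"
      proof (intro AE_I2 tendsto_mult tendsto_const)
        fix x
        show "(\<lambda>n. ?f n x) \<longlonglongrightarrow> indicator C x"
        proof (cases "x \<in> C")
          case False
          then have pos: "infdist x C > 0"
            using C \<open>C \<noteq> {}\<close> infdist_nonneg[of x C] in_closed_iff_infdist_zero[of C x] by (cases "infdist x C = 0") auto
          then obtain N where N: "real N * infdist x C > 1" using reals_Archimedean3 by blast
          have "?f n x = 0" if "n \<ge> N" for n
          proof -
            have "real N * infdist x C \<le> real n * infdist x C" using that pos by (intro mult_right_mono) auto
            then show ?thesis using N by simp
          qed
          then have "eventually (\<lambda>n. ?f n x = indicator C x) sequentially"
            using False by (auto simp: eventually_sequentially)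
          then show ?thesis by (rule tendsto_eventually)
        qed (simp add: infdist_zero)
      qed
      show "AE x in lborel. norm (k x * ?f n x) \<le> \<bar>k x\<bar>" for n
        by (intro AE_I2) (auto simp: abs_mult infdist_nonneg intro!: mult_left_le)
      have "?f n \<in> borel_measurable borel" for n
        by (intro borel_measurable_continuous_onI continuous_intros)
      then show "(\<lambda>x. k x * ?f n x) \<in> borel_measurable lborel" for n by simp
    qed (use k C in auto)
    moreover have "(LINT x|lborel. k x * ?f n x) = 0" for n
      by (intro cont continuous_intros)
    ultimately show ?thesis by (simp add: LIMSEQ_const_iff)
  qed simp
qed

text \<open>Any bump function \<open>\<phi>\<close> suffices to localise: the products of its translates with polynomials
  are test functions.\<close>

lemma fundamental_lemma:
  fixes h \<phi> :: "real^'n::finite \<Rightarrow> real"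
  assumes h: "\<And>R. integrable lborel (\<lambda>x. h x * indicator (cball 0 R) x)"
    and [measurable]: "h \<in> borel_measurable borel"
    and \<phi>: "\<phi> \<in> Cc_infty UNIV" "\<phi> x0 \<noteq> 0"
    and test: "\<And>\<psi>. \<psi> \<in> Cc_infty UNIV \<Longrightarrow> (LINT x|lborel. h x * \<psi> x) = 0"
  shows "AE x in lborel. h x = 0"
proof -
  have local: "AE x in lborel. h x * \<phi> (a + x) = 0" for a
  proof -
    have \<phi>a: "(\<lambda>x. \<phi> (a + x)) \<in> Cc_infty UNIV" using Cc_infty_affine[OF \<phi>(1), of 1 a] by simp
    obtain C R where C: "C > 0" "\<And>x. \<bar>\<phi> (a + x)\<bar> \<le> C * indicator (cball 0 R) x"
      using Cc_infty_bounded[OF \<phi>a] by metis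
    have [measurable]: "(\<lambda>x. \<phi> (a + x)) \<in> borel_measurable borel" by (rule Cc_infty_measurable[OF \<phi>a])
    have z: "\<phi> (a + x) = 0" if "R < norm x" for x using C(2)[of x] that by (simp add: indicator_def)
    show ?thesis
    proof (rule integral_polynomial_eq_0_imp_AE[where R=R])
      have "norm (h x * \<phi> (a + x)) \<le> norm (C * (h x * indicator (cball 0 R) x))" for x
        using mult_left_mono[OF C(2)[of x], of "\<bar>h x\<bar>"] C(1) by (auto simp: abs_mult mult_ac)
      then show "integrable lborel (\<lambda>x. h x * \<phi> (a + x))"
        by (intro Bochner_Integration.integrable_bound[OF integrable_mult_right[OF h[of R], of C]]) auto
      fix g :: "real^'n \<Rightarrow> real" assume "real_polynomial_function g"
      then have "(\<lambda>x. \<phi> (a + x) * g x) \<in> Cc_infty UNIV"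
        by (intro Cc_infty_mult \<phi>a smooth_real_polynomial_function)
      from test[OF this] show "(LINT x|lborel. h x * \<phi> (a + x) * g x) = 0" by (simp add: mult.assoc)
    qed (simp add: z)
  qed
  \<comment> \<open>Countably many translates suffice: for each \<open>x\<close> the translations
    \<open>a\<close> with \<open>\<phi> (a + x) \<noteq> 0\<close> form a nonempty open set, which
    meets \<open>D\<close>.\<close>
  obtain D :: "(real^'n) set" where D: "countable D" "\<And>X. open X \<Longrightarrow> X \<noteq> {} \<Longrightarrow> \<exists>d\<in>D. d \<in> X"
    using countable_dense_exists by metis
  have "AE x in lborel. \<forall>a\<in>D. h x * \<phi> (a + x) = 0"
    unfolding AE_ball_countable[OF D(1)] using local by blast
  then show ?thesis
  proof eventually_elim
    case (elim x)
    have c\<phi>: "continuous_on UNIV \<phi>" by (intro smooth_continuous Cc_infty_smooth[OF \<phi>(1)])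
    have "open {a. \<phi> (a + x) \<noteq> 0}"
      by (intro open_Collect_neq continuous_intros continuous_on_compose2[OF c\<phi>]) auto
    moreover have "x0 - x \<in> {a. \<phi> (a + x) \<noteq> 0}" using \<phi>(2) by simp
    ultimately obtain a where "a \<in> D" "\<phi> (a + x) \<noteq> 0" using D(2)[of "{a. \<phi> (a + x) \<noteq> 0}"] by blast
    then show ?case using elim by auto
  qed
qed

section \<open>The environment\<close>

text \<open>Rounding half up matches the half-open \<open>unit_cell\<close>, so every point belongs
  to exactly one lattice translate.\<close>

definition cell :: "real^'n::finite \<Rightarrow> int^'n" where
  "cell x = (\<chi> i. \<lfloor>x $ i + 1/2\<rfloor>)"

lemma cell_eq_iff: "cell x = j \<longleftrightarrow> (\<forall>i. \<lfloor>x $ i + 1/2\<rfloor> = j $ i)"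
  by (auto simp: cell_def vec_eq_iff)

lemma cell_measurable [measurable]: "(cell :: real^'n::finite \<Rightarrow> int^'n) \<in> borel \<rightarrow>\<^sub>M count_space UNIV"
proof (subst measurable_count_space_eq_countable)
  have "(cell :: real^'n \<Rightarrow> int^'n) -` {j} \<in> sets borel" for j
  proof -
    have "cell -` {j} = {x::real^'n. \<forall>i. \<lfloor>x $ i + 1/2\<rfloor> = j $ i}" by (simp add: set_eq_iff cell_eq_iff)
    also have "\<dots> \<in> sets borel" by measurable
    finally show ?thesis .
  qed
  then show "(cell :: real^'n \<Rightarrow> int^'n) \<in> space borel \<rightarrow> UNIV \<and> (\<forall>a\<in>UNIV. cell -` {a} \<inter> space (borel :: (real^'n) measure) \<in> sets borel)"
    by auto
qed (rule countableI_type)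

lemma cell_add_lattice_pt: "cell (x + lattice_pt z) = cell x + z"
proof -
  have "\<lfloor>x $ i + real_of_int (z $ i) + 1/2\<rfloor> = \<lfloor>x $ i + 1/2\<rfloor> + z $ i" for i
    using floor_add_int[of "x $ i + 1/2" "z $ i"] by (simp add: algebra_simps)
  then show ?thesis by (simp add: cell_def vec_eq_iff lattice_pt_def)
qed

lemma lattice_pt_add: "lattice_pt (a + b) = lattice_pt a + lattice_pt b"
  by (simp add: lattice_pt_def vec_eq_iff)

lemma lattice_pt_minus: "lattice_pt (- a) = - lattice_pt a"
  by (simp add: lattice_pt_def vec_eq_iff)

lemma cell_0_iff: "cell x = 0 \<longleftrightarrow> x \<in> unit_cell"
proof -
  have "\<lfloor>x $ i + 1/2\<rfloor> = 0 \<longleftrightarrow> - (1/2) \<le> x $ i \<and> x $ i < 1/2" for i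
    unfolding floor_eq_iff by (simp, linarith)
  then show ?thesis by (simp add: cell_eq_iff unit_cell_def)
qed

lemma cell_iff: "cell x = j \<longleftrightarrow> x - lattice_pt j \<in> unit_cell"
  using cell_add_lattice_pt[of "x - lattice_pt j" j] cell_0_iff[of "x - lattice_pt j"] by auto

lemma cell_near:
  assumes "norm (x - lattice_pt j) < 1/2" shows "cell x = j"
  unfolding cell_iff unit_cell_def
proof (rule CollectI, rule allI)
  fix i
  have "\<bar>(x - lattice_pt j) $ i\<bar> < 1/2" using component_le_norm_cart[of "x - lattice_pt j" i] assms by linarith
  then show "- (1/2) \<le> (x - lattice_pt j) $ i \<and> (x - lattice_pt j) $ i < 1/2" by linarith
qed

lemma unit_cell_measurable [measurable]: "unit_cell \<in> sets borel"
proof -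
  have "unit_cell = cell -` {0} \<inter> space borel" by (auto simp: cell_0_iff)
  also have "\<dots> \<in> sets borel" by (rule measurable_sets[OF cell_measurable]) simp
  finally show ?thesis .
qed

lemma shift_add: "shift a (shift b \<omega>) = shift (a + b) \<omega>"
  by (simp add: shift_def add.assoc)

section \<open>Environment, potential and survival probability\<close>

locale landscape =
  fixes \<phi> :: "real^'n::finite \<Rightarrow> real" and \<mu> :: "real measure" and \<Lambda> :: real
  assumes phi_bump: "\<phi> \<in> Cc_infty (ball 0 (1/10))"
    and phi_range: "\<And>x. 0 \<le> \<phi> x \<and> \<phi> x \<le> 1"
    and phi_nontrivial: "\<exists>x. \<phi> x \<noteq> 0"
    and mu_prob: "prob_space \<mu>"
    and mu_sets: "sets \<mu> = sets (restrict_space borel {0..1})"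
    and mu_nondegenerate: "\<And>a. measure \<mu> {a} \<noteq> 1"
    and Lambda_pos: "\<Lambda> > 0"
begin

abbreviation cfg :: "'n config measure" where "cfg \<equiv> config_space \<mu>"

sublocale mu: prob_space \<mu> by (rule mu_prob)

sublocale cfg: prob_space cfg
  unfolding config_space_def by (rule prob_space_PiM) (rule mu_prob)

sublocale walk: prob_space "step \<Lambda> k :: (real \<times> (real^'n)) measure" for k
  by (rule prob_space_step[OF Lambda_pos])

lemma space_mu: "space \<mu> = {0..1}"
  using sets_eq_imp_space_eq[OF mu_sets] by (simp add: space_restrict_space)

lemma space_cfg: "space cfg = {\<omega>. \<forall>j. \<omega> j \<in> {0..1}}"
  by (auto simp: config_space_def space_PiM space_mu PiE_def Pi_def)

lemma mu_borel: "(\<lambda>x. x) \<in> borel_measurable \<mu>"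
  using mu_sets by (simp add: measurable_cong_sets[OF mu_sets refl] measurable_restrict_space1)

lemma coordinate_measurable_mu: "(\<lambda>\<omega>. \<omega> j) \<in> cfg \<rightarrow>\<^sub>M \<mu>"
  unfolding config_space_def by (rule measurable_component_singleton) simp

lemma coordinate_measurable [measurable]: "(\<lambda>\<omega>. \<omega> j) \<in> borel_measurable cfg"
  using measurable_compose[OF coordinate_measurable_mu mu_borel] .

lemma shift_measurable [measurable]: "shift z \<in> cfg \<rightarrow>\<^sub>M cfg"
proof -
  have "(\<lambda>\<omega>. \<lambda>j. \<omega> (j + z)) \<in> cfg \<rightarrow>\<^sub>M PiM UNIV (\<lambda>_. \<mu>)"
    by (rule measurable_PiM_single') (auto simp: coordinate_measurable_mu space_cfg space_mu)
  then show ?thesis by (simp add: shift_def[abs_def] config_space_def)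
qed

lemma distr_shift: "distr cfg cfg (shift z) = cfg"
proof -
  have "distr (PiM UNIV (\<lambda>_. \<mu>)) (PiM UNIV (\<lambda>i. \<mu>)) (\<lambda>\<omega>. \<lambda>n\<in>UNIV. \<omega> (n + z)) = PiM UNIV (\<lambda>i. \<mu>)"
    by (rule distr_PiM_reindex) (auto simp: mu_prob inj_on_def)
  then show ?thesis by (simp add: shift_def[abs_def] config_space_def restrict_UNIV)
qed

lemma nn_integral_shift:
  assumes [measurable]: "f \<in> borel_measurable cfg"
  shows "(\<integral>\<^sup>+\<omega>. f (shift z \<omega>) \<partial>cfg) = (\<integral>\<^sup>+\<omega>. f \<omega> \<partial>cfg)"
proof -
  have "(\<integral>\<^sup>+\<omega>. f \<omega> \<partial>cfg) = (\<integral>\<^sup>+\<omega>. f \<omega> \<partial>distr cfg cfg (shift z))" by (simp add: distr_shift)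
  also have "\<dots> = (\<integral>\<^sup>+\<omega>. f (shift z \<omega>) \<partial>cfg)" by (rule nn_integral_distr) auto
  finally show ?thesis ..
qed

lemma AE_shift:
  assumes "AE \<omega> in cfg. P \<omega>" shows "AE \<omega> in cfg. P (shift z \<omega>)"
proof -
  have "AE \<omega> in distr cfg cfg (shift z). P \<omega>" unfolding distr_shift by (rule assms)
  then show ?thesis using AE_distrD[OF shift_measurable] by blast
qed

text \<open>Overwriting coordinate \<open>j\<close> by an independent sample preserves the product
  law, and \<open>h\<close> does not notice the change; the integral over the enlarged space then
  factors.\<close>

lemma nn_integral_coordinate_independent:
  assumes [measurable]: "f \<in> borel_measurable borel" "h \<in> borel_measurable cfg"
    and h: "\<And>\<omega> a. h (fun_upd \<omega> j a) = h \<omega>"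
  shows "(\<integral>\<^sup>+\<omega>. f (\<omega> j) * h \<omega> \<partial>cfg) = (\<integral>\<^sup>+a. f a \<partial>\<mu>) * (\<integral>\<^sup>+\<omega>. h \<omega> \<partial>cfg)"
proof -
  have eq: "distr (\<mu> \<Otimes>\<^sub>M cfg) cfg (\<lambda>(a, \<omega>). fun_upd \<omega> j a) = cfg"
    using distr_pair_PiM_eq_PiM[of UNIV "\<lambda>_. \<mu>" j] by (simp add: mu_prob config_space_def)
  have upd [measurable]: "(\<lambda>(a, \<omega>). fun_upd \<omega> j a) \<in> \<mu> \<Otimes>\<^sub>M cfg \<rightarrow>\<^sub>M cfg"
    using measurable_add_dim[of j UNIV "\<lambda>_. \<mu>"]
      measurable_compose[OF measurable_pair_swap' measurable_add_dim[of j UNIV "\<lambda>_. \<mu>"]]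
    by (simp add: config_space_def case_prod_beta')
  have [measurable]: "f \<in> borel_measurable \<mu>" by (rule measurable_compose[OF mu_borel assms(1)])
  have "(\<integral>\<^sup>+\<omega>. f (\<omega> j) * h \<omega> \<partial>cfg) = (\<integral>\<^sup>+\<omega>. f (\<omega> j) * h \<omega> \<partial>(distr (\<mu> \<Otimes>\<^sub>M cfg) cfg (\<lambda>(a, \<omega>). fun_upd \<omega> j a)))"
    by (simp add: eq)
  also have "\<dots> = (\<integral>\<^sup>+p. f (fst p) * h (snd p) \<partial>(\<mu> \<Otimes>\<^sub>M cfg))"
    by (subst nn_integral_distr) (auto simp: case_prod_beta' h)
  also have "\<dots> = (\<integral>\<^sup>+a. \<integral>\<^sup>+\<omega>. f a * h \<omega> \<partial>cfg \<partial>\<mu>)"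
    by (subst cfg.nn_integral_fst[symmetric]) auto
  also have "\<dots> = (\<integral>\<^sup>+a. f a \<partial>\<mu>) * (\<integral>\<^sup>+\<omega>. h \<omega> \<partial>cfg)"
    by (simp add: nn_integral_cmult nn_integral_multc)
  finally show ?thesis .
qed

lemma phi_eq_0: "1/10 \<le> norm x \<Longrightarrow> \<phi> x = 0"
  using phi_bump closure_subset[of "{x. \<phi> x \<noteq> 0}"] by (fastforce simp: Cc_infty_def)

lemma phi_Cc: "\<phi> \<in> Cc_infty UNIV" using phi_bump by (rule Cc_infty_mono)

lemma phi_continuous: "continuous_on UNIV \<phi>"
  by (intro smooth_continuous Cc_infty_smooth[OF phi_Cc])

lemma phi_measurable [measurable]: "\<phi> \<in> borel_measurable borel"
  by (rule Cc_infty_measurable[OF phi_Cc])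

text \<open>The survival probability of a walker at \<open>x\<close> is \<open>1 - V x\<close>; the potential of the cells in \<open>S\<close> is
  switched off. Clamping the weights to \<open>[0, 1]\<close> changes nothing on the configuration space and
  makes the bounds hold for every function \<open>\<omega>\<close>.\<close>

definition survival :: "(int^'n) set \<Rightarrow> 'n config \<Rightarrow> real^'n \<Rightarrow> real" where
  "survival S \<omega> x = (if cell x \<in> S then 1 else 1 - max 0 (min 1 (\<omega> (cell x))) * \<phi> (x - lattice_pt (cell x)))"

lemma survival_range: "0 \<le> survival S \<omega> x" "survival S \<omega> x \<le> 1"
proof -
  have "max 0 (min 1 (\<omega> (cell x))) * \<phi> (x - lattice_pt (cell x)) \<le> 1 * 1"
    using phi_range by (intro mult_mono) auto
  then show "0 \<le> survival S \<omega> x" "survival S \<omega> x \<le> 1"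
    using phi_range by (auto simp: survival_def)
qed

text \<open>The bumps have radius 1/10, so only the one centred in the cell of \<open>x\<close> can
  be nonzero at \<open>x\<close>; on the configuration space the clamping is the identity.\<close>

lemma random_potential_eq:
  assumes "\<omega> \<in> space cfg"
  shows "random_potential \<phi> \<omega> x = 1 - survival {} \<omega> x"
proof -
  have "\<phi> (x - lattice_pt j) = 0" if "j \<noteq> cell x" for j
    using cell_near[of x j] that phi_eq_0[of "x - lattice_pt j"] by (cases "norm (x - lattice_pt j) < 1/2") force+
  then have "(\<Sum>\<^sub>\<infinity>j\<in>UNIV. \<omega> j * \<phi> (x - lattice_pt j)) = (\<Sum>\<^sub>\<infinity>j\<in>{cell x}. \<omega> j * \<phi> (x - lattice_pt j))"
    by (intro infsum_cong_neutral) auto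
  then have "random_potential \<phi> \<omega> x = \<omega> (cell x) * \<phi> (x - lattice_pt (cell x))"
    by (simp add: random_potential_def)
  moreover have "max 0 (min 1 (\<omega> (cell x))) = \<omega> (cell x)" using assms by (auto simp: space_cfg)
  ultimately show ?thesis by (simp add: survival_def)
qed

lemma survival_mono: "S \<subseteq> S' \<Longrightarrow> survival S \<omega> x \<le> survival S' \<omega> x"
  using survival_range[of S] by (auto simp: survival_def)

lemma survival_update: "j \<in> S \<Longrightarrow> survival S (fun_upd \<omega> j a) x = survival S \<omega> x"
  by (auto simp: survival_def)

lemma survival_shift: "survival {} \<omega> (x + lattice_pt z) = survival {} (shift z \<omega>) x"
  by (simp add: survival_def cell_add_lattice_pt shift_def lattice_pt_add)

lemma coordinate_cell_measurable [measurable]: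
  "(\<lambda>(x, \<omega>). \<omega> (cell x)) \<in> borel_measurable (borel \<Otimes>\<^sub>M cfg)"
proof -
  have "(\<lambda>p. (\<lambda>j p. (snd p :: 'n config) j) (cell (fst p)) p) \<in> borel_measurable (borel \<Otimes>\<^sub>M cfg)"
    by (rule measurable_compose_countable) measurable
  then show ?thesis by (simp add: case_prod_beta')
qed

lemma lattice_pt_cell_measurable [measurable]: "(\<lambda>x::real^'n. lattice_pt (cell x)) \<in> borel_measurable borel"
  by (rule measurable_compose[OF cell_measurable]) simp

lemma survival_measurable:
  "(\<lambda>(x, \<omega>). survival S \<omega> x) \<in> borel_measurable (borel \<Otimes>\<^sub>M cfg)"
proof -
  have [measurable]: "Measurable.pred (borel \<Otimes>\<^sub>M cfg) (\<lambda>p. cell (fst p) \<in> S)"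
    by (rule measurable_compose[OF measurable_compose[OF measurable_fst cell_measurable]]) simp
  have [measurable]: "(\<lambda>p. snd p (cell (fst p))) \<in> borel_measurable (borel \<Otimes>\<^sub>M cfg)"
    using coordinate_cell_measurable by (simp add: case_prod_beta')
  show ?thesis unfolding survival_def case_prod_beta' by measurable
qed

lemma survival_measurable' [measurable (raw)]:
  assumes "f \<in> borel_measurable M" "g \<in> M \<rightarrow>\<^sub>M cfg"
  shows "(\<lambda>x. survival S (g x) (f x)) \<in> borel_measurable M"
  using measurable_compose[OF measurable_Pair[OF assms] survival_measurable] by (simp only: prod.case)

text \<open>\<open>cell\<close> jumps at cell boundaries, but the bumps vanish there. In the ball of
  radius 1/10 about \<open>x0\<close>, either a lattice point within 2/10 of \<open>x0\<close> fixes
  the cell, or the ball misses the support of every bump.\<close>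

lemma survival_continuous: "continuous_on UNIV (survival {} \<omega>)"
proof (intro continuous_at_imp_continuous_on ballI)
  fix x0
  let ?W = "\<lambda>y. max 0 (min 1 (\<omega> (cell y))) * \<phi> (y - lattice_pt (cell y))"
  obtain c j where c: "\<And>y. y \<in> ball x0 (1/10) \<Longrightarrow> ?W y = c * \<phi> (y - lattice_pt j)"
  proof (cases "\<exists>j. norm (x0 - lattice_pt j) < 2/10")
    case True
    then obtain j where j: "norm (x0 - lattice_pt j) < 2/10" by blast
    have "cell y = j" if "y \<in> ball x0 (1/10)" for y
    proof (rule cell_near)
      have "norm (y - lattice_pt j) \<le> norm (y - x0) + norm (x0 - lattice_pt j)"
        using norm_triangle_ineq[of "y - x0" "x0 - lattice_pt j"] by simp
      then show "norm (y - lattice_pt j) < 1/2" using that j by (simp add: dist_norm norm_minus_commute)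
    qed
    then show thesis by (intro that[of "max 0 (min 1 (\<omega> j))" j]) simp
  next
    case False
    have "\<phi> (y - lattice_pt j) = 0" if "y \<in> ball x0 (1/10)" for y j
    proof (rule phi_eq_0)
      have "norm (x0 - lattice_pt j) \<le> norm (x0 - y) + norm (y - lattice_pt j)"
        using norm_triangle_ineq[of "x0 - y" "y - lattice_pt j"] by simp
      moreover have "norm (x0 - lattice_pt j) \<ge> 2/10" using False by (simp add: not_less)
      ultimately show "1/10 \<le> norm (y - lattice_pt j)" using that by (simp add: dist_norm)
    qed
    then show thesis by (intro that[of 0 0]) simp
  qed
  have "isCont (\<lambda>y. 1 - c * \<phi> (y - lattice_pt j)) x0"
  proof -
    have "continuous_on UNIV (\<lambda>y. 1 - c * \<phi> (y - lattice_pt j))"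
      by (intro continuous_intros continuous_on_compose2[OF phi_continuous]) auto
    then show ?thesis by (simp add: continuous_on_eq_continuous_at)
  qed
  moreover have ev: "eventually (\<lambda>y. survival {} \<omega> y = 1 - c * \<phi> (y - lattice_pt j)) (nhds x0)"
    using eventually_nhds_in_open[of "ball x0 (1/10)" x0] c by (auto elim!: eventually_mono simp: survival_def)
  ultimately show "isCont (survival {} \<omega>) x0" using isCont_cong[OF ev] by simp
qed

text \<open>A vanishing mean would force the nonnegative weight to be 0 almost surely, a one-point
  law excluded by nondegeneracy.\<close>

lemma mean_weight_pos: "0 < (\<integral>\<^sup>+a. ennreal (max 0 (min 1 a)) \<partial>\<mu>)"
proof (rule ccontr)
  assume "\<not> ?thesis"
  moreover have [measurable]: "(\<lambda>a. ennreal (max 0 (min 1 a))) \<in> borel_measurable \<mu>"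
    by (rule measurable_compose[OF mu_borel]) measurable
  ultimately have "AE a in \<mu>. ennreal (max 0 (min 1 a)) = 0"
    by (subst nn_integral_0_iff_AE[symmetric]) (auto simp only: not_less le_zero_eq)
  then have "AE a in \<mu>. a \<in> {0}"
  proof (rule AE_mp, intro AE_I2 impI)
    fix a assume "a \<in> space \<mu>" "ennreal (max 0 (min 1 a)) = 0"
    then show "a \<in> {0}" by (auto simp: space_mu max_def min_def split: if_splits)
  qed
  then have "mu.prob {0} = 1"
    by (intro mu.prob_eq_1[THEN iffD2]) (auto simp: mu_sets sets_restrict_space_iff)
  then show False using mu_nondegenerate by blast
qed

end

section \<open>Decay of the survival probability\<close>

lemma power_le_fact_exp:
  assumes "0 \<le> (x::real)" shows "x ^ n \<le> fact n * exp x"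
proof -
  have "(\<Sum>i\<in>{n}. x ^ i /\<^sub>R fact i) \<le> (\<Sum>i. x ^ i /\<^sub>R fact i)"
    using assms by (intro sum_le_suminf summable_exp_generic) auto
  then show ?thesis by (simp add: exp_def field_simps)
qed

lemma one_minus_power_le_exp:
  assumes "0 \<le> x" "x \<le> (1::real)" shows "(1 - x) ^ n \<le> exp (- x * real n)"
proof -
  have "(1 - x) ^ n \<le> exp (- x) ^ n"
    using assms exp_ge_add_one_self[of "- x"] by (intro power_mono) auto
  also have "\<dots> = exp (- x * real n)" by (simp add: exp_of_nat_mult[symmetric] mult.commute)
  finally show ?thesis .
qed

context landscape
begin

text \<open>Survival is tested at the point of arrival, which makes this the operator
  \<open>P q\<close> and not \<open>q P\<close>.\<close>

definition killed_step :: "(int^'n) set \<Rightarrow> 'n config \<Rightarrow> (real^'n \<Rightarrow> ennreal) \<Rightarrow> real^'n \<Rightarrow> ennreal" where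
  "killed_step S \<omega> f x = (\<integral>\<^sup>+z. ennreal (survival S \<omega> (x + snd z)) * f (x + snd z) \<partial>step \<Lambda> 0)"

abbreviation "killed S \<omega> n \<equiv> killed_step S \<omega> ^^ n"

definition surv :: "(int^'n) set \<Rightarrow> nat \<Rightarrow> 'n config \<Rightarrow> real^'n \<Rightarrow> ennreal" where
  "surv S n \<omega> = killed S \<omega> n (\<lambda>_. 1)"

lemma surv_0 [simp]: "surv S 0 \<omega> x = 1"
  by (simp add: surv_def)

lemma surv_Suc: "surv S (Suc n) \<omega> = killed_step S \<omega> (surv S n \<omega>)"
  by (simp add: surv_def)

lemma killed_step_measurable:
  assumes "(\<lambda>(x, \<omega>). f x \<omega>) \<in> borel_measurable (borel \<Otimes>\<^sub>M cfg)"
  shows "(\<lambda>(x, \<omega>). killed_step S \<omega> (\<lambda>y. f y \<omega>) x) \<in> borel_measurable (borel \<Otimes>\<^sub>M cfg)"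
proof -
  let ?M = "(borel \<Otimes>\<^sub>M cfg) \<Otimes>\<^sub>M step \<Lambda> 0"
  have m: "(\<lambda>p. (fst (fst p) + snd (snd p), snd (fst p))) \<in> ?M \<rightarrow>\<^sub>M borel \<Otimes>\<^sub>M cfg"
    by measurable
  have m2: "(\<lambda>p. f (fst (fst p) + snd (snd p)) (snd (fst p))) \<in> borel_measurable ?M"
    using measurable_compose[OF m assms] by (simp only: prod.case)
  have m3: "(\<lambda>p. ennreal (survival S (snd (fst p)) (fst (fst p) + snd (snd p)))) \<in> borel_measurable ?M"
    by (intro measurable_compose[OF _ measurable_ennreal] survival_measurable') measurable
  show ?thesis
    unfolding killed_step_def case_prod_beta'
    by (rule walk.borel_measurable_nn_integral)
       (use borel_measurable_times_ennreal[OF m3 m2] in \<open>simp only: case_prod_beta'\<close>)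
qed

lemma killed_measurable:
  assumes "(\<lambda>(x, \<omega>). f x \<omega>) \<in> borel_measurable (borel \<Otimes>\<^sub>M cfg)"
  shows "(\<lambda>(x, \<omega>). killed S \<omega> n (\<lambda>y. f y \<omega>) x) \<in> borel_measurable (borel \<Otimes>\<^sub>M cfg)"
  by (induction n) (use assms in \<open>auto intro!: killed_step_measurable\<close>)

lemma surv_measurable: "(\<lambda>(x, \<omega>). surv S n \<omega> x) \<in> borel_measurable (borel \<Otimes>\<^sub>M cfg)"
  unfolding surv_def by (rule killed_measurable) simp

lemma surv_measurable' [measurable (raw)]:
  assumes "f \<in> borel_measurable M" "g \<in> M \<rightarrow>\<^sub>M cfg"
  shows "(\<lambda>x. surv S n (g x) (f x)) \<in> borel_measurable M"
  using measurable_compose[OF measurable_Pair[OF assms] surv_measurable] by (simp only: prod.case)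

lemma killed_step_mono: "(\<And>x. f x \<le> g x) \<Longrightarrow> killed_step S \<omega> f x \<le> killed_step S \<omega> g x"
  unfolding killed_step_def by (intro nn_integral_mono mult_left_mono) auto

lemma killed_mono: "(\<And>x. f x \<le> g x) \<Longrightarrow> killed S \<omega> n f x \<le> killed S \<omega> n g x"
  by (induction n arbitrary: x) (auto intro: killed_step_mono)

lemma surv_le_1: "surv S n \<omega> x \<le> 1"
proof (induction n arbitrary: x)
  case (Suc n)
  have "ennreal (survival S \<omega> y) * surv S n \<omega> y \<le> 1" for y
    using mult_mono[of "ennreal (survival S \<omega> y)" 1 "surv S n \<omega> y" 1] survival_range Suc by simp
  then have "surv S (Suc n) \<omega> x \<le> (\<integral>\<^sup>+z. 1 \<partial>(step \<Lambda> 0 :: (real \<times> (real^'n)) measure))"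
    unfolding surv_Suc killed_step_def by (intro nn_integral_mono)
  also have "\<dots> = 1" using walk.emeasure_space_1[of 0] by simp
  finally show ?case .
qed simp

lemma surv_Suc_le: "surv S (Suc n) \<omega> x \<le> surv S n \<omega> x"
proof (induction n arbitrary: x)
  case 0 show ?case using surv_le_1 by simp
next
  case (Suc n)
  then show ?case unfolding surv_Suc[of S "Suc n"] surv_Suc[of S n] by (rule killed_step_mono)
qed

lemma surv_antimono: "m \<le> n \<Longrightarrow> surv S n \<omega> x \<le> surv S m \<omega> x"
  by (rule lift_Suc_antimono_le[of "\<lambda>n. surv S n \<omega> x"]) (rule surv_Suc_le)

lemma surv_mono: "S \<subseteq> S' \<Longrightarrow> surv S n \<omega> x \<le> surv S' n \<omega> x"
proof (induction n arbitrary: x)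
  case (Suc n)
  then show ?case unfolding surv_Suc killed_step_def
    by (intro nn_integral_mono mult_mono ennreal_leI survival_mono) auto
qed simp

lemma surv_update: "j \<in> S \<Longrightarrow> surv S n (fun_upd \<omega> j a) = surv S n \<omega>"
  by (induction n) (auto simp: surv_Suc killed_step_def survival_update fun_eq_iff surv_def)

lemma killed_shift:
  assumes "\<And>x. f (x + lattice_pt z) = g x"
  shows "killed {} \<omega> n f (x + lattice_pt z) = killed {} (shift z \<omega>) n g x"
proof (induction n arbitrary: x)
  case (Suc n)
  have "x + lattice_pt z + snd y = x + snd y + lattice_pt z" for y :: "real \<times> (real^'n)"
    by (simp add: algebra_simps)
  then have "killed_step {} \<omega> (killed {} \<omega> n f) (x + lattice_pt z) = killed_step {} (shift z \<omega>) (killed {} (shift z \<omega>) n g) x"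
    unfolding killed_step_def[of "{}" \<omega> "killed {} \<omega> n f"] killed_step_def[of "{}" "shift z \<omega>" "killed {} (shift z \<omega>) n g"]
    by (simp only: survival_shift Suc.IH)
  then show ?case by simp
qed (simp add: assms)

lemma surv_shift: "surv {} n \<omega> (x + lattice_pt z) = surv {} n (shift z \<omega>) x"
  unfolding surv_def by (rule killed_shift) simp

lemma surv_measurable_x:
  assumes "\<omega> \<in> space cfg" shows "surv S n \<omega> \<in> borel_measurable borel"
  by (rule surv_measurable'[OF measurable_ident_sets[OF refl] measurable_const[OF assms]])

lemma survival_measurable_x:
  assumes "\<omega> \<in> space cfg" shows "survival S \<omega> \<in> borel_measurable borel"
  by (rule survival_measurable'[OF measurable_ident_sets[OF refl] measurable_const[OF assms]])

text \<open>Killing is ignored at all but the last of the \<open>k + 1\<close> steps; the free steps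
  then merge into a single step of Erlang order \<open>k\<close>.\<close>

lemma killed_le_step:
  assumes \<omega>: "\<omega> \<in> space cfg" and f: "f \<in> borel_measurable borel"
  shows "killed S \<omega> (Suc k) f x \<le> (\<integral>\<^sup>+z. ennreal (survival S \<omega> (x + snd z)) * f (x + snd z) \<partial>step \<Lambda> k)"
proof (induction k arbitrary: x)
  case (Suc k)
  have m: "(\<lambda>y. ennreal (survival S \<omega> y) * f y) \<in> borel_measurable borel"
    by (intro borel_measurable_times_ennreal measurable_compose[OF _ measurable_ennreal] survival_measurable_x \<omega> f)
  have "killed S \<omega> (Suc (Suc k)) f x \<le> (\<integral>\<^sup>+z. killed S \<omega> (Suc k) f (x + snd z) \<partial>step \<Lambda> 0)"
  proof -
    have "ennreal (survival S \<omega> y) * a \<le> a" for y a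
      using mult_right_mono[of "ennreal (survival S \<omega> y)" 1 a] survival_range by simp
    then show ?thesis
      unfolding funpow.simps(2)[of "Suc k"] o_def killed_step_def[of S \<omega> "killed S \<omega> (Suc k) f"]
      by (intro nn_integral_mono)
  qed
  also have "\<dots> \<le> (\<integral>\<^sup>+z. \<integral>\<^sup>+z'. ennreal (survival S \<omega> (x + snd z + snd z')) * f (x + snd z + snd z') \<partial>step \<Lambda> k \<partial>step \<Lambda> 0)"
    by (intro nn_integral_mono Suc)
  also have "\<dots> = (\<integral>\<^sup>+z. ennreal (survival S \<omega> (x + snd z)) * f (x + snd z) \<partial>step \<Lambda> (Suc k))"
    by (rule nn_integral_step_Suc[OF Lambda_pos m])
  finally show ?case .
qed (simp add: killed_step_def)

definition mean_surv :: "(int^'n) set \<Rightarrow> nat \<Rightarrow> real^'n \<Rightarrow> ennreal" where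
  "mean_surv S n x = (\<integral>\<^sup>+\<omega>. surv S n \<omega> x \<partial>cfg)"

lemma mean_surv_le_1: "mean_surv S n x \<le> 1"
proof -
  have "mean_surv S n x \<le> (\<integral>\<^sup>+\<omega>. 1 \<partial>cfg)" unfolding mean_surv_def by (intro nn_integral_mono surv_le_1)
  then show ?thesis using cfg.emeasure_space_1 by simp
qed

lemma mean_surv_antimono: "m \<le> n \<Longrightarrow> mean_surv S n x \<le> mean_surv S m x"
  unfolding mean_surv_def by (intro nn_integral_mono surv_antimono)

section \<open>Landing in the core of a fresh cell\<close>

text \<open>Half of a positive value of \<open>\<phi>\<close>, so that the strict superlevel set is
  open and nonempty and the core has positive volume.\<close>

definition peak :: real where "peak = \<phi> (SOME x. \<phi> x \<noteq> 0) / 2"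

lemma peak: "0 < peak" "peak \<le> 1/2"
proof -
  have "\<phi> (SOME x. \<phi> x \<noteq> 0) \<noteq> 0" using phi_nontrivial by (rule someI_ex)
  then show "0 < peak" "peak \<le> 1/2" using phi_range[of "SOME x. \<phi> x \<noteq> 0"] by (auto simp: peak_def)
qed

definition core :: "(real^'n) set" where "core = {x. peak \<le> \<phi> x}"

lemma core_measurable [measurable]: "core \<in> sets borel"
  unfolding core_def by measurable

lemma core_norm: "x \<in> core \<Longrightarrow> norm x < 1/10"
  using phi_eq_0[of x] peak by (force simp: core_def)

lemma core_volume: "0 < measure lborel core" "emeasure lborel core = ennreal (measure lborel core)"
proof -
  have sub: "core \<subseteq> cball 0 (1/10)" using core_norm by (fastforce simp: less_imp_le)
  have fin: "emeasure lborel core < \<infinity>" by (rule emeasure_bounded_finite) (rule bounded_subset[OF bounded_cball sub])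
  then show eq: "emeasure lborel core = ennreal (measure lborel core)" by (intro emeasure_eq_ennreal_measure) auto
  let ?U = "{x. peak < \<phi> x}"
  have U: "open ?U" by (intro open_Collect_less continuous_intros phi_continuous)
  have "(SOME x. \<phi> x \<noteq> 0) \<in> ?U" using peak by (simp add: peak_def)
  then have "?U \<noteq> {}" by blast
  then have "\<not> negligible ?U" using U open_not_negligible by blast
  then have "emeasure lborel ?U \<noteq> 0"
    using U by (simp add: negligible_iff_emeasure0 emeasure_completion)
  moreover have "emeasure lborel ?U \<le> emeasure lborel core" by (intro emeasure_mono) (auto simp: core_def)
  ultimately show "0 < measure lborel core" using eq
    by (cases "0 < measure lborel core") (auto simp: not_less ennreal_neg)
qed

text \<open>In the core of a cell with weight \<open>a\<close> the survival probability is at most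
  \<open>1 - peak * a\<close>; this is the mean loss over the law of the weight.\<close>

definition kill_rate :: real where "kill_rate = peak * (LINT a|\<mu>. max 0 (min 1 a))"

lemma clamp_integrable: "integrable \<mu> (\<lambda>a. max 0 (min 1 a) :: real)"
proof (rule mu.integrable_const_bound[of _ 1])
  show "(\<lambda>a. max 0 (min 1 a) :: real) \<in> borel_measurable \<mu>"
    by (rule measurable_compose[OF mu_borel]) measurable
qed auto

lemma kill_rate: "0 < kill_rate" "kill_rate \<le> 1/2"
  "(\<integral>\<^sup>+a. ennreal (1 - peak * max 0 (min 1 a)) \<partial>\<mu>) = ennreal (1 - kill_rate)"
proof -
  let ?m = "LINT a|\<mu>. max 0 (min 1 a)"
  have "ennreal ?m > 0"
    using mean_weight_pos nn_integral_eq_integral[OF clamp_integrable] by simp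
  then have "?m > 0" by simp
  then show "0 < kill_rate" using peak by (simp add: kill_rate_def)
  have "?m \<le> 1" using mu.integral_le_const[OF clamp_integrable, of 1] by simp
  then show "kill_rate \<le> 1/2" using peak \<open>?m > 0\<close> mult_mono[of peak "1/2" ?m 1] by (simp add: kill_rate_def)
  have nn: "0 \<le> 1 - peak * max 0 (min 1 a)" for a
    using peak mult_mono[of peak 1 "max 0 (min 1 a)" 1] by simp
  have "(\<integral>\<^sup>+a. ennreal (1 - peak * max 0 (min 1 a)) \<partial>\<mu>) = ennreal (LINT a|\<mu>. 1 - peak * max 0 (min 1 a))"
    using clamp_integrable nn by (intro nn_integral_eq_integral) auto
  also have "(LINT a|\<mu>. 1 - peak * max 0 (min 1 a)) = 1 - kill_rate"
    using clamp_integrable mu.prob_space by (simp add: kill_rate_def)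
  finally show "(\<integral>\<^sup>+a. ennreal (1 - peak * max 0 (min 1 a)) \<partial>\<mu>) = ennreal (1 - kill_rate)" .
qed

definition target :: "(int^'n) set \<Rightarrow> (real^'n) set" where
  "target S = {y. cell y \<notin> S \<and> y - lattice_pt (cell y) \<in> core}"

lemma target_measurable [measurable]: "target S \<in> sets borel"
proof -
  have [measurable]: "Measurable.pred borel (\<lambda>y::real^'n. cell y \<in> S)"
    by (rule measurable_compose[OF cell_measurable]) simp
  show ?thesis unfolding target_def by measurable
qed

lemma target_step_measurable [measurable]: "{z. x + snd z \<in> target S} \<in> sets (borel \<Otimes>\<^sub>M borel)"
  using measurable_sets[of "\<lambda>z. x + snd z" "borel \<Otimes>\<^sub>M borel" borel "target S"]
  by (simp add: vimage_def space_pair_measure)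

text \<open>Being in the core of a fresh cell costs an independent factor; afterwards that cell is
  removed from the environment.\<close>

lemma mean_surv_target:
  assumes "y \<in> target S"
  shows "(\<integral>\<^sup>+\<omega>. ennreal (survival S \<omega> y) * surv S n \<omega> y \<partial>cfg) \<le> ennreal (1 - kill_rate) * mean_surv (insert (cell y) S) n y"
proof -
  let ?j = "cell y" and ?f = "\<lambda>a. ennreal (1 - peak * max 0 (min 1 a))"
  have "(\<integral>\<^sup>+\<omega>. ennreal (survival S \<omega> y) * surv S n \<omega> y \<partial>cfg) \<le> (\<integral>\<^sup>+\<omega>. ?f (\<omega> ?j) * surv (insert ?j S) n \<omega> y \<partial>cfg)"
  proof (intro nn_integral_mono mult_mono ennreal_leI surv_mono)
    fix \<omega> :: "'n config"
    have "peak * max 0 (min 1 (\<omega> ?j)) \<le> max 0 (min 1 (\<omega> ?j)) * \<phi> (y - lattice_pt ?j)"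
      using assms by (subst mult.commute) (auto simp: target_def core_def intro!: mult_left_mono)
    then show "survival S \<omega> y \<le> 1 - peak * max 0 (min 1 (\<omega> ?j))"
      using assms by (simp add: survival_def target_def)
  qed auto
  also have "\<dots> = (\<integral>\<^sup>+a. ?f a \<partial>\<mu>) * (\<integral>\<^sup>+\<omega>. surv (insert ?j S) n \<omega> y \<partial>cfg)"
    by (rule nn_integral_coordinate_independent) (auto simp: surv_update)
  also have "\<dots> = ennreal (1 - kill_rate) * mean_surv (insert ?j S) n y"
    by (simp add: kill_rate mean_surv_def)
  finally show ?thesis .
qed

lemma fresh_cell:
  fixes x :: "real^'n"
  assumes "finite S" "card S \<le> L"
  obtains j where "j \<notin> S" "\<And>i. \<bar>x $ i - lattice_pt j $ i\<bar> \<le> real L + 1/2"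
proof -
  \<comment> \<open>Any direction serves: the \<open>L + 1\<close> consecutive cells from
    \<open>cell x\<close> along this axis cannot all lie in \<open>S\<close>.\<close>
  define i0 :: 'n where "i0 = undefined"
  let ?g = "\<lambda>k::nat. cell x + axis i0 (int k)"
  have "inj_on ?g {..L}" by (auto simp: inj_on_def axis_eq_axis)
  then have "card (?g ` {..L}) = Suc L" by (simp add: card_image)
  then have "\<not> ?g ` {..L} \<subseteq> S" using assms card_mono[of S "?g ` {..L}"] by auto
  then obtain k where k: "k \<le> L" "?g k \<notin> S" by auto
  have "\<bar>x $ i - lattice_pt (?g k) $ i\<bar> \<le> real L + 1/2" for i
  proof -
    have "\<bar>x $ i - of_int (cell x $ i)\<bar> \<le> 1/2"
    proof -
      have "of_int \<lfloor>x $ i + 1/2\<rfloor> \<le> x $ i + 1/2" "x $ i + 1/2 < of_int \<lfloor>x $ i + 1/2\<rfloor> + 1"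
        using floor_correct[of "x $ i + 1/2"] by auto
      then show ?thesis unfolding cell_def vec_lambda_beta by linarith
    qed
    moreover define r where "r = (if i = i0 then real k else 0)"
    moreover have "lattice_pt (?g k) $ i = of_int (cell x $ i) + r"
      by (simp add: lattice_pt_def axis_def r_def)
    moreover have "0 \<le> r" "r \<le> real L" using k(1) by (auto simp: r_def)
    ultimately show ?thesis by linarith
  qed
  with k(2) show thesis by (rule that)
qed

text \<open>The volume of the core times the lower bound for the resolvent kernel at distances of
  the order of the square root of the mean time.\<close>

definition landing :: "nat \<Rightarrow> real" where
  "landing k = measure lborel core * (1/2 * (exp (-1/2) / sqrt (6 * pi * (real (k + 1) / \<Lambda>))) ^ CARD('n))"

text \<open>A fresh cell has its centre within \<open>L + 1/2\<close> of \<open>x\<close> in every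
  coordinate and its core within 1/10 of that centre. All points of the core are thus within
  \<open>L + 1\<close>, where the kernel bound applies by the second condition on
  \<open>k\<close>.\<close>

lemma landing_prob:
  assumes S: "finite S" "card S \<le> L" and k: "k \<ge> 7" "(real L + 1)\<^sup>2 \<le> real (k + 1) / \<Lambda>"
  shows "landing k \<le> walk.prob k {z. x + snd z \<in> target S}"
proof -
  let ?p = "1/2 * (exp (-1/2) / sqrt (6 * pi * (real (k + 1) / \<Lambda>))) ^ CARD('n)"
  obtain j where j: "j \<notin> S" "\<And>i. \<bar>x $ i - lattice_pt j $ i\<bar> \<le> real L + 1/2"
    using fresh_cell[OF S, of x] by metis
  have p: "0 \<le> ?p" using Lambda_pos by simp
  have cell: "cell y = j" if "y - lattice_pt j \<in> core" for y
    using core_norm[OF that] by (intro cell_near) simp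
  have "ennreal (landing k) = ennreal ?p * emeasure lborel core"
    using p core_volume by (simp add: landing_def ennreal_mult[symmetric] mult.commute)
  also have "\<dots> = (\<integral>\<^sup>+y. ennreal ?p * indicator core (y - lattice_pt j) \<partial>lborel)"
    using nn_integral_translate[of "\<lambda>y. ennreal ?p * indicator core y" "- lattice_pt j"]
    by (simp add: nn_integral_cmult)
  also have "\<dots> \<le> (\<integral>\<^sup>+y. resolvent_kernel \<Lambda> k (y - x) * indicator (target S) y \<partial>lborel)"
  proof (rule nn_integral_mono)
    fix y :: "real^'n"
    show "ennreal ?p * indicator core (y - lattice_pt j) \<le> resolvent_kernel \<Lambda> k (y - x) * indicator (target S) y"
    proof (cases "y - lattice_pt j \<in> core")
      case True
      have "((y - x) $ i)\<^sup>2 \<le> real (k + 1) / \<Lambda>" for i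
      proof -
        have "\<bar>(y - lattice_pt j) $ i\<bar> \<le> 1/10"
          using core_norm[OF True] component_le_norm_cart[of "y - lattice_pt j" i] by linarith
        then have "\<bar>(y - x) $ i\<bar> \<le> real L + 1" using j(2)[of i]
          unfolding vector_minus_component by linarith
        then have "((y - x) $ i)\<^sup>2 \<le> (real L + 1)\<^sup>2" by (metis abs_ge_zero power2_abs power_mono)
        then show ?thesis using k(2) by simp
      qed
      then have "ennreal ?p \<le> resolvent_kernel \<Lambda> k (y - x)"
        by (rule resolvent_kernel_lower_bound[OF Lambda_pos k(1)])
      moreover have "y \<in> target S" using cell[OF True] True j(1) by (simp add: target_def)
      ultimately show ?thesis using True by simp
    qed simp
  qed
  also have "\<dots> = (\<integral>\<^sup>+z. indicator (target S) (x + snd z) \<partial>step \<Lambda> k)"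
    by (rule nn_integral_step_add[symmetric]) simp
  also have "\<dots> = emeasure (step \<Lambda> k) {z. x + snd z \<in> target S}"
  proof -
    have "(\<integral>\<^sup>+z. indicator (target S) (x + snd z) \<partial>step \<Lambda> k) = (\<integral>\<^sup>+z. indicator {z. x + snd z \<in> target S} z \<partial>step \<Lambda> k)"
      by (intro nn_integral_cong) (simp add: indicator_def)
    then show ?thesis by (simp only: nn_integral_indicator sets_step target_step_measurable)
  qed
  finally have "ennreal (landing k) \<le> ennreal (walk.prob k {z. x + snd z \<in> target S})"
    by (simp add: walk.emeasure_eq_measure)
  then show ?thesis by (simp add: ennreal_le_iff)
qed

lemma landing_nonneg: "0 \<le> landing k"
  using Lambda_pos by (simp add: landing_def)

text \<open>Induction over blocks of \<open>Suc k\<close> steps, for all sets \<open>S\<close> of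
  used cells and all starting points at once. The first term describes a walk that has used up its
  \<open>L - card S\<close> remaining fresh cells, each costing \<open>1 - kill_rate\<close>; the
  second pays in each block the mean factor \<open>1 - landing k * kill_rate\<close>. The sum of
  both is preserved by one block.\<close>

lemma mean_surv_block:
  assumes k: "k \<ge> 7" "(real L + 1)\<^sup>2 \<le> real (k + 1) / \<Lambda>"
    and S: "finite S" "card S \<le> L"
  shows "mean_surv S (n * Suc k) x \<le> ennreal ((1 - kill_rate) ^ (L - card S) + (1 - landing k * kill_rate) ^ n)"
  using S
proof (induction n arbitrary: S x)
  case 0
  have "mean_surv S (0 * Suc k) x \<le> ennreal 1" using mean_surv_le_1[of S 0 x] by simp
  also have "\<dots> \<le> ennreal ((1 - kill_rate) ^ (L - card S) + (1 - landing k * kill_rate) ^ 0)"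
    using kill_rate by (intro ennreal_leI) simp
  finally show ?case .
next
  case (Suc n)
  let ?r = "1 - landing k * kill_rate" and ?m = "n * Suc k"
  have "landing k \<le> 1" using landing_prob[OF Suc.prems k, of x] walk.prob_le_1 order_trans by blast
  then have r: "0 \<le> ?r"
    using kill_rate mult_mono[of "landing k" 1 kill_rate 1] landing_nonneg by simp
  show ?case
  \<comment> \<open>With \<open>L\<close> cells used the first term is one and the bound trivial;
    below \<open>L\<close> one more cell can be inserted within the hypotheses.\<close>
  proof (cases "card S = L")
    case True
    have "mean_surv S (Suc n * Suc k) x \<le> ennreal 1" using mean_surv_le_1 by simp
    also have "\<dots> \<le> ennreal ((1 - kill_rate) ^ (L - card S) + ?r ^ Suc n)"
      using True r by (intro ennreal_leI) simp
    finally show ?thesis .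
  next
    case False
    let ?a = "(1 - kill_rate) ^ (L - card S)"
    let ?A = "{z. x + snd z \<in> target S}"
    \<comment> \<open>On a landing, the factor \<open>1 - kill_rate\<close> restores the exponent
      \<open>L - card S\<close> of the first term and multiplies \<open>?r ^ n\<close>; otherwise
      the induction hypothesis is used with the same \<open>S\<close>. \<open>?h\<close> covers both
      cases.\<close>
    let ?h = "\<lambda>z. ?a + ?r ^ n * (1 - kill_rate * indicator ?A z)"
    have [measurable]: "?A \<in> sets (step \<Lambda> k)" by simp
    interpret P: pair_sigma_finite cfg "step \<Lambda> k :: (real \<times> (real^'n)) measure" ..
    have a: "0 \<le> ?a" using kill_rate by simp
    have i: "integrable (step \<Lambda> k) (indicator ?A :: _ \<Rightarrow> real)"
      by (intro integrable_real_indicator) (auto simp: walk.emeasure_finite less_top[symmetric])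
    have "mean_surv S (Suc n * Suc k) x \<le> (\<integral>\<^sup>+\<omega>. \<integral>\<^sup>+z. ennreal (survival S \<omega> (x + snd z)) * surv S ?m \<omega> (x + snd z) \<partial>step \<Lambda> k \<partial>cfg)"
      unfolding mean_surv_def
    proof (rule nn_integral_mono)
      fix \<omega> :: "'n config" assume \<omega>: "\<omega> \<in> space cfg"
      have "surv S (Suc n * Suc k) \<omega> x = killed S \<omega> (Suc k) (surv S ?m \<omega>) x"
      proof -
        have "Suc n * Suc k = Suc k + ?m" by simp
        then show ?thesis unfolding surv_def by (simp only: funpow_add o_def)
      qed
      also have "\<dots> \<le> (\<integral>\<^sup>+z. ennreal (survival S \<omega> (x + snd z)) * surv S ?m \<omega> (x + snd z) \<partial>step \<Lambda> k)"
        by (rule killed_le_step[OF \<omega>]) (rule surv_measurable_x[OF \<omega>])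
      finally show "surv S (Suc n * Suc k) \<omega> x \<le> (\<integral>\<^sup>+z. ennreal (survival S \<omega> (x + snd z)) * surv S ?m \<omega> (x + snd z) \<partial>step \<Lambda> k)" .
    qed
    \<comment> \<open>For a fixed landing point the average over the environment comes first, so
      that independence of the fresh cell can be used.\<close>
    also have "\<dots> = (\<integral>\<^sup>+z. \<integral>\<^sup>+\<omega>. ennreal (survival S \<omega> (x + snd z)) * surv S ?m \<omega> (x + snd z) \<partial>cfg \<partial>step \<Lambda> k)"
    proof (rule P.Fubini'[symmetric])
      show "(\<lambda>(\<omega>, z). ennreal (survival S \<omega> (x + snd z)) * surv S ?m \<omega> (x + snd z)) \<in> borel_measurable (cfg \<Otimes>\<^sub>M step \<Lambda> k)"
        unfolding case_prod_beta'
        by (intro borel_measurable_times_ennreal measurable_compose[OF _ measurable_ennreal] survival_measurable' surv_measurable') measurable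
    qed
    also have "\<dots> \<le> (\<integral>\<^sup>+z. ennreal (?h z) \<partial>step \<Lambda> k)"
    proof (rule nn_integral_mono)
      fix z :: "real \<times> (real^'n)"
      let ?y = "x + snd z"
      show "(\<integral>\<^sup>+\<omega>. ennreal (survival S \<omega> ?y) * surv S ?m \<omega> ?y \<partial>cfg) \<le> ennreal (?h z)"
      proof (cases "z \<in> ?A")
        case True
        then have t: "?y \<in> target S" by simp
        then have "card (insert (cell ?y) S) = Suc (card S)" using Suc.prems by (simp add: target_def)
        then have IH: "mean_surv (insert (cell ?y) S) ?m ?y \<le> ennreal ((1 - kill_rate) ^ (L - Suc (card S)) + ?r ^ n)"
          using Suc.IH[of "insert (cell ?y) S" ?y] Suc.prems False by simp
        have "(\<integral>\<^sup>+\<omega>. ennreal (survival S \<omega> ?y) * surv S ?m \<omega> ?y \<partial>cfg) \<le> ennreal (1 - kill_rate) * ennreal ((1 - kill_rate) ^ (L - Suc (card S)) + ?r ^ n)"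
          by (rule order_trans[OF mean_surv_target[OF t] mult_left_mono[OF IH]]) simp
        also have "\<dots> = ennreal ((1 - kill_rate) * ((1 - kill_rate) ^ (L - Suc (card S)) + ?r ^ n))"
          using kill_rate r by (intro ennreal_mult[symmetric]) auto
        also have "(1 - kill_rate) * ((1 - kill_rate) ^ (L - Suc (card S)) + ?r ^ n) = ?h z"
        proof -
          have "L - card S = Suc (L - Suc (card S))" using False Suc.prems by simp
          then show ?thesis using True by (simp add: algebra_simps)
        qed
        finally show ?thesis .
      next
        case False
        have "(\<integral>\<^sup>+\<omega>. ennreal (survival S \<omega> ?y) * surv S ?m \<omega> ?y \<partial>cfg) \<le> mean_surv S ?m ?y"
          unfolding mean_surv_def
        proof (rule nn_integral_mono)
          fix \<omega> show "ennreal (survival S \<omega> ?y) * surv S ?m \<omega> ?y \<le> surv S ?m \<omega> ?y"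
            using mult_right_mono[of "ennreal (survival S \<omega> ?y)" 1 "surv S ?m \<omega> ?y"] survival_range by simp
        qed
        also have "\<dots> \<le> ennreal (?a + ?r ^ n)" using Suc by simp
        finally show ?thesis using False by simp
      qed
    qed
    also have "\<dots> = ennreal (LINT z|step \<Lambda> k. ?h z)"
    proof (rule nn_integral_eq_integral)
      show "integrable (step \<Lambda> k) ?h"
        using i by (intro Bochner_Integration.integrable_add integrable_mult_right Bochner_Integration.integrable_diff) auto
      have "0 \<le> ?h z" for z
        using a r kill_rate by (intro add_nonneg_nonneg mult_nonneg_nonneg) (auto simp: indicator_def)
      then show "AE z in step \<Lambda> k. 0 \<le> ?h z" by (rule AE_I2)
    qed
    also have "(LINT z|step \<Lambda> k. ?h z) = ?a + ?r ^ n * (1 - kill_rate * walk.prob k ?A)"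
    proof -
      have "(LINT z|step \<Lambda> k. 1 - kill_rate * indicator ?A z) = 1 - kill_rate * walk.prob k ?A"
        using walk.prob_space[of k] i by (subst Bochner_Integration.integral_diff) auto
      moreover have "(LINT z|step \<Lambda> k. ?h z) = ?a + ?r ^ n * (LINT z|step \<Lambda> k. 1 - kill_rate * indicator ?A z)"
        using walk.prob_space[of k] i by (subst Bochner_Integration.integral_add) auto
      ultimately show ?thesis by simp
    qed
    also have "ennreal \<dots> \<le> ennreal (?a + ?r ^ Suc n)"
    proof (rule ennreal_leI)
      have "1 - kill_rate * walk.prob k ?A \<le> ?r"
        using landing_prob[OF Suc.prems k, of x] kill_rate by (simp add: mult.commute mult_left_mono)
      then have "?r ^ n * (1 - kill_rate * walk.prob k ?A) \<le> ?r ^ n * ?r"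
        using r by (intro mult_left_mono) auto
      then show "?a + ?r ^ n * (1 - kill_rate * walk.prob k ?A) \<le> ?a + ?r ^ Suc n" by (simp add: mult.commute)
    qed
    finally show ?thesis .
  qed
qed

end

section \<open>Moments of the supremum\<close>

text \<open>The increment of the power of a partial sum factors as \<open>s N\<close> times
  \<open>Suc m\<close> products, each at most \<open>real (Suc N) ^ m\<close> because the terms are
  at most 1. The bound is linear in \<open>s\<close>, so after taking means only first moments of
  the individual terms remain.\<close>

lemma sum_power_le:
  fixes s :: "nat \<Rightarrow> real"
  assumes "\<And>n. 0 \<le> s n" "\<And>n. s n \<le> 1"
  shows "(\<Sum>n<N. s n) ^ Suc m \<le> (\<Sum>n<N. real (Suc m) * real (Suc n) ^ m * s n)"
proof (induction N)
  case (Suc N)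
  let ?S = "\<Sum>n<N. s n"
  have S0: "0 \<le> ?S" using assms by (intro sum_nonneg) auto
  have "?S \<le> (\<Sum>n<N. 1)" using assms by (intro sum_mono) auto
  then have SN: "?S \<le> real N" by simp
  have "(?S + s N) ^ Suc m - ?S ^ Suc m = s N * (\<Sum>p<Suc m. (?S + s N) ^ p * ?S ^ (m - p))"
    by (subst diff_power_eq_sum) simp
  also have "\<dots> \<le> s N * (\<Sum>p<Suc m. real (Suc N) ^ m)"
  proof (intro mult_left_mono sum_mono)
    fix p assume "p \<in> {..<Suc m}"
    then have "(?S + s N) ^ p * ?S ^ (m - p) \<le> real (Suc N) ^ p * real (Suc N) ^ (m - p)"
      using S0 SN assms[of N] by (intro mult_mono power_mono) auto
    also have "\<dots> = real (Suc N) ^ m" using \<open>p \<in> {..<Suc m}\<close> by (simp add: power_add[symmetric])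
    finally show "(?S + s N) ^ p * ?S ^ (m - p) \<le> real (Suc N) ^ m" .
  qed (use assms in auto)
  also have "\<dots> = real (Suc m) * real (Suc N) ^ m * s N" by (simp add: mult_ac)
  finally show ?case using Suc by simp
qed simp

context landscape
begin

text \<open>Blocks of length \<open>N0 * (L + 2)\<^sup>2\<close> spread over distance
  \<open>L\<close> and land with probability of order \<open>L\<close> to the power
  \<open>- CARD('n)\<close>. Taking \<open>(L + 2) ^ (CARD('n) + 1)\<close> such blocks makes both
  terms of the block estimate exponentially small in \<open>L\<close>. The number of steps is
  polynomial in \<open>L\<close>, so the decay in \<open>n\<close> is a stretched exponential, which
  beats every power.\<close>

lemma mean_surv_decay:
  "\<exists>C\<ge>0. \<forall>n x. mean_surv {} n x \<le> ennreal (C / real (Suc n) ^ Q)"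
proof -
  let ?d = "CARD('n)"
  \<comment> \<open>\<open>CARD('n) + 1\<close> for the number of blocks plus 2 for their
    length.\<close>
  define e where "e = ?d + 3"
  \<comment> \<open>At least 8 for the concentration of the Erlang time, and at least
    \<open>\<Lambda>\<close> so that the typical displacement of a block exceeds
    \<open>L + 1\<close>.\<close>
  define N0 where "N0 = max 8 (nat \<lceil>\<Lambda>\<rceil>)"
  have N0: "8 \<le> N0" "\<Lambda> \<le> real N0" by (auto simp: N0_def le_max_iff_disj) linarith
  define c1 where "c1 = measure lborel core * (1/2 * (exp (-1/2) / sqrt (6 * pi * (real N0 / \<Lambda>))) ^ ?d)"
  have c1: "c1 > 0" using core_volume Lambda_pos N0 by (simp add: c1_def)
  define c2 where "c2 = min kill_rate (c1 * kill_rate)"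
  have c2: "c2 > 0" using c1 kill_rate by (simp add: c2_def)
  have block: "mean_surv {} (N0 * (L + 2) ^ e) x \<le> ennreal (2 * exp (- c2 * real L))" for L x
  proof -
    define k where "k = N0 * (L + 2)\<^sup>2 - 1"
    have "1 * 1 \<le> N0 * (L + 2)\<^sup>2" using N0 by (intro mult_mono) auto
    then have Suc_k: "Suc k = N0 * (L + 2)\<^sup>2" by (simp add: k_def)
    have "8 * 1 \<le> N0 * (L + 2)\<^sup>2" using N0 by (intro mult_mono) auto
    then have k7: "k \<ge> 7" by (simp add: k_def)
    have real_k: "real (k + 1) = real N0 * (real L + 2)\<^sup>2" using Suc_k by (metis Suc_eq_plus1 of_nat_add of_nat_mult of_nat_numeral of_nat_power)
    have "(real L + 1)\<^sup>2 \<le> (real L + 2)\<^sup>2" by (intro power_mono) auto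
    also have "\<dots> \<le> real N0 / \<Lambda> * (real L + 2)\<^sup>2"
      using N0 Lambda_pos by (intro mult_le_cancel_right1[THEN iffD2]) auto
    finally have k2: "(real L + 1)\<^sup>2 \<le> real (k + 1) / \<Lambda>" unfolding real_k by simp
    have landing: "landing k = c1 / (real L + 2) ^ ?d"
    proof -
      have "sqrt (6 * pi * (real (k + 1) / \<Lambda>)) = sqrt (6 * pi * (real N0 / \<Lambda>)) * (real L + 2)"
        unfolding real_k by (simp add: real_sqrt_mult real_sqrt_divide)
      then show ?thesis unfolding landing_def c1_def by (simp add: power_divide power_mult_distrib)
    qed
    have l1: "landing k \<le> 1" using landing_prob[of "{}" L k x] k7 k2 walk.prob_le_1 order_trans by fastforce
    have "landing k * kill_rate \<le> 1" using l1 kill_rate landing_nonneg[of k] mult_mono[of "landing k" 1 kill_rate 1] by simp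
    moreover have "0 \<le> landing k * kill_rate" using kill_rate landing_nonneg by simp
    ultimately have "(1 - landing k * kill_rate) ^ ((L + 2) ^ (?d + 1)) \<le> exp (- (landing k * kill_rate) * real ((L + 2) ^ (?d + 1)))"
      by (intro one_minus_power_le_exp)
    also have "\<dots> = exp (- (c1 * kill_rate * (real L + 2)))"
      by (simp add: landing field_simps add_eq_0_iff)
    also have "\<dots> \<le> exp (- c2 * real L)"
    proof -
      have "c2 * real L \<le> c1 * kill_rate * (real L + 2)" using c1 kill_rate by (intro mult_mono) (auto simp: c2_def)
      then show ?thesis by simp
    qed
    finally have t2: "(1 - landing k * kill_rate) ^ ((L + 2) ^ (?d + 1)) \<le> exp (- c2 * real L)" .
    have "(1 - kill_rate) ^ L \<le> exp (- kill_rate * real L)" using kill_rate by (intro one_minus_power_le_exp) auto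
    also have "\<dots> \<le> exp (- c2 * real L)" by (simp add: c2_def mult_right_mono)
    finally have t1: "(1 - kill_rate) ^ L \<le> exp (- c2 * real L)" .
    have "N0 * (L + 2) ^ e = (L + 2) ^ (?d + 1) * Suc k"
    proof -
      have "e = (?d + 1) + 2" by (simp add: e_def)
      then have "(L + 2) ^ e = (L + 2) ^ (?d + 1) * (L + 2)\<^sup>2" by (simp only: power_add)
      then show ?thesis unfolding Suc_k by simp
    qed
    then have "mean_surv {} (N0 * (L + 2) ^ e) x \<le> ennreal ((1 - kill_rate) ^ (L - card ({}::(int^'n) set)) + (1 - landing k * kill_rate) ^ ((L + 2) ^ (?d + 1)))"
      using mean_surv_block[OF k7 k2, of "{}" "(L + 2) ^ (?d + 1)" x] by (simp only: finite.emptyI card.empty le0)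
    also have "\<dots> \<le> ennreal (2 * exp (- c2 * real L))" using t1 t2 by (intro ennreal_leI) simp
    finally show ?thesis .
  qed
  \<comment> \<open>The bound \<open>x ^ M \<le> fact M * exp x\<close> with
    \<open>x = c2 * (L + 3)\<close> converts the exponential into the power \<open>Q\<close> of
    \<open>N0 * (L + 3) ^ e\<close>, whence \<open>K\<close>. \<open>K'\<close> covers the finitely
    many \<open>n\<close> below the first block count.\<close>
  define M where "M = e * Q"
  define K where "K = 2 * exp (3 * c2) * fact M / c2 ^ M * real N0 ^ Q"
  define K' where "K' = real (N0 * 2 ^ e) ^ Q"
  have K: "K \<ge> 0" "K' \<ge> 0" using c2 by (auto simp: K_def K'_def)
  have "mean_surv {} n x \<le> ennreal ((K + K') / real (Suc n) ^ Q)" for n x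
  proof (cases "n < N0 * 2 ^ e")
    case True
    have "mean_surv {} n x \<le> ennreal 1" using mean_surv_le_1 by simp
    also have "\<dots> \<le> ennreal ((K + K') / real (Suc n) ^ Q)"
    proof (rule ennreal_leI)
      have "real (Suc n) ^ Q \<le> K'" unfolding K'_def using True by (intro power_mono of_nat_mono) auto
      then show "1 \<le> (K + K') / real (Suc n) ^ Q" using K by (simp add: le_divide_eq del: of_nat_Suc)
    qed
    finally show ?thesis .
  next
    case False
    let ?A = "{L. N0 * (L + 2) ^ e \<le> n}"
    have "L \<le> n" if "L \<in> ?A" for L
    proof -
      have "1 * (L + 2) ^ 1 \<le> N0 * (L + 2) ^ e" using N0 by (intro mult_mono power_increasing) (auto simp: e_def)
      then show ?thesis using that by simp
    qed
    then have fin: "finite ?A" by (intro finite_subset[of ?A "{..n}"]) auto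
    have ne: "0 \<in> ?A" using False by (simp only: mem_Collect_eq add_0 not_less)
    define L where "L = Max ?A"
    have "L \<in> ?A" unfolding L_def using fin ne by (intro Max_in) auto
    then have L: "N0 * (L + 2) ^ e \<le> n" by simp
    have "Suc L \<notin> ?A" using Max_ge[OF fin, of "Suc L"] unfolding L_def by auto
    then have "Suc n \<le> N0 * (L + 3) ^ e" by (simp add: eval_nat_numeral)
    then have "real (Suc n) \<le> real N0 * (real L + 3) ^ e"
      by (metis of_nat_add of_nat_le_iff of_nat_mult of_nat_numeral of_nat_power)
    then have "real (Suc n) ^ Q \<le> (real N0 * (real L + 3) ^ e) ^ Q" by (intro power_mono) auto
    also have "\<dots> = real N0 ^ Q * (real L + 3) ^ M" by (simp add: M_def power_mult_distrib power_mult)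
    finally have n: "real (Suc n) ^ Q \<le> real N0 ^ Q * (real L + 3) ^ M" .
    have "(c2 * (real L + 3)) ^ M \<le> fact M * exp (c2 * (real L + 3))" using c2 by (intro power_le_fact_exp) auto
    then have "(real L + 3) ^ M \<le> fact M / c2 ^ M * exp (c2 * (real L + 3))"
    proof -
      have "a * X \<le> F \<Longrightarrow> 0 < a \<Longrightarrow> X \<le> F / a" for a X F :: real by (simp add: field_simps)
      from this[OF \<open>(c2 * (real L + 3)) ^ M \<le> _\<close>[unfolded power_mult_distrib]] c2 show ?thesis by simp
    qed
    then have "real (Suc n) ^ Q \<le> real N0 ^ Q * (fact M / c2 ^ M * exp (c2 * (real L + 3)))"
      using n by (meson mult_left_mono order_trans of_nat_0_le_iff zero_le_power)
    also have "\<dots> = K / (2 * exp (- c2 * real L))"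
    proof -
      have "exp (c2 * (real L + 3)) = exp (3 * c2) / exp (- c2 * real L)"
        unfolding exp_diff[symmetric] by (simp add: algebra_simps)
      then show ?thesis by (simp add: K_def)
    qed
    finally have nK: "real (Suc n) ^ Q \<le> K / (2 * exp (- c2 * real L))" .
    have "2 * exp (- c2 * real L) \<le> K / real (Suc n) ^ Q"
    proof -
      have "X \<le> K / Y \<Longrightarrow> 0 < X \<Longrightarrow> 0 < Y \<Longrightarrow> Y \<le> K / X" for X Y :: real by (simp add: field_simps)
      from this[OF nK] show ?thesis by simp
    qed
    also have "\<dots> \<le> (K + K') / real (Suc n) ^ Q" using K by (intro divide_right_mono) auto
    finally have "ennreal (2 * exp (- c2 * real L)) \<le> ennreal ((K + K') / real (Suc n) ^ Q)" by (rule ennreal_leI)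
    with block[of L x] mean_surv_antimono[OF L, of "{}" x] show ?thesis by (meson order_trans)
  qed
  then show ?thesis using K by (intro exI[of _ "K + K'"]) auto
qed

lemma continuous_step_average:
  fixes h :: "real^'n \<Rightarrow> real"
  assumes h: "continuous_on UNIV h" "\<And>x. \<bar>h x\<bar> \<le> 1"
  shows "continuous_on UNIV (\<lambda>x. LINT z|step \<Lambda> 0. h (x + snd z))"
proof (rule continuous_on_sequentiallyI)
  fix u :: "nat \<Rightarrow> real^'n" and a assume u: "u \<longlonglongrightarrow> a"
  have [measurable]: "h \<in> borel_measurable borel" by (rule borel_measurable_continuous_onI[OF h(1)])
  show "(\<lambda>n. LINT z|step \<Lambda> 0. h (u n + snd z)) \<longlonglongrightarrow> (LINT z|step \<Lambda> 0. h (a + snd z))"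
  proof (rule integral_dominated_convergence[where w="\<lambda>_. 1"])
    show "AE z in step \<Lambda> 0. (\<lambda>n. h (u n + snd z)) \<longlonglongrightarrow> h (a + snd z)"
      by (intro AE_I2 continuous_on_tendsto_compose[OF h(1)] tendsto_add u tendsto_const) auto
    have meas: "(\<lambda>z. h (b + snd z)) \<in> borel_measurable (step \<Lambda> 0)" for b
      by (rule measurable_compose[OF _ \<open>h \<in> borel_measurable borel\<close>]) simp
    show "(\<lambda>z. h (a + snd z)) \<in> borel_measurable (step \<Lambda> 0)" by (rule meas)
    show "(\<lambda>z. h (u n + snd z)) \<in> borel_measurable (step \<Lambda> 0)" for n by (rule meas)
    show "integrable (step \<Lambda> 0 :: (real \<times> (real^'n)) measure) (\<lambda>_. 1 :: real)" by simp
    show "AE z in step \<Lambda> 0. norm (h (u n + snd z)) \<le> 1" for n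
      using h(2) by (intro AE_I2) simp
  qed
qed

text \<open>Averaging over a step preserves bounded continuous functions, and
  \<open>survival {}\<close> is continuous. Continuity is used to replace suprema over the cell by
  countable ones.\<close>

lemma surv_continuous:
  assumes \<omega>: "\<omega> \<in> space cfg"
  shows "\<exists>g. continuous_on UNIV g \<and> (\<forall>x. 0 \<le> g x \<and> g x \<le> 1 \<and> surv {} n \<omega> x = ennreal (g x))"
proof (induction n)
  case 0 show ?case by (intro exI[of _ "\<lambda>_. 1"]) auto
next
  case (Suc n)
  then obtain g where g: "continuous_on UNIV g" "\<And>x. 0 \<le> g x" "\<And>x. g x \<le> 1" "\<And>x. surv {} n \<omega> x = ennreal (g x)" by blast
  let ?h = "\<lambda>x. survival {} \<omega> x * g x"
  have h: "continuous_on UNIV ?h" by (intro continuous_on_mult survival_continuous g)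
  have h1: "0 \<le> ?h x" "?h x \<le> 1" for x
    using g(2,3)[of x] survival_range[of "{}" \<omega> x] mult_mono[of "survival {} \<omega> x" 1 "g x" 1] by auto
  have [measurable]: "?h \<in> borel_measurable borel" by (rule borel_measurable_continuous_onI[OF h])
  have int: "integrable (step \<Lambda> 0) (\<lambda>z. ?h (x + snd z))" for x
  proof (rule walk.integrable_const_bound[where B=1])
    show "(\<lambda>z. ?h (x + snd z)) \<in> borel_measurable (step \<Lambda> 0)"
      by (rule measurable_compose[OF _ \<open>?h \<in> borel_measurable borel\<close>]) simp
    show "AE z in step \<Lambda> 0. norm (?h (x + snd z)) \<le> 1"
      using h1 by (intro AE_I2) simp
  qed
  have eq: "surv {} (Suc n) \<omega> x = ennreal (LINT z|step \<Lambda> 0. ?h (x + snd z))" for x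
  proof -
    have "surv {} (Suc n) \<omega> x = (\<integral>\<^sup>+z. ennreal (?h (x + snd z)) \<partial>step \<Lambda> 0)"
      unfolding surv_Suc killed_step_def g(4) using g survival_range by (simp add: ennreal_mult)
    also have "\<dots> = ennreal (LINT z|step \<Lambda> 0. ?h (x + snd z))"
      using h1 by (intro nn_integral_eq_integral int AE_I2)
    finally show ?thesis .
  qed
  have "0 \<le> (LINT z|step \<Lambda> 0. ?h (x + snd z))" for x using h1 by (intro Bochner_Integration.integral_nonneg)
  moreover have "(LINT z|step \<Lambda> 0. ?h (x + snd z)) \<le> 1" for x
    using h1 by (intro walk.integral_le_const int AE_I2)
  ultimately show ?case
    using eq h1 continuous_step_average[OF h]
    by (intro exI[of _ "\<lambda>x. LINT z|step \<Lambda> 0. ?h (x + snd z)"]) (auto simp: abs_le_iff intro: order_trans[of _ 0])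
qed

section \<open>Suprema over the unit cell\<close>

text \<open>Countable, so that suprema over it are measurable in the environment; contained in the
  cell, so that they do not exceed suprema over the cell.\<close>

definition dense :: "(real^'n) set" where
  "dense = (SOME D. countable D \<and> D \<subseteq> unit_cell \<and> unit_cell \<subseteq> closure D)"

lemma dense: "countable dense" "dense \<subseteq> unit_cell" "unit_cell \<subseteq> closure dense" "dense \<noteq> {}"
proof -
  have "\<exists>D. countable D \<and> D \<subseteq> unit_cell \<and> unit_cell \<subseteq> closure (D :: (real^'n) set)"
    using separable[of unit_cell] by metis
  then have "countable dense \<and> dense \<subseteq> unit_cell \<and> unit_cell \<subseteq> closure dense"
    unfolding dense_def by (rule someI_ex)
  then show *: "countable dense" "dense \<subseteq> unit_cell" "unit_cell \<subseteq> closure dense" by auto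
  have "(0::real^'n) \<in> unit_cell" by (simp add: unit_cell_def)
  with * show "dense \<noteq> {}" by auto
qed

definition sup_surv :: "nat \<Rightarrow> 'n config \<Rightarrow> ennreal" where
  "sup_surv n \<omega> = (SUP x\<in>dense. surv {} n \<omega> x)"

lemma surv_measurable_cfg [measurable]: "(\<lambda>\<omega>. surv S n \<omega> x) \<in> borel_measurable cfg"
  by (rule surv_measurable'[OF measurable_const measurable_ident_sets[OF refl]]) simp

lemma sup_surv_measurable [measurable]: "sup_surv n \<in> borel_measurable cfg"
  unfolding sup_surv_def[abs_def] by (rule borel_measurable_SUP[OF dense(1) surv_measurable_cfg])

lemma sup_surv_le_1: "sup_surv n \<omega> \<le> 1"
  unfolding sup_surv_def by (intro SUP_least surv_le_1)

lemma surv_le_sup: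
  assumes "\<omega> \<in> space cfg" "x \<in> unit_cell" shows "surv {} n \<omega> x \<le> sup_surv n \<omega>"
proof -
  obtain g where g: "continuous_on UNIV g" "\<And>x. 0 \<le> g x" "\<And>x. surv {} n \<omega> x = ennreal (g x)"
    using surv_continuous[OF assms(1), of n] by blast
  have fin: "sup_surv n \<omega> < top" using sup_surv_le_1[of n \<omega>] by (simp add: le_less_trans)
  have "g y \<le> enn2real (sup_surv n \<omega>)" if "y \<in> dense" for y
  proof -
    have "ennreal (g y) \<le> sup_surv n \<omega>" unfolding sup_surv_def g(3)[symmetric] using that by (rule SUP_upper)
    then show ?thesis using g(2) fin by (metis enn2real_ennreal enn2real_mono)
  qed
  moreover have "closed {y. g y \<le> enn2real (sup_surv n \<omega>)}"
    by (intro closed_Collect_le g continuous_intros)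
  ultimately have "closure dense \<subseteq> {y. g y \<le> enn2real (sup_surv n \<omega>)}"
    by (intro closure_minimal) auto
  then have "g x \<le> enn2real (sup_surv n \<omega>)" using assms(2) dense(3) by blast
  then have "ennreal (g x) \<le> ennreal (enn2real (sup_surv n \<omega>))" by (rule ennreal_leI)
  then show ?thesis using g(3) fin by simp
qed

text \<open>The first \<open>Suc CARD('n)\<close> steps are spent, without counting their killing,
  on smoothing: together they form one step whose kernel is dominated by the envelope for every
  start in the cell.\<close>

lemma sup_surv_le_envelope:
  assumes \<omega>: "\<omega> \<in> space cfg"
  shows "sup_surv (Suc CARD('n) + n) \<omega> \<le> (\<integral>\<^sup>+y. kernel_envelope \<Lambda> y * surv {} n \<omega> y \<partial>lborel)"
  unfolding sup_surv_def
proof (rule SUP_least)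
  fix x assume "x \<in> dense"
  then have xQ: "x \<in> unit_cell" using dense(2) by blast
  have x: "\<bar>x $ i\<bar> \<le> 1/2" for i
  proof -
    have "- (1/2) \<le> x $ i \<and> x $ i < 1/2" using xQ by (simp add: unit_cell_def)
    then show ?thesis by linarith
  qed
  have "surv {} (Suc CARD('n) + n) \<omega> x = killed {} \<omega> (Suc CARD('n)) (surv {} n \<omega>) x"
    unfolding surv_def by (simp only: funpow_add o_def)
  also have "\<dots> \<le> (\<integral>\<^sup>+z. ennreal (survival {} \<omega> (x + snd z)) * surv {} n \<omega> (x + snd z) \<partial>step \<Lambda> CARD('n))"
    by (rule killed_le_step[OF \<omega> surv_measurable_x[OF \<omega>]])
  also have "\<dots> \<le> (\<integral>\<^sup>+z. surv {} n \<omega> (x + snd z) \<partial>step \<Lambda> CARD('n))"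
  proof (rule nn_integral_mono)
    fix z :: "real \<times> (real^'n)"
    show "ennreal (survival {} \<omega> (x + snd z)) * surv {} n \<omega> (x + snd z) \<le> surv {} n \<omega> (x + snd z)"
      using mult_right_mono[of "ennreal (survival {} \<omega> (x + snd z))" 1 "surv {} n \<omega> (x + snd z)"] survival_range by simp
  qed
  also have "\<dots> = (\<integral>\<^sup>+y. resolvent_kernel \<Lambda> CARD('n) (y - x) * surv {} n \<omega> y \<partial>lborel)"
    by (rule nn_integral_step_add[OF surv_measurable_x[OF \<omega>]])
  also have "\<dots> \<le> (\<integral>\<^sup>+y. kernel_envelope \<Lambda> y * surv {} n \<omega> y \<partial>lborel)"
    by (intro nn_integral_mono mult_right_mono resolvent_kernel_le_envelope Lambda_pos x) auto
  finally show "surv {} (Suc CARD('n) + n) \<omega> x \<le> (\<integral>\<^sup>+y. kernel_envelope \<Lambda> y * surv {} n \<omega> y \<partial>lborel)" .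
qed

lemma mean_sup_surv_decay:
  "\<exists>C\<ge>0. \<forall>n. (\<integral>\<^sup>+\<omega>. sup_surv n \<omega> \<partial>cfg) \<le> ennreal (C / real (Suc n) ^ Q)"
proof -
  obtain C where C: "C \<ge> 0" "\<And>n x. mean_surv {} n x \<le> ennreal (C / real (Suc n) ^ Q)"
    using mean_surv_decay by blast
  let ?d = "Suc CARD('n)"
  define K where "K = enn2real (\<integral>\<^sup>+y. kernel_envelope \<Lambda> (y::real^'n) \<partial>lborel)"
  have K: "(\<integral>\<^sup>+y. kernel_envelope \<Lambda> (y::real^'n) \<partial>lborel) = ennreal K" "K \<ge> 0"
    using nn_integral_kernel_envelope[OF Lambda_pos, where 'n='n] by (auto simp: K_def)
  interpret P: pair_sigma_finite lborel cfg ..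
  have 1: "(\<integral>\<^sup>+\<omega>. sup_surv (?d + n) \<omega> \<partial>cfg) \<le> ennreal (K * C / real (Suc n) ^ Q)" for n
  proof -
    have "(\<integral>\<^sup>+\<omega>. sup_surv (?d + n) \<omega> \<partial>cfg) \<le> (\<integral>\<^sup>+\<omega>. \<integral>\<^sup>+y. kernel_envelope \<Lambda> y * surv {} n \<omega> y \<partial>lborel \<partial>cfg)"
      by (intro nn_integral_mono sup_surv_le_envelope)
    also have "\<dots> = (\<integral>\<^sup>+y. \<integral>\<^sup>+\<omega>. kernel_envelope \<Lambda> y * surv {} n \<omega> y \<partial>cfg \<partial>lborel)"
    proof (rule P.Fubini')
      show "(\<lambda>(y, \<omega>). kernel_envelope \<Lambda> y * surv {} n \<omega> y) \<in> borel_measurable (lborel \<Otimes>\<^sub>M cfg)"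
        unfolding case_prod_beta'
        by (intro borel_measurable_times_ennreal surv_measurable' measurable_compose[OF _ kernel_envelope_measurable]) measurable
    qed
    also have "\<dots> = (\<integral>\<^sup>+y. kernel_envelope \<Lambda> y * mean_surv {} n y \<partial>lborel)"
      unfolding mean_surv_def by (intro nn_integral_cong nn_integral_cmult) measurable
    also have "\<dots> \<le> (\<integral>\<^sup>+y. kernel_envelope \<Lambda> (y::real^'n) * ennreal (C / real (Suc n) ^ Q) \<partial>lborel)"
      by (intro nn_integral_mono mult_left_mono C) auto
    also have "\<dots> = ennreal K * ennreal (C / real (Suc n) ^ Q)"
      by (simp add: nn_integral_multc K(1))
    also have "\<dots> = ennreal (K * C / real (Suc n) ^ Q)" using K C by (simp add: ennreal_mult[symmetric])
    finally show ?thesis .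
  qed
  \<comment> \<open>With \<open>n = ?d + m\<close> one has
    \<open>Suc n \<le> Suc ?d * Suc m\<close>, which pays for the lost steps; the summand 1 covers
    \<open>n < ?d\<close>, where the trivial bound 1 is used.\<close>
  define C' where "C' = (K * C + 1) * real (Suc ?d) ^ Q"
  have C': "C' \<ge> 0" using K C by (simp add: C'_def)
  have "(\<integral>\<^sup>+\<omega>. sup_surv n \<omega> \<partial>cfg) \<le> ennreal (C' / real (Suc n) ^ Q)" for n
  proof (cases "n < ?d")
    case True
    have "(\<integral>\<^sup>+\<omega>. sup_surv n \<omega> \<partial>cfg) \<le> (\<integral>\<^sup>+\<omega>. 1 \<partial>cfg)" by (intro nn_integral_mono sup_surv_le_1)
    also have "\<dots> = ennreal 1" using cfg.emeasure_space_1 by simp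
    also have "\<dots> \<le> ennreal (C' / real (Suc n) ^ Q)"
    proof (rule ennreal_leI)
      have "1 * real (Suc n) ^ Q \<le> (K * C + 1) * real (Suc ?d) ^ Q"
        using True K C by (intro mult_mono power_mono of_nat_mono) auto
      then show "1 \<le> C' / real (Suc n) ^ Q" by (simp add: C'_def le_divide_eq del: of_nat_Suc)
    qed
    finally show ?thesis .
  next
    case False
    then obtain m where m: "n = ?d + m" using le_Suc_ex not_less by blast
    have "(\<integral>\<^sup>+\<omega>. sup_surv n \<omega> \<partial>cfg) \<le> ennreal (K * C / real (Suc m) ^ Q)" unfolding m by (rule 1)
    also have "\<dots> \<le> ennreal (C' / real (Suc n) ^ Q)"
    proof (rule ennreal_leI)
      have "Suc n \<le> Suc ?d * Suc m" unfolding m by simp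
      then have "real (Suc n) \<le> real (Suc ?d) * real (Suc m)" by (metis of_nat_le_iff of_nat_mult)
      then have "real (Suc n) ^ Q \<le> real (Suc ?d) ^ Q * real (Suc m) ^ Q"
        by (metis of_nat_0_le_iff power_mono power_mult_distrib)
      then have "K * C * real (Suc n) ^ Q \<le> (K * C + 1) * (real (Suc ?d) ^ Q * real (Suc m) ^ Q)"
        using K C by (intro mult_mono) auto
      then show "K * C / real (Suc m) ^ Q \<le> C' / real (Suc n) ^ Q"
        by (simp add: C'_def field_simps del: of_nat_Suc)
    qed
    finally show ?thesis .
  qed
  then show ?thesis using C' by blast
qed

definition total :: "'n config \<Rightarrow> ennreal" where
  "total \<omega> = (\<Sum>n. sup_surv n \<omega>)"

lemma total_measurable [measurable]: "total \<in> borel_measurable cfg"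
  unfolding total_def[abs_def] by measurable

text \<open>The limit of \<open>sum_power_le\<close>. When the right side is finite the series of
  suprema is summable, because the weights are at least 1.\<close>

lemma total_power_le:
  "total \<omega> ^ Suc m \<le> (\<Sum>n. ennreal (real (Suc m) * real (Suc n) ^ m) * sup_surv n \<omega>)" (is "_ \<le> ?R")
proof (cases "?R = top")
  case False
  define s where "s n = enn2real (sup_surv n \<omega>)" for n
  have s: "0 \<le> s n" "s n \<le> 1" "sup_surv n \<omega> = ennreal (s n)" for n
    using sup_surv_le_1[of n \<omega>] enn2real_mono[OF sup_surv_le_1[of n \<omega>]]
    by (auto simp: s_def intro!: ennreal_enn2real[symmetric] le_less_trans[of "sup_surv n \<omega>" 1])
  let ?r = "\<lambda>n. real (Suc m) * real (Suc n) ^ m * s n"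
  have r: "0 \<le> ?r n" for n using s by simp
  have R: "?R = (\<Sum>n. ennreal (?r n))" by (simp add: s ennreal_mult)
  then have sr: "summable ?r" using False r by (intro summable_suminf_not_top) auto
  have "s n \<le> ?r n" for n
  proof -
    have "1 * 1 \<le> real (Suc m) * real (Suc n) ^ m" by (intro mult_mono) auto
    then show ?thesis using s(1)[of n] mult_right_mono[of 1 "real (Suc m) * real (Suc n) ^ m" "s n"] by simp
  qed
  then have ss: "summable s" using s(1) by (intro summable_comparison_test'[OF sr, of 0]) auto
  have lim: "(\<lambda>N. (\<Sum>n<N. s n) ^ Suc m) \<longlonglongrightarrow> (\<Sum>n. s n) ^ Suc m"
    by (intro tendsto_power summable_LIMSEQ ss)
  moreover have "(\<Sum>n<N. s n) ^ Suc m \<le> (\<Sum>n. ?r n)" for N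
    using sum_power_le[of s N m, OF s(1,2)] sum_le_suminf[OF sr, of "{..<N}"] r by (meson finite_lessThan order_trans)
  ultimately have "(\<Sum>n. s n) ^ Suc m \<le> (\<Sum>n. ?r n)"
    by (intro LIMSEQ_le_const2[OF lim]) blast
  then have "ennreal ((\<Sum>n. s n) ^ Suc m) \<le> ennreal (\<Sum>n. ?r n)" by (rule ennreal_leI)
  moreover have "total \<omega> = ennreal (\<Sum>n. s n)"
    unfolding total_def s(3) by (rule suminf_ennreal2[OF s(1) ss])
  moreover have "?R = ennreal (\<Sum>n. ?r n)" unfolding R by (rule suminf_ennreal2[OF r sr])
  ultimately show ?thesis using s(1) by (simp only: ennreal_power suminf_nonneg[OF ss])
qed (simp only: top_greatest)

lemma total_moment: "(\<integral>\<^sup>+\<omega>. total \<omega> ^ Suc m \<partial>cfg) < \<infinity>"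
proof -
  \<comment> \<open>Decay of order \<open>m + 2\<close> leaves the summable weight
    \<open>1 / real (Suc n) ^ 2\<close> after multiplication by
    \<open>real (Suc n) ^ m\<close>.\<close>
  obtain C where C: "C \<ge> 0" "\<And>n. (\<integral>\<^sup>+\<omega>. sup_surv n \<omega> \<partial>cfg) \<le> ennreal (C / real (Suc n) ^ (m + 2))"
    using mean_sup_surv_decay by blast
  have "(\<integral>\<^sup>+\<omega>. total \<omega> ^ Suc m \<partial>cfg) \<le> (\<integral>\<^sup>+\<omega>. (\<Sum>n. ennreal (real (Suc m) * real (Suc n) ^ m) * sup_surv n \<omega>) \<partial>cfg)"
    by (intro nn_integral_mono total_power_le)
  also have "\<dots> = (\<Sum>n. \<integral>\<^sup>+\<omega>. ennreal (real (Suc m) * real (Suc n) ^ m) * sup_surv n \<omega> \<partial>cfg)"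
    by (intro nn_integral_suminf) measurable
  also have "\<dots> = (\<Sum>n. ennreal (real (Suc m) * real (Suc n) ^ m) * (\<integral>\<^sup>+\<omega>. sup_surv n \<omega> \<partial>cfg))"
    by (intro suminf_cong nn_integral_cmult) measurable
  also have "\<dots> \<le> (\<Sum>n. ennreal (real (Suc m) * C * (1 / real (Suc n) ^ 2)))"
  proof (intro suminf_le allI)
    fix n
    have "ennreal (real (Suc m) * real (Suc n) ^ m) * (\<integral>\<^sup>+\<omega>. sup_surv n \<omega> \<partial>cfg) \<le> ennreal (real (Suc m) * real (Suc n) ^ m) * ennreal (C / real (Suc n) ^ (m + 2))"
      by (intro mult_left_mono C) simp
    also have "\<dots> = ennreal (real (Suc m) * real (Suc n) ^ m * (C / real (Suc n) ^ (m + 2)))"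
      using C by (intro ennreal_mult[symmetric]) auto
    also have "real (Suc m) * real (Suc n) ^ m * (C / real (Suc n) ^ (m + 2)) = real (Suc m) * C * (1 / real (Suc n) ^ 2)"
      by (simp add: power_add power2_eq_square del: of_nat_Suc)
    finally show "ennreal (real (Suc m) * real (Suc n) ^ m) * (\<integral>\<^sup>+\<omega>. sup_surv n \<omega> \<partial>cfg) \<le> ennreal (real (Suc m) * C * (1 / real (Suc n) ^ 2))" .
  qed auto
  also have "\<dots> < \<infinity>"
  proof -
    have "summable (\<lambda>n. 1 / real (Suc n) ^ 2)"
      using inverse_power_summable[of 2, where 'a=real] by (subst summable_Suc_iff) (simp add: inverse_eq_divide)
    then have "summable (\<lambda>n. real (Suc m) * C * (1 / real (Suc n) ^ 2))" by (rule summable_mult)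
    then show ?thesis using C(1) by (subst suminf_ennreal2) auto
  qed
  finally show ?thesis .
qed

end

section \<open>Weak solutions from the resolvent\<close>

lemma cball_borel [measurable]: "cball (a::'a::euclidean_space) r \<in> sets borel"
  by (rule borel_closed) simp

lemma L2_locI:
  fixes f :: "real^'n::finite \<Rightarrow> 'b::euclidean_space"
  assumes [measurable]: "f \<in> borel_measurable borel"
    and fin: "\<And>R. (\<integral>\<^sup>+x. ennreal ((norm (f x))\<^sup>2) * indicator (cball 0 R) x \<partial>lborel) < \<infinity>"
  shows "L2_loc f"
  unfolding L2_loc_def
proof (intro conjI allI impI)
  fix K :: "(real^'n) set" assume K: "compact K"
  then have [measurable]: "K \<in> sets borel" by (rule borel_compact)
  obtain R where R: "K \<subseteq> cball 0 R" using compact_imp_bounded[OF K] by (auto simp: bounded_iff subset_iff)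
  show "set_integrable lborel K (\<lambda>x. (norm (f x))\<^sup>2)"
    unfolding set_integrable_def
  proof (rule integrableI_bounded)
    have "(\<integral>\<^sup>+x. ennreal (norm (indicator K x *\<^sub>R (norm (f x))\<^sup>2)) \<partial>lborel) \<le> (\<integral>\<^sup>+x. ennreal ((norm (f x))\<^sup>2) * indicator (cball 0 R) x \<partial>lborel)"
      using R by (intro nn_integral_mono) (auto simp: indicator_def)
    also have "\<dots> < \<infinity>" by (rule fin)
    finally show "(\<integral>\<^sup>+x. ennreal (norm (indicator K x *\<^sub>R (norm (f x))\<^sup>2)) \<partial>lborel) < \<infinity>" .
  qed measurable
qed simp

lemma L2_loc_integrable:
  fixes f :: "real^'n::finite \<Rightarrow> real"
  assumes "L2_loc f" shows "integrable lborel (\<lambda>x. f x * indicator (cball 0 R) x)"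
proof -
  have [measurable]: "f \<in> borel_measurable borel" using assms by (simp add: L2_loc_def)
  have i: "integrable lborel (\<lambda>x. indicator (cball 0 R) x *\<^sub>R (norm (f x))\<^sup>2)"
    using assms unfolding L2_loc_def set_integrable_def by (meson compact_cball)
  have j: "integrable lborel (\<lambda>x::real^'n. indicator (cball 0 R) x :: real)"
    by (intro integrable_real_indicator) (auto intro: emeasure_bounded_finite[unfolded infinity_ennreal_def])
  have "norm (f x * indicator (cball 0 R) x) \<le> norm (indicator (cball 0 R) x *\<^sub>R (norm (f x))\<^sup>2 + indicator (cball 0 R) x)" for x
  proof -
    have "\<bar>f x\<bar> \<le> (f x)\<^sup>2 + 1"
    proof (cases "\<bar>f x\<bar> \<le> 1")
      case False
      then have "\<bar>f x\<bar> * 1 \<le> \<bar>f x\<bar> * \<bar>f x\<bar>" by (intro mult_left_mono) auto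
      then show ?thesis by (simp add: power2_eq_square)
    qed (use zero_le_power2[of "f x"] in linarith)
    then show ?thesis by (auto simp: indicator_def)
  qed
  moreover have m1: "f \<in> borel_measurable lborel" by simp
  moreover have m2: "(indicator (cball 0 R) :: real^'n \<Rightarrow> real) \<in> borel_measurable lborel"
    by (simp only: measurable_lborel2 borel_measurable_indicator[OF cball_borel])
  ultimately show ?thesis
    by (intro Bochner_Integration.integrable_bound[OF Bochner_Integration.integrable_add[OF i j]] AE_I2
        borel_measurable_times m1 m2)
qed

lemma locally_integrable_test:
  fixes f :: "real^'n::finite \<Rightarrow> real"
  assumes f: "\<And>R. integrable lborel (\<lambda>x. f x * indicator (cball 0 R) x)" "f \<in> borel_measurable borel"
    and \<psi>: "\<psi> \<in> Cc_infty UNIV"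
  shows "integrable lborel (\<lambda>x. f x * \<psi> x)"
proof -
  obtain C R where C: "C > 0" "\<And>x. \<bar>\<psi> x\<bar> \<le> C * indicator (cball 0 R) x"
    using Cc_infty_bounded[OF \<psi>] by metis
  have "norm (f x * \<psi> x) \<le> norm (C * (f x * indicator (cball 0 R) x))" for x
    using mult_left_mono[OF C(2)[of x], of "\<bar>f x\<bar>"] C(1) by (auto simp: abs_mult mult_ac)
  then show ?thesis
    using f(2) Cc_infty_measurable[OF \<psi>]
    by (intro Bochner_Integration.integrable_bound[OF integrable_mult_right[OF f(1)[of R], of C]]) auto
qed

lemma L2_loc_test:
  fixes f :: "real^'n::finite \<Rightarrow> real"
  assumes "L2_loc f" "\<psi> \<in> Cc_infty UNIV" shows "integrable lborel (\<lambda>x. f x * \<psi> x)"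
  by (rule locally_integrable_test[OF L2_loc_integrable[OF assms(1)] _ assms(2)]) (use assms(1) in \<open>simp add: L2_loc_def\<close>)

lemma L2_loc_component:
  fixes g :: "real^'n::finite \<Rightarrow> real^'m::finite"
  assumes "L2_loc g" shows "L2_loc (\<lambda>x. g x $ i)"
  unfolding L2_loc_def
proof (intro conjI allI impI)
  have [measurable]: "g \<in> borel_measurable borel" using assms by (simp add: L2_loc_def)
  show "(\<lambda>x. g x $ i) \<in> borel_measurable lborel" by simp
  fix K :: "(real^'n) set" assume K: "compact K"
  then have [measurable]: "K \<in> sets borel" by (rule borel_compact)
  have i: "integrable lborel (\<lambda>x. indicator K x *\<^sub>R (norm (g x))\<^sup>2)"
    using assms K by (simp add: L2_loc_def set_integrable_def)
  have "(g x $ i)\<^sup>2 \<le> (norm (g x))\<^sup>2" for x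
    using component_le_norm_cart[of "g x" i] by (metis abs_ge_zero power2_abs power_mono)
  then show "set_integrable lborel K (\<lambda>x. (norm (g x $ i))\<^sup>2)"
    unfolding set_integrable_def
    by (intro Bochner_Integration.integrable_bound[OF i] AE_I2) (auto simp: indicator_def)
qed

lemma L2_loc_vec:
  fixes g :: "real^'n::finite \<Rightarrow> real^'m::finite"
  assumes "\<And>i. L2_loc (\<lambda>x. g x $ i)" shows "L2_loc g"
  unfolding L2_loc_def
proof (intro conjI allI impI)
  have m: "(\<lambda>x. g x $ i) \<in> borel_measurable borel" for i using assms by (simp add: L2_loc_def)
  have "(\<lambda>x. \<Sum>i\<in>UNIV. g x $ i *\<^sub>R axis i (1::real)) \<in> borel_measurable borel"
    using m by (intro borel_measurable_sum borel_measurable_scaleR) auto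
  then show "g \<in> borel_measurable lborel"
    using basis_expansion[of "g _"] by (simp add: scalar_mult_eq_scaleR)
  fix K :: "(real^'n) set" assume K: "compact K"
  have "(norm (g x))\<^sup>2 = (\<Sum>i\<in>UNIV. (norm (g x $ i))\<^sup>2)" for x
    by (simp add: norm_vec_def L2_set_def sum_nonneg)
  then show "set_integrable lborel K (\<lambda>x. (norm (g x))\<^sup>2)"
    unfolding set_integrable_def scaleR_sum_right
    using assms K by (auto simp only: L2_loc_def set_integrable_def scaleR_sum_right intro!: Bochner_Integration.integrable_sum)
qed

section \<open>Duality of the step average and weak solutions\<close>

context
  fixes l :: real assumes l: "0 < l"
begin

lemma distr_step_reflect:
  "distr (step l k) (borel \<Otimes>\<^sub>M borel) (\<lambda>z. (fst z, - snd z :: real^'n::finite)) = step l k"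
proof (rule measure_eqI)
  fix A assume "A \<in> sets (distr (step l k) (borel \<Otimes>\<^sub>M borel) (\<lambda>z. (fst z, - snd z :: real^'n)))"
  then have [measurable]: "A \<in> sets (borel \<Otimes>\<^sub>M borel)" by simp
  have "emeasure (distr (step l k) (borel \<Otimes>\<^sub>M borel) (\<lambda>z. (fst z, - snd z))) A = (\<integral>\<^sup>+z. indicator A (fst z, - snd z) \<partial>step l k)"
  proof -
    have "emeasure (distr (step l k) (borel \<Otimes>\<^sub>M borel) (\<lambda>z. (fst z, - snd z))) A
        = (\<integral>\<^sup>+z. indicator A z \<partial>(distr (step l k) (borel \<Otimes>\<^sub>M borel) (\<lambda>z. (fst z, - snd z :: real^'n))))"
      by simp
    also have "\<dots> = (\<integral>\<^sup>+z. indicator A (fst z, - snd z) \<partial>step l k)"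
      by (subst nn_integral_distr) auto
    finally show ?thesis .
  qed
  also have "\<dots> = (\<integral>\<^sup>+t. ennreal (erlang_density k l t) * (\<integral>\<^sup>+y. ennreal (heat t y) * indicator A (t, - y) \<partial>lborel) \<partial>lborel)"
    by (subst nn_integral_step) auto
  also have "\<dots> = (\<integral>\<^sup>+t. ennreal (erlang_density k l t) * (\<integral>\<^sup>+y. ennreal (heat t y) * indicator A (t, y) \<partial>lborel) \<partial>lborel)"
    using nn_integral_reflect[where a=0 and f="\<lambda>y. ennreal (heat _ y) * indicator A (_, y)"] by simp
  also have "\<dots> = (\<integral>\<^sup>+z. indicator A z \<partial>step l k)"
    by (subst nn_integral_step) auto
  also have "\<dots> = emeasure (step l k) A" by simp
  finally show "emeasure (distr (step l k) (borel \<Otimes>\<^sub>M borel) (\<lambda>z. (fst z, - snd z))) A = emeasure (step l k) A" .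
qed simp

lemma integral_step_reflect:
  fixes f :: "real \<times> (real^'n::finite) \<Rightarrow> real"
  assumes [measurable]: "f \<in> borel_measurable (borel \<Otimes>\<^sub>M borel)"
  shows "(LINT z|step l k. f (fst z, - snd z)) = (LINT z|step l k. f z)"
proof -
  have "(LINT z|step l k. f z) = (LINT z|(distr (step l k) (borel \<Otimes>\<^sub>M borel) (\<lambda>z. (fst z, - snd z))). f z)"
    unfolding distr_step_reflect ..
  also have "\<dots> = (LINT z|step l k. f (fst z, - snd z))"
    by (rule integral_distr) auto
  finally show ?thesis ..
qed

text \<open>Fubini and the translation \<open>x\<close> to \<open>x - snd z\<close> move the average
  from \<open>F\<close> to \<open>\<psi>\<close>. The weight \<open>c\<close> is general so that the
  plain average and the gradient average are both covered.\<close>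

lemma integral_step_duality:
  fixes F \<psi> :: "real^'n::finite \<Rightarrow> real" and c :: "real \<times> (real^'n) \<Rightarrow> real"
  assumes [measurable]: "F \<in> borel_measurable borel" "\<psi> \<in> borel_measurable borel" "c \<in> borel_measurable (borel \<Otimes>\<^sub>M borel)"
    and fin: "(\<integral>\<^sup>+x. ennreal \<bar>\<psi> x\<bar> * (\<integral>\<^sup>+z. ennreal (\<bar>c z\<bar> * \<bar>F (x + snd z)\<bar>) \<partial>step l k) \<partial>lborel) < \<infinity>"
  shows "(LINT x|lborel. \<psi> x * (LINT z|step l k. c z * F (x + snd z))) = (LINT x|lborel. F x * (LINT z|step l k. c z * \<psi> (x - snd z)))"
    and "integrable lborel (\<lambda>x. F x * (LINT z|step l k. c z * \<psi> (x - snd z)))"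
    and "integrable lborel (\<lambda>x. \<psi> x * (LINT z|step l k. c z * F (x + snd z)))"
proof -
  interpret S: prob_space "step l k :: (real \<times> (real^'n)) measure" by (rule prob_space_step[OF l])
  interpret P: pair_sigma_finite lborel "step l k :: (real \<times> (real^'n)) measure" ..
  let ?f = "\<lambda>x z. \<psi> x * (c z * F (x + snd z))" and ?g = "\<lambda>x z. F x * (c z * \<psi> (x - snd z))"
  let ?M = "lborel \<Otimes>\<^sub>M (step l k :: (real \<times> (real^'n)) measure)"
  have mf: "case_prod ?f \<in> borel_measurable ?M" "case_prod ?g \<in> borel_measurable ?M"
    unfolding case_prod_beta' by measurable
  have "(\<integral>\<^sup>+p. ennreal (norm (case_prod ?f p)) \<partial>?M) = (\<integral>\<^sup>+x. \<integral>\<^sup>+z. ennreal (norm (?f x z)) \<partial>step l k \<partial>lborel)"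
    using mf by (subst S.nn_integral_fst[symmetric]) auto
  also have "\<dots> = (\<integral>\<^sup>+x. ennreal \<bar>\<psi> x\<bar> * (\<integral>\<^sup>+z. ennreal (\<bar>c z\<bar> * \<bar>F (x + snd z)\<bar>) \<partial>step l k) \<partial>lborel)"
    by (subst nn_integral_cmult[symmetric]) (auto simp: abs_mult ennreal_mult)
  finally have nf: "(\<integral>\<^sup>+p. ennreal (norm (case_prod ?f p)) \<partial>?M) < \<infinity>" using fin by simp
  then have f: "integrable ?M (case_prod ?f)" using mf by (intro integrableI_bounded)
  have tr: "(\<integral>\<^sup>+x. ennreal (norm (?f x z)) \<partial>lborel) = (\<integral>\<^sup>+x. ennreal (norm (?g x z)) \<partial>lborel)" for z
  proof -
    have "(\<integral>\<^sup>+x. ennreal (norm (?g x z)) \<partial>lborel) = (\<integral>\<^sup>+x. ennreal (norm (?g (snd z + x) z)) \<partial>lborel)"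
      by (rule nn_integral_translate[symmetric]) measurable
    then show ?thesis by (simp add: add.commute mult_ac)
  qed
  have tr2: "(LINT x|lborel. ?f x z) = (LINT x|lborel. ?g x z)" for z
  proof -
    have "(LINT x|lborel. ?g x z) = (LINT x|lborel. ?g (snd z + x) z)"
      by (rule integral_translate[symmetric])
    then show ?thesis by (simp add: add.commute mult_ac)
  qed
  have "(\<integral>\<^sup>+p. ennreal (norm (case_prod ?g p)) \<partial>?M) = (\<integral>\<^sup>+z. \<integral>\<^sup>+x. ennreal (norm (?g x z)) \<partial>lborel \<partial>step l k)"
    using mf by (subst P.nn_integral_snd[symmetric]) auto
  also have "\<dots> = (\<integral>\<^sup>+p. ennreal (norm (case_prod ?f p)) \<partial>?M)"
    using mf unfolding tr[symmetric] by (subst P.nn_integral_snd[symmetric]) auto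
  finally have g: "integrable ?M (case_prod ?g)" using mf nf by (intro integrableI_bounded) auto
  have "(LINT x|lborel. \<psi> x * (LINT z|step l k. c z * F (x + snd z))) = (LINT x|lborel. LINT z|step l k. ?f x z)"
    by simp
  also have "\<dots> = (LINT z|step l k. LINT x|lborel. ?f x z)"
    by (rule P.Fubini_integral[symmetric, OF f])
  also have "\<dots> = (LINT z|step l k. LINT x|lborel. ?g x z)" by (simp only: tr2)
  also have "\<dots> = (LINT x|lborel. LINT z|step l k. ?g x z)"
    by (rule P.Fubini_integral[OF g])
  finally show "(LINT x|lborel. \<psi> x * (LINT z|step l k. c z * F (x + snd z))) = (LINT x|lborel. F x * (LINT z|step l k. c z * \<psi> (x - snd z)))"
    by simp
  show "integrable lborel (\<lambda>x. F x * (LINT z|step l k. c z * \<psi> (x - snd z)))"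
    using P.integrable_fst[OF g] by simp
  show "integrable lborel (\<lambda>x. \<psi> x * (LINT z|step l k. c z * F (x + snd z)))"
    using P.integrable_fst[OF f] by simp
qed

lemma nn_integral_test_finite:
  fixes G :: "real^'n::finite \<Rightarrow> ennreal"
  assumes \<psi>: "\<psi> \<in> Cc_infty UNIV" and [measurable]: "G \<in> borel_measurable borel"
    and G: "\<And>R. (\<integral>\<^sup>+x. G x * indicator (cball 0 R) x \<partial>lborel) < \<infinity>"
  shows "(\<integral>\<^sup>+x. ennreal \<bar>\<psi> x\<bar> * G x \<partial>lborel) < \<infinity>"
proof -
  obtain C R where C: "C > 0" "\<And>x. \<bar>\<psi> x\<bar> \<le> C * indicator (cball 0 R) x"
    using Cc_infty_bounded[OF \<psi>] by metis
  have "(\<integral>\<^sup>+x. ennreal \<bar>\<psi> x\<bar> * G x \<partial>lborel) \<le> (\<integral>\<^sup>+x. ennreal C * (G x * indicator (cball 0 R) x) \<partial>lborel)"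
  proof (rule nn_integral_mono)
    fix x :: "real^'n"
    have "ennreal \<bar>\<psi> x\<bar> \<le> ennreal (C * indicator (cball 0 R) x)" by (rule ennreal_leI[OF C(2)])
    also have "\<dots> = ennreal C * indicator (cball 0 R) x" by (auto simp: indicator_def)
    finally have "ennreal \<bar>\<psi> x\<bar> * G x \<le> ennreal C * indicator (cball 0 R) x * G x"
      by (rule mult_right_mono) simp
    then show "ennreal \<bar>\<psi> x\<bar> * G x \<le> ennreal C * (G x * indicator (cball 0 R) x)"
      by (simp only: mult_ac)
  qed
  also have "\<dots> = ennreal C * (\<integral>\<^sup>+x. G x * indicator (cball 0 R) x \<partial>lborel)"
    by (rule nn_integral_cmult) measurable
  also have "\<dots> < \<infinity>" using G by (simp add: ennreal_mult_less_top)
  finally show ?thesis .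
qed

text \<open>The gradient of \<open>u = P F\<close> is the average of \<open>F\<close> with
  \<open>gradient_weight\<close>, the derivative having fallen on the kernel. Duality moves the
  averages to the test function, where Gaussian integration by parts identifies the weak gradient
  and \<open>integral_step_resolvent\<close> gives the equation
  \<open>(l - \<Delta>) u = l F\<close>.\<close>

lemma resolvent_weak_solution:
  fixes u F :: "real^'n::finite \<Rightarrow> real"
  assumes [measurable]: "u \<in> borel_measurable borel" "F \<in> borel_measurable borel"
    and u: "\<And>x. 0 \<le> u x" and F: "\<And>x. 0 \<le> F x"
    and eq: "\<And>x. ennreal (u x) = (\<integral>\<^sup>+z. ennreal (F (x + snd z)) \<partial>step l 0)"
    and u2: "\<And>R. (\<integral>\<^sup>+x. ennreal ((u x)\<^sup>2) * indicator (cball 0 R) x \<partial>lborel) < \<infinity>"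
    and F1: "\<And>R. integrable lborel (\<lambda>x. F x * indicator (cball 0 R) x)"
    and g2: "\<And>R i. (\<integral>\<^sup>+x. (\<integral>\<^sup>+z. ennreal (\<bar>gradient_weight i z\<bar> * F (x + snd z)) \<partial>step l 0)\<^sup>2 * indicator (cball 0 R) x \<partial>lborel) < \<infinity>"
  shows "\<exists>g. L2_loc g \<and> weak_gradient u g \<and>
    (\<forall>\<psi>\<in>Cc_infty UNIV. (LINT x|lborel. g x \<bullet> gradient \<psi> x) + (LINT x|lborel. (l * u x - l * F x) * \<psi> x) = 0)"
    and "L2_loc u"
proof -
  interpret S: prob_space "step l 0 :: (real \<times> (real^'n)) measure" by (rule prob_space_step[OF l])
  define g where "g x = (\<chi> i. LINT z|step l 0. gradient_weight i z * F (x + snd z))" for x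
  define G where "G i x = (\<integral>\<^sup>+z. ennreal (\<bar>gradient_weight i z\<bar> * F (x + snd z)) \<partial>step l 0)" for i x
  have [measurable]: "G i \<in> borel_measurable borel" for i unfolding G_def[abs_def] by measurable
  have gm: "(\<lambda>x. g x $ i) \<in> borel_measurable borel" for i unfolding g_def by simp
  have gG: "ennreal \<bar>g x $ i\<bar> \<le> G i x" for x i
  proof (cases "integrable (step l 0) (\<lambda>z. gradient_weight i z * F (x + snd z))")
    case True
    then have "ennreal (norm (g x $ i)) \<le> (\<integral>\<^sup>+z. ennreal (norm (gradient_weight i z * F (x + snd z))) \<partial>step l 0)"
      using integral_norm_bound_ennreal[OF True] by (simp add: g_def)
    then show ?thesis using F by (simp add: G_def abs_mult)
  next
    \<comment> \<open>Where the average diverges, the Bochner integral is 0 by default and the bound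
      still holds.\<close>
    case False
    then show ?thesis by (simp add: g_def not_integrable_integral_eq)
  qed
  show L2u: "L2_loc u" using u2 by (intro L2_locI) auto
  have L2g: "L2_loc (\<lambda>x. g x $ i)" for i
  proof (rule L2_locI[OF gm])
    fix R
    have "(\<integral>\<^sup>+x. ennreal ((norm (g x $ i))\<^sup>2) * indicator (cball 0 R) x \<partial>lborel) \<le> (\<integral>\<^sup>+x. (G i x)\<^sup>2 * indicator (cball 0 R) x \<partial>lborel)"
    proof (intro nn_integral_mono mult_right_mono)
      fix x
      have "ennreal ((norm (g x $ i))\<^sup>2) = (ennreal \<bar>g x $ i\<bar>)\<^sup>2" by (simp add: ennreal_power)
      also have "\<dots> \<le> (G i x)\<^sup>2" by (intro power_mono gG) auto
      finally show "ennreal ((norm (g x $ i))\<^sup>2) \<le> (G i x)\<^sup>2" .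
    qed auto
    also have "\<dots> < \<infinity>" unfolding G_def by (rule g2)
    finally show "(\<integral>\<^sup>+x. ennreal ((norm (g x $ i))\<^sup>2) * indicator (cball 0 R) x \<partial>lborel) < \<infinity>" .
  qed
  have G1: "(\<integral>\<^sup>+x. G i x * indicator (cball 0 R) x \<partial>lborel) < \<infinity>" for i R
  proof -
    have "(\<integral>\<^sup>+x. G i x * indicator (cball 0 R) x \<partial>lborel) \<le> (\<integral>\<^sup>+x. (G i x)\<^sup>2 * indicator (cball 0 R) x + indicator (cball 0 R) x \<partial>lborel)"
    proof (rule nn_integral_mono)
      fix x
      have "G i x \<le> (G i x)\<^sup>2 + 1"
      proof (cases "G i x \<le> 1")
        case True then show ?thesis by (simp add: add_increasing)
      next
        case False
        then have "G i x * 1 \<le> G i x * G i x" by (intro mult_left_mono) auto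
        then show ?thesis by (simp add: power2_eq_square add_increasing2)
      qed
      then show "G i x * indicator (cball 0 R) x \<le> (G i x)\<^sup>2 * indicator (cball 0 R) x + indicator (cball 0 R) x"
        by (auto simp: indicator_def)
    qed
    also have "\<dots> = (\<integral>\<^sup>+x. (G i x)\<^sup>2 * indicator (cball 0 R) x \<partial>lborel) + emeasure lborel (cball (0::real^'n) R)"
    proof -
      have m: "(indicator (cball 0 R) :: real^'n \<Rightarrow> ennreal) \<in> borel_measurable lborel"
        by (simp only: measurable_lborel2 borel_measurable_indicator[OF cball_borel])
      show ?thesis
        by (subst nn_integral_add[OF borel_measurable_times_ennreal[OF _ m] m]) simp_all
    qed
    also have "\<dots> < \<infinity>"
      using g2[of i R] emeasure_bounded_finite[OF bounded_cball, of "0::real^'n" R] by (simp add: G_def)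
    finally show ?thesis .
  qed
  have u1: "(\<integral>\<^sup>+x. ennreal (u x) * indicator (cball 0 R) x \<partial>lborel) < \<infinity>" for R
  proof -
    have "(\<integral>\<^sup>+x. ennreal (u x) * indicator (cball 0 R) x \<partial>lborel) = (\<integral>\<^sup>+x. ennreal (norm (u x * indicator (cball 0 R) x)) \<partial>lborel)"
      using u by (intro nn_integral_cong) (auto simp: indicator_def)
    then show ?thesis using L2_loc_integrable[OF L2u, of R] by (simp add: integrable_iff_bounded)
  qed
  have intu: "u x = (LINT z|step l 0. 1 * F (x + snd z))" for x
    using eq[of x] F u by (subst integral_eq_nn_integral) (auto simp flip: eq)
  have dual_u: "(LINT x|lborel. \<psi> x * u x) = (LINT x|lborel. F x * (LINT z|step l 0. \<psi> (x + snd z)))" if \<psi>: "\<psi> \<in> Cc_infty UNIV" for \<psi>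
  proof -
    have [measurable]: "\<psi> \<in> borel_measurable borel" by (rule Cc_infty_measurable[OF \<psi>])
    have "(LINT x|lborel. \<psi> x * (LINT z|step l 0. 1 * F (x + snd z))) = (LINT x|lborel. F x * (LINT z|step l 0. 1 * \<psi> (x - snd z)))"
      using nn_integral_test_finite[OF \<psi>, of "\<lambda>x. ennreal (u x)"] u1 F
      by (intro integral_step_duality(1)) (auto simp: eq)
    moreover have "(LINT z|step l 0. \<psi> (x - snd z)) = (LINT z|step l 0. \<psi> (x + snd z))" for x
      using integral_step_reflect[of "\<lambda>z. \<psi> (x + snd z)" 0] by simp
    ultimately show ?thesis by (simp add: intu)
  qed
  have dual_g: "(LINT x|lborel. \<psi> x * g x $ i) = - (LINT x|lborel. F x * (LINT z|step l 0. partial_deriv i \<psi> (x + snd z)))" if \<psi>: "\<psi> \<in> Cc_infty UNIV" for \<psi> i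
  proof -
    have [measurable]: "\<psi> \<in> borel_measurable borel" by (rule Cc_infty_measurable[OF \<psi>])
    have "(LINT x|lborel. \<psi> x * (LINT z|step l 0. gradient_weight i z * F (x + snd z))) = (LINT x|lborel. F x * (LINT z|step l 0. gradient_weight i z * \<psi> (x - snd z)))"
      using nn_integral_test_finite[OF \<psi>, of "G i"] G1 F
      by (intro integral_step_duality(1)) (auto simp: G_def[symmetric])
    moreover have "(LINT z|step l 0. gradient_weight i z * \<psi> (x - snd z)) = - (LINT z|step l 0. partial_deriv i \<psi> (x + snd z))" for x
    proof -
      \<comment> \<open>The weight is odd in the displacement, so the reflection produced by duality
        yields the minus sign in the definition of the weak gradient.\<close>
      have w: "gradient_weight i (fst z, - snd z) = - gradient_weight i z" for z :: "real \<times> (real^'n)"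
        by (simp add: gradient_weight_def)
      have "(LINT z|step l 0. gradient_weight i (fst z, - snd z) * \<psi> (x + snd (fst z, - snd z))) = (LINT z|step l 0. gradient_weight i z * \<psi> (x + snd z))"
        by (rule integral_step_reflect[of "\<lambda>z. gradient_weight i z * \<psi> (x + snd z)" 0]) measurable
      then show ?thesis
        unfolding w integral_step_gradient_weight[OF l \<psi>] by simp
    qed
    ultimately show ?thesis by (simp add: g_def)
  qed
  have wg: "weak_gradient u g"
    unfolding weak_gradient_def
  proof (intro ballI allI)
    fix \<psi> :: "real^'n \<Rightarrow> real" and i assume \<psi>: "\<psi> \<in> Cc_infty UNIV"
    show "(LINT x|lborel. u x * partial_deriv i \<psi> x) = - (LINT x|lborel. g x $ i * \<psi> x)"
      using dual_u[OF Cc_infty_partial_deriv[OF \<psi>, of i]] dual_g[OF \<psi>, of i] by (simp add: mult.commute)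
  qed
  show "\<exists>g. L2_loc g \<and> weak_gradient u g \<and>
    (\<forall>\<psi>\<in>Cc_infty UNIV. (LINT x|lborel. g x \<bullet> gradient \<psi> x) + (LINT x|lborel. (l * u x - l * F x) * \<psi> x) = 0)"
  proof (intro exI[of _ g] conjI ballI)
    show "L2_loc g" by (rule L2_loc_vec[OF L2g])
    show "weak_gradient u g" by (rule wg)
    fix \<psi> :: "real^'n \<Rightarrow> real" assume \<psi>: "\<psi> \<in> Cc_infty UNIV"
    note d\<psi> = Cc_infty_partial_deriv[OF \<psi>]
    have "(LINT x|lborel. g x \<bullet> gradient \<psi> x) = (LINT x|lborel. (\<Sum>i\<in>UNIV. g x $ i * partial_deriv i \<psi> x))"
      by (simp add: inner_vec_def gradient_def)
    also have "\<dots> = (\<Sum>i\<in>UNIV. (LINT x|lborel. g x $ i * partial_deriv i \<psi> x))"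
      by (intro Bochner_Integration.integral_sum L2_loc_test L2g d\<psi>)
    also have "\<dots> = (\<Sum>i\<in>UNIV. - (LINT x|lborel. u x * partial_deriv i (partial_deriv i \<psi>) x))"
      using wg d\<psi> unfolding weak_gradient_def by simp
    also have "\<dots> = - (LINT x|lborel. (\<Sum>i\<in>UNIV. u x * partial_deriv i (partial_deriv i \<psi>) x))"
      by (subst Bochner_Integration.integral_sum) (auto simp: sum_negf intro!: L2_loc_test L2u Cc_infty_partial_deriv d\<psi>)
    also have "\<dots> = - (LINT x|lborel. u x * laplacian \<psi> x)" by (simp add: laplacian_def sum_distrib_left)
    finally have gr: "(LINT x|lborel. g x \<bullet> gradient \<psi> x) = - (LINT x|lborel. u x * laplacian \<psi> x)" .
    \<comment> \<open>Pairing \<open>u\<close> with \<open>l \<psi> - \<Delta> \<psi>\<close> and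
      moving the average over leaves \<open>F\<close> paired with \<open>l \<psi>\<close>.\<close>
    let ?\<eta> = "\<lambda>x. l * \<psi> x + (- 1) * laplacian \<psi> x"
    have \<eta>: "?\<eta> \<in> Cc_infty UNIV" by (intro Cc_infty_add Cc_infty_cmult \<psi> Cc_infty_laplacian)
    have i1: "integrable lborel (\<lambda>x. u x * \<psi> x)" "integrable lborel (\<lambda>x. u x * laplacian \<psi> x)"
      by (rule L2_loc_test[OF L2u \<psi>], rule L2_loc_test[OF L2u Cc_infty_laplacian[OF \<psi>]])
    have i2: "integrable lborel (\<lambda>x. F x * \<psi> x)" by (rule locally_integrable_test[OF F1 _ \<psi>]) simp
    have "l * (LINT x|lborel. u x * \<psi> x) - (LINT x|lborel. u x * laplacian \<psi> x) = (LINT x|lborel. l * (u x * \<psi> x) - u x * laplacian \<psi> x)"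
      using i1 by (subst Bochner_Integration.integral_diff) auto
    also have "\<dots> = (LINT x|lborel. ?\<eta> x * u x)" by (rule Bochner_Integration.integral_cong) (auto simp: algebra_simps)
    also have "\<dots> = (LINT x|lborel. F x * (LINT z|step l 0. ?\<eta> (x + snd z)))" by (rule dual_u[OF \<eta>])
    also have "\<dots> = (LINT x|lborel. F x * (l * \<psi> x))"
      using integral_step_resolvent[OF l \<psi>] by simp
    finally have "l * (LINT x|lborel. u x * \<psi> x) - (LINT x|lborel. u x * laplacian \<psi> x) = l * (LINT x|lborel. F x * \<psi> x)"
      by (simp add: mult.left_commute)
    moreover have "(LINT x|lborel. (l * u x - l * F x) * \<psi> x) = l * (LINT x|lborel. u x * \<psi> x) - l * (LINT x|lborel. F x * \<psi> x)"
    proof -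
      have "(LINT x|lborel. (l * u x - l * F x) * \<psi> x) = (LINT x|lborel. l * (u x * \<psi> x) - l * (F x * \<psi> x))"
        by (rule Bochner_Integration.integral_cong) (auto simp: algebra_simps)
      then show ?thesis using i1 i2 by (simp add: Bochner_Integration.integral_diff)
    qed
    ultimately show "(LINT x|lborel. g x \<bullet> gradient \<psi> x) + (LINT x|lborel. (l * u x - l * F x) * \<psi> x) = 0"
      unfolding gr by simp
  qed
qed

end

section \<open>Existence\<close>

lemma sqrt_gradient_weight_measurable:
  "(\<lambda>z. sqrt \<bar>gradient_weight i z\<bar>) \<in> borel_measurable (borel \<Otimes>\<^sub>M borel)"
  by measurable

context landscape
begin

lemma step_average_measurable:
  fixes f :: "real^'n \<Rightarrow> 'n config \<Rightarrow> ennreal"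
  assumes f: "(\<lambda>(x, \<omega>). f x \<omega>) \<in> borel_measurable (borel \<Otimes>\<^sub>M cfg)" and c: "c \<in> borel_measurable (borel \<Otimes>\<^sub>M borel)"
  shows "(\<lambda>(x, \<omega>). \<integral>\<^sup>+z. c z * f (x + snd z) \<omega> \<partial>step \<Lambda> k) \<in> borel_measurable (borel \<Otimes>\<^sub>M cfg)"
proof -
  let ?M = "(borel \<Otimes>\<^sub>M cfg) \<Otimes>\<^sub>M step \<Lambda> k"
  have m: "(\<lambda>p. (fst (fst p) + snd (snd p), snd (fst p))) \<in> ?M \<rightarrow>\<^sub>M borel \<Otimes>\<^sub>M cfg"
    by measurable
  have m2: "(\<lambda>p. f (fst (fst p) + snd (snd p)) (snd (fst p))) \<in> borel_measurable ?M"
    using measurable_compose[OF m f] by (simp only: prod.case)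
  have m3: "(\<lambda>p. c (snd p)) \<in> borel_measurable ?M"
    by (rule measurable_compose[OF _ c]) measurable
  show ?thesis
    unfolding case_prod_beta'
    by (rule walk.borel_measurable_nn_integral)
       (use borel_measurable_times_ennreal[OF m3 m2] in \<open>simp only: case_prod_beta'\<close>)
qed

lemma section_measurable:
  assumes f: "(\<lambda>(x, \<omega>). f x \<omega>) \<in> borel_measurable (borel \<Otimes>\<^sub>M cfg)"
  shows "\<omega> \<in> space cfg \<Longrightarrow> (\<lambda>x. f x \<omega>) \<in> borel_measurable borel" "(\<lambda>\<omega>. f x \<omega>) \<in> borel_measurable cfg"
proof -
  show "(\<lambda>x. f x \<omega>) \<in> borel_measurable borel" if "\<omega> \<in> space cfg"
    using measurable_compose[OF measurable_Pair[OF measurable_ident_sets[OF refl] measurable_const[OF that]] f]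
    by (simp only: prod.case)
  show "(\<lambda>\<omega>. f x \<omega>) \<in> borel_measurable cfg"
    using measurable_compose[OF measurable_Pair1' f, of x] by simp
qed

text \<open>A mean bound uniform in \<open>x\<close> integrates to a finite mean over every ball.
  Integer radii give one common null set, and monotonicity in the radius covers the others.\<close>

lemma AE_local_integral:
  fixes f :: "real^'n \<Rightarrow> 'n config \<Rightarrow> ennreal"
  assumes f: "(\<lambda>(x, \<omega>). f x \<omega>) \<in> borel_measurable (borel \<Otimes>\<^sub>M cfg)" and B: "\<And>x. (\<integral>\<^sup>+\<omega>. f x \<omega> \<partial>cfg) \<le> ennreal B"
  shows "A \<in> sets borel \<Longrightarrow> (\<integral>\<^sup>+\<omega>. \<integral>\<^sup>+x. f x \<omega> * indicator A x \<partial>lborel \<partial>cfg) \<le> ennreal B * emeasure lborel A"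
    and "AE \<omega> in cfg. \<forall>R. (\<integral>\<^sup>+x. f x \<omega> * indicator (cball 0 R) x \<partial>lborel) < \<infinity>"
proof -
  interpret P: pair_sigma_finite lborel cfg ..
  have f': "(\<lambda>p. f (fst p) (snd p)) \<in> borel_measurable (lborel \<Otimes>\<^sub>M cfg)"
    using f by (simp add: case_prod_beta' cong: measurable_cong_sets sets_pair_measure_cong)
  have fA: "(\<lambda>(x, \<omega>). f x \<omega> * indicator A x) \<in> borel_measurable (lborel \<Otimes>\<^sub>M cfg)" if "A \<in> sets borel" for A
  proof -
    have "(\<lambda>p. indicator A (fst p) :: ennreal) \<in> borel_measurable (lborel \<Otimes>\<^sub>M cfg)"
      by (rule measurable_compose[OF measurable_fst]) (use that in simp)
    from borel_measurable_times_ennreal[OF f' this] show ?thesis by (simp only: case_prod_beta')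
  qed
  have le: "(\<integral>\<^sup>+\<omega>. \<integral>\<^sup>+x. f x \<omega> * indicator A x \<partial>lborel \<partial>cfg) \<le> ennreal B * emeasure lborel A" if A: "A \<in> sets borel" for A
  proof -
    have "(\<integral>\<^sup>+\<omega>. \<integral>\<^sup>+x. f x \<omega> * indicator A x \<partial>lborel \<partial>cfg) = (\<integral>\<^sup>+x. \<integral>\<^sup>+\<omega>. f x \<omega> * indicator A x \<partial>cfg \<partial>lborel)"
      by (rule P.Fubini'[OF fA[OF A]])
    also have "\<dots> = (\<integral>\<^sup>+x. (\<integral>\<^sup>+\<omega>. f x \<omega> \<partial>cfg) * indicator A x \<partial>lborel)"
      by (intro nn_integral_cong nn_integral_multc section_measurable(2)[OF f])
    also have "\<dots> \<le> (\<integral>\<^sup>+x. ennreal B * indicator A x \<partial>lborel)"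
      by (intro nn_integral_mono mult_right_mono B) auto
    also have "\<dots> = ennreal B * emeasure lborel A" using A by (simp add: nn_integral_cmult_indicator)
    finally show ?thesis .
  qed
  show "(\<integral>\<^sup>+\<omega>. \<integral>\<^sup>+x. f x \<omega> * indicator A x \<partial>lborel \<partial>cfg) \<le> ennreal B * emeasure lborel A" if "A \<in> sets borel"
    by (rule le[OF that])
  have "AE \<omega> in cfg. (\<integral>\<^sup>+x. f x \<omega> * indicator (cball 0 (real n)) x \<partial>lborel) \<noteq> \<infinity>" for n :: nat
  proof (rule nn_integral_PInf_AE)
    show "(\<lambda>\<omega>. \<integral>\<^sup>+x. f x \<omega> * indicator (cball 0 (real n)) x \<partial>lborel) \<in> borel_measurable cfg"
      using measurable_pair_swap[OF fA[OF cball_borel]]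
      by (intro lborel.borel_measurable_nn_integral) (simp only: case_prod_beta' fst_conv snd_conv)
    have "(\<integral>\<^sup>+\<omega>. \<integral>\<^sup>+x. f x \<omega> * indicator (cball 0 (real n)) x \<partial>lborel \<partial>cfg) \<le> ennreal B * emeasure lborel (cball (0::real^'n) (real n))"
      by (rule le[OF cball_borel])
    also have "\<dots> < \<infinity>" using emeasure_bounded_finite[OF bounded_cball, of "0::real^'n" "real n"] by (simp add: ennreal_mult_less_top)
    finally show "(\<integral>\<^sup>+\<omega>. \<integral>\<^sup>+x. f x \<omega> * indicator (cball 0 (real n)) x \<partial>lborel \<partial>cfg) \<noteq> \<infinity>" by simp
  qed
  then have "AE \<omega> in cfg. \<forall>n::nat. (\<integral>\<^sup>+x. f x \<omega> * indicator (cball 0 (real n)) x \<partial>lborel) \<noteq> \<infinity>"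
    by (simp add: AE_all_countable)
  then show "AE \<omega> in cfg. \<forall>R. (\<integral>\<^sup>+x. f x \<omega> * indicator (cball 0 R) x \<partial>lborel) < \<infinity>"
  proof eventually_elim
    case (elim \<omega>)
    show ?case
    proof
      fix R :: real
      obtain n :: nat where n: "R \<le> real n" using real_arch_simple by blast
      have "(\<integral>\<^sup>+x. f x \<omega> * indicator (cball 0 R) x \<partial>lborel) \<le> (\<integral>\<^sup>+x. f x \<omega> * indicator (cball 0 (real n)) x \<partial>lborel)"
        using n by (intro nn_integral_mono mult_left_mono) (auto simp: indicator_def)
      also have "\<dots> < \<infinity>" using elim by (simp only: top.not_eq_extremum infinity_ennreal_def)
      finally show "(\<integral>\<^sup>+x. f x \<omega> * indicator (cball 0 R) x \<partial>lborel) < \<infinity>" .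
    qed
  qed
qed

section \<open>The landscape function\<close>

definition good :: "'n config \<Rightarrow> bool" where
  "good \<omega> \<longleftrightarrow> (\<forall>z. total (shift z \<omega>) < \<top>)"

text \<open>The expected number of times, time zero included, at which the killed walk is alive. As
  an \<open>ennreal\<close> series it makes sense for every environment.\<close>

definition green :: "real^'n \<Rightarrow> 'n config \<Rightarrow> ennreal" where
  "green x \<omega> = (\<Sum>n. surv {} n \<omega> x)"

text \<open>Off the shift invariant set of good configurations the series may diverge; the constant
  chosen there keeps the field stationary for every \<open>\<omega>\<close> and its supremum measurable.\<close>

definition landscape_fn :: "real^'n \<Rightarrow> 'n config \<Rightarrow> real" where
  "landscape_fn x \<omega> = (if good \<omega> then enn2real (green x \<omega>) / \<Lambda> else 1 / \<Lambda>)"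

lemma good_shift: "good (shift z \<omega>) \<longleftrightarrow> good \<omega>"
proof
  assume "good (shift z \<omega>)"
  then have "total (shift (w - z) (shift z \<omega>)) < \<top>" for w unfolding good_def by blast
  then show "good \<omega>" by (simp add: good_def shift_add)
qed (simp add: good_def shift_add)

lemma good_measurable [measurable]: "Measurable.pred cfg good"
proof -
  have "(\<lambda>\<omega>. total (shift z \<omega>)) \<in> borel_measurable cfg" for z
    by (rule measurable_compose[OF shift_measurable total_measurable])
  then have "Measurable.pred cfg (\<lambda>\<omega>. total (shift z \<omega>) < \<top>)" for z
    by (intro borel_measurable_pred_less) auto
  then show ?thesis unfolding good_def[abs_def] by (rule pred_intros_countable)
qed

lemma AE_good: "AE \<omega> in cfg. good \<omega>"
proof -
  have "(\<integral>\<^sup>+\<omega>. total \<omega> \<partial>cfg) < \<infinity>" using total_moment[of 0] by simp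
  then have "AE \<omega> in cfg. total \<omega> < \<top>"
    using nn_integral_PInf_AE[OF total_measurable] by (auto simp: less_top)
  then have "AE \<omega> in cfg. total (shift z \<omega>) < \<top>" for z by (rule AE_shift)
  then show ?thesis by (simp add: good_def AE_all_countable)
qed

lemma shift_space: "\<omega> \<in> space cfg \<Longrightarrow> shift z \<omega> \<in> space cfg"
  by (auto simp: space_cfg shift_def)

lemma green_measurable: "(\<lambda>(x, \<omega>). green x \<omega>) \<in> borel_measurable (borel \<Otimes>\<^sub>M cfg)"
  using surv_measurable unfolding green_def case_prod_beta' by (rule borel_measurable_suminf_order)

lemma green_shift: "green (x + lattice_pt z) \<omega> = green x (shift z \<omega>)"
  by (simp add: green_def surv_shift)

text \<open>Stationarity moves \<open>x\<close> into the unit cell of the shifted environment, where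
  \<open>total\<close> dominates the series termwise.\<close>

lemma green_le_total:
  assumes "\<omega> \<in> space cfg" shows "green x \<omega> \<le> total (shift (cell x) \<omega>)"
proof -
  let ?y = "x - lattice_pt (cell x)"
  have y: "?y \<in> unit_cell" using cell_iff by blast
  have "green x \<omega> = green ?y (shift (cell x) \<omega>)" using green_shift[of ?y "cell x" \<omega>] by simp
  also have "\<dots> \<le> total (shift (cell x) \<omega>)"
    unfolding green_def total_def by (intro suminf_le surv_le_sup shift_space assms y) auto
  finally show ?thesis .
qed

lemma green_finite: "good \<omega> \<Longrightarrow> \<omega> \<in> space cfg \<Longrightarrow> green x \<omega> < \<top>"
  using green_le_total[of \<omega> x] by (auto simp: good_def intro: le_less_trans)

text \<open>Splitting off the term \<open>n = 0\<close> and exchanging sum and average gives the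
  fixed point equation in \<open>ennreal\<close>, even where the series diverges.\<close>

lemma green_eq:
  assumes \<omega>: "\<omega> \<in> space cfg"
  shows "green x \<omega> = 1 + killed_step {} \<omega> (\<lambda>y. green y \<omega>) x"
proof -
  have m: "(\<lambda>z. ennreal (survival {} \<omega> (x + snd z)) * surv {} n \<omega> (x + snd z)) \<in> borel_measurable (step \<Lambda> 0)" for n
    by (intro borel_measurable_times_ennreal measurable_compose[OF _ surv_measurable_x[OF \<omega>]]
       measurable_compose[OF measurable_compose[OF _ survival_measurable_x[OF \<omega>]] measurable_ennreal]) simp_all
  have "(\<lambda>n. surv {} n \<omega> x) sums green x \<omega>" unfolding green_def by (rule summable_sums) auto
  have "green x \<omega> = surv {} 0 \<omega> x + (\<Sum>n. surv {} (Suc n) \<omega> x)"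
    unfolding green_def using suminf_offset[of "\<lambda>n. surv {} n \<omega> x" 1] by (simp add: add.commute)
  also have "(\<Sum>n. surv {} (Suc n) \<omega> x) = (\<integral>\<^sup>+z. (\<Sum>n. ennreal (survival {} \<omega> (x + snd z)) * surv {} n \<omega> (x + snd z)) \<partial>step \<Lambda> 0)"
    unfolding surv_Suc killed_step_def by (rule nn_integral_suminf[OF m, symmetric])
  also have "\<dots> = killed_step {} \<omega> (\<lambda>y. green y \<omega>) x"
    unfolding killed_step_def green_def by simp
  finally show ?thesis by simp
qed

lemma landscape_fn_measurable: "(\<lambda>(x, \<omega>). landscape_fn x \<omega>) \<in> borel_measurable (borel \<Otimes>\<^sub>M cfg)"
proof -
  have g: "Measurable.pred (borel \<Otimes>\<^sub>M cfg) (\<lambda>p :: (real^'n) \<times> 'n config. good (snd p))"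
    by (rule measurable_compose[OF measurable_snd good_measurable])
  have e: "(\<lambda>p. enn2real (green (fst p) (snd p)) / \<Lambda>) \<in> borel_measurable (borel \<Otimes>\<^sub>M cfg)"
  proof -
    have "(\<lambda>p. green (fst p) (snd p)) \<in> borel_measurable (borel \<Otimes>\<^sub>M cfg)"
      using green_measurable by (simp only: case_prod_beta')
    from borel_measurable_enn2real[OF this] show ?thesis
      by (intro borel_measurable_divide borel_measurable_const)
  qed
  show ?thesis
    unfolding landscape_fn_def case_prod_beta' by (rule measurable_If[OF e borel_measurable_const predE[OF g]])
qed

lemma landscape_fn_shift: "landscape_fn (x + lattice_pt z) \<omega> = landscape_fn x (shift z \<omega>)"
  by (simp add: landscape_fn_def good_shift green_shift)

lemma landscape_fn_green: "good \<omega> \<Longrightarrow> \<omega> \<in> space cfg \<Longrightarrow> ennreal (landscape_fn x \<omega>) = ennreal (1 / \<Lambda>) * green x \<omega>"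
  using green_finite[of \<omega> x] Lambda_pos
  by (cases "green x \<omega>") (auto simp: landscape_fn_def ennreal_mult[symmetric])

lemma landscape_fn_nonneg: "0 \<le> landscape_fn x \<omega>"
  using Lambda_pos by (simp add: landscape_fn_def)

lemma landscape_fn_pos:
  assumes "\<omega> \<in> space cfg" shows "0 < landscape_fn x \<omega>"
proof (cases "good \<omega>")
  case True
  have "1 \<le> green x \<omega>" using green_eq[OF assms, of x] by simp
  then have "0 < enn2real (green x \<omega>)"
    using green_finite[OF True assms, of x] by (intro enn2real_positive_iff[THEN iffD2]) (auto intro: less_le_trans[of 0 1])
  then show ?thesis using True Lambda_pos by (simp add: landscape_fn_def)
qed (use Lambda_pos in \<open>simp add: landscape_fn_def\<close>)

text \<open>The function whose step average is the landscape: since a step has mass one, the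
  constant \<open>1 / \<Lambda>\<close> passes through the average unchanged.\<close>

definition source :: "real^'n \<Rightarrow> 'n config \<Rightarrow> real" where
  "source x \<omega> = 1 / \<Lambda> + survival {} \<omega> x * landscape_fn x \<omega>"

lemma source_nonneg: "0 \<le> source x \<omega>"
  using Lambda_pos survival_range landscape_fn_nonneg by (simp add: source_def)

lemma source_measurable: "(\<lambda>(x, \<omega>). source x \<omega>) \<in> borel_measurable (borel \<Otimes>\<^sub>M cfg)"
  using survival_measurable[of "{}"] landscape_fn_measurable
  unfolding source_def case_prod_beta' by (intro borel_measurable_add borel_measurable_times borel_measurable_const)

lemma landscape_fn_eq:
  assumes g: "good \<omega>" and \<omega>: "\<omega> \<in> space cfg"
  shows "ennreal (landscape_fn x \<omega>) = (\<integral>\<^sup>+z. ennreal (source (x + snd z) \<omega>) \<partial>step \<Lambda> 0)"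
proof -
  have m: "(\<lambda>z. ennreal (survival {} \<omega> (x + snd z)) * green (x + snd z) \<omega>) \<in> borel_measurable (step \<Lambda> 0)"
    by (intro borel_measurable_times_ennreal measurable_compose[OF _ section_measurable(1)[OF green_measurable \<omega>]]
       measurable_compose[OF measurable_compose[OF _ survival_measurable_x[OF \<omega>]] measurable_ennreal]) simp_all
  have "ennreal (source y \<omega>) = ennreal (1 / \<Lambda>) * (1 + ennreal (survival {} \<omega> y) * green y \<omega>)" for y
  proof -
    have "ennreal (source y \<omega>) = ennreal (1 / \<Lambda>) + ennreal (survival {} \<omega> y) * ennreal (landscape_fn y \<omega>)"
      using Lambda_pos survival_range landscape_fn_nonneg by (simp add: source_def ennreal_mult)
    then show ?thesis unfolding landscape_fn_green[OF g \<omega>] by (simp add: distrib_left mult_ac)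
  qed
  then have "(\<integral>\<^sup>+z. ennreal (source (x + snd z) \<omega>) \<partial>step \<Lambda> 0) = ennreal (1 / \<Lambda>) * (\<integral>\<^sup>+z. 1 + ennreal (survival {} \<omega> (x + snd z)) * green (x + snd z) \<omega> \<partial>step \<Lambda> 0)"
    using nn_integral_cmult[OF borel_measurable_add[OF borel_measurable_const m], of "ennreal (1 / \<Lambda>)" 1] by (simp only:)
  also have "(\<integral>\<^sup>+z. 1 + ennreal (survival {} \<omega> (x + snd z)) * green (x + snd z) \<omega> \<partial>step \<Lambda> 0) = green x \<omega>"
    unfolding green_eq[OF \<omega>, of x] killed_step_def
    using nn_integral_add[OF borel_measurable_const m, of 1] walk.emeasure_space_1[of 0]
    by (simp only: nn_integral_const mult_1)
  finally show ?thesis by (simp add: landscape_fn_green[OF g \<omega>])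
qed

text \<open>The bound by \<open>total\<close> in the environment shifted to the cell of
  \<open>x\<close> has a law independent of that cell, so the estimate is uniform in
  \<open>x\<close>.\<close>

lemma mean_landscape_fn_square: "\<exists>B\<ge>0. \<forall>x. (\<integral>\<^sup>+\<omega>. ennreal ((landscape_fn x \<omega>)\<^sup>2) \<partial>cfg) \<le> ennreal B"
proof -
  let ?T = "\<integral>\<^sup>+\<omega>. total \<omega> ^ 2 \<partial>cfg"
  have T: "?T < \<infinity>" using total_moment[of 1] by (simp add: numeral_2_eq_2)
  have "(\<integral>\<^sup>+\<omega>. ennreal ((landscape_fn x \<omega>)\<^sup>2) \<partial>cfg) \<le> ennreal ((1 / \<Lambda>)\<^sup>2) * ?T" for x
  proof -
    have "(\<integral>\<^sup>+\<omega>. ennreal ((landscape_fn x \<omega>)\<^sup>2) \<partial>cfg) \<le> (\<integral>\<^sup>+\<omega>. ennreal ((1 / \<Lambda>)\<^sup>2) * total (shift (cell x) \<omega>) ^ 2 \<partial>cfg)"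
    proof (rule nn_integral_mono_AE, rule AE_mp[OF AE_good], rule AE_I2, rule impI)
      fix \<omega> assume \<omega>: "\<omega> \<in> space cfg" "good \<omega>"
      have "ennreal ((landscape_fn x \<omega>)\<^sup>2) = (ennreal (1 / \<Lambda>) * green x \<omega>)\<^sup>2"
        using landscape_fn_nonneg by (simp add: landscape_fn_green[OF \<omega>(2,1), symmetric] ennreal_power)
      also have "\<dots> \<le> (ennreal (1 / \<Lambda>) * total (shift (cell x) \<omega>))\<^sup>2"
        by (intro power_mono mult_left_mono green_le_total \<omega>) auto
      also have "\<dots> = ennreal ((1 / \<Lambda>)\<^sup>2) * total (shift (cell x) \<omega>) ^ 2"
        using Lambda_pos by (simp add: power_mult_distrib ennreal_power)
      finally show "ennreal ((landscape_fn x \<omega>)\<^sup>2) \<le> ennreal ((1 / \<Lambda>)\<^sup>2) * total (shift (cell x) \<omega>) ^ 2" .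
    qed
    also have "\<dots> = (\<integral>\<^sup>+\<omega>. ennreal ((1 / \<Lambda>)\<^sup>2) * total \<omega> ^ 2 \<partial>cfg)"
      by (rule nn_integral_shift) measurable
    also have "\<dots> = ennreal ((1 / \<Lambda>)\<^sup>2) * ?T" by (rule nn_integral_cmult) measurable
    finally show ?thesis .
  qed
  moreover have "ennreal ((1 / \<Lambda>)\<^sup>2) * ?T = ennreal ((1 / \<Lambda>)\<^sup>2 * enn2real ?T)"
    using T by (simp add: ennreal_mult)
  ultimately show ?thesis by (intro exI[of _ "(1 / \<Lambda>)\<^sup>2 * enn2real ?T"]) auto
qed

lemma mean_source_square: "\<exists>B\<ge>0. \<forall>x. (\<integral>\<^sup>+\<omega>. ennreal ((source x \<omega>)\<^sup>2) \<partial>cfg) \<le> ennreal B"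
proof -
  obtain B where B: "B \<ge> 0" "\<And>x. (\<integral>\<^sup>+\<omega>. ennreal ((landscape_fn x \<omega>)\<^sup>2) \<partial>cfg) \<le> ennreal B"
    using mean_landscape_fn_square by blast
  have "(\<integral>\<^sup>+\<omega>. ennreal ((source x \<omega>)\<^sup>2) \<partial>cfg) \<le> ennreal (2 * (1 / \<Lambda>)\<^sup>2 + 2 * B)" for x
  proof -
    have m: "(\<lambda>\<omega>. ennreal ((landscape_fn x \<omega>)\<^sup>2)) \<in> borel_measurable cfg"
      by (intro measurable_compose[OF _ measurable_ennreal] borel_measurable_power section_measurable(2)[OF landscape_fn_measurable])
    have "(\<integral>\<^sup>+\<omega>. ennreal ((source x \<omega>)\<^sup>2) \<partial>cfg) \<le> (\<integral>\<^sup>+\<omega>. ennreal (2 * (1 / \<Lambda>)\<^sup>2) + 2 * ennreal ((landscape_fn x \<omega>)\<^sup>2) \<partial>cfg)"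
    proof (rule nn_integral_mono)
      fix \<omega>
      have "source x \<omega> \<le> 1 / \<Lambda> + landscape_fn x \<omega>"
        using survival_range[of "{}" \<omega> x] landscape_fn_nonneg[of x \<omega>] by (simp add: source_def mult_left_le_one_le)
      then have "(source x \<omega>)\<^sup>2 \<le> (1 / \<Lambda> + landscape_fn x \<omega>)\<^sup>2"
        using source_nonneg by (intro power_mono) auto
      also have "\<dots> \<le> 2 * (1 / \<Lambda>)\<^sup>2 + 2 * (landscape_fn x \<omega>)\<^sup>2"
        using zero_le_power2[of "1 / \<Lambda> - landscape_fn x \<omega>"] by (simp add: power2_sum power2_diff)
      finally have "ennreal ((source x \<omega>)\<^sup>2) \<le> ennreal (2 * (1 / \<Lambda>)\<^sup>2 + 2 * (landscape_fn x \<omega>)\<^sup>2)" by (rule ennreal_leI)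
      then show "ennreal ((source x \<omega>)\<^sup>2) \<le> ennreal (2 * (1 / \<Lambda>)\<^sup>2) + 2 * ennreal ((landscape_fn x \<omega>)\<^sup>2)"
        by (simp add: ennreal_mult)
    qed
    also have "\<dots> = ennreal (2 * (1 / \<Lambda>)\<^sup>2) + 2 * (\<integral>\<^sup>+\<omega>. ennreal ((landscape_fn x \<omega>)\<^sup>2) \<partial>cfg)"
      using cfg.emeasure_space_1
      by (simp only: nn_integral_add[OF borel_measurable_const borel_measurable_times_ennreal[OF borel_measurable_const m]]
          nn_integral_cmult[OF m] nn_integral_const mult_1_right)
    also have "\<dots> \<le> ennreal (2 * (1 / \<Lambda>)\<^sup>2) + 2 * ennreal B"
      by (intro add_left_mono mult_left_mono B) auto
    also have "\<dots> = ennreal (2 * (1 / \<Lambda>)\<^sup>2 + 2 * B)" using B by (simp add: ennreal_mult)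
    finally show ?thesis .
  qed
  then show ?thesis using B by (intro exI[of _ "2 * (1 / \<Lambda>)\<^sup>2 + 2 * B"]) auto
qed

lemma square_measurable:
  fixes f :: "real^'n \<Rightarrow> 'n config \<Rightarrow> real"
  assumes "(\<lambda>(x, \<omega>). f x \<omega>) \<in> borel_measurable (borel \<Otimes>\<^sub>M cfg)"
  shows "(\<lambda>(x, \<omega>). ennreal ((f x \<omega>)\<^sup>2)) \<in> borel_measurable (borel \<Otimes>\<^sub>M cfg)"
  using assms unfolding case_prod_beta'
  by (intro measurable_compose[OF _ measurable_ennreal] borel_measurable_power)

text \<open>Cauchy-Schwarz with respect to the weighted step: the square of the weighted average is
  at most the total weight times the weighted average of the square. The latter has a mean bounded
  uniformly in \<open>x\<close>, hence is almost surely locally integrable.\<close>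

lemma AE_gradient_square:
  "AE \<omega> in cfg. \<forall>R. (\<integral>\<^sup>+x. (\<integral>\<^sup>+z. ennreal (\<bar>gradient_weight i z\<bar> * source (x + snd z) \<omega>) \<partial>step \<Lambda> 0)\<^sup>2 * indicator (cball 0 R) x \<partial>lborel) < \<infinity>"
proof -
  obtain B where B: "B \<ge> 0" "\<And>x. (\<integral>\<^sup>+\<omega>. ennreal ((source x \<omega>)\<^sup>2) \<partial>cfg) \<le> ennreal B"
    using mean_source_square by blast
  let ?c = "\<lambda>z. ennreal \<bar>gradient_weight i z\<bar> :: ennreal"
  let ?M = "\<integral>\<^sup>+z. ?c z \<partial>(step \<Lambda> 0 :: (real \<times> (real^'n)) measure)"
  have c: "?c \<in> borel_measurable (borel \<Otimes>\<^sub>M borel)"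
    by (intro measurable_compose[OF _ measurable_ennreal] borel_measurable_abs gradient_weight_measurable)
  have c': "?c \<in> borel_measurable (step \<Lambda> 0)" using c by (simp cong: measurable_cong_sets)
  have M: "?M < \<infinity>"
    using integrable_step_gradient_weight[OF Lambda_pos, of "\<lambda>_. 1" 1 i] by (simp add: integrable_iff_bounded)
  interpret P: pair_sigma_finite "step \<Lambda> 0 :: (real \<times> (real^'n)) measure" cfg ..
  let ?f = "\<lambda>x \<omega>. \<integral>\<^sup>+z. ?c z * ennreal ((source (x + snd z) \<omega>)\<^sup>2) \<partial>step \<Lambda> 0"
  note sq = square_measurable[OF source_measurable]
  have fm: "(\<lambda>(x, \<omega>). ?f x \<omega>) \<in> borel_measurable (borel \<Otimes>\<^sub>M cfg)"
    by (rule step_average_measurable[OF sq c])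
  have "(\<integral>\<^sup>+\<omega>. ?f x \<omega> \<partial>cfg) \<le> ennreal (enn2real ?M * B)" for x
  proof -
    have "(\<integral>\<^sup>+\<omega>. ?f x \<omega> \<partial>cfg) = (\<integral>\<^sup>+z. \<integral>\<^sup>+\<omega>. ?c z * ennreal ((source (x + snd z) \<omega>)\<^sup>2) \<partial>cfg \<partial>step \<Lambda> 0)"
    proof (rule P.Fubini')
      have "(\<lambda>p. (x + snd (fst p), snd p)) \<in> step \<Lambda> 0 \<Otimes>\<^sub>M cfg \<rightarrow>\<^sub>M borel \<Otimes>\<^sub>M cfg" by measurable
      from measurable_compose[OF this sq]
      show "(\<lambda>(z, \<omega>). ?c z * ennreal ((source (x + snd z) \<omega>)\<^sup>2)) \<in> borel_measurable (step \<Lambda> 0 \<Otimes>\<^sub>M cfg)"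
        unfolding case_prod_beta' fst_conv snd_conv
        by (intro borel_measurable_times_ennreal measurable_compose[OF measurable_fst c'])
    qed
    also have "\<dots> = (\<integral>\<^sup>+z. ?c z * (\<integral>\<^sup>+\<omega>. ennreal ((source (x + snd z) \<omega>)\<^sup>2) \<partial>cfg) \<partial>step \<Lambda> 0)"
      by (intro nn_integral_cong nn_integral_cmult section_measurable(2)[OF sq])
    also have "\<dots> \<le> (\<integral>\<^sup>+z. ?c z * ennreal B \<partial>(step \<Lambda> 0 :: (real \<times> (real^'n)) measure))"
      by (intro nn_integral_mono mult_left_mono B) auto
    also have "\<dots> = ?M * ennreal B" by (rule nn_integral_multc[OF c'])
    also have "\<dots> = ennreal (enn2real ?M * B)" using M B by (simp add: ennreal_mult)
    finally show ?thesis .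
  qed
  then have "AE \<omega> in cfg. \<forall>R. (\<integral>\<^sup>+x. ?f x \<omega> * indicator (cball 0 R) x \<partial>lborel) < \<infinity>"
    by (rule AE_local_integral(2)[OF fm])
  then show ?thesis
  proof (rule AE_mp, intro AE_I2 impI allI)
    fix \<omega> R assume \<omega>: "\<omega> \<in> space cfg" and fin: "\<forall>R. (\<integral>\<^sup>+x. ?f x \<omega> * indicator (cball 0 R) x \<partial>lborel) < \<infinity>"
    let ?G = "\<lambda>x. \<integral>\<^sup>+z. ennreal (\<bar>gradient_weight i z\<bar> * source (x + snd z) \<omega>) \<partial>step \<Lambda> 0"
    have cs: "(?G x)\<^sup>2 \<le> ?M * ?f x \<omega>" for x
    proof -
      \<comment> \<open>The weight is split evenly between the two factors, so that both resulting
        integrals are finite.\<close>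
      let ?a = "\<lambda>z. ennreal (sqrt \<bar>gradient_weight i z\<bar>) :: ennreal" and ?b = "\<lambda>z. ennreal (sqrt \<bar>gradient_weight i z\<bar> * source (x + snd z) \<omega>)"
      have m1: "(\<lambda>z. sqrt \<bar>gradient_weight i z\<bar>) \<in> borel_measurable (step \<Lambda> 0)"
        using sqrt_gradient_weight_measurable by (simp cong: measurable_cong_sets)
      have m2: "(\<lambda>z. source (x + snd z) \<omega>) \<in> borel_measurable (step \<Lambda> 0)"
        by (rule measurable_compose[OF _ section_measurable(1)[OF source_measurable \<omega>]]) simp
      have "?G x = (\<integral>\<^sup>+z. ?a z * ?b z \<partial>step \<Lambda> 0)"
        using source_nonneg by (intro nn_integral_cong) (simp add: ennreal_mult[symmetric] mult.assoc[symmetric])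
      then have "(?G x)\<^sup>2 \<le> (\<integral>\<^sup>+z. ?a z ^ 2 \<partial>step \<Lambda> 0) * (\<integral>\<^sup>+z. ?b z ^ 2 \<partial>step \<Lambda> 0)"
        using Cauchy_Schwarz_nn_integral[OF measurable_compose[OF m1 measurable_ennreal] measurable_compose[OF borel_measurable_times[OF m1 m2] measurable_ennreal]]
        by (simp only:)
      also have "(\<integral>\<^sup>+z. ?a z ^ 2 \<partial>step \<Lambda> 0) = ?M"
        by (simp add: ennreal_power)
      also have "(\<integral>\<^sup>+z. ?b z ^ 2 \<partial>step \<Lambda> 0) = ?f x \<omega>"
        using source_nonneg by (intro nn_integral_cong) (simp add: ennreal_power power_mult_distrib ennreal_mult)
      finally show ?thesis .
    qed
    have fx: "(\<lambda>x. ?f x \<omega> * indicator (cball 0 R) x) \<in> borel_measurable lborel"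
      using borel_measurable_times_ennreal[OF section_measurable(1)[OF fm \<omega>] borel_measurable_indicator[OF cball_borel]]
      by (simp only: measurable_lborel2)
    have "(\<integral>\<^sup>+x. (?G x)\<^sup>2 * indicator (cball 0 R) x \<partial>lborel) \<le> (\<integral>\<^sup>+x. ?M * (?f x \<omega> * indicator (cball 0 R) x) \<partial>lborel)"
      by (intro nn_integral_mono) (simp add: mult.assoc[symmetric] mult_right_mono[OF cs])
    also have "\<dots> = ?M * (\<integral>\<^sup>+x. ?f x \<omega> * indicator (cball 0 R) x \<partial>lborel)"
      by (rule nn_integral_cmult[OF fx])
    also have "\<dots> < \<infinity>" using M fin by (simp add: ennreal_mult_less_top)
    finally show "(\<integral>\<^sup>+x. (?G x)\<^sup>2 * indicator (cball 0 R) x \<partial>lborel) < \<infinity>" .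
  qed
qed

end

lemma unit_cell_bounded: "unit_cell \<subseteq> cball (0::real^'n::finite) (real CARD('n))"
proof
  fix x :: "real^'n" assume x: "x \<in> unit_cell"
  have "norm x \<le> (\<Sum>i\<in>UNIV. \<bar>x $ i\<bar>)" by (rule norm_le_l1_cart)
  also have "\<dots> \<le> (\<Sum>i\<in>(UNIV::'n set). 1)"
  proof (rule sum_mono)
    fix i
    have "- (1/2) \<le> x $ i \<and> x $ i < 1/2" using x by (simp add: unit_cell_def)
    then show "\<bar>x $ i\<bar> \<le> 1" by linarith
  qed
  finally show "x \<in> cball 0 (real CARD('n))" by simp
qed

lemma emeasure_unit_cell: "emeasure lborel (unit_cell :: (real^'n::finite) set) < \<infinity>"
  by (rule emeasure_bounded_finite) (rule bounded_subset[OF bounded_cball unit_cell_bounded])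

lemma lborel_pair_borel: "borel_measurable (lborel \<Otimes>\<^sub>M M) = borel_measurable (borel \<Otimes>\<^sub>M M)"
  by (rule measurable_cong_sets[OF sets_pair_measure_cong[OF sets_lborel refl] refl])

lemma powr_const_measurable: "(\<lambda>r::real. r powr p) \<in> borel_measurable borel"
  by measurable

context landscape
begin

lemma landscape_fn_weak_solution:
  "AE \<omega> in cfg. H1_loc (\<lambda>x. landscape_fn x \<omega>) \<and>
     weak_landscape_solution (\<lambda>x. \<Lambda> * random_potential \<phi> \<omega> x) (\<lambda>x. landscape_fn x \<omega>)"
proof -
  obtain B where B: "\<And>x. (\<integral>\<^sup>+\<omega>. ennreal ((landscape_fn x \<omega>)\<^sup>2) \<partial>cfg) \<le> ennreal B" using mean_landscape_fn_square by blast
  obtain B' where B': "\<And>x. (\<integral>\<^sup>+\<omega>. ennreal ((source x \<omega>)\<^sup>2) \<partial>cfg) \<le> ennreal B'" using mean_source_square by blast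
  have "AE \<omega> in cfg. \<forall>i. \<forall>R. (\<integral>\<^sup>+x. (\<integral>\<^sup>+z. ennreal (\<bar>gradient_weight i z\<bar> * source (x + snd z) \<omega>) \<partial>step \<Lambda> 0)\<^sup>2 * indicator (cball 0 R) x \<partial>lborel) < \<infinity>"
    using AE_gradient_square by (simp add: AE_all_countable)
  then show ?thesis
    using AE_good AE_local_integral(2)[OF square_measurable[OF landscape_fn_measurable] B]
      AE_local_integral(2)[OF square_measurable[OF source_measurable] B'] AE_space
  proof eventually_elim
    case (elim \<omega>)
    let ?u = "\<lambda>x. landscape_fn x \<omega>" and ?F = "\<lambda>x. source x \<omega>" and ?W = "\<lambda>x. \<Lambda> * random_potential \<phi> \<omega> x"
    have \<omega>: "\<omega> \<in> space cfg" by fact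
    have um: "?u \<in> borel_measurable borel" by (rule section_measurable(1)[OF landscape_fn_measurable \<omega>])
    have Fm: "?F \<in> borel_measurable borel" by (rule section_measurable(1)[OF source_measurable \<omega>])
    have F1: "integrable lborel (\<lambda>x. ?F x * indicator (cball 0 R) x)" for R
      using elim(4) by (intro L2_loc_integrable L2_locI Fm) auto
    note sol = resolvent_weak_solution[OF Lambda_pos um Fm landscape_fn_nonneg source_nonneg
        landscape_fn_eq[OF \<open>good \<omega>\<close> \<omega>] elim(3)[rule_format] F1 elim(1)[rule_format]]
    obtain g where g: "L2_loc g" "weak_gradient ?u g"
      "\<And>\<psi>. \<psi> \<in> Cc_infty UNIV \<Longrightarrow> (LINT x|lborel. g x \<bullet> gradient \<psi> x) + (LINT x|lborel. (\<Lambda> * ?u x - \<Lambda> * ?F x) * \<psi> x) = 0"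
      using sol(1) by blast
    have W: "?W x = \<Lambda> * (1 - survival {} \<omega> x)" for x using random_potential_eq[OF \<omega>] by simp
    \<comment> \<open>With \<open>W = \<Lambda> (1 - q)\<close> and
      \<open>\<Lambda> F = 1 + \<Lambda> q u\<close>, the resolvent equation becomes the landscape
      equation.\<close>
    have Wu: "\<Lambda> * ?u x - \<Lambda> * ?F x = ?W x * ?u x - 1" for x
      using Lambda_pos unfolding W by (simp add: source_def algebra_simps)
    have "(LINT x|lborel. g x \<bullet> gradient \<psi> x) + (LINT x|lborel. ?W x * ?u x * \<psi> x) = (LINT x|lborel. \<psi> x)" if \<psi>: "\<psi> \<in> Cc_infty UNIV" for \<psi>
    proof -
      have i: "integrable lborel (\<lambda>x. ?u x * \<psi> x)" by (rule L2_loc_test[OF sol(2) \<psi>])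
      have i1: "integrable lborel (\<lambda>x. ?W x * ?u x * \<psi> x)"
      proof (rule Bochner_Integration.integrable_bound[OF integrable_mult_right[OF i, of \<Lambda>]])
        have "(\<lambda>x. \<Lambda> * (1 - survival {} \<omega> x) * ?u x * \<psi> x) \<in> borel_measurable borel"
          by (intro borel_measurable_times borel_measurable_const borel_measurable_diff survival_measurable_x[OF \<omega>] um Cc_infty_measurable[OF \<psi>])
        then show "(\<lambda>x. ?W x * ?u x * \<psi> x) \<in> borel_measurable lborel" by (simp only: W measurable_lborel2)
        have "norm (?W x * ?u x * \<psi> x) \<le> norm (\<Lambda> * (?u x * \<psi> x))" for x
        proof -
          have "\<bar>?W x\<bar> \<le> \<Lambda>" unfolding W using survival_range[of "{}" \<omega> x] Lambda_pos by (simp add: abs_mult mult_left_le)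
          then have "\<bar>?W x\<bar> * (\<bar>?u x\<bar> * \<bar>\<psi> x\<bar>) \<le> \<Lambda> * (\<bar>?u x\<bar> * \<bar>\<psi> x\<bar>)" by (intro mult_right_mono) auto
          then show ?thesis using Lambda_pos by (simp add: abs_mult mult.assoc)
        qed
        then show "AE x in lborel. norm (?W x * ?u x * \<psi> x) \<le> norm (\<Lambda> * (?u x * \<psi> x))" by (rule AE_I2)
      qed
      have i2: "integrable lborel \<psi>"
      proof -
        obtain R where "\<And>x. R < norm x \<Longrightarrow> \<psi> x = 0" using Cc_infty_support[OF \<psi>] by metis
        then show ?thesis by (rule integrable_compact_support[OF smooth_continuous[OF Cc_infty_smooth[OF \<psi>]]])
      qed
      have "(LINT x|lborel. (\<Lambda> * ?u x - \<Lambda> * ?F x) * \<psi> x) = (LINT x|lborel. ?W x * ?u x * \<psi> x - \<psi> x)"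
        unfolding Wu by (simp only: left_diff_distrib mult_1)
      also have "\<dots> = (LINT x|lborel. ?W x * ?u x * \<psi> x) - (LINT x|lborel. \<psi> x)"
        by (rule Bochner_Integration.integral_diff[OF i1 i2])
      finally show ?thesis using g(3)[OF \<psi>] by simp
    qed
    then show ?case using g sol(2) unfolding H1_loc_def weak_landscape_solution_def by blast
  qed
qed

lemma landscape_fn_stationary_landscape: "stationary_landscape \<phi> \<mu> \<Lambda> landscape_fn"
  unfolding stationary_landscape_def
proof (intro conjI)
  show "random_field \<mu> landscape_fn"
    unfolding random_field_def lborel_pair_borel by (rule landscape_fn_measurable)
  show "stationary \<mu> landscape_fn" by (simp add: stationary_def landscape_fn_shift)
  show "AE \<omega> in cfg. H1_loc (\<lambda>x. landscape_fn x \<omega>) \<and>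
     weak_landscape_solution (\<lambda>x. \<Lambda> * random_potential \<phi> \<omega> x) (\<lambda>x. landscape_fn x \<omega>)"
    by (rule landscape_fn_weak_solution)
  obtain B where B: "\<And>x. (\<integral>\<^sup>+\<omega>. ennreal ((landscape_fn x \<omega>)\<^sup>2) \<partial>cfg) \<le> ennreal B" using mean_landscape_fn_square by blast
  have "(\<integral>\<^sup>+\<omega>. (\<integral>\<^sup>+x\<in>unit_cell. ennreal ((landscape_fn x \<omega>)\<^sup>2) \<partial>lborel) \<partial>cfg) \<le> ennreal B * emeasure lborel (unit_cell :: (real^'n) set)"
    by (rule AE_local_integral(1)[OF square_measurable[OF landscape_fn_measurable] B unit_cell_measurable])
  also have "\<dots> < \<infinity>" using emeasure_unit_cell[where 'n='n] by (simp add: ennreal_mult_less_top)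
  finally show "(\<integral>\<^sup>+\<omega>. (\<integral>\<^sup>+x\<in>unit_cell. ennreal ((landscape_fn x \<omega>)\<^sup>2) \<partial>lborel) \<partial>cfg) < \<infinity>" .
qed

section \<open>Measurability and moments of the supremum of the landscape\<close>

lemma landscape_fn_le_total:
  assumes "good \<omega>" "\<omega> \<in> space cfg" "x \<in> unit_cell"
  shows "landscape_fn x \<omega> \<le> enn2real (total \<omega>) / \<Lambda>"
proof -
  have "shift 0 \<omega> = \<omega>" by (simp add: shift_def)
  then have "green x \<omega> \<le> total \<omega>" "total \<omega> < \<top>"
    using green_le_total[OF assms(2), of x] assms cell_0_iff[of x] unfolding good_def by metis+
  then have "enn2real (green x \<omega>) \<le> enn2real (total \<omega>)" by (intro enn2real_mono) auto
  then show ?thesis using assms Lambda_pos by (simp add: landscape_fn_def divide_right_mono)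
qed

lemma landscape_fn_bdd:
  assumes "\<omega> \<in> space cfg" "p \<ge> 0"
  shows "bdd_above ((\<lambda>x. landscape_fn x \<omega> powr p) ` unit_cell)"
proof (cases "good \<omega>")
  case True
  then show ?thesis
    using landscape_fn_le_total[OF True assms(1)] assms(2) landscape_fn_nonneg
    by (intro bdd_aboveI2[of _ _ "(enn2real (total \<omega>) / \<Lambda>) powr p"] powr_mono2) auto
next
  case False
  then show ?thesis by (intro bdd_aboveI2[of _ _ "(1 / \<Lambda>) powr p"]) (simp add: landscape_fn_def)
qed

text \<open>The partial sums are continuous and increase to the landscape. A bound on the dense set
  therefore passes to the whole cell for each partial sum, by closedness of its sublevel sets, and
  then to the limit. This makes the supremum measurable in the environment.\<close>

lemma landscape_fn_sup_dense:
  assumes \<omega>: "\<omega> \<in> space cfg" and p: "p > 0"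
  shows "(SUP x\<in>unit_cell. landscape_fn x \<omega> powr p) = (SUP x\<in>dense. landscape_fn x \<omega> powr p)"
proof (rule antisym)
  let ?f = "\<lambda>x. landscape_fn x \<omega> powr p"
  note bdd = landscape_fn_bdd[OF \<omega>, of p]
  have ne: "(unit_cell :: (real^'n) set) \<noteq> {}" using dense by blast
  have bdd': "bdd_above (?f ` dense)" by (rule bdd_above_mono[OF bdd image_mono[OF dense(2)]]) (use p in simp)
  show "(SUP x\<in>dense. ?f x) \<le> (SUP x\<in>unit_cell. ?f x)"
    using p by (intro cSUP_subset_mono[OF dense(4) bdd dense(2)]) auto
  define B where "B = (SUP x\<in>dense. ?f x)"
  have B: "?f y \<le> B" if "y \<in> dense" for y unfolding B_def by (rule cSUP_upper[OF that bdd'])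
  obtain y0 where "y0 \<in> dense" using dense(4) by blast
  then have B0: "0 \<le> B" using B[of y0] powr_ge_zero[of "landscape_fn y0 \<omega>" p] by linarith
  show "(SUP x\<in>unit_cell. ?f x) \<le> (SUP x\<in>dense. ?f x)"
  \<comment> \<open>Off the good set the field is constant, so both suprema have the same
    value.\<close>
  proof (cases "good \<omega>")
    case False
    then show ?thesis using ne dense(4) by (simp add: landscape_fn_def)
  next
    case True
    let ?b = "B powr (1 / p)"
    have yb: "landscape_fn y \<omega> \<le> ?b" if "y \<in> dense" for y
    proof -
      have "?f y powr (1 / p) \<le> ?b" using B[OF that] p by (intro powr_mono2) auto
      then show ?thesis using p landscape_fn_nonneg by (simp add: powr_powr)
    qed
    have le: "landscape_fn x \<omega> \<le> ?b" if x: "x \<in> unit_cell" for x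
    proof -
      obtain g where g: "\<And>n. continuous_on UNIV (g n)" "\<And>n x. 0 \<le> g n x" "\<And>n x. surv {} n \<omega> x = ennreal (g n x)"
        using surv_continuous[OF \<omega>] by metis
      have part: "(\<Sum>n<N. surv {} n \<omega> x) \<le> ennreal (\<Lambda> * ?b)" for N
      proof -
        let ?S = "\<lambda>x. \<Sum>n<N. g n x"
        have S: "(\<Sum>n<N. surv {} n \<omega> x) = ennreal (?S x)" for x using g(2) by (simp add: g(3) sum_ennreal)
        have "?S y \<le> \<Lambda> * ?b" if y: "y \<in> dense" for y
        proof -
          have "ennreal (?S y) \<le> green y \<omega>"
            unfolding S[symmetric] green_def by (rule sum_le_suminf) auto
          also have "green y \<omega> = ennreal (enn2real (green y \<omega>))" using green_finite[OF True \<omega>, of y] by simp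
          finally have "?S y \<le> enn2real (green y \<omega>)" by (simp add: ennreal_le_iff)
          then show ?thesis using yb[OF y] True Lambda_pos by (simp add: landscape_fn_def divide_le_eq mult.commute)
        qed
        moreover have "closed {y. ?S y \<le> \<Lambda> * ?b}"
          by (intro closed_Collect_le continuous_intros g)
        ultimately have "closure dense \<subseteq> {y. ?S y \<le> \<Lambda> * ?b}" by (intro closure_minimal) auto
        then have "?S x \<le> \<Lambda> * ?b" using x dense(3) by blast
        then show ?thesis unfolding S by (rule ennreal_leI)
      qed
      have "green x \<omega> \<le> ennreal (\<Lambda> * ?b)"
        unfolding green_def by (rule suminf_le_const) (use part in auto)
      then have "enn2real (green x \<omega>) \<le> \<Lambda> * ?b" using Lambda_pos by (intro enn2real_leI) auto
      then show ?thesis using True Lambda_pos by (simp add: landscape_fn_def divide_le_eq mult.commute)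
    qed
    show ?thesis
    proof (rule cSUP_least[OF ne])
      fix x :: "real^'n" assume "x \<in> unit_cell"
      then have "?f x \<le> ?b powr p" using le landscape_fn_nonneg p by (intro powr_mono2) auto
      then show "?f x \<le> (SUP x\<in>dense. ?f x)" using p B0 by (simp add: powr_powr B_def[symmetric])
    qed
  qed
qed

lemma landscape_fn_sup_integrable:
  assumes p: "p \<ge> 1"
  shows "integrable cfg (\<lambda>\<omega>. SUP x\<in>unit_cell. landscape_fn x \<omega> powr p)"
proof -
  let ?S = "\<lambda>\<omega>. SUP x\<in>unit_cell. landscape_fn x \<omega> powr p"
  obtain m :: nat where m: "p \<le> real m" using real_arch_simple by blast
  let ?T = "\<lambda>\<omega>. enn2real (total \<omega>)"
  have T: "integrable cfg (\<lambda>\<omega>. ?T \<omega> ^ Suc m)"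
  proof (rule integrableI_bounded)
    show "(\<lambda>\<omega>. ?T \<omega> ^ Suc m) \<in> borel_measurable cfg"
      by (intro borel_measurable_power borel_measurable_enn2real total_measurable)
    have "ennreal (norm (?T \<omega> ^ Suc m)) \<le> total \<omega> ^ Suc m" for \<omega>
    proof (cases "total \<omega>")
      case (real r)
      then show ?thesis by (simp only: enn2real_ennreal real_norm_def ennreal_power abs_of_nonneg zero_le_power order_refl)
    qed (simp add: top_power_ennreal)
    then have "(\<integral>\<^sup>+\<omega>. ennreal (norm (?T \<omega> ^ Suc m)) \<partial>cfg) \<le> (\<integral>\<^sup>+\<omega>. total \<omega> ^ Suc m \<partial>cfg)"
      by (intro nn_integral_mono)
    then show "(\<integral>\<^sup>+\<omega>. ennreal (norm (?T \<omega> ^ Suc m)) \<partial>cfg) < \<infinity>" using total_moment[of m] by (rule le_less_trans)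
  qed
  have w: "integrable cfg (\<lambda>\<omega>. 1 + (1 / \<Lambda>) ^ Suc m * ?T \<omega> ^ Suc m)"
    by (intro Bochner_Integration.integrable_add integrable_mult_right T cfg.integrable_const)
  show ?thesis
  proof (rule Bochner_Integration.integrable_bound[OF w])
    have m1: "(\<lambda>\<omega>. landscape_fn x \<omega> powr p) \<in> borel_measurable cfg" for x
      by (rule measurable_compose[OF section_measurable(2)[OF landscape_fn_measurable] powr_const_measurable])
    have "(\<lambda>\<omega>. SUP x\<in>dense. landscape_fn x \<omega> powr p) \<in> borel_measurable cfg"
    proof (rule borel_measurable_cSUP[OF dense(1) m1])
      fix \<omega> assume "\<omega> \<in> space cfg"
      then show "bdd_above ((\<lambda>x. landscape_fn x \<omega> powr p) ` dense)"
        using bdd_above_mono[OF landscape_fn_bdd image_mono[OF dense(2)]] p by simp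
    qed
    moreover have "?S \<in> borel_measurable cfg \<longleftrightarrow> (\<lambda>\<omega>. SUP x\<in>dense. landscape_fn x \<omega> powr p) \<in> borel_measurable cfg"
      using p by (intro measurable_cong landscape_fn_sup_dense) auto
    ultimately show "?S \<in> borel_measurable cfg" by blast
    show "AE \<omega> in cfg. norm (?S \<omega>) \<le> norm (1 + (1 / \<Lambda>) ^ Suc m * ?T \<omega> ^ Suc m)"
      using AE_good AE_space
    proof eventually_elim
      case (elim \<omega>)
      let ?t = "?T \<omega> / \<Lambda>"
      have t0: "0 \<le> ?t" using Lambda_pos by simp
      \<comment> \<open>The constant covers \<open>?t \<le> 1\<close>; above 1 the integer power
        \<open>Suc m\<close> exceeds \<open>p\<close> and has a finite moment.\<close>
      have tp: "?t powr p \<le> 1 + ?t ^ Suc m"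
      proof (cases "?t \<le> 1")
        case True
        then have "?t powr p \<le> 1" using t0 p by (intro powr_le1) auto
        moreover have "0 \<le> ?t ^ Suc m" using t0 by (rule zero_le_power)
        ultimately show ?thesis by linarith
      next
        case False
        then have "?t powr p \<le> ?t powr real (Suc m)" using m by (intro powr_mono) auto
        also have "\<dots> = ?t ^ Suc m" using False by (intro powr_realpow) auto
        finally show ?thesis by linarith
      qed
      have le: "landscape_fn x \<omega> powr p \<le> 1 + ?t ^ Suc m" if "x \<in> unit_cell" for x
        using powr_mono2[of p "landscape_fn x \<omega>" ?t] landscape_fn_le_total[OF elim that] landscape_fn_nonneg p tp
        by (meson less_imp_le order_trans zero_less_one)
      have ne: "(unit_cell :: (real^'n) set) \<noteq> {}" using dense by blast
      have "?S \<omega> \<le> 1 + ?t ^ Suc m" by (rule cSUP_least[OF ne le])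
      moreover have "0 \<le> ?S \<omega>"
      proof -
        obtain x :: "real^'n" where x: "x \<in> unit_cell" using ne by blast
        have "landscape_fn x \<omega> powr p \<le> ?S \<omega>" using p by (intro cSUP_upper[OF x landscape_fn_bdd[OF elim(2)]]) auto
        then show ?thesis using powr_ge_zero[of "landscape_fn x \<omega>" p] by linarith
      qed
      moreover have "?t ^ Suc m = (1 / \<Lambda>) ^ Suc m * ?T \<omega> ^ Suc m"
        by (simp only: power_mult_distrib[symmetric]) simp
      moreover have "0 \<le> ?t ^ Suc m" using t0 by (rule zero_le_power)
      ultimately show ?case by (simp only: real_norm_def)
    qed
  qed
qed

end

section \<open>Uniqueness\<close>

lemma laplacian_mult:
  fixes f g :: "real^'n::finite \<Rightarrow> real"
  assumes f: "smooth f" and g: "smooth g"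
  shows "laplacian (\<lambda>x. f x * g x) x = f x * laplacian g x + 2 * (\<Sum>i\<in>UNIV. partial_deriv i f x * partial_deriv i g x) + laplacian f x * g x"
proof -
  have d: "f differentiable (at x)" "g differentiable (at x)" "partial_deriv i f differentiable (at x)" "partial_deriv i g differentiable (at x)" for i x
    using smooth_differentiable smooth_partial_deriv f g by blast+
  have "partial_deriv i (partial_deriv i (\<lambda>x. f x * g x)) x
      = f x * partial_deriv i (partial_deriv i g) x + 2 * (partial_deriv i f x * partial_deriv i g x) + partial_deriv i (partial_deriv i f) x * g x" for i
  proof -
    have e: "partial_deriv i (\<lambda>x. f x * g x) = (\<lambda>x. f x * partial_deriv i g x + partial_deriv i f x * g x)"
      by (rule ext) (rule partial_deriv_mult[OF d(1,2)])
    have dd: "(\<lambda>x. f x * partial_deriv i g x) differentiable (at x)" "(\<lambda>x. partial_deriv i f x * g x) differentiable (at x)"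
      by (intro differentiable_mult d)+
    show ?thesis
      unfolding e partial_deriv_add[OF dd] partial_deriv_mult[OF d(1) d(4)] partial_deriv_mult[OF d(3) d(2)] by simp
  qed
  then show ?thesis
    by (simp add: laplacian_def sum.distrib sum_distrib_left sum_distrib_right)
qed

lemma partial_deriv_dilate:
  fixes f :: "real^'n::finite \<Rightarrow> real"
  assumes "smooth f"
  shows "partial_deriv i (\<lambda>x. f (a + c *\<^sub>R x)) = (\<lambda>x. c * partial_deriv i f (a + c *\<^sub>R x))"
  by (rule ext) (rule partial_deriv_affine[OF smooth_differentiable[OF assms]])

lemma laplacian_dilate:
  fixes f :: "real^'n::finite \<Rightarrow> real"
  assumes "smooth f"
  shows "laplacian (\<lambda>x. f (a + c *\<^sub>R x)) x = c\<^sup>2 * laplacian f (a + c *\<^sub>R x)"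
proof -
  have "partial_deriv i (partial_deriv i (\<lambda>x. f (a + c *\<^sub>R x))) x = c\<^sup>2 * partial_deriv i (partial_deriv i f) (a + c *\<^sub>R x)" for i
  proof -
    have d: "(\<lambda>x. partial_deriv i f (a + c *\<^sub>R x)) differentiable (at x)"
      by (rule smooth_differentiable[OF smooth_affine[OF smooth_partial_deriv[OF assms]]])
    have "(\<lambda>x. c) differentiable (at x)" by simp
    from partial_deriv_mult[OF this d, of i] show ?thesis
      unfolding partial_deriv_dilate[OF assms] partial_deriv_dilate[OF smooth_partial_deriv[OF assms]]
      by (simp add: partial_deriv_eq[OF has_derivative_const] power2_eq_square)
  qed
  then show ?thesis by (simp add: laplacian_def sum_distrib_left)
qed

context
  fixes l :: real assumes l: "0 < l"
begin

lemma nn_integral_step_duality: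
  fixes f g :: "real^'n::finite \<Rightarrow> ennreal"
  assumes [measurable]: "f \<in> borel_measurable borel" "g \<in> borel_measurable borel"
  shows "(\<integral>\<^sup>+x. f x * (\<integral>\<^sup>+z. g (x + snd z) \<partial>step l k) \<partial>lborel) = (\<integral>\<^sup>+x. g x * (\<integral>\<^sup>+z. f (x + snd z) \<partial>step l k) \<partial>lborel)"
proof -
  have sym: "resolvent_kernel l k (y - x) = resolvent_kernel l k (x - y)" for x y :: "real^'n"
    using resolvent_kernel_minus[of l k "x - y"] by simp
  have "(\<integral>\<^sup>+x. f x * (\<integral>\<^sup>+z. g (x + snd z) \<partial>step l k) \<partial>lborel) = (\<integral>\<^sup>+x. \<integral>\<^sup>+y. f x * (resolvent_kernel l k (y - x) * g y) \<partial>lborel \<partial>lborel)"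
    by (simp add: nn_integral_step_add nn_integral_cmult)
  also have "\<dots> = (\<integral>\<^sup>+y. \<integral>\<^sup>+x. f x * (resolvent_kernel l k (y - x) * g y) \<partial>lborel \<partial>lborel)"
    by (rule lborel_pair.Fubini') measurable
  also have "\<dots> = (\<integral>\<^sup>+y. \<integral>\<^sup>+x. g y * (resolvent_kernel l k (x - y) * f x) \<partial>lborel \<partial>lborel)"
    unfolding sym[of _ _] by (simp only: mult_ac sym)
  also have "\<dots> = (\<integral>\<^sup>+y. g y * (\<integral>\<^sup>+z. f (y + snd z) \<partial>step l k) \<partial>lborel)"
    by (simp add: nn_integral_step_add nn_integral_cmult)
  finally show ?thesis .
qed

text \<open>Derivatives commute with the step average, so \<open>integral_step_resolvent\<close>
  also says that the averaged function itself solves the resolvent equation with right side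
  \<open>l f\<close>.\<close>

lemma step_average_partial:
  fixes f :: "real^'n::finite \<Rightarrow> real"
  assumes f: "f \<in> Cc_infty UNIV"
  shows "l * (LINT z|step l 0. f (x + snd z)) - laplacian (\<lambda>x. LINT z|step l 0. f (x + snd z)) x = l * f x"
proof -
  have "partial_deriv i (partial_deriv i (\<lambda>x. LINT z|step l 0. f (x + snd z))) x = (LINT z|step l 0. partial_deriv i (partial_deriv i f) (x + snd z))" for i
    by (simp add: partial_deriv_step_average[OF l f] partial_deriv_step_average[OF l Cc_infty_partial_deriv[OF f]])
  then have "laplacian (\<lambda>x. LINT z|step l 0. f (x + snd z)) x = (LINT z|step l 0. laplacian f (x + snd z))"
    unfolding laplacian_def
    by (simp add: Bochner_Integration.integral_sum integrable_step_test[OF l] Cc_infty_partial_deriv f)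
  then show ?thesis
    using integral_step_resolvent[OF l f, of x] integrable_step_test[OF l f, of 0 x] integrable_step_test[OF l Cc_infty_laplacian[OF f], of 0 x]
    by (simp add: Bochner_Integration.integral_diff)
qed

text \<open>Formally the weak equation is tested with \<open>\<Psi> = P \<eta>\<close>, for which
  \<open>(l - \<Delta>) \<Psi> = l \<eta>\<close>. As \<open>\<Psi>\<close> has unbounded support it
  is multiplied by dilated cutoffs; \<open>loc\<close> and the symmetry of \<open>P\<close> make
  \<open>w \<Psi>\<close> and \<open>w\<close> times the first derivatives of \<open>\<Psi>\<close>
  integrable, which dominates the error terms.\<close>

lemma resolvent_uniqueness_test:
  fixes w q \<kappa> \<eta> :: "real^'n::finite \<Rightarrow> real"
  assumes wm: "w \<in> borel_measurable borel" and qm: "q \<in> borel_measurable borel"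
    and q: "\<And>x. 0 \<le> q x" "\<And>x. q x \<le> 1"
    and L2: "L2_loc w"
    and eq: "\<And>\<psi>. \<psi> \<in> Cc_infty UNIV \<Longrightarrow> (LINT x|lborel. w x * (l * \<psi> x - laplacian \<psi> x)) = (LINT x|lborel. l * q x * w x * \<psi> x)"
    and loc: "\<And>R. (\<integral>\<^sup>+x. (\<integral>\<^sup>+z. ennreal \<bar>w (x + snd z)\<bar> \<partial>step l 0) * indicator (cball 0 R) x \<partial>lborel) < \<infinity>"
    and \<kappa>: "\<kappa> \<in> Cc_infty UNIV" "\<kappa> x0 \<noteq> 0"
    and \<eta>: "\<eta> \<in> Cc_infty UNIV"
  shows "(LINT x|lborel. w x * \<eta> x) = (LINT x|lborel. q x * w x * (LINT z|step l 0. \<eta> (x + snd z)))"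
    and "integrable lborel (\<lambda>x. w x * (LINT z|step l 0. \<eta> (x + snd z)))"
proof -
  define \<Psi> where "\<Psi> x = (LINT z|step l 0. \<eta> (x + snd z))" for x
  have smooth: "smooth \<Psi>" unfolding \<Psi>_def[abs_def] by (rule smooth_step_average[OF l \<eta>])
  have d\<Psi>: "partial_deriv i \<Psi> x = (LINT z|step l 0. partial_deriv i \<eta> (x + snd z))" for i x
    unfolding \<Psi>_def[abs_def] partial_deriv_step_average[OF l \<eta>] ..
  have lap: "l * \<Psi> x - laplacian \<Psi> x = l * \<eta> x" for x
    unfolding \<Psi>_def[abs_def] by (rule step_average_partial[OF \<eta>])
  have intw: "integrable lborel (\<lambda>x. w x * (LINT z|step l 0. \<psi> (x + snd z)))" if \<psi>: "\<psi> \<in> Cc_infty UNIV" for \<psi>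
  proof (rule integrableI_bounded)
    have \<psi>m: "\<psi> \<in> borel_measurable borel" by (rule Cc_infty_measurable[OF \<psi>])
    have am: "(\<lambda>x. LINT z|step l 0. \<psi> (x + snd z)) \<in> borel_measurable borel"
      by (rule borel_measurable_continuous_onI[OF smooth_continuous[OF smooth_step_average[OF l \<psi>]]])
    show "(\<lambda>x. w x * (LINT z|step l 0. \<psi> (x + snd z))) \<in> borel_measurable lborel"
      using borel_measurable_times[OF wm am] by (simp only: measurable_lborel2)
    have nm: "(\<lambda>x. ennreal \<bar>w x\<bar>) \<in> borel_measurable borel" "(\<lambda>x. ennreal \<bar>\<psi> x\<bar>) \<in> borel_measurable borel"
      using wm \<psi>m by measurable
    have "(\<integral>\<^sup>+x. ennreal (norm (w x * (LINT z|step l 0. \<psi> (x + snd z)))) \<partial>lborel) \<le> (\<integral>\<^sup>+x. ennreal \<bar>w x\<bar> * (\<integral>\<^sup>+z. ennreal \<bar>\<psi> (x + snd z)\<bar> \<partial>step l 0) \<partial>lborel)"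
    proof (rule nn_integral_mono)
      fix x
      have "ennreal \<bar>LINT z|step l 0. \<psi> (x + snd z)\<bar> \<le> (\<integral>\<^sup>+z. ennreal \<bar>\<psi> (x + snd z)\<bar> \<partial>step l 0)"
        using integral_norm_bound_ennreal[OF integrable_step_test[OF l \<psi>, of 0 x]] by simp
      then show "ennreal (norm (w x * (LINT z|step l 0. \<psi> (x + snd z)))) \<le> ennreal \<bar>w x\<bar> * (\<integral>\<^sup>+z. ennreal \<bar>\<psi> (x + snd z)\<bar> \<partial>step l 0)"
        by (simp add: abs_mult ennreal_mult mult_left_mono)
    qed
    also have "\<dots> = (\<integral>\<^sup>+x. ennreal \<bar>\<psi> x\<bar> * (\<integral>\<^sup>+z. ennreal \<bar>w (x + snd z)\<bar> \<partial>step l 0) \<partial>lborel)"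
      by (rule nn_integral_step_duality[OF nm])
    also have "\<dots> < \<infinity>"
    proof (rule nn_integral_test_finite[OF l \<psi>])
      show "(\<lambda>x. \<integral>\<^sup>+z. ennreal \<bar>w (x + snd z)\<bar> \<partial>step l 0) \<in> borel_measurable borel"
        unfolding nn_integral_step_add[OF nm(1)] using nm(1) by measurable
    qed (rule loc)
    finally show "(\<integral>\<^sup>+x. ennreal (norm (w x * (LINT z|step l 0. \<psi> (x + snd z)))) \<partial>lborel) < \<infinity>" .
  qed
  show "integrable lborel (\<lambda>x. w x * (LINT z|step l 0. \<eta> (x + snd z)))" by (rule intw[OF \<eta>])
  have iw\<Psi>: "integrable lborel (\<lambda>x. w x * \<Psi> x)" unfolding \<Psi>_def by (rule intw[OF \<eta>])
  have iwd\<Psi>: "integrable lborel (\<lambda>x. w x * partial_deriv i \<Psi> x)" for i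
    unfolding d\<Psi> by (rule intw[OF Cc_infty_partial_deriv[OF \<eta>]])
  have iw\<eta>: "integrable lborel (\<lambda>x. w x * \<eta> x)" by (rule L2_loc_test[OF L2 \<eta>])
  obtain C0 where C0: "C0 > 0" "\<And>x. \<bar>\<kappa> x\<bar> \<le> C0" using Cc_infty_bounded_by[OF \<kappa>(1)] by metis
  have "\<exists>C. \<forall>x. \<bar>partial_deriv i \<kappa> x\<bar> \<le> C" for i
    using Cc_infty_bounded_by[OF Cc_infty_partial_deriv[OF \<kappa>(1)], of i] by metis
  then obtain C1 where C1: "\<And>i x. \<bar>partial_deriv i \<kappa> x\<bar> \<le> C1 i" by metis
  obtain C2 where C2: "\<And>x. \<bar>laplacian \<kappa> x\<bar> \<le> C2" using Cc_infty_bounded_by[OF Cc_infty_laplacian[OF \<kappa>(1)]] by metis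
  have s\<kappa>: "smooth \<kappa>" by (rule Cc_infty_smooth[OF \<kappa>(1)])
  define r where "r n = 1 / real (Suc n)" for n
  have r: "0 < r n" "r n \<le> 1" for n by (auto simp: r_def)
  have r0: "r \<longlonglongrightarrow> 0" unfolding r_def[abs_def] using LIMSEQ_inverse_real_of_nat by (simp add: inverse_eq_divide)
  \<comment> \<open>Dilation flattens \<open>\<kappa>\<close> to the nonzero constant
    \<open>\<kappa> x0\<close>, which is divided out at the end; each derivative of the cutoff
    brings a factor \<open>r n\<close> tending to 0.\<close>
  define \<kappa>n where "\<kappa>n n x = \<kappa> (x0 + r n *\<^sub>R x)" for n x
  have \<kappa>n: "\<kappa>n n \<in> Cc_infty UNIV" for n
    unfolding \<kappa>n_def[abs_def] using r(1)[of n] by (intro Cc_infty_affine[OF \<kappa>(1)]) simp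
  \<comment> \<open>This is \<open>(l - \<Delta>) (\<kappa>n n \<Psi>)\<close> with the Laplacian of
    \<open>\<Psi>\<close> eliminated by the resolvent equation, so that only \<open>\<eta>\<close>,
    \<open>\<Psi>\<close> and first derivatives of \<open>\<Psi>\<close> are left to
    dominate.\<close>
  define s where "s n x = \<kappa>n n x * (l * \<eta> x) - 2 * (\<Sum>i\<in>UNIV. r n * partial_deriv i \<kappa> (x0 + r n *\<^sub>R x) * partial_deriv i \<Psi> x) - (r n)\<^sup>2 * laplacian \<kappa> (x0 + r n *\<^sub>R x) * \<Psi> x" for n x
  have s_eq: "l * (\<kappa>n n x * \<Psi> x) - laplacian (\<lambda>x. \<kappa>n n x * \<Psi> x) x = s n x" for n x
  proof -
    have "laplacian (\<lambda>x. \<kappa>n n x * \<Psi> x) x = \<kappa>n n x * laplacian \<Psi> x + 2 * (\<Sum>i\<in>UNIV. r n * partial_deriv i \<kappa> (x0 + r n *\<^sub>R x) * partial_deriv i \<Psi> x) + (r n)\<^sup>2 * laplacian \<kappa> (x0 + r n *\<^sub>R x) * \<Psi> x"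
      using laplacian_mult[OF Cc_infty_smooth[OF \<kappa>n] smooth, of n x]
      unfolding \<kappa>n_def[abs_def] partial_deriv_dilate[OF s\<kappa>] laplacian_dilate[OF s\<kappa>] by simp
    moreover have "laplacian \<Psi> x = l * \<Psi> x - l * \<eta> x" using lap[of x] by simp
    ultimately show ?thesis by (simp add: s_def algebra_simps)
  qed
  have c\<kappa>: "continuous_on UNIV \<kappa>" "continuous_on UNIV (partial_deriv i \<kappa>)" "continuous_on UNIV (laplacian \<kappa>)" for i
    by (rule smooth_continuous[OF s\<kappa>], rule smooth_continuous[OF smooth_partial_deriv[OF s\<kappa>]],
        rule smooth_continuous[OF Cc_infty_smooth[OF Cc_infty_laplacian[OF \<kappa>(1)]]])
  have arg: "(\<lambda>n. x0 + r n *\<^sub>R x) \<longlonglongrightarrow> x0" for x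
    using tendsto_add[OF tendsto_const tendsto_scaleR[OF r0 tendsto_const], of x0 x] by simp
  have lim\<kappa>: "(\<lambda>n. \<kappa>n n x) \<longlonglongrightarrow> \<kappa> x0" for x
    unfolding \<kappa>n_def by (rule continuous_on_tendsto_compose[OF c\<kappa>(1) arg]) auto
  have lims: "(\<lambda>n. s n x) \<longlonglongrightarrow> \<kappa> x0 * (l * \<eta> x)" for x
  proof -
    have d: "(\<lambda>n. partial_deriv i \<kappa> (x0 + r n *\<^sub>R x)) \<longlonglongrightarrow> partial_deriv i \<kappa> x0" for i
      by (rule continuous_on_tendsto_compose[OF c\<kappa>(2) arg]) auto
    have L: "(\<lambda>n. laplacian \<kappa> (x0 + r n *\<^sub>R x)) \<longlonglongrightarrow> laplacian \<kappa> x0"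
      by (rule continuous_on_tendsto_compose[OF c\<kappa>(3) arg]) auto
    have "(\<lambda>n. s n x) \<longlonglongrightarrow> \<kappa> x0 * (l * \<eta> x) - 2 * (\<Sum>i\<in>UNIV. 0 * partial_deriv i \<kappa> x0 * partial_deriv i \<Psi> x) - 0\<^sup>2 * laplacian \<kappa> x0 * \<Psi> x"
      unfolding s_def by (intro tendsto_diff tendsto_mult tendsto_const tendsto_sum tendsto_power lim\<kappa> d L r0)
    then show ?thesis by simp
  qed
  have wl: "w \<in> borel_measurable lborel" using wm by (simp only: measurable_lborel2)
  have sm: "s n \<in> borel_measurable borel" for n
  proof (rule borel_measurable_continuous_onI)
    have a: "continuous_on UNIV (\<lambda>x. x0 + r n *\<^sub>R x)" by (intro continuous_intros)
    note c = smooth_continuous[OF smooth] smooth_continuous[OF smooth_partial_deriv[OF smooth]]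
       smooth_continuous[OF Cc_infty_smooth[OF \<eta>]] smooth_continuous[OF Cc_infty_smooth[OF \<kappa>n]]
       continuous_on_compose2[OF c\<kappa>(2) a] continuous_on_compose2[OF c\<kappa>(3) a]
    show "continuous_on UNIV (s n)"
      unfolding s_def[abs_def]
      by (intro continuous_on_diff continuous_on_mult continuous_on_const continuous_on_sum c) auto
  qed
  have lim1: "(\<lambda>n. LINT x|lborel. w x * s n x) \<longlonglongrightarrow> (LINT x|lborel. w x * (\<kappa> x0 * (l * \<eta> x)))"
  proof (rule integral_dominated_convergence[where w="\<lambda>x. (C0 * l) * \<bar>w x * \<eta> x\<bar> + 2 * (\<Sum>i\<in>UNIV. C1 i * \<bar>w x * partial_deriv i \<Psi> x\<bar>) + C2 * \<bar>w x * \<Psi> x\<bar>"])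
    show "(\<lambda>x. w x * (\<kappa> x0 * (l * \<eta> x))) \<in> borel_measurable lborel"
      using wm Cc_infty_measurable[OF \<eta>] by measurable
    show "(\<lambda>x. w x * s n x) \<in> borel_measurable lborel" for n
      using borel_measurable_times[OF wm sm[of n]] by (simp only: measurable_lborel2)
    show "integrable lborel (\<lambda>x. (C0 * l) * \<bar>w x * \<eta> x\<bar> + 2 * (\<Sum>i\<in>UNIV. C1 i * \<bar>w x * partial_deriv i \<Psi> x\<bar>) + C2 * \<bar>w x * \<Psi> x\<bar>)"
      by (intro Bochner_Integration.integrable_add integrable_mult_right Bochner_Integration.integrable_sum integrable_abs iw\<eta> iw\<Psi> iwd\<Psi>)
    show "AE x in lborel. (\<lambda>n. w x * s n x) \<longlonglongrightarrow> w x * (\<kappa> x0 * (l * \<eta> x))"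
      by (intro AE_I2 tendsto_mult tendsto_const lims)
    show "AE x in lborel. norm (w x * s n x) \<le> (C0 * l) * \<bar>w x * \<eta> x\<bar> + 2 * (\<Sum>i\<in>UNIV. C1 i * \<bar>w x * partial_deriv i \<Psi> x\<bar>) + C2 * \<bar>w x * \<Psi> x\<bar>" for n
    proof (rule AE_I2)
      fix x
      have 1: "\<bar>\<kappa>n n x * (l * \<eta> x)\<bar> \<le> C0 * l * \<bar>\<eta> x\<bar>"
        using C0(2)[of "x0 + r n *\<^sub>R x"] l by (simp add: \<kappa>n_def abs_mult mult.assoc mult_right_mono)
      have 2: "\<bar>\<Sum>i\<in>UNIV. r n * partial_deriv i \<kappa> (x0 + r n *\<^sub>R x) * partial_deriv i \<Psi> x\<bar> \<le> (\<Sum>i\<in>UNIV. C1 i * \<bar>partial_deriv i \<Psi> x\<bar>)"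
      proof (rule order_trans[OF sum_abs sum_mono])
        fix i
        have "\<bar>r n * partial_deriv i \<kappa> (x0 + r n *\<^sub>R x)\<bar> \<le> 1 * C1 i"
          using r[of n] C1 unfolding abs_mult by (intro mult_mono) auto
        then show "\<bar>r n * partial_deriv i \<kappa> (x0 + r n *\<^sub>R x) * partial_deriv i \<Psi> x\<bar> \<le> C1 i * \<bar>partial_deriv i \<Psi> x\<bar>"
          unfolding abs_mult[of _ "partial_deriv i \<Psi> x"] by (intro mult_right_mono) auto
      qed
      have 3: "\<bar>(r n)\<^sup>2 * laplacian \<kappa> (x0 + r n *\<^sub>R x) * \<Psi> x\<bar> \<le> C2 * \<bar>\<Psi> x\<bar>"
      proof -
        have "\<bar>(r n)\<^sup>2 * laplacian \<kappa> (x0 + r n *\<^sub>R x)\<bar> \<le> 1 * C2"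
          using r[of n] C2 unfolding abs_mult by (intro mult_mono) (auto simp: power_le_one)
        then show ?thesis unfolding abs_mult[of _ "\<Psi> x"] by (intro mult_right_mono) auto
      qed
      have "\<bar>s n x\<bar> \<le> C0 * l * \<bar>\<eta> x\<bar> + 2 * (\<Sum>i\<in>UNIV. C1 i * \<bar>partial_deriv i \<Psi> x\<bar>) + C2 * \<bar>\<Psi> x\<bar>"
        using 1 2 3 unfolding s_def by linarith
      then have "\<bar>w x\<bar> * \<bar>s n x\<bar> \<le> \<bar>w x\<bar> * (C0 * l * \<bar>\<eta> x\<bar> + 2 * (\<Sum>i\<in>UNIV. C1 i * \<bar>partial_deriv i \<Psi> x\<bar>) + C2 * \<bar>\<Psi> x\<bar>)"
        by (rule mult_left_mono) simp
      also have "\<dots> = (C0 * l) * \<bar>w x * \<eta> x\<bar> + 2 * (\<Sum>i\<in>UNIV. C1 i * \<bar>w x * partial_deriv i \<Psi> x\<bar>) + C2 * \<bar>w x * \<Psi> x\<bar>"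
        by (simp add: abs_mult distrib_left sum_distrib_left mult_ac)
      finally show "norm (w x * s n x) \<le> (C0 * l) * \<bar>w x * \<eta> x\<bar> + 2 * (\<Sum>i\<in>UNIV. C1 i * \<bar>w x * partial_deriv i \<Psi> x\<bar>) + C2 * \<bar>w x * \<Psi> x\<bar>"
        by (simp add: abs_mult)
    qed
  qed
  have lim2: "(\<lambda>n. LINT x|lborel. l * q x * w x * (\<kappa>n n x * \<Psi> x)) \<longlonglongrightarrow> (LINT x|lborel. l * q x * w x * (\<kappa> x0 * \<Psi> x))"
  proof (rule integral_dominated_convergence[where w="\<lambda>x. (l * C0) * \<bar>w x * \<Psi> x\<bar>"])
    have \<Psi>m: "\<Psi> \<in> borel_measurable borel" by (rule borel_measurable_continuous_onI[OF smooth_continuous[OF smooth]])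
    show "(\<lambda>x. l * q x * w x * (\<kappa> x0 * \<Psi> x)) \<in> borel_measurable lborel"
      using wm qm \<Psi>m by measurable
    show "(\<lambda>x. l * q x * w x * (\<kappa>n n x * \<Psi> x)) \<in> borel_measurable lborel" for n
      using wm qm \<Psi>m Cc_infty_measurable[OF \<kappa>n[of n]] by measurable
    show "integrable lborel (\<lambda>x. (l * C0) * \<bar>w x * \<Psi> x\<bar>)"
      by (intro integrable_mult_right integrable_abs iw\<Psi>)
    show "AE x in lborel. (\<lambda>n. l * q x * w x * (\<kappa>n n x * \<Psi> x)) \<longlonglongrightarrow> l * q x * w x * (\<kappa> x0 * \<Psi> x)"
      by (intro AE_I2 tendsto_mult tendsto_const lim\<kappa>)
    show "AE x in lborel. norm (l * q x * w x * (\<kappa>n n x * \<Psi> x)) \<le> (l * C0) * \<bar>w x * \<Psi> x\<bar>" for n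
    proof (rule AE_I2)
      fix x
      have "norm (l * q x * w x * (\<kappa>n n x * \<Psi> x)) = (l * \<bar>\<kappa>n n x\<bar>) * (q x * \<bar>w x * \<Psi> x\<bar>)"
        using l q(1)[of x] by (simp add: abs_mult mult_ac)
      also have "\<dots> \<le> (l * C0) * (1 * \<bar>w x * \<Psi> x\<bar>)"
        using l q[of x] C0 by (intro mult_mono mult_nonneg_nonneg) (auto simp: \<kappa>n_def)
      finally show "norm (l * q x * w x * (\<kappa>n n x * \<Psi> x)) \<le> (l * C0) * \<bar>w x * \<Psi> x\<bar>" by simp
    qed
  qed
  have "(LINT x|lborel. w x * s n x) = (LINT x|lborel. l * q x * w x * (\<kappa>n n x * \<Psi> x))" for n
    using eq[OF Cc_infty_mult[OF \<kappa>n smooth], of n] unfolding s_eq .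
  then have "(LINT x|lborel. w x * (\<kappa> x0 * (l * \<eta> x))) = (LINT x|lborel. l * q x * w x * (\<kappa> x0 * \<Psi> x))"
    using lim1 lim2 LIMSEQ_unique by simp
  moreover have "(LINT x|lborel. w x * (\<kappa> x0 * (l * \<eta> x))) = (\<kappa> x0 * l) * (LINT x|lborel. w x * \<eta> x)"
    by (subst integral_mult_right_zero[symmetric]) (simp only: mult_ac)
  moreover have "(LINT x|lborel. l * q x * w x * (\<kappa> x0 * \<Psi> x)) = (\<kappa> x0 * l) * (LINT x|lborel. q x * w x * \<Psi> x)"
    by (subst integral_mult_right_zero[symmetric]) (simp only: mult_ac)
  ultimately show "(LINT x|lborel. w x * \<eta> x) = (LINT x|lborel. q x * w x * (LINT z|step l 0. \<eta> (x + snd z)))"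
    using \<kappa>(2) l by (simp add: \<Psi>_def)
qed

text \<open>The previous lemma and duality show that \<open>w - P (q w)\<close> annihilates every
  test function, so it vanishes almost everywhere. The conclusion keeps only the inequality for
  absolute values, since the \<open>ennreal\<close> form can be iterated.\<close>

lemma resolvent_uniqueness:
  fixes w q \<kappa> :: "real^'n::finite \<Rightarrow> real"
  assumes wm: "w \<in> borel_measurable borel" and qm: "q \<in> borel_measurable borel"
    and q: "\<And>x. 0 \<le> q x" "\<And>x. q x \<le> 1"
    and L2: "L2_loc w"
    and eq: "\<And>\<psi>. \<psi> \<in> Cc_infty UNIV \<Longrightarrow> (LINT x|lborel. w x * (l * \<psi> x - laplacian \<psi> x)) = (LINT x|lborel. l * q x * w x * \<psi> x)"
    and loc: "\<And>R. (\<integral>\<^sup>+x. (\<integral>\<^sup>+z. ennreal \<bar>w (x + snd z)\<bar> \<partial>step l 0) * indicator (cball 0 R) x \<partial>lborel) < \<infinity>"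
    and \<kappa>: "\<kappa> \<in> Cc_infty UNIV" "\<kappa> x0 \<noteq> 0"
  shows "AE x in lborel. ennreal \<bar>w x\<bar> \<le> (\<integral>\<^sup>+z. ennreal (q (x + snd z)) * ennreal \<bar>w (x + snd z)\<bar> \<partial>step l 0)"
proof -
  let ?F = "\<lambda>x. q x * w x"
  \<comment> \<open>The factor 1 is the weight \<open>c\<close> in
    \<open>integral_step_duality\<close>.\<close>
  let ?P = "\<lambda>x. LINT z|step l 0. 1 * ?F (x + snd z)"
  have Fm: "?F \<in> borel_measurable borel" using wm qm by measurable
  interpret S: prob_space "step l 0 :: (real \<times> (real^'n)) measure" by (rule prob_space_step[OF l])
  have "(\<lambda>(x, z). 1 * ?F (x + snd z)) \<in> borel_measurable (borel \<Otimes>\<^sub>M step l 0)"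
  proof -
    have "(\<lambda>p. fst p + snd (snd p)) \<in> borel_measurable (borel \<Otimes>\<^sub>M (step l 0 :: (real \<times> (real^'n)) measure))" by measurable
    from measurable_compose[OF this Fm] show ?thesis by (simp only: case_prod_beta' mult_1)
  qed
  then have Pm: "?P \<in> borel_measurable borel" by (rule S.borel_measurable_lebesgue_integral)
  have Fw: "\<bar>?F x\<bar> \<le> \<bar>w x\<bar>" for x using q[of x] by (simp add: abs_mult mult_left_le_one_le)
  have Ploc: "(\<integral>\<^sup>+x. (\<integral>\<^sup>+z. ennreal \<bar>?F (x + snd z)\<bar> \<partial>step l 0) * indicator (cball 0 R) x \<partial>lborel) < \<infinity>" for R
  proof -
    have "(\<integral>\<^sup>+x. (\<integral>\<^sup>+z. ennreal \<bar>?F (x + snd z)\<bar> \<partial>step l 0) * indicator (cball 0 R) x \<partial>lborel) \<le> (\<integral>\<^sup>+x. (\<integral>\<^sup>+z. ennreal \<bar>w (x + snd z)\<bar> \<partial>step l 0) * indicator (cball 0 R) x \<partial>lborel)"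
      by (intro nn_integral_mono mult_right_mono ennreal_leI Fw) auto
    also have "\<dots> < \<infinity>" by (rule loc)
    finally show ?thesis .
  qed
  have Pn: "ennreal \<bar>?P x\<bar> \<le> (\<integral>\<^sup>+z. ennreal \<bar>?F (x + snd z)\<bar> \<partial>step l 0)" for x
  proof (cases "integrable (step l 0) (\<lambda>z. 1 * ?F (x + snd z))")
    case True
    then show ?thesis using integral_norm_bound_ennreal[OF True] by simp
  qed (simp add: not_integrable_integral_eq)
  have nFm: "(\<lambda>x. ennreal \<bar>?F x\<bar>) \<in> borel_measurable borel" using Fm by measurable
  have nPm: "(\<lambda>x. \<integral>\<^sup>+z. ennreal \<bar>?F (x + snd z)\<bar> \<partial>step l 0) \<in> borel_measurable borel"
    unfolding nn_integral_step_add[OF nFm] using nFm by measurable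
  have iP: "integrable lborel (\<lambda>x. ?P x * indicator (cball 0 R) x)" for R
  proof (rule integrableI_bounded)
    show "(\<lambda>x. ?P x * indicator (cball 0 R) x) \<in> borel_measurable lborel"
      using borel_measurable_times[OF Pm borel_measurable_indicator[OF cball_borel]] by (simp only: measurable_lborel2)
    have "(\<integral>\<^sup>+x. ennreal (norm (?P x * indicator (cball 0 R) x)) \<partial>lborel) \<le> (\<integral>\<^sup>+x. (\<integral>\<^sup>+z. ennreal \<bar>?F (x + snd z)\<bar> \<partial>step l 0) * indicator (cball 0 R) x \<partial>lborel)"
    proof (rule nn_integral_mono)
      fix x
      show "ennreal (norm (?P x * indicator (cball 0 R) x)) \<le> (\<integral>\<^sup>+z. ennreal \<bar>?F (x + snd z)\<bar> \<partial>step l 0) * indicator (cball 0 R) x"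
        using Pn[of x] by (cases "x \<in> cball 0 R") simp_all
    qed
    also have "\<dots> < \<infinity>" by (rule Ploc)
    finally show "(\<integral>\<^sup>+x. ennreal (norm (?P x * indicator (cball 0 R) x)) \<partial>lborel) < \<infinity>" .
  qed
  have "AE x in lborel. w x - ?P x = 0"
  proof (rule fundamental_lemma[OF _ _ \<kappa>])
    show "integrable lborel (\<lambda>x. (w x - ?P x) * indicator (cball 0 R) x)" for R
      unfolding left_diff_distrib by (rule Bochner_Integration.integrable_diff[OF L2_loc_integrable[OF L2] iP])
    show "(\<lambda>x. w x - ?P x) \<in> borel_measurable borel" by (rule borel_measurable_diff[OF wm Pm])
    fix \<eta> :: "real^'n \<Rightarrow> real" assume \<eta>: "\<eta> \<in> Cc_infty UNIV"
    have \<eta>m: "\<eta> \<in> borel_measurable borel" by (rule Cc_infty_measurable[OF \<eta>])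
    have "(LINT x|lborel. \<eta> x * ?P x) = (LINT x|lborel. ?F x * (LINT z|step l 0. 1 * \<eta> (x - snd z)))"
      using nn_integral_test_finite[OF l \<eta> nPm Ploc] Fm \<eta>m
      by (intro integral_step_duality(1)[OF l]) auto
    also have "\<dots> = (LINT x|lborel. ?F x * (LINT z|step l 0. \<eta> (x + snd z)))"
    proof -
      have "(\<lambda>z. \<eta> (x + snd z)) \<in> borel_measurable (borel \<Otimes>\<^sub>M borel)" for x using \<eta>m by measurable
      from integral_step_reflect[OF l this, of 0] show ?thesis by simp
    qed
    also have "\<dots> = (LINT x|lborel. w x * \<eta> x)"
      using resolvent_uniqueness_test(1)[OF wm qm q L2 eq loc \<kappa> \<eta>] by simp
    finally have e: "(LINT x|lborel. ?P x * \<eta> x) = (LINT x|lborel. w x * \<eta> x)" by (simp only: mult.commute)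
    have i: "integrable lborel (\<lambda>x. ?P x * \<eta> x)" by (rule locally_integrable_test[OF iP Pm \<eta>])
    have "(LINT x|lborel. (w x - ?P x) * \<eta> x) = (LINT x|lborel. w x * \<eta> x) - (LINT x|lborel. ?P x * \<eta> x)"
      unfolding left_diff_distrib by (rule Bochner_Integration.integral_diff[OF L2_loc_test[OF L2 \<eta>] i])
    then show "(LINT x|lborel. (w x - ?P x) * \<eta> x) = 0" using e by simp
  qed
  then show ?thesis
  proof eventually_elim
    case (elim x)
    then have "ennreal \<bar>w x\<bar> = ennreal \<bar>?P x\<bar>" by simp
    also have "\<dots> \<le> (\<integral>\<^sup>+z. ennreal \<bar>?F (x + snd z)\<bar> \<partial>step l 0)" by (rule Pn)
    also have "\<dots> = (\<integral>\<^sup>+z. ennreal (q (x + snd z)) * ennreal \<bar>w (x + snd z)\<bar> \<partial>step l 0)"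
      using q(1) by (simp add: abs_mult ennreal_mult)
    finally show ?case .
  qed
qed

end

section \<open>Tiling of space by lattice cells\<close>

text \<open>The lattice is summed through its enumeration \<open>to_nat\<close>, with zero outside
  the range; the indicators of the tiles then form a partition of unity over the natural
  numbers.\<close>

lemma suminf_lattice_single:
  fixes j0 :: "int^'n::finite"
  assumes "\<And>j. P j \<longleftrightarrow> j = j0"
  shows "(\<Sum>n. if n \<in> range (to_nat :: int^'n \<Rightarrow> nat) then (if P (from_nat n) then 1 else 0) else 0 :: ennreal) = 1"
proof -
  have "(if n \<in> range (to_nat :: int^'n \<Rightarrow> nat) then (if P (from_nat n) then 1 else 0) else 0 :: ennreal) = (if n = to_nat j0 then 1 else 0)" for n
  proof (cases "n \<in> range (to_nat :: int^'n \<Rightarrow> nat)")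
    case True
    then obtain j :: "int^'n" where j: "n = to_nat j" by blast
    then show ?thesis by (simp add: assms)
  next
    case False
    then show ?thesis by auto
  qed
  then show ?thesis using sums_unique[OF sums_single[of "to_nat j0" "\<lambda>_. 1 :: ennreal"]] by simp
qed

lemma nn_integral_tiles:
  fixes g :: "real^'n::finite \<Rightarrow> ennreal"
  assumes [measurable]: "g \<in> borel_measurable borel"
  shows "(\<integral>\<^sup>+x. g x \<partial>lborel) = (\<Sum>n. if n \<in> range (to_nat :: int^'n \<Rightarrow> nat) then (\<integral>\<^sup>+x. g (x + lattice_pt (from_nat n)) * indicator unit_cell x \<partial>lborel) else 0)"
proof -
  let ?t = "\<lambda>n (x :: real^'n). if n \<in> range (to_nat :: int^'n \<Rightarrow> nat) then (if x - lattice_pt (from_nat n) \<in> unit_cell then 1 else 0) else 0 :: ennreal"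
  have tile: "(\<Sum>n. ?t n x) = 1" for x
    by (rule suminf_lattice_single[of "\<lambda>j. x - lattice_pt j \<in> unit_cell" "cell x"]) (auto simp: cell_iff[symmetric])
  have t_eq: "?t n x = (if n \<in> range (to_nat :: int^'n \<Rightarrow> nat) then indicator unit_cell (x - lattice_pt (from_nat n)) else 0)" for n x
    by (simp add: indicator_def)
  have tm: "?t n \<in> borel_measurable borel" for n
    unfolding t_eq by measurable
  have "(\<integral>\<^sup>+x. g x \<partial>lborel) = (\<integral>\<^sup>+x. (\<Sum>n. ?t n x * g x) \<partial>lborel)"
    by (simp only: ennreal_suminf_multc tile mult_1)
  also have "\<dots> = (\<Sum>n. \<integral>\<^sup>+x. ?t n x * g x \<partial>lborel)"
    using tm by (intro nn_integral_suminf) measurable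
  also have "(\<lambda>n. \<integral>\<^sup>+x. ?t n x * g x \<partial>lborel) = (\<lambda>n. if n \<in> range (to_nat :: int^'n \<Rightarrow> nat) then (\<integral>\<^sup>+x. g (x + lattice_pt (from_nat n)) * indicator unit_cell x \<partial>lborel) else 0)"
  proof
    fix n
    show "(\<integral>\<^sup>+x. ?t n x * g x \<partial>lborel) = (if n \<in> range (to_nat :: int^'n \<Rightarrow> nat) then (\<integral>\<^sup>+x. g (x + lattice_pt (from_nat n)) * indicator unit_cell x \<partial>lborel) else 0)"
    proof (cases "n \<in> range (to_nat :: int^'n \<Rightarrow> nat)")
      case True
      let ?l = "lattice_pt (from_nat n :: int^'n)"
      have "(\<integral>\<^sup>+x. ?t n x * g x \<partial>lborel) = (\<integral>\<^sup>+x. indicator unit_cell (x - ?l) * g x \<partial>lborel)"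
        by (intro nn_integral_cong) (use True in \<open>simp add: indicator_def\<close>)
      also have "\<dots> = (\<integral>\<^sup>+x. indicator unit_cell (?l + x - ?l) * g (?l + x) \<partial>lborel)"
        by (rule nn_integral_translate[symmetric]) measurable
      also have "\<dots> = (\<integral>\<^sup>+x. g (x + ?l) * indicator unit_cell x \<partial>lborel)"
        by (simp add: add.commute mult.commute)
      finally show ?thesis using True by simp
    qed simp
  qed
  finally show ?thesis .
qed

text \<open>The shifted cell is cut along the lattice and its pieces are moved back into the unit
  cell; periodicity leaves the integrand unchanged and the pieces fill the cell exactly
  once.\<close>

lemma nn_integral_unit_cell_translate:
  fixes e :: "real^'n::finite \<Rightarrow> ennreal"
  assumes [measurable]: "e \<in> borel_measurable borel" and per: "\<And>x z. e (x + lattice_pt z) = e x"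
  shows "(\<integral>\<^sup>+x. e (x + y) * indicator unit_cell x \<partial>lborel) = (\<integral>\<^sup>+x. e x * indicator unit_cell x \<partial>lborel)"
proof -
  let ?t = "\<lambda>n (x :: real^'n). if n \<in> range (to_nat :: int^'n \<Rightarrow> nat) then (if x - y + lattice_pt (from_nat n) \<in> unit_cell then 1 else 0) else 0 :: ennreal"
  have tile: "(\<Sum>n. ?t n x) = 1" for x
  proof (rule suminf_lattice_single[of "\<lambda>j. x - y + lattice_pt j \<in> unit_cell" "- cell (x - y)"])
    fix j :: "int^'n"
    show "x - y + lattice_pt j \<in> unit_cell \<longleftrightarrow> j = - cell (x - y)"
      using cell_iff[of "x - y" "- j"] by (auto simp: lattice_pt_minus)
  qed
  have t_eq: "?t n x = (if n \<in> range (to_nat :: int^'n \<Rightarrow> nat) then indicator unit_cell (x - y + lattice_pt (from_nat n)) else 0)" for n x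
    by (simp add: indicator_def)
  have tm: "?t n \<in> borel_measurable borel" for n
    unfolding t_eq by measurable
  have "(\<integral>\<^sup>+x. e (x + y) * indicator unit_cell x \<partial>lborel) = (\<integral>\<^sup>+x. e x * indicator unit_cell (x - y) \<partial>lborel)"
    using nn_integral_translate[of "\<lambda>x. e x * indicator unit_cell (x - y)" y] by (simp add: add.commute)
  also have "\<dots> = (\<Sum>n. if n \<in> range (to_nat :: int^'n \<Rightarrow> nat) then (\<integral>\<^sup>+x. e (x + lattice_pt (from_nat n)) * indicator unit_cell (x + lattice_pt (from_nat n) - y) * indicator unit_cell x \<partial>lborel) else 0)"
    by (rule nn_integral_tiles) measurable
  also have "\<dots> = (\<Sum>n. \<integral>\<^sup>+x. ?t n x * (e x * indicator unit_cell x) \<partial>lborel)"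
  proof (rule suminf_cong)
    fix n
    have "x + lattice_pt (from_nat n) - y = x - y + lattice_pt (from_nat n)" for x :: "real^'n" by simp
    then show "(if n \<in> range (to_nat :: int^'n \<Rightarrow> nat) then (\<integral>\<^sup>+x. e (x + lattice_pt (from_nat n)) * indicator unit_cell (x + lattice_pt (from_nat n) - y) * indicator unit_cell x \<partial>lborel) else 0)
      = (\<integral>\<^sup>+x. ?t n x * (e x * indicator unit_cell x) \<partial>lborel)"
      by (cases "n \<in> range (to_nat :: int^'n \<Rightarrow> nat)") (simp_all only: indicator_def of_bool_def per if_True if_False mult_ac mult_zero_left nn_integral_const)
  qed
  also have "\<dots> = (\<integral>\<^sup>+x. (\<Sum>n. ?t n x * (e x * indicator unit_cell x)) \<partial>lborel)"
    using tm by (intro nn_integral_suminf[symmetric]) measurable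
  also have "\<dots> = (\<integral>\<^sup>+x. e x * indicator unit_cell x \<partial>lborel)"
    by (simp only: ennreal_suminf_multc tile mult_1)
  finally show ?thesis .
qed

lemma finite_lattice_box: "finite {j :: int^'n::finite. \<forall>i. \<bar>j $ i\<bar> \<le> N}"
proof (rule finite_imageD)
  have "vec_nth ` {j :: int^'n. \<forall>i. \<bar>j $ i\<bar> \<le> N} \<subseteq> PiE UNIV (\<lambda>_. {-N..N})"
    by (auto simp: abs_le_iff) (metis minus_le_iff)
  moreover have "finite (PiE (UNIV :: 'n set) (\<lambda>_. {-N..N}))" by (intro finite_PiE) auto
  ultimately show "finite (vec_nth ` {j :: int^'n. \<forall>i. \<bar>j $ i\<bar> \<le> N})" by (rule finite_subset)
qed (simp add: inj_on_def vec_nth_inject)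

lemma finite_cells: "finite (cell ` cball (0::real^'n::finite) R)"
proof (rule finite_subset[OF _ finite_lattice_box[of "\<lceil>R\<rceil> + 1"]], safe)
  fix x :: "real^'n" and i assume "x \<in> cball 0 R"
  then have x: "\<bar>x $ i\<bar> \<le> R" using component_le_norm_cart[of x i] by simp
  have "\<bar>x $ i - of_int (cell x $ i)\<bar> \<le> 1"
    unfolding cell_def vec_lambda_beta using floor_correct[of "x $ i + 1/2"] by (simp add: abs_le_iff, linarith)
  moreover have "R \<le> of_int \<lceil>R\<rceil>" by simp
  ultimately have "\<bar>of_int (cell x $ i)\<bar> \<le> (of_int (\<lceil>R\<rceil> + 1) :: real)" using x by (simp, linarith)
  then show "\<bar>cell x $ i\<bar> \<le> \<lceil>R\<rceil> + 1" by linarith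
qed

lemma nn_integral_cball_finite:
  fixes g :: "real^'n::finite \<Rightarrow> ennreal"
  assumes [measurable]: "g \<in> borel_measurable borel"
    and fin: "\<And>z. (\<integral>\<^sup>+x. g (x + lattice_pt z) * indicator unit_cell x \<partial>lborel) \<noteq> \<infinity>"
  shows "(\<integral>\<^sup>+x. g x * indicator (cball 0 R) x \<partial>lborel) < \<infinity>"
proof -
  let ?Z = "cell ` cball (0::real^'n) R"
  have "(\<integral>\<^sup>+x. g x * indicator (cball 0 R) x \<partial>lborel) \<le> (\<integral>\<^sup>+x. (\<Sum>z\<in>?Z. g x * indicator unit_cell (x - lattice_pt z)) \<partial>lborel)"
  proof (rule nn_integral_mono)
    fix x :: "real^'n"
    show "g x * indicator (cball 0 R) x \<le> (\<Sum>z\<in>?Z. g x * indicator unit_cell (x - lattice_pt z))"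
    proof (cases "x \<in> cball 0 R")
      case True
      then have "cell x \<in> ?Z" by (rule imageI)
      then have "g x * indicator unit_cell (x - lattice_pt (cell x)) \<le> (\<Sum>z\<in>?Z. g x * indicator unit_cell (x - lattice_pt z))"
        by (rule member_le_sum) (auto simp: finite_cells)
      moreover have "x - lattice_pt (cell x) \<in> unit_cell" using cell_iff by blast
      ultimately show ?thesis using True by simp
    qed simp
  qed
  also have "\<dots> = (\<Sum>z\<in>?Z. \<integral>\<^sup>+x. g x * indicator unit_cell (x - lattice_pt z) \<partial>lborel)"
    by (rule nn_integral_sum) measurable
  also have "\<dots> = (\<Sum>z\<in>?Z. \<integral>\<^sup>+x. g (x + lattice_pt z) * indicator unit_cell x \<partial>lborel)"
  proof (rule sum.cong[OF refl])
    fix z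
    show "(\<integral>\<^sup>+x. g x * indicator unit_cell (x - lattice_pt z) \<partial>lborel) = (\<integral>\<^sup>+x. g (x + lattice_pt z) * indicator unit_cell x \<partial>lborel)"
      using nn_integral_translate[of "\<lambda>x. g x * indicator unit_cell (x - lattice_pt z)" "lattice_pt z"] by (simp add: add.commute)
  qed
  also have "\<dots> < \<infinity>"
    using fin finite_cells[of R, where 'n='n] by (simp add: less_top)
  finally show ?thesis .
qed

text \<open>Applying the definition of the weak gradient to the partial derivatives of
  \<open>\<psi>\<close> eliminates the gradient and puts both derivatives on the test
  function.\<close>

lemma weak_solution_distribution:
  fixes f W :: "real^'n::finite \<Rightarrow> real"
  assumes sol: "weak_landscape_solution W f" and f: "L2_loc f" and \<psi>: "\<psi> \<in> Cc_infty UNIV"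
  shows "(LINT x|lborel. W x * f x * \<psi> x) - (LINT x|lborel. f x * laplacian \<psi> x) = (LINT x|lborel. \<psi> x)"
proof -
  obtain g where g: "L2_loc g" "weak_gradient f g"
    "(LINT x|lborel. g x \<bullet> gradient \<psi> x) + (LINT x|lborel. W x * f x * \<psi> x) = (LINT x|lborel. \<psi> x)"
    using sol \<psi> unfolding weak_landscape_solution_def by blast
  note d\<psi> = Cc_infty_partial_deriv[OF \<psi>]
  have "(LINT x|lborel. g x \<bullet> gradient \<psi> x) = (LINT x|lborel. (\<Sum>i\<in>UNIV. g x $ i * partial_deriv i \<psi> x))"
    by (simp add: inner_vec_def gradient_def)
  also have "\<dots> = (\<Sum>i\<in>UNIV. (LINT x|lborel. g x $ i * partial_deriv i \<psi> x))"
    by (rule Bochner_Integration.integral_sum) (rule L2_loc_test[OF L2_loc_component[OF g(1)] d\<psi>])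
  also have "\<dots> = (\<Sum>i\<in>UNIV. - (LINT x|lborel. f x * partial_deriv i (partial_deriv i \<psi>) x))"
    using g(2) d\<psi> unfolding weak_gradient_def by simp
  also have "\<dots> = - (LINT x|lborel. (\<Sum>i\<in>UNIV. f x * partial_deriv i (partial_deriv i \<psi>) x))"
    by (subst Bochner_Integration.integral_sum) (auto simp: sum_negf intro!: L2_loc_test f Cc_infty_partial_deriv d\<psi>)
  also have "\<dots> = - (LINT x|lborel. f x * laplacian \<psi> x)" by (simp add: laplacian_def sum_distrib_left)
  finally show ?thesis using g(3) by simp
qed

lemma nonpos_of_le_inverse:
  fixes a b :: real
  assumes "\<And>m::nat. a \<le> b / real (Suc m)" shows "a \<le> 0"
proof -
  have "(\<lambda>m. b / real (Suc m)) \<longlonglongrightarrow> 0"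
    using tendsto_mult_right_zero[OF LIMSEQ_inverse_real_of_nat, of b] by (simp add: divide_inverse)
  then show ?thesis by (rule LIMSEQ_le_const) (use assms in blast)
qed

section \<open>Cell averages of stationary fields\<close>

context landscape
begin

lemma mean_local:
  fixes f :: "real^'n \<Rightarrow> 'n config \<Rightarrow> ennreal"
  assumes f: "(\<lambda>(x, \<omega>). f x \<omega>) \<in> borel_measurable (borel \<Otimes>\<^sub>M cfg)"
  shows "(\<integral>\<^sup>+\<omega>. \<integral>\<^sup>+x. f x \<omega> * indicator unit_cell x \<partial>lborel \<partial>cfg) = (\<integral>\<^sup>+x. (\<integral>\<^sup>+\<omega>. f x \<omega> \<partial>cfg) * indicator unit_cell x \<partial>lborel)"
    and "(\<lambda>\<omega>. \<integral>\<^sup>+x. f x \<omega> * indicator unit_cell x \<partial>lborel) \<in> borel_measurable cfg"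
    and "(\<lambda>x. \<integral>\<^sup>+\<omega>. f x \<omega> \<partial>cfg) \<in> borel_measurable borel"
proof -
  interpret P: pair_sigma_finite lborel cfg ..
  have "(\<lambda>p. indicator unit_cell (fst p) :: ennreal) \<in> borel_measurable (borel \<Otimes>\<^sub>M cfg)"
    by (rule measurable_compose[OF measurable_fst]) simp
  moreover have "(\<lambda>p. f (fst p) (snd p)) \<in> borel_measurable (borel \<Otimes>\<^sub>M cfg)" using f by (simp only: case_prod_beta')
  ultimately have fQ: "(\<lambda>(x, \<omega>). f x \<omega> * indicator unit_cell x) \<in> borel_measurable (lborel \<Otimes>\<^sub>M cfg)"
    unfolding lborel_pair_borel case_prod_beta' by (intro borel_measurable_times_ennreal)
  have "(\<integral>\<^sup>+\<omega>. \<integral>\<^sup>+x. f x \<omega> * indicator unit_cell x \<partial>lborel \<partial>cfg) = (\<integral>\<^sup>+x. \<integral>\<^sup>+\<omega>. f x \<omega> * indicator unit_cell x \<partial>cfg \<partial>lborel)"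
    by (rule P.Fubini'[OF fQ])
  also have "\<dots> = (\<integral>\<^sup>+x. (\<integral>\<^sup>+\<omega>. f x \<omega> \<partial>cfg) * indicator unit_cell x \<partial>lborel)"
    by (intro nn_integral_cong nn_integral_multc section_measurable(2)[OF f])
  finally show "(\<integral>\<^sup>+\<omega>. \<integral>\<^sup>+x. f x \<omega> * indicator unit_cell x \<partial>lborel \<partial>cfg) = (\<integral>\<^sup>+x. (\<integral>\<^sup>+\<omega>. f x \<omega> \<partial>cfg) * indicator unit_cell x \<partial>lborel)" .
  show "(\<lambda>\<omega>. \<integral>\<^sup>+x. f x \<omega> * indicator unit_cell x \<partial>lborel) \<in> borel_measurable cfg"
    using measurable_pair_swap[OF fQ]
    by (intro lborel.borel_measurable_nn_integral) (simp only: case_prod_beta' fst_conv snd_conv)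
  show "(\<lambda>x. \<integral>\<^sup>+\<omega>. f x \<omega> \<partial>cfg) \<in> borel_measurable borel"
    by (rule cfg.borel_measurable_nn_integral[OF f])
qed

text \<open>The mean of a stationary field is a periodic function of \<open>x\<close>. For each
  fixed displacement its integral over the translated cell is unchanged, and the displacement law
  has mass one.\<close>

lemma mean_step_unit_cell:
  fixes f :: "real^'n \<Rightarrow> 'n config \<Rightarrow> ennreal"
  assumes f: "(\<lambda>(x, \<omega>). f x \<omega>) \<in> borel_measurable (borel \<Otimes>\<^sub>M cfg)"
    and stat: "\<And>\<omega> x z. \<omega> \<in> space cfg \<Longrightarrow> f (x + lattice_pt z) \<omega> = f x (shift z \<omega>)"
  shows "(\<integral>\<^sup>+\<omega>. \<integral>\<^sup>+x. (\<integral>\<^sup>+z. f (x + snd z) \<omega> \<partial>step \<Lambda> 0) * indicator unit_cell x \<partial>lborel \<partial>cfg) = (\<integral>\<^sup>+\<omega>. \<integral>\<^sup>+x. f x \<omega> * indicator unit_cell x \<partial>lborel \<partial>cfg)"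
proof -
  define e where "e x = (\<integral>\<^sup>+\<omega>. f x \<omega> \<partial>cfg)" for x
  have em: "e \<in> borel_measurable borel" unfolding e_def[abs_def] by (rule mean_local(3)[OF f])
  have per: "e (x + lattice_pt z) = e x" for x z
  proof -
    have "e (x + lattice_pt z) = (\<integral>\<^sup>+\<omega>. f x (shift z \<omega>) \<partial>cfg)"
      unfolding e_def by (intro nn_integral_cong stat)
    also have "\<dots> = e x" unfolding e_def by (rule nn_integral_shift[OF section_measurable(2)[OF f]])
    finally show ?thesis .
  qed
  interpret P: pair_sigma_finite "step \<Lambda> 0 :: (real \<times> (real^'n)) measure" cfg ..
  interpret L: pair_sigma_finite "step \<Lambda> 0 :: (real \<times> (real^'n)) measure" "lborel :: (real^'n) measure" ..
  have m1: "(\<lambda>(x, \<omega>). \<integral>\<^sup>+z. f (x + snd z) \<omega> \<partial>step \<Lambda> 0) \<in> borel_measurable (borel \<Otimes>\<^sub>M cfg)"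
    using step_average_measurable[OF f borel_measurable_const[of 1], of 0] by (simp only: mult_1)
  have "(\<integral>\<^sup>+\<omega>. \<integral>\<^sup>+z. f (x + snd z) \<omega> \<partial>step \<Lambda> 0 \<partial>cfg) = (\<integral>\<^sup>+z. e (x + snd z) \<partial>step \<Lambda> 0)" for x
  proof -
    have "(\<lambda>p. (x + snd (fst p), snd p)) \<in> step \<Lambda> 0 \<Otimes>\<^sub>M cfg \<rightarrow>\<^sub>M borel \<Otimes>\<^sub>M cfg" by measurable
    from measurable_compose[OF this f]
    have "(\<lambda>(z, \<omega>). f (x + snd z) \<omega>) \<in> borel_measurable (step \<Lambda> 0 \<Otimes>\<^sub>M cfg)"
      by (simp only: case_prod_beta' fst_conv snd_conv)
    then show ?thesis unfolding e_def by (rule P.Fubini')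
  qed
  then have "(\<integral>\<^sup>+\<omega>. \<integral>\<^sup>+x. (\<integral>\<^sup>+z. f (x + snd z) \<omega> \<partial>step \<Lambda> 0) * indicator unit_cell x \<partial>lborel \<partial>cfg) = (\<integral>\<^sup>+x. (\<integral>\<^sup>+z. e (x + snd z) \<partial>step \<Lambda> 0) * indicator unit_cell x \<partial>lborel)"
    unfolding mean_local(1)[OF m1] by (simp only:)
  also have "\<dots> = (\<integral>\<^sup>+x. \<integral>\<^sup>+z. e (x + snd z) * indicator unit_cell x \<partial>step \<Lambda> 0 \<partial>lborel)"
    by (intro nn_integral_cong nn_integral_multc[symmetric] measurable_compose[OF _ em]) simp
  also have "\<dots> = (\<integral>\<^sup>+z. \<integral>\<^sup>+x. e (x + snd z) * indicator unit_cell x \<partial>lborel \<partial>step \<Lambda> 0)"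
  proof (rule L.Fubini')
    have "(\<lambda>p. snd p + snd (fst p)) \<in> borel_measurable (step \<Lambda> 0 \<Otimes>\<^sub>M (lborel :: (real^'n) measure))" by measurable
    from borel_measurable_times_ennreal[OF measurable_compose[OF this em] measurable_compose[OF measurable_snd borel_measurable_indicator, of unit_cell lborel]]
    show "(\<lambda>(z, x). e (x + snd z) * indicator unit_cell x) \<in> borel_measurable (step \<Lambda> 0 \<Otimes>\<^sub>M lborel)"
      by (simp add: case_prod_beta')
  qed
  also have "\<dots> = (\<integral>\<^sup>+z. (\<integral>\<^sup>+x. e x * indicator unit_cell x \<partial>lborel) \<partial>(step \<Lambda> 0 :: (real \<times> (real^'n)) measure))"
    unfolding nn_integral_unit_cell_translate[OF em per] ..
  also have "\<dots> = (\<integral>\<^sup>+x. e x * indicator unit_cell x \<partial>lborel)"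
    using walk.emeasure_space_1[of 0] by (simp only: nn_integral_const mult_1_right)
  also have "\<dots> = (\<integral>\<^sup>+\<omega>. \<integral>\<^sup>+x. f x \<omega> * indicator unit_cell x \<partial>lborel \<partial>cfg)"
    unfolding mean_local(1)[OF f] e_def ..
  finally show ?thesis .
qed

lemma mean_killed_le:
  fixes f :: "real^'n \<Rightarrow> 'n config \<Rightarrow> ennreal"
  assumes f: "(\<lambda>(x, \<omega>). f x \<omega>) \<in> borel_measurable (borel \<Otimes>\<^sub>M cfg)"
    and stat: "\<And>\<omega> x z. \<omega> \<in> space cfg \<Longrightarrow> f (x + lattice_pt z) \<omega> = f x (shift z \<omega>)"
  shows "(\<integral>\<^sup>+\<omega>. \<integral>\<^sup>+x. killed {} \<omega> n (\<lambda>y. f y \<omega>) x * indicator unit_cell x \<partial>lborel \<partial>cfg) \<le> (\<integral>\<^sup>+\<omega>. \<integral>\<^sup>+x. f x \<omega> * indicator unit_cell x \<partial>lborel \<partial>cfg)"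
proof (induction n)
  case (Suc n)
  let ?f = "\<lambda>x \<omega>. killed {} \<omega> n (\<lambda>y. f y \<omega>) x"
  have "killed {} \<omega> (Suc n) (\<lambda>y. f y \<omega>) x \<le> (\<integral>\<^sup>+z. ?f (x + snd z) \<omega> \<partial>step \<Lambda> 0)" for x \<omega>
  proof -
    have "ennreal (survival {} \<omega> y) * a \<le> a" for y a
      using mult_right_mono[of "ennreal (survival {} \<omega> y)" 1 a] survival_range by simp
    then show ?thesis
      unfolding funpow.simps(2)[of n] o_def killed_step_def[of "{}" \<omega> "killed {} \<omega> n (\<lambda>y. f y \<omega>)"]
      by (intro nn_integral_mono)
  qed
  then have "(\<integral>\<^sup>+\<omega>. \<integral>\<^sup>+x. killed {} \<omega> (Suc n) (\<lambda>y. f y \<omega>) x * indicator unit_cell x \<partial>lborel \<partial>cfg) \<le> (\<integral>\<^sup>+\<omega>. \<integral>\<^sup>+x. (\<integral>\<^sup>+z. ?f (x + snd z) \<omega> \<partial>step \<Lambda> 0) * indicator unit_cell x \<partial>lborel \<partial>cfg)"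
    by (intro nn_integral_mono mult_right_mono) auto
  also have "\<dots> = (\<integral>\<^sup>+\<omega>. \<integral>\<^sup>+x. ?f x \<omega> * indicator unit_cell x \<partial>lborel \<partial>cfg)"
  proof (rule mean_step_unit_cell[OF killed_measurable[OF f]])
    fix \<omega> x z assume "\<omega> \<in> space cfg"
    then show "?f (x + lattice_pt z) \<omega> = ?f x (shift z \<omega>)" by (intro killed_shift stat)
  qed
  finally show ?case using Suc by (rule order_trans)
qed simp

lemma killed_affine:
  fixes f :: "real^'n \<Rightarrow> 'n config \<Rightarrow> ennreal"
  assumes f: "(\<lambda>(x, \<omega>). f x \<omega>) \<in> borel_measurable (borel \<Otimes>\<^sub>M cfg)" and \<omega>: "\<omega> \<in> space cfg"
  shows "killed {} \<omega> n (\<lambda>y. a + b * f y \<omega>) x = a * surv {} n \<omega> x + b * killed {} \<omega> n (\<lambda>y. f y \<omega>) x"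
proof (induction n arbitrary: x)
  case (Suc n)
  let ?q = "\<lambda>z. ennreal (survival {} \<omega> (x + snd z))"
  let ?s = "\<lambda>z. surv {} n \<omega> (x + snd z)" and ?k = "\<lambda>z. killed {} \<omega> n (\<lambda>y. f y \<omega>) (x + snd z)"
  have add: "(\<lambda>z. x + snd z) \<in> borel_measurable (step \<Lambda> 0 :: (real \<times> (real^'n)) measure)" by simp
  have qm: "?q \<in> borel_measurable (step \<Lambda> 0)"
    by (rule measurable_compose[OF measurable_compose[OF add survival_measurable_x[OF \<omega>]] measurable_ennreal])
  have m1: "(\<lambda>z. ?q z * ?s z) \<in> borel_measurable (step \<Lambda> 0)"
    by (rule borel_measurable_times_ennreal[OF qm measurable_compose[OF add surv_measurable_x[OF \<omega>]]])
  have m2: "(\<lambda>z. ?q z * ?k z) \<in> borel_measurable (step \<Lambda> 0)"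
    by (rule borel_measurable_times_ennreal[OF qm measurable_compose[OF add section_measurable(1)[OF killed_measurable[OF f] \<omega>]]])
  have "killed {} \<omega> (Suc n) (\<lambda>y. a + b * f y \<omega>) x = (\<integral>\<^sup>+z. a * (?q z * ?s z) + b * (?q z * ?k z) \<partial>step \<Lambda> 0)"
    unfolding funpow.simps(2)[of n] o_def killed_step_def[of "{}" \<omega> "killed {} \<omega> n (\<lambda>y. a + b * f y \<omega>)"] Suc
    by (simp only: distrib_left mult_ac)
  also have "\<dots> = a * (\<integral>\<^sup>+z. ?q z * ?s z \<partial>step \<Lambda> 0) + b * (\<integral>\<^sup>+z. ?q z * ?k z \<partial>step \<Lambda> 0)"
    using borel_measurable_times_ennreal[OF borel_measurable_const m1, of a] borel_measurable_times_ennreal[OF borel_measurable_const m2, of b]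
    by (simp only: nn_integral_add nn_integral_cmult[OF m1] nn_integral_cmult[OF m2])
  also have "\<dots> = a * surv {} (Suc n) \<omega> x + b * killed {} \<omega> (Suc n) (\<lambda>y. f y \<omega>) x"
    unfolding surv_Suc funpow.simps(2)[of n] o_def killed_step_def[of "{}" \<omega> "surv {} n \<omega>"] killed_step_def[of "{}" \<omega> "killed {} \<omega> n (\<lambda>y. f y \<omega>)"] ..
  finally show ?case .
qed simp

text \<open>Decay of order one suffices: with \<open>n + 1 = K\<^sup>2\<close> steps,
  \<open>K\<close> times this bound is still of order \<open>1 / K\<close>.\<close>

lemma mean_surv_unit_cell:
  "\<exists>C\<ge>0. \<forall>n. (\<integral>\<^sup>+\<omega>. \<integral>\<^sup>+x. surv {} n \<omega> x * indicator unit_cell x \<partial>lborel \<partial>cfg) \<le> ennreal (C / real (Suc n))"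
proof -
  obtain C where C: "C \<ge> 0" "\<And>n x. mean_surv {} n x \<le> ennreal (C / real (Suc n) ^ 1)"
    using mean_surv_decay[of 1] by blast
  define V where "V = measure lborel (unit_cell :: (real^'n) set)"
  have V: "emeasure lborel (unit_cell :: (real^'n) set) = ennreal V"
    unfolding V_def using emeasure_unit_cell[where 'n='n] by (intro emeasure_eq_ennreal_measure) auto
  have "(\<integral>\<^sup>+\<omega>. \<integral>\<^sup>+x. surv {} n \<omega> x * indicator unit_cell x \<partial>lborel \<partial>cfg) \<le> ennreal (C * V / real (Suc n))" for n
  proof -
    have "(\<integral>\<^sup>+\<omega>. \<integral>\<^sup>+x. surv {} n \<omega> x * indicator unit_cell x \<partial>lborel \<partial>cfg) = (\<integral>\<^sup>+x. mean_surv {} n x * indicator unit_cell x \<partial>lborel)"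
      unfolding mean_surv_def by (rule mean_local(1)[OF surv_measurable])
    also have "\<dots> \<le> (\<integral>\<^sup>+x. ennreal (C / real (Suc n) ^ 1) * indicator (unit_cell :: (real^'n) set) x \<partial>lborel)"
      by (intro nn_integral_mono mult_right_mono C) auto
    also have "\<dots> = ennreal (C / real (Suc n) ^ 1) * ennreal V" unfolding V[symmetric] by (rule nn_integral_cmult_indicator) simp
    also have "\<dots> = ennreal (C * V / real (Suc n))"
      using C by (subst ennreal_mult[symmetric]) (auto simp: V_def)
    finally show ?thesis .
  qed
  moreover have "0 \<le> C * V" using C by (simp add: V_def)
  ultimately show ?thesis by blast
qed

end

section \<open>Comparison of two stationary solutions\<close>

lemma L2_loc_diff:
  fixes f g :: "real^'n::finite \<Rightarrow> real"
  assumes f: "L2_loc f" and g: "L2_loc g"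
  shows "L2_loc (\<lambda>x. f x - g x)"
  unfolding L2_loc_def
proof (intro conjI allI impI)
  have [measurable]: "f \<in> borel_measurable lborel" "g \<in> borel_measurable lborel"
    using f g unfolding L2_loc_def by blast+
  show "(\<lambda>x. f x - g x) \<in> borel_measurable lborel" by measurable
  fix K :: "(real^'n) set" assume K: "compact K"
  then have [measurable]: "K \<in> sets lborel" by (simp add: borel_compact)
  have "integrable lborel (\<lambda>x. 2 * (indicator K x *\<^sub>R (norm (f x))\<^sup>2) + 2 * (indicator K x *\<^sub>R (norm (g x))\<^sup>2))"
    using f g K unfolding L2_loc_def set_integrable_def
    by (intro Bochner_Integration.integrable_add integrable_mult_right) blast+
  then show "set_integrable lborel K (\<lambda>x. (norm (f x - g x))\<^sup>2)"
    unfolding set_integrable_def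
  proof (rule Bochner_Integration.integrable_bound)
    show "AE x in lborel. norm (indicator K x *\<^sub>R (norm (f x - g x))\<^sup>2) \<le> norm (2 * (indicator K x *\<^sub>R (norm (f x))\<^sup>2) + 2 * (indicator K x *\<^sub>R (norm (g x))\<^sup>2))"
    proof (rule AE_I2)
      fix x
      have "0 \<le> (f x + g x)\<^sup>2" by simp
      then have "(f x - g x)\<^sup>2 \<le> 2 * (f x)\<^sup>2 + 2 * (g x)\<^sup>2" by (simp add: power2_eq_square algebra_simps)
      then show "norm (indicator K x *\<^sub>R (norm (f x - g x))\<^sup>2) \<le> norm (2 * (indicator K x *\<^sub>R (norm (f x))\<^sup>2) + 2 * (indicator K x *\<^sub>R (norm (g x))\<^sup>2))"
        by (simp add: indicator_def)
    qed
  qed measurable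
qed

context landscape
begin

lemma weak_solution_test:
  assumes \<omega>: "\<omega> \<in> space cfg" and L2: "L2_loc f" and \<psi>: "\<psi> \<in> Cc_infty UNIV"
    and sol: "weak_landscape_solution (\<lambda>x. \<Lambda> * random_potential \<phi> \<omega> x) f"
  shows "integrable lborel (\<lambda>x. f x * (\<Lambda> * \<psi> x - laplacian \<psi> x))"
    and "integrable lborel (\<lambda>x. \<Lambda> * survival {} \<omega> x * f x * \<psi> x)"
    and "(LINT x|lborel. f x * (\<Lambda> * \<psi> x - laplacian \<psi> x)) = (LINT x|lborel. \<Lambda> * survival {} \<omega> x * f x * \<psi> x) + (LINT x|lborel. \<psi> x)"
proof -
  have i1: "integrable lborel (\<lambda>x. f x * \<psi> x)" by (rule L2_loc_test[OF L2 \<psi>])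
  have i2: "integrable lborel (\<lambda>x. f x * laplacian \<psi> x)" by (rule L2_loc_test[OF L2 Cc_infty_laplacian[OF \<psi>]])
  have i3: "integrable lborel (\<lambda>x. survival {} \<omega> x * (f x * \<psi> x))"
  proof (rule Bochner_Integration.integrable_bound[OF i1])
    show "(\<lambda>x. survival {} \<omega> x * (f x * \<psi> x)) \<in> borel_measurable lborel"
      unfolding measurable_lborel2
      by (rule borel_measurable_times[OF survival_measurable_x[OF \<omega>] borel_measurable_integrable[OF i1, unfolded measurable_lborel2]])
    show "AE x in lborel. norm (survival {} \<omega> x * (f x * \<psi> x)) \<le> norm (f x * \<psi> x)"
      using survival_range[of "{}" \<omega>] by (intro AE_I2) (simp add: abs_mult mult_left_le_one_le)
  qed
  have e1: "f x * (\<Lambda> * \<psi> x - laplacian \<psi> x) = \<Lambda> * (f x * \<psi> x) - f x * laplacian \<psi> x" for x by (simp add: algebra_simps)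
  have e2: "\<Lambda> * survival {} \<omega> x * f x * \<psi> x = \<Lambda> * (survival {} \<omega> x * (f x * \<psi> x))" for x by simp
  have e3: "\<Lambda> * random_potential \<phi> \<omega> x * f x * \<psi> x = \<Lambda> * (f x * \<psi> x) - \<Lambda> * (survival {} \<omega> x * (f x * \<psi> x))" for x
    unfolding random_potential_eq[OF \<omega>] by (simp add: algebra_simps)
  show "integrable lborel (\<lambda>x. f x * (\<Lambda> * \<psi> x - laplacian \<psi> x))"
    unfolding e1 by (intro Bochner_Integration.integrable_diff integrable_mult_right i1 i2)
  show "integrable lborel (\<lambda>x. \<Lambda> * survival {} \<omega> x * f x * \<psi> x)"
    unfolding e2 by (intro integrable_mult_right i3)
  have "(LINT x|lborel. \<Lambda> * random_potential \<phi> \<omega> x * f x * \<psi> x) = (LINT x|lborel. \<Lambda> * (f x * \<psi> x)) - (LINT x|lborel. \<Lambda> * (survival {} \<omega> x * (f x * \<psi> x)))"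
    unfolding e3 by (intro Bochner_Integration.integral_diff integrable_mult_right i1 i3)
  moreover have "(LINT x|lborel. f x * (\<Lambda> * \<psi> x - laplacian \<psi> x)) = (LINT x|lborel. \<Lambda> * (f x * \<psi> x)) - (LINT x|lborel. f x * laplacian \<psi> x)"
    unfolding e1 by (intro Bochner_Integration.integral_diff integrable_mult_right i1 i2)
  ultimately show "(LINT x|lborel. f x * (\<Lambda> * \<psi> x - laplacian \<psi> x)) = (LINT x|lborel. \<Lambda> * survival {} \<omega> x * f x * \<psi> x) + (LINT x|lborel. \<psi> x)"
    using weak_solution_distribution[OF sol L2 \<psi>] unfolding e2 by linarith
qed

text \<open>The constant right sides cancel in the difference, which makes
  \<open>resolvent_uniqueness\<close> applicable. Its inequality holds only almost everywhere, but
  one step of the walk ignores null sets, so it can be iterated.\<close>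

lemma difference_le_killed:
  assumes \<omega>: "\<omega> \<in> space cfg" and v: "L2_loc v" and u: "L2_loc u"
    and solv: "weak_landscape_solution (\<lambda>x. \<Lambda> * random_potential \<phi> \<omega> x) v"
    and solu: "weak_landscape_solution (\<lambda>x. \<Lambda> * random_potential \<phi> \<omega> x) u"
    and loc: "\<And>R. (\<integral>\<^sup>+x. (\<integral>\<^sup>+z. ennreal \<bar>v (x + snd z) - u (x + snd z)\<bar> \<partial>step \<Lambda> 0) * indicator (cball 0 R) x \<partial>lborel) < \<infinity>"
  shows "AE x in lborel. ennreal \<bar>v x - u x\<bar> \<le> killed {} \<omega> n (\<lambda>y. ennreal \<bar>v y - u y\<bar>) x"
proof -
  let ?w = "\<lambda>x. v x - u x"
  obtain x0 where x0: "\<phi> x0 \<noteq> 0" using phi_nontrivial by blast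
  have vm: "v \<in> borel_measurable borel" and um: "u \<in> borel_measurable borel"
    using v u unfolding L2_loc_def measurable_lborel2 by blast+
  have wm: "?w \<in> borel_measurable borel" by (rule borel_measurable_diff[OF vm um])
  have L2: "L2_loc ?w" by (rule L2_loc_diff[OF v u])
  have eq: "(LINT x|lborel. ?w x * (\<Lambda> * \<psi> x - laplacian \<psi> x)) = (LINT x|lborel. \<Lambda> * survival {} \<omega> x * ?w x * \<psi> x)"
    if \<psi>: "\<psi> \<in> Cc_infty UNIV" for \<psi>
    using weak_solution_test[OF \<omega> v \<psi> solv] weak_solution_test[OF \<omega> u \<psi> solu]
    by (simp only: left_diff_distrib right_diff_distrib[of "\<Lambda> * survival {} \<omega> _"] Bochner_Integration.integral_diff)
  have base: "AE x in lborel. ennreal \<bar>?w x\<bar> \<le> killed_step {} \<omega> (\<lambda>y. ennreal \<bar>?w y\<bar>) x"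
    unfolding killed_step_def
    by (rule resolvent_uniqueness[OF Lambda_pos wm survival_measurable_x[OF \<omega>] survival_range L2 eq loc phi_Cc x0])
  have am: "(\<lambda>y. ennreal \<bar>?w y\<bar>) \<in> borel_measurable borel"
    by (intro measurable_compose[OF _ measurable_ennreal] borel_measurable_abs wm)
  have qm: "(\<lambda>y. ennreal (survival {} \<omega> y)) \<in> borel_measurable borel"
    by (rule measurable_compose[OF survival_measurable_x[OF \<omega>] measurable_ennreal])
  show ?thesis
  proof (induction n)
    case (Suc n)
    \<comment> \<open>The difference is regarded as a field constant in the environment, so that the
      joint measurability of \<open>killed\<close> applies at the fixed
      \<open>\<omega>\<close>.\<close>
    have "(\<lambda>(y, \<omega>). (\<lambda>y (_ :: 'n config). ennreal \<bar>?w y\<bar>) y \<omega>) \<in> borel_measurable (borel \<Otimes>\<^sub>M cfg)"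
      unfolding case_prod_beta' by (rule measurable_compose[OF measurable_fst am])
    note km = section_measurable(1)[OF killed_measurable[OF this, where S="{}" and n=n] \<omega>]
    have step: "killed_step {} \<omega> (\<lambda>y. ennreal \<bar>?w y\<bar>) x \<le> killed {} \<omega> (Suc n) (\<lambda>y. ennreal \<bar>?w y\<bar>) x" for x
      unfolding funpow.simps(2)[of n] o_def killed_step_def[of "{}" \<omega> "\<lambda>y. ennreal \<bar>?w y\<bar>"] killed_step_def[of "{}" \<omega> "killed {} \<omega> n (\<lambda>y. ennreal \<bar>?w y\<bar>)"]
      by (rule nn_integral_step_mono_AE[OF borel_measurable_times_ennreal[OF qm am] borel_measurable_times_ennreal[OF qm km]],
          rule AE_mp[OF Suc], rule AE_I2, rule impI, rule mult_left_mono, assumption, rule zero_le)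
    show ?case by (rule AE_mp[OF base], rule AE_I2, rule impI, erule order_trans[OF _ step])
  qed simp
qed

lemma stationary_killed_zero:
  assumes wm: "(\<lambda>(x, \<omega>). w x \<omega>) \<in> borel_measurable (borel \<Otimes>\<^sub>M cfg)"
    and stat: "\<And>\<omega> x z. \<omega> \<in> space cfg \<Longrightarrow> w (x + lattice_pt z) \<omega> = w x (shift z \<omega>)"
    and sq: "(\<integral>\<^sup>+\<omega>. \<integral>\<^sup>+x. ennreal ((w x \<omega>)\<^sup>2) * indicator unit_cell x \<partial>lborel \<partial>cfg) < \<infinity>"
    and sub: "\<And>n. AE \<omega> in cfg. AE x in lborel. ennreal \<bar>w x \<omega>\<bar> \<le> killed {} \<omega> n (\<lambda>y. ennreal \<bar>w y \<omega>\<bar>) x"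
  shows "AE \<omega> in cfg. AE x in lborel. w x \<omega> = 0"
proof -
  let ?f = "\<lambda>x \<omega>. ennreal \<bar>w x \<omega>\<bar>" and ?g = "\<lambda>x \<omega>. ennreal ((w x \<omega>)\<^sup>2)"
  let ?E = "\<lambda>h. \<integral>\<^sup>+\<omega>. \<integral>\<^sup>+x. h x \<omega> * indicator unit_cell x \<partial>lborel \<partial>cfg"
  have fm: "(\<lambda>(x, \<omega>). ?f x \<omega>) \<in> borel_measurable (borel \<Otimes>\<^sub>M cfg)"
    using wm unfolding case_prod_beta' by (intro measurable_compose[OF _ measurable_ennreal] borel_measurable_abs)
  have gm: "(\<lambda>(x, \<omega>). ?g x \<omega>) \<in> borel_measurable (borel \<Otimes>\<^sub>M cfg)" by (rule square_measurable[OF wm])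
  define I where "I = enn2real (?E ?g)"
  have I: "?E ?g = ennreal I" "0 \<le> I" using sq by (auto simp: I_def)
  obtain C where C: "C \<ge> 0" "\<And>n. ?E (\<lambda>x \<omega>. surv {} n \<omega> x) \<le> ennreal (C / real (Suc n))"
    using mean_surv_unit_cell by blast
  have bound: "?E ?f \<le> ennreal ((C + I) / real (Suc m))" for m
  proof -
    define K where "K = real (Suc m)"
    \<comment> \<open>Chosen so that \<open>Suc n = K * K\<close>, which balances
      \<open>K * C / Suc n\<close> against \<open>I / K\<close>.\<close>
    define n where "n = Suc m * Suc m - 1"
    have K: "K > 0" and n: "real (Suc n) = K * K" by (simp_all add: K_def n_def algebra_simps)
    let ?k = "\<lambda>x \<omega>. killed {} \<omega> n (\<lambda>y. ?g y \<omega>) x"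
    note sm = surv_measurable[where S="{}" and n=n] and km = killed_measurable[OF gm, where S="{}" and n=n]
    \<comment> \<open>Follows from
      \<open>(\<bar>t\<bar> - K)\<^sup>2 + K * \<bar>t\<bar> \<ge> 0\<close>; it trades the
      unbounded difference for a constant, to which the decay applies, and a small multiple of its
      square.\<close>
    have young: "ennreal \<bar>t\<bar> \<le> ennreal K + ennreal (1 / K) * ennreal (t\<^sup>2)" for t
    proof -
      have "0 \<le> (\<bar>t\<bar> - K)\<^sup>2 + K * \<bar>t\<bar>" using K by simp
      then have "\<bar>t\<bar> * K \<le> K * K + t\<^sup>2" by (simp add: power2_eq_square algebra_simps)
      then have "\<bar>t\<bar> \<le> K + 1 / K * t\<^sup>2" using K by (simp add: field_simps)
      then show ?thesis using K by (simp flip: ennreal_mult ennreal_plus)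
    qed
    have "?E ?f \<le> ?E (\<lambda>x \<omega>. ennreal K * surv {} n \<omega> x + ennreal (1 / K) * ?k x \<omega>)"
    proof (rule nn_integral_mono_AE, rule AE_mp[OF sub[of n]], rule AE_I2, rule impI)
      fix \<omega> assume \<omega>: "\<omega> \<in> space cfg" and le: "AE x in lborel. ?f x \<omega> \<le> killed {} \<omega> n (\<lambda>y. ?f y \<omega>) x"
      have kle: "killed {} \<omega> n (\<lambda>y. ?f y \<omega>) x \<le> ennreal K * surv {} n \<omega> x + ennreal (1 / K) * ?k x \<omega>" for x
        unfolding killed_affine[OF gm \<omega>, symmetric] by (rule killed_mono[OF young])
      have "AE x in lborel. ?f x \<omega> * indicator unit_cell x \<le> (ennreal K * surv {} n \<omega> x + ennreal (1 / K) * ?k x \<omega>) * indicator unit_cell x"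
        by (rule AE_mp[OF le], rule AE_I2, rule impI, erule mult_right_mono[OF order_trans[OF _ kle] zero_le])
      then show "(\<integral>\<^sup>+x. ?f x \<omega> * indicator unit_cell x \<partial>lborel) \<le> (\<integral>\<^sup>+x. (ennreal K * surv {} n \<omega> x + ennreal (1 / K) * ?k x \<omega>) * indicator unit_cell x \<partial>lborel)"
        by (rule nn_integral_mono_AE)
    qed
    also have "\<dots> = (\<integral>\<^sup>+\<omega>. ennreal K * (\<integral>\<^sup>+x. surv {} n \<omega> x * indicator unit_cell x \<partial>lborel) + ennreal (1 / K) * (\<integral>\<^sup>+x. ?k x \<omega> * indicator unit_cell x \<partial>lborel) \<partial>cfg)"
    proof (rule nn_integral_cong)
      fix \<omega> assume \<omega>: "\<omega> \<in> space cfg"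
      have s: "(\<lambda>x. surv {} n \<omega> x * indicator unit_cell x) \<in> borel_measurable lborel"
        and k: "(\<lambda>x. ?k x \<omega> * indicator unit_cell x) \<in> borel_measurable lborel"
        unfolding measurable_lborel2
        by (intro borel_measurable_times_ennreal section_measurable(1)[OF sm \<omega>] section_measurable(1)[OF km \<omega>] borel_measurable_indicator; simp)+
      show "(\<integral>\<^sup>+x. (ennreal K * surv {} n \<omega> x + ennreal (1 / K) * ?k x \<omega>) * indicator unit_cell x \<partial>lborel)
        = ennreal K * (\<integral>\<^sup>+x. surv {} n \<omega> x * indicator unit_cell x \<partial>lborel) + ennreal (1 / K) * (\<integral>\<^sup>+x. ?k x \<omega> * indicator unit_cell x \<partial>lborel)"
        unfolding distrib_right mult.assoc nn_integral_cmult[OF s, symmetric] nn_integral_cmult[OF k, symmetric]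
        by (rule nn_integral_add) (rule borel_measurable_times_ennreal[OF borel_measurable_const s] borel_measurable_times_ennreal[OF borel_measurable_const k])+
    qed
    also have "\<dots> = ennreal K * ?E (\<lambda>x \<omega>. surv {} n \<omega> x) + ennreal (1 / K) * ?E ?k"
      unfolding nn_integral_cmult[OF mean_local(2)[OF sm], symmetric] nn_integral_cmult[OF mean_local(2)[OF km], symmetric]
      by (rule nn_integral_add) (rule borel_measurable_times_ennreal[OF borel_measurable_const mean_local(2)[OF sm]] borel_measurable_times_ennreal[OF borel_measurable_const mean_local(2)[OF km]])+
    also have "\<dots> \<le> ennreal K * ennreal (C / real (Suc n)) + ennreal (1 / K) * ennreal I"
      unfolding I(1)[symmetric]
      by (intro add_mono mult_left_mono C(2) mean_killed_le[OF gm]) (simp_all add: stat)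
    also have "\<dots> = ennreal ((C + I) / K)"
      using K C(1) I(2) unfolding n by (simp add: field_simps flip: ennreal_mult ennreal_plus)
    finally show ?thesis unfolding K_def .
  qed
  have fin: "?E ?f < \<infinity>" using bound[of 0] by (rule le_less_trans) simp
  have "enn2real (?E ?f) \<le> (C + I) / real (Suc m)" for m
    using enn2real_mono[OF bound[of m]] C(1) I(2) by (simp add: ennreal_less_top)
  note le = nonpos_of_le_inverse[OF this]
  have "X < \<infinity> \<Longrightarrow> enn2real X \<le> 0 \<Longrightarrow> X = 0" for X
    by (cases X) simp_all
  from this[OF fin le] have zero: "?E ?f = 0" .
  then have "AE \<omega> in cfg. (\<integral>\<^sup>+x. ?f x \<omega> * indicator unit_cell x \<partial>lborel) = 0"
    by (rule iffD1[OF nn_integral_0_iff_AE[OF mean_local(2)[OF fm]]])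
  \<comment> \<open>Vanishing in the unit cell transfers to every cell by shift invariance, with a
    single null set for the countably many shifts.\<close>
  then have AEz: "AE \<omega> in cfg. \<forall>z. (\<integral>\<^sup>+x. ?f x (shift z \<omega>) * indicator unit_cell x \<partial>lborel) = 0"
    unfolding AE_all_countable by (intro allI AE_shift)
  show ?thesis
  proof (rule AE_mp[OF AEz], rule AE_I2, rule impI)
    fix \<omega> assume \<omega>: "\<omega> \<in> space cfg" and z: "\<forall>z. (\<integral>\<^sup>+x. ?f x (shift z \<omega>) * indicator unit_cell x \<partial>lborel) = 0"
    note fx = section_measurable(1)[OF fm \<omega>]
    have "(\<integral>\<^sup>+x. ?f x \<omega> \<partial>lborel) = 0"
      unfolding nn_integral_tiles[OF fx] stat[OF \<omega>] z[rule_format] by simp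
    moreover have "(\<lambda>x. ?f x \<omega>) \<in> borel_measurable lborel" using fx unfolding measurable_lborel2 .
    ultimately have "AE x in lborel. ?f x \<omega> = 0" by (rule iffD1[OF nn_integral_0_iff_AE, rotated])
    then show "AE x in lborel. w x \<omega> = 0" by (rule AE_mp) (rule AE_I2, simp)
  qed
qed

text \<open>Here only the mean over the unit cell is controlled. Shift invariance makes the integral
  over every cell almost surely finite, and a ball meets finitely many cells.\<close>

lemma stationary_local_integral:
  fixes f :: "real^'n \<Rightarrow> 'n config \<Rightarrow> ennreal"
  assumes f: "(\<lambda>(x, \<omega>). f x \<omega>) \<in> borel_measurable (borel \<Otimes>\<^sub>M cfg)"
    and stat: "\<And>\<omega> x z. \<omega> \<in> space cfg \<Longrightarrow> f (x + lattice_pt z) \<omega> = f x (shift z \<omega>)"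
    and fin: "(\<integral>\<^sup>+\<omega>. \<integral>\<^sup>+x. f x \<omega> * indicator unit_cell x \<partial>lborel \<partial>cfg) < \<infinity>"
  shows "AE \<omega> in cfg. \<forall>R. (\<integral>\<^sup>+x. f x \<omega> * indicator (cball 0 R) x \<partial>lborel) < \<infinity>"
proof -
  have "AE \<omega> in cfg. (\<integral>\<^sup>+x. f x \<omega> * indicator unit_cell x \<partial>lborel) \<noteq> \<infinity>"
    using fin by (intro nn_integral_PInf_AE mean_local(2)[OF f]) simp
  then have AEz: "AE \<omega> in cfg. \<forall>z. (\<integral>\<^sup>+x. f x (shift z \<omega>) * indicator unit_cell x \<partial>lborel) \<noteq> \<infinity>"
    unfolding AE_all_countable by (intro allI AE_shift)
  show ?thesis
  proof (rule AE_mp[OF AEz], intro AE_I2 impI allI)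
    fix \<omega> R assume \<omega>: "\<omega> \<in> space cfg" and z: "\<forall>z. (\<integral>\<^sup>+x. f x (shift z \<omega>) * indicator unit_cell x \<partial>lborel) \<noteq> \<infinity>"
    show "(\<integral>\<^sup>+x. f x \<omega> * indicator (cball 0 R) x \<partial>lborel) < \<infinity>"
    proof (rule nn_integral_cball_finite[OF section_measurable(1)[OF f \<omega>]])
      fix j show "(\<integral>\<^sup>+x. f (x + lattice_pt j) \<omega> * indicator unit_cell x \<partial>lborel) \<noteq> \<infinity>"
        unfolding stat[OF \<omega>] using z by blast
    qed
  qed
qed

lemma stationary_landscape_unique:
  assumes v: "stationary_landscape \<phi> \<mu> \<Lambda> v" and u: "stationary_landscape \<phi> \<mu> \<Lambda> u"
  shows "AE \<omega> in cfg. AE x in lborel. v x \<omega> = u x \<omega>"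
proof -
  let ?w = "\<lambda>x \<omega>. v x \<omega> - u x \<omega>"
  let ?f = "\<lambda>x \<omega>. ennreal \<bar>?w x \<omega>\<bar>"
  let ?E = "\<lambda>h. \<integral>\<^sup>+\<omega>. \<integral>\<^sup>+x. h x \<omega> * indicator unit_cell x \<partial>lborel \<partial>cfg"
  note defs = stationary_landscape_def random_field_def stationary_def lborel_pair_borel
  have vm: "(\<lambda>(x, \<omega>). v x \<omega>) \<in> borel_measurable (borel \<Otimes>\<^sub>M cfg)" and um: "(\<lambda>(x, \<omega>). u x \<omega>) \<in> borel_measurable (borel \<Otimes>\<^sub>M cfg)"
    using v u unfolding defs by blast+
  have wm: "(\<lambda>(x, \<omega>). ?w x \<omega>) \<in> borel_measurable (borel \<Otimes>\<^sub>M cfg)"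
    using vm um unfolding case_prod_beta' by (rule borel_measurable_diff)
  have fm: "(\<lambda>(x, \<omega>). ?f x \<omega>) \<in> borel_measurable (borel \<Otimes>\<^sub>M cfg)"
    using wm unfolding case_prod_beta' by (intro measurable_compose[OF _ measurable_ennreal] borel_measurable_abs)
  have stat: "?w (x + lattice_pt z) \<omega> = ?w x (shift z \<omega>)" if "\<omega> \<in> space cfg" for x z \<omega>
  proof -
    have "v (x + lattice_pt z) \<omega> = v x (shift z \<omega>)" "u (x + lattice_pt z) \<omega> = u x (shift z \<omega>)"
      using v u that unfolding defs by blast+
    then show ?thesis by (simp only:)
  qed
  have vI: "?E (\<lambda>x \<omega>. ennreal ((v x \<omega>)\<^sup>2)) < \<infinity>" and uI: "?E (\<lambda>x \<omega>. ennreal ((u x \<omega>)\<^sup>2)) < \<infinity>"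
    using v u unfolding stationary_landscape_def by blast+
  note sq = square_measurable[OF vm] square_measurable[OF um]
  \<comment> \<open>Used with \<open>a = 0\<close> to bound the square of the difference and with
    \<open>a = 1\<close> to bound its absolute value.\<close>
  have sum: "?E (\<lambda>x \<omega>. a + ennreal 2 * ennreal ((v x \<omega>)\<^sup>2) + ennreal 2 * ennreal ((u x \<omega>)\<^sup>2)) < \<infinity>" if a: "a < \<infinity>" for a
  proof -
    have *: "(\<integral>\<^sup>+x. (a + ennreal 2 * ennreal ((v x \<omega>)\<^sup>2) + ennreal 2 * ennreal ((u x \<omega>)\<^sup>2)) * indicator unit_cell x \<partial>lborel)
      = a * emeasure lborel (unit_cell :: (real^'n) set) + ennreal 2 * (\<integral>\<^sup>+x. ennreal ((v x \<omega>)\<^sup>2) * indicator unit_cell x \<partial>lborel)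
        + ennreal 2 * (\<integral>\<^sup>+x. ennreal ((u x \<omega>)\<^sup>2) * indicator unit_cell x \<partial>lborel)" if \<omega>: "\<omega> \<in> space cfg" for \<omega>
    proof -
      have m: "(\<lambda>x. ennreal ((v x \<omega>)\<^sup>2) * indicator unit_cell x) \<in> borel_measurable lborel" "(\<lambda>x. ennreal ((u x \<omega>)\<^sup>2) * indicator unit_cell x) \<in> borel_measurable lborel"
        "(\<lambda>x. a * indicator (unit_cell :: (real^'n) set) x) \<in> borel_measurable lborel"
        unfolding measurable_lborel2
        by (intro borel_measurable_times_ennreal section_measurable(1)[OF sq(1) \<omega>] section_measurable(1)[OF sq(2) \<omega>] borel_measurable_indicator borel_measurable_const; simp)+
      note m2 = borel_measurable_times_ennreal[OF borel_measurable_const m(1), of "ennreal 2"] borel_measurable_times_ennreal[OF borel_measurable_const m(2), of "ennreal 2"]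
      show ?thesis
        unfolding distrib_right mult.assoc nn_integral_add[OF borel_measurable_add[OF m(3) m2(1)] m2(2)] nn_integral_add[OF m(3) m2(1)]
          nn_integral_cmult[OF m(1)] nn_integral_cmult[OF m(2)] by (simp add: nn_integral_cmult_indicator)
    qed
    note M = mean_local(2)[OF sq(1)] mean_local(2)[OF sq(2)]
    note M2 = borel_measurable_times_ennreal[OF borel_measurable_const M(1), of "ennreal 2"] borel_measurable_times_ennreal[OF borel_measurable_const M(2), of "ennreal 2"]
    have "?E (\<lambda>x \<omega>. a + ennreal 2 * ennreal ((v x \<omega>)\<^sup>2) + ennreal 2 * ennreal ((u x \<omega>)\<^sup>2))
      = (\<integral>\<^sup>+\<omega>. a * emeasure lborel (unit_cell :: (real^'n) set) + ennreal 2 * (\<integral>\<^sup>+x. ennreal ((v x \<omega>)\<^sup>2) * indicator unit_cell x \<partial>lborel)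
        + ennreal 2 * (\<integral>\<^sup>+x. ennreal ((u x \<omega>)\<^sup>2) * indicator unit_cell x \<partial>lborel) \<partial>cfg)"
      by (rule nn_integral_cong) (rule *)
    also have "\<dots> = a * emeasure lborel (unit_cell :: (real^'n) set) + ennreal 2 * ?E (\<lambda>x \<omega>. ennreal ((v x \<omega>)\<^sup>2)) + ennreal 2 * ?E (\<lambda>x \<omega>. ennreal ((u x \<omega>)\<^sup>2))"
      unfolding nn_integral_add[OF borel_measurable_add[OF borel_measurable_const M2(1)] M2(2)] nn_integral_add[OF borel_measurable_const M2(1)]
        nn_integral_cmult[OF M(1)] nn_integral_cmult[OF M(2)] by (simp only: nn_integral_const cfg.emeasure_space_1 mult_1_right)
    also have "\<dots> < \<infinity>"
      using vI uI a emeasure_unit_cell[where 'n='n] by (simp add: ennreal_mult_less_top)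
    finally show ?thesis .
  qed
  have sq_fin: "?E (\<lambda>x \<omega>. ennreal ((?w x \<omega>)\<^sup>2)) < \<infinity>"
  proof (rule le_less_trans[OF _ sum[of 0]], intro nn_integral_mono mult_right_mono)
    fix \<omega> x
    have "0 \<le> (v x \<omega> + u x \<omega>)\<^sup>2" by simp
    then have "(?w x \<omega>)\<^sup>2 \<le> 2 * (v x \<omega>)\<^sup>2 + 2 * (u x \<omega>)\<^sup>2" by (simp add: power2_eq_square algebra_simps)
    from ennreal_leI[OF this]
    show "ennreal ((?w x \<omega>)\<^sup>2) \<le> 0 + ennreal 2 * ennreal ((v x \<omega>)\<^sup>2) + ennreal 2 * ennreal ((u x \<omega>)\<^sup>2)"
      by (simp add: ennreal_mult)
  qed (rule zero_le, simp)
  have abs_fin: "?E ?f < \<infinity>"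
  proof (rule le_less_trans[OF _ sum[of 1]], intro nn_integral_mono mult_right_mono)
    fix \<omega> x
    have "\<bar>t\<bar> \<le> 1 + t\<^sup>2" for t :: real
      using zero_le_power2[of "\<bar>t\<bar> - 1"] by (simp add: power2_diff)
    moreover have "(?w x \<omega>)\<^sup>2 \<le> 2 * (v x \<omega>)\<^sup>2 + 2 * (u x \<omega>)\<^sup>2"
      using zero_le_power2[of "v x \<omega> + u x \<omega>"] by (simp add: power2_eq_square algebra_simps)
    ultimately have "\<bar>?w x \<omega>\<bar> \<le> 1 + 2 * (v x \<omega>)\<^sup>2 + 2 * (u x \<omega>)\<^sup>2"
      by (smt (verit))
    from ennreal_leI[OF this]
    show "?f x \<omega> \<le> 1 + ennreal 2 * ennreal ((v x \<omega>)\<^sup>2) + ennreal 2 * ennreal ((u x \<omega>)\<^sup>2)"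
      by (simp add: ennreal_mult)
  qed (rule zero_le, simp)
  have loc: "AE \<omega> in cfg. \<forall>R. (\<integral>\<^sup>+x. (\<integral>\<^sup>+z. ?f (x + snd z) \<omega> \<partial>step \<Lambda> 0) * indicator (cball 0 R) x \<partial>lborel) < \<infinity>"
  proof (rule stationary_local_integral)
    show "(\<lambda>(x, \<omega>). \<integral>\<^sup>+z. ?f (x + snd z) \<omega> \<partial>step \<Lambda> 0) \<in> borel_measurable (borel \<Otimes>\<^sub>M cfg)"
      using step_average_measurable[OF fm borel_measurable_const[of 1], of 0] by (simp only: mult_1)
    fix \<omega> and x :: "real^'n" and z assume \<omega>: "\<omega> \<in> space cfg"
    have "x + lattice_pt z + y = x + y + lattice_pt z" for y by simp
    then show "(\<integral>\<^sup>+y. ?f (x + lattice_pt z + snd y) \<omega> \<partial>step \<Lambda> 0) = (\<integral>\<^sup>+y. ?f (x + snd y) (shift z \<omega>) \<partial>step \<Lambda> 0)"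
      by (simp only: stat[OF \<omega>])
  next
    show "?E (\<lambda>x \<omega>. \<integral>\<^sup>+z. ?f (x + snd z) \<omega> \<partial>step \<Lambda> 0) < \<infinity>"
      using abs_fin by (subst mean_step_unit_cell[OF fm]) (simp_all only: stat)
  qed
  have sv: "AE \<omega> in cfg. H1_loc (\<lambda>x. v x \<omega>) \<and> weak_landscape_solution (\<lambda>x. \<Lambda> * random_potential \<phi> \<omega> x) (\<lambda>x. v x \<omega>)"
    and su: "AE \<omega> in cfg. H1_loc (\<lambda>x. u x \<omega>) \<and> weak_landscape_solution (\<lambda>x. \<Lambda> * random_potential \<phi> \<omega> x) (\<lambda>x. u x \<omega>)"
    using v u unfolding stationary_landscape_def by blast+
  have sub: "AE \<omega> in cfg. AE x in lborel. ?f x \<omega> \<le> killed {} \<omega> n (\<lambda>y. ?f y \<omega>) x" for n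
  proof (rule AE_mp[OF AE_conjI[OF loc AE_conjI[OF sv su]]], rule AE_I2, rule impI)
    fix \<omega> assume \<omega>: "\<omega> \<in> space cfg"
      and a: "(\<forall>R. (\<integral>\<^sup>+x. (\<integral>\<^sup>+z. ?f (x + snd z) \<omega> \<partial>step \<Lambda> 0) * indicator (cball 0 R) x \<partial>lborel) < \<infinity>) \<and>
        (H1_loc (\<lambda>x. v x \<omega>) \<and> weak_landscape_solution (\<lambda>x. \<Lambda> * random_potential \<phi> \<omega> x) (\<lambda>x. v x \<omega>)) \<and>
        (H1_loc (\<lambda>x. u x \<omega>) \<and> weak_landscape_solution (\<lambda>x. \<Lambda> * random_potential \<phi> \<omega> x) (\<lambda>x. u x \<omega>))"
    show "AE x in lborel. ?f x \<omega> \<le> killed {} \<omega> n (\<lambda>y. ?f y \<omega>) x"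
      by (rule difference_le_killed[OF \<omega>]) (use a in \<open>unfold H1_loc_def, blast+\<close>)
  qed
  have "AE \<omega> in cfg. AE x in lborel. ?w x \<omega> = 0"
    by (rule stationary_killed_zero[OF wm stat sq_fin sub])
  then show ?thesis by (simp only: right_minus_eq)
qed

end

theorem theorem1:
  fixes \<phi> :: "real^'n::finite \<Rightarrow> real" and \<mu> :: "real measure" and \<Lambda> :: real
  assumes phi_bump: "\<phi> \<in> Cc_infty (ball 0 (1/10))"
    and phi_range: "\<forall>x. 0 \<le> \<phi> x \<and> \<phi> x \<le> 1"
    and phi_nontrivial: "\<exists>x. \<phi> x \<noteq> 0"
    and mu_prob: "prob_space \<mu>"
    and mu_sets: "sets \<mu> = sets (restrict_space borel {0..1})"
    and mu_nondegenerate: "\<forall>a. measure \<mu> {a} \<noteq> 1"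
    and mu_support: "Inf (law_support \<mu>) = 0"
    and Lambda_pos: "\<Lambda> > 0"
  shows "\<exists>u :: real^'n \<Rightarrow> 'n config \<Rightarrow> real.
    stationary_landscape \<phi> \<mu> \<Lambda> u \<and>
    (\<forall>v. stationary_landscape \<phi> \<mu> \<Lambda> v \<longrightarrow>
       (AE \<omega> in config_space \<mu>. AE x in lborel. v x \<omega> = u x \<omega>)) \<and>
    (AE \<omega> in config_space \<mu>. \<forall>x. 0 < u x \<omega>) \<and>
    (\<forall>p\<ge>1. \<exists>C.
       (AE \<omega> in config_space \<mu>. bdd_above ((\<lambda>x. u x \<omega> powr p) ` unit_cell)) \<and>
       integrable (config_space \<mu>) (\<lambda>\<omega>. SUP x\<in>unit_cell. u x \<omega> powr p) \<and>
       (LINT \<omega>|config_space \<mu>. (SUP x\<in>unit_cell. u x \<omega> powr p)) powr (1/p) \<le> C)"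
proof -
  interpret landscape \<phi> \<mu> \<Lambda>
    by (rule landscape.intro) (use assms in blast)+
  show ?thesis
  proof (intro exI[of _ landscape_fn] conjI allI impI)
    show "stationary_landscape \<phi> \<mu> \<Lambda> landscape_fn" by (rule landscape_fn_stationary_landscape)
    show "AE \<omega> in cfg. AE x in lborel. v x \<omega> = landscape_fn x \<omega>" if "stationary_landscape \<phi> \<mu> \<Lambda> v" for v
      using that landscape_fn_stationary_landscape by (rule stationary_landscape_unique)
    show "AE \<omega> in cfg. \<forall>x. 0 < landscape_fn x \<omega>"
      by (rule AE_I2) (blast intro: landscape_fn_pos)
    fix p :: real assume p: "1 \<le> p"
    have "AE \<omega> in cfg. bdd_above ((\<lambda>x. landscape_fn x \<omega> powr p) ` unit_cell)"
      by (rule AE_I2) (use p in \<open>simp add: landscape_fn_bdd\<close>)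
    \<comment> \<open>The content lies in boundedness and integrability; \<open>C\<close> can then
      be the moment itself, which is determined by \<open>\<phi>\<close>, \<open>\<mu>\<close>,
      \<open>\<Lambda>\<close> and \<open>p\<close>.\<close>
    then show "\<exists>C. (AE \<omega> in cfg. bdd_above ((\<lambda>x. landscape_fn x \<omega> powr p) ` unit_cell)) \<and>
       integrable cfg (\<lambda>\<omega>. SUP x\<in>unit_cell. landscape_fn x \<omega> powr p) \<and>
       (LINT \<omega>|cfg. (SUP x\<in>unit_cell. landscape_fn x \<omega> powr p)) powr (1/p) \<le> C"
      using landscape_fn_sup_integrable[OF p] by blast
  qed
qed

end
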